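(* Assume Smoothness, Stochastic oracle and Network topology (all defined in the context). Let $\mu_0>0$, $p\in(0,1/4)$, $\mu_k=\mu_0(k+1)^{-p}$, and $\gamma\in(0,\frac1{2L_2})$. Choose $\lambda_\theta^k=c_\theta n^{1/2}K^{-1/2}$, $\lambda_x^k=\lambda_y^k=c_\lambda\lambda_\theta^k$ for $k=0,\dots,K-1$, where $c_\theta,c_\lambda$ are positive constants such that the step-size conditions listed in the context hold. Then the iterates of SUN-DSBO-GT satisfy $$\frac1K\sum_{k=0}^{K-1}\mathbb{E}\|\nabla\Psi_{\mu_k}(\bar x^k,\bar y^k)\|^2=\mathcal{O}\Big(\frac{\mathcal{C}_2}{n^{1/2}K^{1/2}}\Big)+\mathcal{O}\Big(\frac{n(\delta_f^2+\delta_g^2)}{(1-\rho)^4K}\Big),$$ $$\frac1K\sum_{k=0}^{K-1}\Delta^k=\mathcal{O}\Big(\frac{\mathcal{C}_2}{K^{1/2}}\Big)+\mathcal{O}\Big(\frac{n^{3/2}(\delta_f^2+\delta_g^2)}{(1-\rho)^4K}\Big),$$ where $\mathcal{C}_2$ is a positive constant depending on $\delta_f^2$ and $\delta_g^2$ but independent of $n$ and $1-\rho$.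
   Context: **Problem.** There are $n$ agents; $[n]=\{1,\dots,n\}$. For $i\in[n]$, $f_i(x,y)=\mathbb{E}_{\xi_{f,i}}[f_i(x,y;\xi_{f,i})]$ and $g_i(x,y)=\mathbb{E}_{\xi_{g,i}}[g_i(x,y;\xi_{g,i})]$ are real functions on $\mathbb{R}^{d_x}\times\mathbb{R}^{d_y}$; $F=\frac1n\sum_i f_i$, $G=\frac1n\sum_i g_i$, and $F$ is bounded below by $\underline{F}$. For $\gamma>0$, $V_\gamma(x,y)=\min_{\theta\in\mathbb{R}^{d_y}}\{G(x,\theta)+\frac1{2\gamma}\|\theta-y\|^2\}$, with unique minimizer $\theta_\gamma^*(x,y)$ when $\gamma\in(0,\frac1{2L_2})$; $\Psi_\mu(x,y)=\mu F(x,y)+G(x,y)-V_\gamma(x,y)$. **Assumptions.** *Smoothness*: each $f_i$, $g_i$ is continuously differentiable, $f_i$ is $L_1$-smooth and $g_i$ is $L_2$-smooth (Lipschitz gradient in $(x,y)$). *Stochastic oracle*: with i.i.d. samples, $\nabla f_i(x,y;\xi_{f,i})$ and $\nabla g_i(x,y;\xi_{g,i})$ are unbiased estimators of $\nabla f_i(x,y)$, $\nabla g_i(x,y)$ with variances $\mathbb{E}\|\cdot\|^2$ of the error at most $\delta_f^2$ and $\delta_g^2$. *Network topology*: $\mathbf{W}=(w_{ij})\in\mathbb{R}^{n\times n}$ is non-negative, symmetric, doubly stochastic, with eigenvalues $1=\lambda_1>\lambda_2\ge\dots\ge\lambda_n$ and $\rho:=\max\{|\lambda_2|,|\lambda_n|\}<1$.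 **Algorithm SUN-DSBO-GT.** Initialize $\theta_i^0,x_i^0,y_i^0$ and $\hat D_{\Diamond,i}^{-1}=D_{\Diamond,i}^{-1}=0$ for $\Diamond\in\{\theta,x,y\}$. For $k=0,\dots,K-1$ each agent $i$ draws fresh samples $\xi_{g,i}^k,\xi_{f,i}^k$ and computes $$\hat D_{\theta,i}^k=\nabla_yg_i(x_i^k,\theta_i^k;\xi_{g,i}^k)+\tfrac1\gamma(\theta_i^k-y_i^k),$$ $$\hat D_{x,i}^k=\mu_k\nabla_xf_i(x_i^k,y_i^k;\xi_{f,i}^k)+\nabla_xg_i(x_i^k,y_i^k;\xi_{g,i}^k)-\nabla_xg_i(x_i^k,\theta_i^k;\xi_{g,i}^k),$$ $$\hat D_{y,i}^k=\mu_k\nabla_yf_i(x_i^k,y_i^k;\xi_{f,i}^k)+\nabla_yg_i(x_i^k,y_i^k;\xi_{g,i}^k)-\tfrac1\gamma(y_i^k-\theta_i^k),$$ then $D_{\Diamond,i}^k=\sum_jw_{ij}(D_{\Diamond,j}^{k-1}+\hat D_{\Diamond,j}^k-\hat D_{\Diamond,j}^{k-1})$ and $\Diamond_i^{k+1}=\sum_jw_{ij}(\Diamond_j^k-\lambda_\Diamond^kD_{\Diamond,j}^k)$. Averages: $\bar\Diamond^k=\frac1n\sum_i\Diamond_i^k$. Consensus error: $\Delta^k=\frac1n\sum_i\mathbb{E}(\|x_i^k-\bar x^k\|^2+\|y_i^k-\bar y^k\|^2+\|\theta_i^k-\bar\theta^k\|^2)$. **Constants.** Let $L_\theta>0$ be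 a Lipschitz constant of $\theta_\gamma^*$, $\eta=\frac1\gamma-L_2$, $L_{\Phi_\infty}=L_2+\min\{L_2,\frac1\gamma\}$, $a_1=\frac1{2L_\theta}\sqrt{L_2^2+\gamma^{-2}}$, $$\tau_2=2\,\frac{3(\mu_0^2L_1^2+2L_2^2)c_\lambda+4(\mu_0^2L_1^2+L_2^2)c_\lambda+\frac{12a_1}{\eta}L_2^2}{c_\lambda(1-\rho)},$$ $$\tau_3=2\,\frac{3(\mu_0^2L_1^2+L_2^2)c_\lambda+4(\mu_0^2L_1^2+L_2^2+\gamma^{-2})c_\lambda+\frac{12a_1}{\eta}\gamma^{-2}}{c_\lambda(1-\rho)},$$ $$\tau_4=2\,\frac{3L_2^2c_\lambda+4\gamma^{-2}c_\lambda+\frac{12a_1}{\eta}(L_2^2+\gamma^{-2})}{c_\lambda(1-\rho)},$$ $\tau_5=\frac{\tau_2}{(1-\rho)^2}$, $\tau_6=\frac{\tau_3}{(1-\rho)^2}$, $\tau_7=\frac{\tau_4}{(1-\rho)^2}$; $a_5^k=\tau_5(\lambda_x^k)^2$, $a_6^k=\tau_6(\lambda_y^k)^2$, $a_7^k=\tau_7(\lambda_\theta^k)^2$. For $c>0$ put $S_x(c)=9\tau_5c(\mu_0^2L_1^2+2L_2^2)+12\tau_6c(\mu_0^2L_1^2+L_2^2)+9\tau_7L_2^2$, $S_y(c)=9\tau_5c(\mu_0^2L_1^2+L_2^2)+12\tau_6c(\mu_0^2L_1^2+L_2^2+\gamma^{-2})+9\tau_7\gamma^{-2}$, $S_\theta(c)=9\tau_5cL_2^2+12\tau_6c\gamma^{-2}+9\tau_7(L_2^2+\gamma^{-2})$.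 **Step-size conditions.** $c_\lambda\le\frac{\eta}{32a_1L_\theta^2}$, $\lambda_\theta^k\le\min\{\frac4{3\eta},\frac{4a_1L_\theta^2}{\eta L_{\Phi_\infty}}\}$, and, with $\lambda=\lambda_\theta^k$: $\lambda\le\frac{1-\rho}{64c_\lambda(L_{\Phi_\infty}/2+4a_1L_\theta^2+8S_x(1))}$; $\lambda\le\frac{1-\rho}{64c_\lambda(L_{\Phi_\infty}/2+4a_1L_\theta^2+8S_y(1))}$; $\lambda\le\frac{1}{32a_1L_\theta^2}(L_2^2+\gamma^{-2})\frac{1-\rho}{64(L_2^2+\gamma^{-2})(9a_5^kL_2^2+12a_6^k\gamma^{-2}+9a_7^k(L_2^2+\gamma^{-2}))}$; $\lambda^2\le\frac{\tau_2c_\lambda(1-\rho)}{64S_x(c_\lambda^3)}$; $\lambda\le\frac{\tau_2c_\lambda(1-\rho)^2}{96L_2^2(2a_1+4S_\theta(c_\lambda^3))}$; $\lambda^2\le\frac{\tau_3c_\lambda(1-\rho)}{64S_y(c_\lambda^3)}$; $\lambda\le\frac{\tau_3c_\lambda(1-\rho)^2}{96\gamma^{-2}(2a_1+4S_\theta(c_\lambda^3))}$; $\lambda^2\le\frac{\tau_4c_\lambda(1-\rho)}{64S_\theta(c_\lambda^3)}$; $\lambda\le\frac{\tau_4c_\lambda(1-\rho)^2}{96(L_2^2+\gamma^{-2})(2a_1+4S_\theta(c_\lambda^3))}$; $\lambda^3\le\frac{(1+\rho)\tau_2}{8c_\lambda^3S_x(1)}$; $\lambda^3\le\frac{(1+\rho)\tau_3}{8c_\lambda^3S_y(1)}$;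 $\lambda^3\le\frac{(1+\rho)\tau_3}{8c_\lambda^3S_\theta(1)}$. **Convention.** $\mathcal{O}(\cdot)$ hides constants independent of $K$, $n$, $1-\rho$, $\delta_f,\delta_g$ (they may depend on $L_1,L_2,\gamma,\mu_0,c_\theta,c_\lambda$).
   Formalization: The constant hidden in O(·) is independent of n only when K ≥ κn, κ depending on L1, L2, γ, μ0, c_θ, c_λ; for smaller K it may depend on n, since full uniformity in n is false. C_2 may also depend on the initial error (gaps, consensus error, mean squared local gradients). *)

theory Defs
  imports "HOL-Probability.Probability" "Jordan_Normal_Form.Char_Poly"
begin

text \<open>
  Agents are numbered from \<open>0\<close> to \<open>n - 1\<close>.  A pair \<open>(x, y)\<close> lives in the
  product of two Euclidean spaces, whose norm is the Euclidean norm of \<open>(x, y)\<close>; the partial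
  gradients \<open>\<nabla>\<^sub>x\<close> and \<open>\<nabla>\<^sub>y\<close> are therefore the two components of the gradient.
\<close>

definition gradient :: "('c::real_inner \<Rightarrow> real) \<Rightarrow> 'c \<Rightarrow> 'c" where
  "gradient f z = (THE d. GDERIV f z :> d)"

definition average :: "nat \<Rightarrow> (nat \<Rightarrow> 'c::real_vector) \<Rightarrow> 'c" where
  "average n u = (1 / real n) *\<^sub>R (\<Sum>i<n. u i)"

definition prox_objective ::
    "real \<Rightarrow> ('a \<times> 'b::real_normed_vector \<Rightarrow> real) \<Rightarrow> 'a \<times> 'b \<Rightarrow> 'b \<Rightarrow> real" where
  "prox_objective \<gamma> G z \<theta> = G (fst z, \<theta>) + (norm (\<theta> - snd z))\<^sup>2 / (2 * \<gamma>)"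

definition moreau_env :: "real \<Rightarrow> ('a \<times> 'b::real_normed_vector \<Rightarrow> real) \<Rightarrow> 'a \<times> 'b \<Rightarrow> real" where
  "moreau_env \<gamma> G z = (INF \<theta>. prox_objective \<gamma> G z \<theta>)"

definition prox_point :: "real \<Rightarrow> ('a \<times> 'b::real_normed_vector \<Rightarrow> real) \<Rightarrow> 'a \<times> 'b \<Rightarrow> 'b" where
  "prox_point \<gamma> G z = arg_min (prox_objective \<gamma> G z) (\<lambda>_. True)"

definition Psi ::
    "real \<Rightarrow> ('a \<times> 'b::real_normed_vector \<Rightarrow> real) \<Rightarrow> ('a \<times> 'b \<Rightarrow> real) \<Rightarrow> real \<Rightarrow> 'a \<times> 'b \<Rightarrow> real" where
  "Psi \<gamma> F G \<mu> z = \<mu> * F z + G z - moreau_env \<gamma> G z"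

definition smoothness :: "real \<Rightarrow> ('c::real_inner \<Rightarrow> real) \<Rightarrow> bool" where
  "smoothness L f \<longleftrightarrow>
     (\<forall>z. f differentiable at z) \<and> continuous_on UNIV (gradient f) \<and>
     L-lipschitz_on UNIV (gradient f)"

text \<open>
  \<open>h s z\<close> is the sampled objective \<open>f\<^sub>i(z; s)\<close>, with \<open>s\<close> distributed according to \<open>P\<close>.
  Integrability is demanded explicitly because the Bochner integral of a non-integrable function
  is \<open>0\<close>.
\<close>

definition stochastic_oracle ::
    "'s measure \<Rightarrow> ('s \<Rightarrow> 'c::euclidean_space \<Rightarrow> real) \<Rightarrow> ('c \<Rightarrow> real) \<Rightarrow> real \<Rightarrow> bool" where
  "stochastic_oracle P h f \<delta> \<longleftrightarrow>
     prob_space P \<and>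
     (\<forall>s\<in>space P. \<forall>z. h s differentiable at z) \<and>
     (\<forall>z. integrable P (\<lambda>s. h s z) \<and> f z = (\<integral>s. h s z \<partial>P)) \<and>
     (\<forall>z. integrable P (\<lambda>s. gradient (h s) z) \<and>
          (\<integral>s. gradient (h s) z \<partial>P) = gradient f z) \<and>
     (\<forall>z. integrable P (\<lambda>s. (norm (gradient (h s) z - gradient f z))\<^sup>2) \<and>
          (\<integral>s. (norm (gradient (h s) z - gradient f z))\<^sup>2 \<partial>P) \<le> \<delta>\<^sup>2)"

text \<open>
  The pairs are independent over agents and iterations and each pair has a product law, so all
  the samples \<open>\<xi>\<^sub>f\<close>, \<open>\<xi>\<^sub>g\<close> together are mutually independent.
\<close>

definition iid_samples ::
    "'w measure \<Rightarrow> nat \<Rightarrow> nat \<Rightarrow> (nat \<Rightarrow> 's measure) \<Rightarrow> (nat \<Rightarrow> 't measure) \<Rightarrow>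
     (nat \<Rightarrow> nat \<Rightarrow> 'w \<Rightarrow> 's) \<Rightarrow> (nat \<Rightarrow> nat \<Rightarrow> 'w \<Rightarrow> 't) \<Rightarrow> bool" where
  "iid_samples M n K Pf Pg \<xi>f \<xi>g \<longleftrightarrow>
     prob_space M \<and>
     prob_space.indep_vars M (\<lambda>(k, i). Pf i \<Otimes>\<^sub>M Pg i) (\<lambda>(k, i) \<omega>. (\<xi>f k i \<omega>, \<xi>g k i \<omega>))
       ({..<K} \<times> {..<n}) \<and>
     (\<forall>k<K. \<forall>i<n. distr M (Pf i \<Otimes>\<^sub>M Pg i) (\<lambda>\<omega>. (\<xi>f k i \<omega>, \<xi>g k i \<omega>)) = Pf i \<Otimes>\<^sub>M Pg i)"

text \<open>\<open>ev\<close> lists the eigenvalues of \<open>W\<close> with multiplicity in decreasing order; \<open>\<lambda>\<^sub>2\<close> is \<open>ev ! 1\<close>.\<close>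

definition network_topology :: "nat \<Rightarrow> real mat \<Rightarrow> real \<Rightarrow> bool" where
  "network_topology n W \<rho> \<longleftrightarrow>
     2 \<le> n \<and> W \<in> carrier_mat n n \<and>
     (\<forall>i<n. \<forall>j<n. 0 \<le> W $$ (i, j) \<and> W $$ (i, j) = W $$ (j, i)) \<and>
     (\<forall>i<n. (\<Sum>j<n. W $$ (i, j)) = 1) \<and> (\<forall>j<n. (\<Sum>i<n. W $$ (i, j)) = 1) \<and>
     (\<exists>ev. length ev = n \<and> char_poly W = (\<Prod>e\<leftarrow>ev. [:- e, 1:]) \<and> sorted_wrt (\<ge>) ev \<and>
           ev ! 0 = 1 \<and> ev ! 1 < 1 \<and> \<rho> = max \<bar>ev ! 1\<bar> \<bar>ev ! (n - 1)\<bar> \<and> \<rho> < 1)"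

text \<open>Sequences are indexed first by the iteration \<open>k\<close> and then by the agent \<open>i\<close>.\<close>

definition prev :: "(nat \<Rightarrow> nat \<Rightarrow> 'c::zero) \<Rightarrow> nat \<Rightarrow> nat \<Rightarrow> 'c" where
  "prev S k i = (case k of 0 \<Rightarrow> 0 | Suc m \<Rightarrow> S m i)"

definition gradient_tracking ::
    "nat \<Rightarrow> real mat \<Rightarrow> nat \<Rightarrow> (nat \<Rightarrow> real) \<Rightarrow> (nat \<Rightarrow> nat \<Rightarrow> 'c::real_vector) \<Rightarrow>
     (nat \<Rightarrow> nat \<Rightarrow> 'c) \<Rightarrow> (nat \<Rightarrow> nat \<Rightarrow> 'c) \<Rightarrow> bool" where
  "gradient_tracking n W K lam Dh D u \<longleftrightarrow>
     (\<forall>k<K. \<forall>i<n.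
        D k i = (\<Sum>j<n. W $$ (i, j) *\<^sub>R (prev D k j + Dh k j - prev Dh k j)) \<and>
        u (Suc k) i = (\<Sum>j<n. W $$ (i, j) *\<^sub>R (u k j - lam k *\<^sub>R D k j)))"

definition dir_theta ::
    "real \<Rightarrow> ('a::real_inner \<times> 'b::real_inner \<Rightarrow> real) \<Rightarrow> 'a \<Rightarrow> 'b \<Rightarrow> 'b \<Rightarrow> 'b" where
  "dir_theta \<gamma> g x y \<theta> = snd (gradient g (x, \<theta>)) + (1 / \<gamma>) *\<^sub>R (\<theta> - y)"

definition dir_x ::
    "real \<Rightarrow> ('a::real_inner \<times> 'b::real_inner \<Rightarrow> real) \<Rightarrow> ('a \<times> 'b \<Rightarrow> real) \<Rightarrow> 'a \<Rightarrow> 'b \<Rightarrow> 'b \<Rightarrow> 'a" where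
  "dir_x \<mu> f g x y \<theta> =
     \<mu> *\<^sub>R fst (gradient f (x, y)) + fst (gradient g (x, y)) - fst (gradient g (x, \<theta>))"

definition dir_y ::
    "real \<Rightarrow> real \<Rightarrow> ('a::real_inner \<times> 'b::real_inner \<Rightarrow> real) \<Rightarrow> ('a \<times> 'b \<Rightarrow> real) \<Rightarrow>
     'a \<Rightarrow> 'b \<Rightarrow> 'b \<Rightarrow> 'b" where
  "dir_y \<gamma> \<mu> f g x y \<theta> =
     \<mu> *\<^sub>R snd (gradient f (x, y)) + snd (gradient g (x, y)) - (1 / \<gamma>) *\<^sub>R (y - \<theta>)"

text \<open>
  \<open>\<phi> k i\<close> and \<open>\<psi> k i\<close> are the functions \<open>f\<^sub>i(\<cdot>; \<xi>)\<close> and \<open>g\<^sub>i(\<cdot>; \<xi>)\<close> for the samples drawn by agent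
  \<open>i\<close> at iteration \<open>k\<close>.
\<close>

definition sun_dsbo_gt_path ::
    "nat \<Rightarrow> real mat \<Rightarrow> nat \<Rightarrow> real \<Rightarrow> (nat \<Rightarrow> real) \<Rightarrow>
     (nat \<Rightarrow> real) \<Rightarrow> (nat \<Rightarrow> real) \<Rightarrow> (nat \<Rightarrow> real) \<Rightarrow>
     (nat \<Rightarrow> nat \<Rightarrow> 'a::real_inner \<times> 'b::real_inner \<Rightarrow> real) \<Rightarrow>
     (nat \<Rightarrow> nat \<Rightarrow> 'a \<times> 'b \<Rightarrow> real) \<Rightarrow>
     (nat \<Rightarrow> nat \<Rightarrow> 'a) \<Rightarrow> (nat \<Rightarrow> nat \<Rightarrow> 'b) \<Rightarrow> (nat \<Rightarrow> nat \<Rightarrow> 'b) \<Rightarrow> bool" where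
  "sun_dsbo_gt_path n W K \<gamma> \<mu> lamx lamy lamt \<phi> \<psi> x y \<theta> \<longleftrightarrow>
     (\<exists>D\<^sub>x D\<^sub>y D\<^sub>\<theta>.
        gradient_tracking n W K lamt (\<lambda>k i. dir_theta \<gamma> (\<psi> k i) (x k i) (y k i) (\<theta> k i)) D\<^sub>\<theta> \<theta> \<and>
        gradient_tracking n W K lamx
          (\<lambda>k i. dir_x (\<mu> k) (\<phi> k i) (\<psi> k i) (x k i) (y k i) (\<theta> k i)) D\<^sub>x x \<and>
        gradient_tracking n W K lamy
          (\<lambda>k i. dir_y \<gamma> (\<mu> k) (\<phi> k i) (\<psi> k i) (x k i) (y k i) (\<theta> k i)) D\<^sub>y y)"

definition sun_dsbo_gt ::
    "'w measure \<Rightarrow> nat \<Rightarrow> real mat \<Rightarrow> nat \<Rightarrow> real \<Rightarrow> (nat \<Rightarrow> real) \<Rightarrow>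
     (nat \<Rightarrow> real) \<Rightarrow> (nat \<Rightarrow> real) \<Rightarrow> (nat \<Rightarrow> real) \<Rightarrow>
     (nat \<Rightarrow> 's \<Rightarrow> 'a::real_inner \<times> 'b::real_inner \<Rightarrow> real) \<Rightarrow>
     (nat \<Rightarrow> 't \<Rightarrow> 'a \<times> 'b \<Rightarrow> real) \<Rightarrow>
     (nat \<Rightarrow> nat \<Rightarrow> 'w \<Rightarrow> 's) \<Rightarrow> (nat \<Rightarrow> nat \<Rightarrow> 'w \<Rightarrow> 't) \<Rightarrow>
     (nat \<Rightarrow> 'a) \<Rightarrow> (nat \<Rightarrow> 'b) \<Rightarrow> (nat \<Rightarrow> 'b) \<Rightarrow>
     (nat \<Rightarrow> nat \<Rightarrow> 'w \<Rightarrow> 'a) \<Rightarrow> (nat \<Rightarrow> nat \<Rightarrow> 'w \<Rightarrow> 'b) \<Rightarrow> (nat \<Rightarrow> nat \<Rightarrow> 'w \<Rightarrow> 'b) \<Rightarrow> bool" where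
  "sun_dsbo_gt M n W K \<gamma> \<mu> lamx lamy lamt fs gs \<xi>f \<xi>g x0 y0 \<theta>0 x y \<theta> \<longleftrightarrow>
     (\<forall>\<omega>\<in>space M.
        (\<forall>i<n. x 0 i \<omega> = x0 i \<and> y 0 i \<omega> = y0 i \<and> \<theta> 0 i \<omega> = \<theta>0 i) \<and>
        sun_dsbo_gt_path n W K \<gamma> \<mu> lamx lamy lamt
          (\<lambda>k i. fs i (\<xi>f k i \<omega>)) (\<lambda>k i. gs i (\<xi>g k i \<omega>))
          (\<lambda>k i. x k i \<omega>) (\<lambda>k i. y k i \<omega>) (\<lambda>k i. \<theta> k i \<omega>))"

definition consensus_gap ::
    "nat \<Rightarrow> (nat \<Rightarrow> 'a::real_normed_vector) \<Rightarrow> (nat \<Rightarrow> 'b::real_normed_vector) \<Rightarrow> (nat \<Rightarrow> 'b) \<Rightarrow>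
     nat \<Rightarrow> real" where
  "consensus_gap n x y \<theta> i =
     (norm (x i - average n x))\<^sup>2 + (norm (y i - average n y))\<^sup>2 + (norm (\<theta> i - average n \<theta>))\<^sup>2"

definition consensus_error ::
    "'w measure \<Rightarrow> nat \<Rightarrow> (nat \<Rightarrow> nat \<Rightarrow> 'w \<Rightarrow> 'a::real_normed_vector) \<Rightarrow>
     (nat \<Rightarrow> nat \<Rightarrow> 'w \<Rightarrow> 'b::real_normed_vector) \<Rightarrow> (nat \<Rightarrow> nat \<Rightarrow> 'w \<Rightarrow> 'b) \<Rightarrow> nat \<Rightarrow> real" where
  "consensus_error M n x y \<theta> k =
     (1 / real n) * (\<Sum>i<n. \<integral>\<omega>. consensus_gap n (\<lambda>i. x k i \<omega>) (\<lambda>i. y k i \<omega>) (\<lambda>i. \<theta> k i \<omega>) i \<partial>M)"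

text \<open>
  What a convergence rate has to depend on through the starting point: the initial gap of \<open>\<Psi>\<close> above its
  lower bound \<open>\<mu>\<^sub>0 Flow\<close>, the initial error of \<open>\<theta>\<close>, the initial consensus error, and the mean size
  of the local gradients, from which the trackers start.  Each is a per-agent average, hence does
  not by itself grow with \<open>n\<close>.
\<close>

definition initial_error ::
    "nat \<Rightarrow> real \<Rightarrow> real \<Rightarrow> real \<Rightarrow>
     (nat \<Rightarrow> 'a::real_inner \<times> 'b::real_inner \<Rightarrow> real) \<Rightarrow> (nat \<Rightarrow> 'a \<times> 'b \<Rightarrow> real) \<Rightarrow>
     (nat \<Rightarrow> 'a) \<Rightarrow> (nat \<Rightarrow> 'b) \<Rightarrow> (nat \<Rightarrow> 'b) \<Rightarrow> real" where
  "initial_error n \<gamma> \<mu>0 Flow f g x0 y0 \<theta>0 =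
     (let F = (\<lambda>z. average n (\<lambda>i. f i z)); G = (\<lambda>z. average n (\<lambda>i. g i z));
          z = (average n x0, average n y0)
      in (Psi \<gamma> F G \<mu>0 z - \<mu>0 * Flow)
         + (norm (average n \<theta>0 - prox_point \<gamma> G z))\<^sup>2
         + average n (consensus_gap n x0 y0 \<theta>0)
         + average n (\<lambda>i. (norm (gradient (f i) (x0 i, y0 i)))\<^sup>2
                         + (norm (gradient (g i) (x0 i, y0 i)))\<^sup>2))"

text \<open>\<open>lam\<close> is \<open>\<lambda>\<^sub>\<theta>\<^sup>k\<close>, and \<open>\<lambda>\<^sub>x\<^sup>k = \<lambda>\<^sub>y\<^sup>k = clam * lam\<close>.\<close>

definition step_size_conditions ::
    "real \<Rightarrow> real \<Rightarrow> real \<Rightarrow> real \<Rightarrow> real \<Rightarrow> real \<Rightarrow> real \<Rightarrow> real \<Rightarrow> bool" where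
  "step_size_conditions L1 L2 \<gamma> \<mu>0 L\<theta> clam \<rho> lam \<longleftrightarrow>
    (let \<eta> = 1 / \<gamma> - L2;
         L\<Phi> = L2 + min L2 (1 / \<gamma>);
         a1 = 1 / (2 * L\<theta>) * sqrt (L2\<^sup>2 + (1 / \<gamma>)\<^sup>2);
         m = \<mu>0\<^sup>2 * L1\<^sup>2;
         l = L2\<^sup>2;
         h = (1 / \<gamma>)\<^sup>2;
         \<tau>2 = 2 * ((3 * (m + 2 * l) * clam + 4 * (m + l) * clam + 12 * a1 / \<eta> * l) / (clam * (1 - \<rho>)));
         \<tau>3 = 2 * ((3 * (m + l) * clam + 4 * (m + l + h) * clam + 12 * a1 / \<eta> * h) / (clam * (1 - \<rho>)));
         \<tau>4 = 2 * ((3 * l * clam + 4 * h * clam + 12 * a1 / \<eta> * (l + h)) / (clam * (1 - \<rho>)));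
         \<tau>5 = \<tau>2 / (1 - \<rho>)\<^sup>2;
         \<tau>6 = \<tau>3 / (1 - \<rho>)\<^sup>2;
         \<tau>7 = \<tau>4 / (1 - \<rho>)\<^sup>2;
         a5 = \<tau>5 * (clam * lam)\<^sup>2;
         a6 = \<tau>6 * (clam * lam)\<^sup>2;
         a7 = \<tau>7 * lam\<^sup>2;
         Sx = (\<lambda>c. 9 * \<tau>5 * c * (m + 2 * l) + 12 * \<tau>6 * c * (m + l) + 9 * \<tau>7 * l);
         Sy = (\<lambda>c. 9 * \<tau>5 * c * (m + l) + 12 * \<tau>6 * c * (m + l + h) + 9 * \<tau>7 * h);
         S\<theta> = (\<lambda>c. 9 * \<tau>5 * c * l + 12 * \<tau>6 * c * h + 9 * \<tau>7 * (l + h))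
     in clam \<le> \<eta> / (32 * a1 * L\<theta>\<^sup>2) \<and>
        lam \<le> min (4 / (3 * \<eta>)) (4 * a1 * L\<theta>\<^sup>2 / (\<eta> * L\<Phi>)) \<and>
        lam \<le> (1 - \<rho>) / (64 * clam * (L\<Phi> / 2 + 4 * a1 * L\<theta>\<^sup>2 + 8 * Sx 1)) \<and>
        lam \<le> (1 - \<rho>) / (64 * clam * (L\<Phi> / 2 + 4 * a1 * L\<theta>\<^sup>2 + 8 * Sy 1)) \<and>
        lam \<le> 1 / (32 * a1 * L\<theta>\<^sup>2) * (l + h)
              * ((1 - \<rho>) / (64 * (l + h) * (9 * a5 * l + 12 * a6 * h + 9 * a7 * (l + h)))) \<and>
        lam\<^sup>2 \<le> \<tau>2 * clam * (1 - \<rho>) / (64 * Sx (clam ^ 3)) \<and>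
        lam \<le> \<tau>2 * clam * (1 - \<rho>)\<^sup>2 / (96 * l * (2 * a1 + 4 * S\<theta> (clam ^ 3))) \<and>
        lam\<^sup>2 \<le> \<tau>3 * clam * (1 - \<rho>) / (64 * Sy (clam ^ 3)) \<and>
        lam \<le> \<tau>3 * clam * (1 - \<rho>)\<^sup>2 / (96 * h * (2 * a1 + 4 * S\<theta> (clam ^ 3))) \<and>
        lam\<^sup>2 \<le> \<tau>4 * clam * (1 - \<rho>) / (64 * S\<theta> (clam ^ 3)) \<and>
        lam \<le> \<tau>4 * clam * (1 - \<rho>)\<^sup>2 / (96 * (l + h) * (2 * a1 + 4 * S\<theta> (clam ^ 3))) \<and>
        lam ^ 3 \<le> (1 + \<rho>) * \<tau>2 / (8 * clam ^ 3 * Sx 1) \<and>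
        lam ^ 3 \<le> (1 + \<rho>) * \<tau>3 / (8 * clam ^ 3 * Sy 1) \<and>
        lam ^ 3 \<le> (1 + \<rho>) * \<tau>3 / (8 * clam ^ 3 * S\<theta> 1))"

end

theory Submission
  imports Defs "Jordan_Normal_Form.Schur_Decomposition"
begin

text \<open>
  With \<open>c = c\<^sub>\<lambda>\<close>, the three updates are one gradient-tracking recursion with step size \<open>\<lambda>\<close> for the
  joint state \<open>u = ((x, y), \<theta>)\<close>, driven by the direction field \<open>joint_dir\<close>.  Mixing preserves
  averages, so the mean state moves by \<open>- \<lambda> H\<close> with \<open>H\<close> the average of the sampled directions,
  and four quantities have to be controlled: the consensus error, the spread of the trackers, the
  size of \<open>H\<close>, and a Lyapunov function of the mean state.

  The Lyapunov function is \<open>\<Psi>\<^sub>\<mu>(z) + (G(x, \<theta>) + \<parallel>\<theta> - y\<parallel>\<^sup>2 / (2 \<gamma>) - V\<^sub>\<gamma>(z))\<close> for \<open>z = (x, y)\<close>.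
  Its second summand measures the error of \<open>\<theta>\<close> by a function value instead of by
  \<open>\<parallel>\<theta> - \<theta>\<^sup>*\<parallel>\<^sup>2\<close>.  As \<open>\<theta>\<^sup>*\<close> is only Lipschitz, the squared distance would pick up the noise of
  the \<open>z\<close>-step in first order of \<open>\<lambda>\<close>, whereas the gap has a Lipschitz gradient and picks it up in
  second order, averaged over the agents: \<open>\<lambda>\<^sup>2 \<sigma>\<^sup>2 / n\<close>.  Along the mean direction the cross terms
  of the two summands cancel (\<open>inner_lyap_grad_joint_dir\<close>), which leaves a decrease proportional to
  \<open>\<parallel>\<nabla>\<Psi>\<parallel>\<^sup>2\<close> plus the squared residual of the proximal problem.  The time scales are compatible
  because \<open>\<theta>\<^sup>*\<close> has a Lipschitz constant of at least \<open>2/3\<close>, so that the first step-size condition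
  forces \<open>c \<le> 3/32\<close>.

  Sampling errors have mean zero given the past and are independent over the agents
  (\<open>noise_at_random_point\<close>, \<open>sum_noise\<close>); this removes the first-order noise term of the Lyapunov
  function and gives the factor \<open>1/n\<close>.  One mixing step contracts deviations from the average by
  \<open>\<rho>\<close> (\<open>mix_contraction\<close>).  Tracking therefore turns noise of variance \<open>\<sigma>\<^sup>2\<close> into a tracker spread
  of order \<open>\<sigma>\<^sup>2 / (1 - \<rho>)\<^sup>2\<close> and a consensus error of order \<open>\<lambda>\<^sup>2 \<sigma>\<^sup>2 / (1 - \<rho>)\<^sup>4\<close>, which with
  \<open>\<lambda>\<^sup>2 = c\<^sub>\<theta>\<^sup>2 n / K\<close> is the second term of both rates; the first term is the initial error divided
  by \<open>\<lambda> K\<close> together with \<open>\<lambda> \<sigma>\<^sup>2 / n\<close>.  All these inequalities are collected in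
  \<open>satisfies_tracking_recursion\<close>.

  The loop between consensus error and trackers has gain \<open>\<lambda>\<^sup>2 / (1 - \<rho>)\<^sup>4\<close> times a constant.  The
  step-size conditions give \<open>\<lambda> \<le> const (1 - \<rho>)\<^sup>4\<close> (\<open>step_size_conditions_consequences\<close>), and
  \<open>K \<ge> \<kappa> n\<close> gives \<open>\<lambda> \<le> c\<^sub>\<theta> / \<surd>\<kappa>\<close>; the product of the two makes the gain small once \<open>\<kappa>\<close> is large,
  and then the loop closes (\<open>tracking_recursion_sum_bound\<close>).  If \<open>K < \<kappa> n\<close>, then \<open>\<lambda>\<close> is bounded
  below, hence so is \<open>1 - \<rho>\<close>, and boundedly many steps of bounded growth give the claim with a
  constant that depends on \<open>n\<close> (\<open>tracking_recursion_crude_bound\<close>).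
\<close>

section \<open>Mixing by a doubly stochastic matrix\<close>

definition mat_trace :: "real mat \<Rightarrow> real" where
  "mat_trace A = (\<Sum>i<dim_row A. A $$ (i, i))"

lemma mult_mat_entry:
  assumes "A \<in> carrier_mat n n" "B \<in> carrier_mat n n" "i < n" "j < n"
  shows "(A * B) $$ (i, j) = (\<Sum>k<n. A $$ (i, k) * B $$ (k, j :: nat) :: real)"
  using assms by (auto simp: scalar_prod_def lessThan_atLeast0 intro!: sum.cong)

lemma mat_trace_mult_commute:
  assumes "A \<in> carrier_mat n n" "B \<in> carrier_mat n n"
  shows "mat_trace (A * B) = mat_trace (B * A)"
proof -
  have "mat_trace (A * B) = (\<Sum>i<n. \<Sum>k<n. A $$ (i, k) * B $$ (k, i))"
    unfolding mat_trace_def using assms mult_mat_entry[OF assms] by (auto intro!: sum.cong)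
  also have "\<dots> = (\<Sum>k<n. \<Sum>i<n. B $$ (k, i) * A $$ (i, k))"
    by (subst sum.swap) (simp add: mult.commute)
  also have "\<dots> = mat_trace (B * A)"
    unfolding mat_trace_def using assms mult_mat_entry[OF assms(2,1)] by (auto intro!: sum.cong)
  finally show ?thesis .
qed

lemma upper_triangular_pow:
  assumes B: "B \<in> carrier_mat n n" and ut: "upper_triangular B"
  shows "(\<forall>i<n. \<forall>j<i. (B ^\<^sub>m k) $$ (i, j) = (0::real)) \<and> (\<forall>i<n. (B ^\<^sub>m k) $$ (i, i) = B $$ (i, i) ^ k)"
proof (induction k)
  case 0
  then show ?case using B by auto
next
  case (Suc k)
  have Bk: "B ^\<^sub>m k \<in> carrier_mat n n" using B by simp
  have z: "(B ^\<^sub>m k) $$ (i, l) * B $$ (l, j) = 0" if "i < n" "l < n" "j \<le> i" "l \<noteq> i \<or> j \<noteq> i" for i j l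
  proof (cases "l < i")
    case True then show ?thesis using Suc that by auto
  next
    case False
    hence "j < l" using that by auto
    hence "B $$ (l, j) = 0" using ut B that unfolding upper_triangular_def by auto
    thus ?thesis by simp
  qed
  have "(B ^\<^sub>m Suc k) $$ (i, j) = (\<Sum>l<n. (B ^\<^sub>m k) $$ (i, l) * B $$ (l, j))" if "i < n" "j < n" for i j
    using mult_mat_entry[OF Bk B that] by simp
  moreover have "(\<Sum>l<n. (B ^\<^sub>m k) $$ (i, l) * B $$ (l, j)) = 0" if "i < n" "j < i" for i j
    using z that by (intro sum.neutral) auto
  moreover have "(\<Sum>l<n. (B ^\<^sub>m k) $$ (i, l) * B $$ (l, i)) = (B ^\<^sub>m k) $$ (i, i) * B $$ (i, i)"
    if "i < n" for i
    using z[of i _ i] that by (subst sum.remove[of _ i]) (simp, simp, force intro: sum.neutral)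
  ultimately show ?case using Suc by auto
qed

text \<open>
  The trace only sees the diagonal of the triangular Schur form, and that diagonal lists the
  eigenvalues.
\<close>

lemma mat_trace_pow_eigenvalues:
  assumes A: "A \<in> carrier_mat n n" and cp: "char_poly A = (\<Prod>e\<leftarrow>evs. [:- e, 1:])"
  shows "mat_trace (A ^\<^sub>m k) = (\<Sum>e\<leftarrow>evs. e ^ k)"
proof -
  obtain B P Q where sd: "schur_decomposition A evs = (B, P, Q)"
    by (cases "schur_decomposition A evs") auto
  from schur_decomposition[OF A cp sd]
  have sim: "similar_mat_wit A B P Q" and ut: "upper_triangular B" and dg: "diag_mat B = evs" by auto
  note S = similar_mat_witD2[OF A sim]
  have Bk: "B ^\<^sub>m k \<in> carrier_mat n n" using S by simp
  have "mat_trace (A ^\<^sub>m k) = mat_trace (P * (B ^\<^sub>m k * Q))"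
    using similar_mat_wit_pow_id[OF sim, of k] S Bk by (simp add: assoc_mult_mat[of _ n n _ n _ n])
  also have "\<dots> = mat_trace ((B ^\<^sub>m k * Q) * P)"
    using S Bk by (intro mat_trace_mult_commute[of _ n]) auto
  also have "(B ^\<^sub>m k * Q) * P = B ^\<^sub>m k"
    using S Bk by (simp add: assoc_mult_mat[of _ n n _ n _ n])
  also have "mat_trace (B ^\<^sub>m k) = (\<Sum>i<n. B $$ (i, i) ^ k)"
    unfolding mat_trace_def using upper_triangular_pow[OF S(5) ut, of k] S(5) by auto
  also have "\<dots> = (\<Sum>e\<leftarrow>evs. e ^ k)"
    using dg S(5) by (auto simp: diag_mat_def sum_list_sum_nth atLeast0LessThan comp_def)
  finally show ?thesis .
qed

text \<open>
  The head of the list is the eigenvalue of the consensus direction.  By sortedness the others lie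
  between the last entry and the second one.
\<close>

lemma sum_list_eigenvalue_powers_le:
  assumes "sorted_wrt (\<ge>) evs" "evs ! 0 = (1::real)" "2 \<le> length evs"
    and "\<rho> = max \<bar>evs ! 1\<bar> \<bar>evs ! (length evs - 1)\<bar>"
  shows "(\<Sum>e\<leftarrow>evs. e ^ (2 * m)) - 1 \<le> real (length evs) * \<rho> ^ (2 * m)"
proof -
  have le: "\<bar>evs ! i\<bar> \<le> \<rho>" if "1 \<le> i" "i < length evs" for i
  proof -
    have "evs ! i \<le> evs ! 1"
      using sorted_wrt_nth_less[OF assms(1), of 1 i] that by (cases "i = 1") auto
    moreover have "evs ! (length evs - 1) \<le> evs ! i"
      using sorted_wrt_nth_less[OF assms(1), of i "length evs - 1"] that
      by (cases "i = length evs - 1") auto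
    ultimately show ?thesis unfolding assms(4) abs_le_iff max_def by auto
  qed
  have "(\<Sum>e\<leftarrow>evs. e ^ (2 * m)) = (\<Sum>i<length evs. (evs ! i) ^ (2 * m))"
    by (simp add: sum_list_sum_nth atLeast0LessThan)
  also have "\<dots> = 1 + (\<Sum>i\<in>{..<length evs} - {0}. (evs ! i) ^ (2 * m))"
    using assms(2,3) by (subst sum.remove[of _ 0]) auto
  finally have "(\<Sum>e\<leftarrow>evs. e ^ (2 * m)) - 1 = (\<Sum>i\<in>{..<length evs} - {0}. (evs ! i) ^ (2 * m))"
    by simp
  also have "\<dots> \<le> (\<Sum>i\<in>{..<length evs} - {0}. \<rho> ^ (2 * m))"
  proof (rule sum_mono)
    fix i assume i: "i \<in> {..<length evs} - {0}"
    have "(evs ! i) ^ (2 * m) = \<bar>evs ! i\<bar> ^ (2 * m)" by (simp add: power_mult)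
    also have "\<dots> \<le> \<rho> ^ (2 * m)" using le[of i] i by (intro power_mono) auto
    finally show "(evs ! i) ^ (2 * m) \<le> \<rho> ^ (2 * m)" .
  qed
  also have "\<dots> \<le> real (length evs) * \<rho> ^ (2 * m)"
    using card_mono[of "{..<length evs}" "{..<length evs} - {0}"]
    by (auto intro!: mult_right_mono simp: power_mult)
  finally show ?thesis .
qed

definition mix :: "nat \<Rightarrow> real mat \<Rightarrow> (nat \<Rightarrow> 'c::real_vector) \<Rightarrow> nat \<Rightarrow> 'c" where
  "mix n A u i = (\<Sum>j<n. A $$ (i, j) *\<^sub>R u j)"

lemma mix_mult:
  assumes "A \<in> carrier_mat n n" "B \<in> carrier_mat n n" "i < n"
  shows "mix n (A * B) u i = mix n A (mix n B u) i"
proof -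
  have "mix n (A * B) u i = (\<Sum>j<n. \<Sum>k<n. (A $$ (i, k) * B $$ (k, j)) *\<^sub>R u j)"
    unfolding mix_def using mult_mat_entry[OF assms(1,2,3)] by (simp add: scaleR_sum_left)
  also have "\<dots> = (\<Sum>k<n. \<Sum>j<n. (A $$ (i, k) * B $$ (k, j)) *\<^sub>R u j)" by (rule sum.swap)
  also have "\<dots> = mix n A (mix n B u) i" unfolding mix_def by (simp add: scaleR_sum_right)
  finally show ?thesis .
qed

lemma mix_self_adjoint:
  fixes u v :: "nat \<Rightarrow> 'c::real_inner"
  assumes "\<forall>i<n. \<forall>j<n. A $$ (i, j) = A $$ (j, i)"
  shows "(\<Sum>i<n. inner (mix n A u i) (v i)) = (\<Sum>i<n. inner (u i) (mix n A v i))"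
proof -
  have "(\<Sum>i<n. inner (mix n A u i) (v i)) = (\<Sum>i<n. \<Sum>j<n. A $$ (i, j) * inner (u j) (v i))"
    unfolding mix_def by (simp add: inner_sum_left)
  also have "\<dots> = (\<Sum>j<n. \<Sum>i<n. A $$ (i, j) * inner (u j) (v i))" by (rule sum.swap)
  also have "\<dots> = (\<Sum>j<n. \<Sum>i<n. A $$ (j, i) * inner (u j) (v i))"
    using assms by (auto intro!: sum.cong)
  also have "\<dots> = (\<Sum>i<n. inner (u i) (mix n A v i))"
    unfolding mix_def by (simp add: inner_sum_right)
  finally show ?thesis .
qed

lemma mix_norm_le_frobenius:
  fixes u :: "nat \<Rightarrow> 'c::real_normed_vector"
  shows "(\<Sum>i<n. (norm (mix n A u i))\<^sup>2) \<le> (\<Sum>i<n. \<Sum>j<n. (A $$ (i, j))\<^sup>2) * (\<Sum>j<n. (norm (u j))\<^sup>2)"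
proof -
  have "(norm (mix n A u i))\<^sup>2 \<le> (\<Sum>j<n. (A $$ (i, j))\<^sup>2) * (\<Sum>j<n. (norm (u j))\<^sup>2)" for i
  proof -
    have "norm (mix n A u i) \<le> (\<Sum>j<n. \<bar>A $$ (i, j)\<bar> * norm (u j))"
      unfolding mix_def by (rule order_trans[OF norm_sum]) simp
    hence "(norm (mix n A u i))\<^sup>2 \<le> (\<Sum>j<n. \<bar>A $$ (i, j)\<bar> * norm (u j))\<^sup>2"
      by (intro power_mono) auto
    also have "\<dots> \<le> (\<Sum>j<n. \<bar>A $$ (i, j)\<bar>\<^sup>2) * (\<Sum>j<n. (norm (u j))\<^sup>2)"
      by (rule Cauchy_Schwarz_ineq_sum)
    finally show ?thesis by simp
  qed
  thus ?thesis by (simp add: sum_distrib_right sum_mono)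
qed

lemma sum_inner_Cauchy_Schwarz:
  fixes u v :: "nat \<Rightarrow> 'c::real_inner"
  shows "(\<Sum>i<n. inner (u i) (v i))\<^sup>2 \<le> (\<Sum>i<n. (norm (u i))\<^sup>2) * (\<Sum>i<n. (norm (v i))\<^sup>2)"
proof -
  have "\<bar>\<Sum>i<n. inner (u i) (v i)\<bar> \<le> (\<Sum>i<n. norm (u i) * norm (v i))"
    by (rule order_trans[OF sum_abs]) (intro sum_mono Cauchy_Schwarz_ineq2)
  hence "\<bar>\<Sum>i<n. inner (u i) (v i)\<bar>\<^sup>2 \<le> (\<Sum>i<n. norm (u i) * norm (v i))\<^sup>2"
    by (intro power_mono) auto
  also have "\<dots> \<le> (\<Sum>i<n. (norm (u i))\<^sup>2) * (\<Sum>i<n. (norm (v i))\<^sup>2)"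
    by (rule Cauchy_Schwarz_ineq_sum)
  finally show ?thesis by simp
qed

text \<open>
  A log-convex sequence grows at least geometrically with its first ratio, so a geometric upper
  bound, however bad its constant, already bounds that first ratio.
\<close>

lemma log_convex_first_ratio_le:
  fixes a :: "nat \<Rightarrow> real"
  assumes nn: "\<And>m. 0 \<le> a m" and lc: "\<And>m. (a (Suc m))\<^sup>2 \<le> a m * a (Suc (Suc m))"
    and ub: "\<And>m. a (Suc m) \<le> c * r ^ Suc m * a 0" and r: "0 \<le> r"
  shows "a 1 \<le> r * a 0"
proof (rule ccontr)
  assume neg: "\<not> a 1 \<le> r * a 0"
  have a0: "0 < a 0"
  proof (rule ccontr)
    assume "\<not> 0 < a 0"
    hence "a 0 = 0" using nn[of 0] by simp
    thus False using ub[of 0] neg by simp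
  qed
  define t where "t = a 1 / a 0"
  have t: "r < t" using neg a0 by (simp add: t_def field_simps)
  have tpos: "0 < t" using t r by simp
  have step: "0 < a m \<and> t * a m \<le> a (Suc m)" for m
  proof (induction m)
    case 0 thus ?case using a0 by (simp add: t_def)
  next
    case (Suc m)
    have pos: "0 < a (Suc m)" using Suc tpos by (meson less_le_trans mult_pos_pos)
    have "t * a m * a (Suc m) \<le> a (Suc m) * a (Suc m)" using Suc pos by (intro mult_right_mono) auto
    also have "\<dots> \<le> a m * a (Suc (Suc m))" using lc[of m] by (simp add: power2_eq_square)
    finally have "a m * (t * a (Suc m)) \<le> a m * a (Suc (Suc m))" by (simp add: ac_simps)
    thus ?case using Suc pos by simp
  qed
  have geo: "t ^ m * a 0 \<le> a m" for m
  proof (induction m)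
    case (Suc m)
    have "t ^ Suc m * a 0 = t * (t ^ m * a 0)" by simp
    also have "\<dots> \<le> t * a m" using Suc tpos by (intro mult_left_mono) auto
    also have "\<dots> \<le> a (Suc m)" using step by blast
    finally show ?case .
  qed simp
  have bd: "t ^ Suc m \<le> c * r ^ Suc m" for m
  proof -
    have "t ^ Suc m * a 0 \<le> c * r ^ Suc m * a 0" using geo[of "Suc m"] ub[of m] by linarith
    thus ?thesis using a0 by simp
  qed
  show False
  proof (cases "r = 0")
    case True thus ?thesis using bd[of 0] tpos by simp
  next
    case False
    hence rp: "0 < r" using r by simp
    have "1 < t / r" using t rp by simp
    then obtain m where m: "c < (t / r) ^ m" using real_arch_pow by blast
    have "(t / r) ^ m \<le> (t / r) ^ Suc m" using \<open>1 < t / r\<close> by (intro power_increasing) auto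
    hence "c < (t / r) ^ Suc m" using m by simp
    moreover have "(t / r) ^ Suc m \<le> c"
      using bd[of m] rp by (simp add: power_divide divide_le_eq del: power_Suc)
    ultimately show False by simp
  qed
qed

lemma network_topology_rho:
  assumes "network_topology n W \<rho>" shows "0 \<le> \<rho>" "\<rho> < 1"
  using assms unfolding network_topology_def by auto

lemma pow_mat_add:
  assumes "(A :: real mat) \<in> carrier_mat n n"
  shows "A ^\<^sub>m (k + l) = A ^\<^sub>m k * A ^\<^sub>m l"
  using assms by (induction l) (auto simp: assoc_mult_mat[of _ n n _ n _ n])

lemma pow_mat_symmetric_stochastic:
  assumes W: "W \<in> carrier_mat n n"
    and sym: "\<forall>i<n. \<forall>j<n. W $$ (i, j) = W $$ (j, i)"
    and row: "\<forall>i<n. (\<Sum>j<n. W $$ (i, j)) = (1::real)"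
  shows "(\<forall>i<n. \<forall>j<n. (W ^\<^sub>m k) $$ (i, j) = (W ^\<^sub>m k) $$ (j, i)) \<and>
    (\<forall>i<n. (\<Sum>j<n. (W ^\<^sub>m k) $$ (i, j)) = 1) \<and> W * W ^\<^sub>m k = W ^\<^sub>m k * W"
proof (induction k)
  case 0
  then show ?case using W by auto
next
  case (Suc k)
  have Wk: "W ^\<^sub>m k \<in> carrier_mat n n" using W by simp
  have com: "W * W ^\<^sub>m Suc k = W ^\<^sub>m Suc k * W"
  proof -
    have "W * (W ^\<^sub>m k * W) = (W * W ^\<^sub>m k) * W" using W Wk by (simp add: assoc_mult_mat[of _ n n _ n _ n])
    thus ?thesis using Suc by simp
  qed
  have e: "(W ^\<^sub>m Suc k) $$ (i, j) = (\<Sum>l<n. (W ^\<^sub>m k) $$ (i, l) * W $$ (l, j))" if "i < n" "j < n" for i j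
    using mult_mat_entry[OF Wk W that] by simp
  have e': "(W ^\<^sub>m Suc k) $$ (i, j) = (\<Sum>l<n. W $$ (i, l) * (W ^\<^sub>m k) $$ (l, j))" if "i < n" "j < n" for i j
    using mult_mat_entry[OF W Wk that] Suc by simp
  have "(W ^\<^sub>m Suc k) $$ (i, j) = (W ^\<^sub>m Suc k) $$ (j, i)" if "i < n" "j < n" for i j
    unfolding e[OF that] e'[OF that(2,1)] using Suc sym that by (auto intro!: sum.cong simp: mult.commute)
  moreover have "(\<Sum>j<n. (W ^\<^sub>m Suc k) $$ (i, j)) = 1" if "i < n" for i
  proof -
    have "(\<Sum>j<n. (W ^\<^sub>m Suc k) $$ (i, j)) = (\<Sum>j<n. \<Sum>l<n. (W ^\<^sub>m k) $$ (i, l) * W $$ (l, j))"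
      using e that by (auto intro!: sum.cong)
    also have "\<dots> = (\<Sum>l<n. \<Sum>j<n. (W ^\<^sub>m k) $$ (i, l) * W $$ (l, j))" by (rule sum.swap)
    also have "\<dots> = (\<Sum>l<n. (W ^\<^sub>m k) $$ (i, l))" using row by (simp add: sum_distrib_left[symmetric])
    also have "\<dots> = 1" using Suc that by blast
    finally show ?thesis .
  qed
  ultimately show ?case using com by blast
qed

text \<open>
  Let \<open>J\<close> be the all-ones matrix.  The squared Frobenius norm of \<open>W\<^sup>m - J/n\<close> is the trace of
  \<open>W\<^sup>2\<^sup>m\<close> minus one, hence a power sum over the eigenvalues other than \<open>1\<close>.  On vectors with zero
  average this bounds \<open>\<parallel>W\<^sup>m v\<parallel>\<^sup>2\<close> by \<open>n \<rho>\<^sup>2\<^sup>m \<parallel>v\<parallel>\<^sup>2\<close>, and log-convexity of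
  \<open>m \<mapsto> \<parallel>W\<^sup>m v\<parallel>\<^sup>2\<close> removes the factor \<open>n\<close>.
\<close>

lemma mix_contraction:
  fixes u :: "nat \<Rightarrow> 'c::real_inner"
  assumes nt: "network_topology n W \<rho>" and zero: "(\<Sum>i<n. u i) = 0"
  shows "(\<Sum>i<n. (norm (mix n W u i))\<^sup>2) \<le> \<rho>\<^sup>2 * (\<Sum>i<n. (norm (u i))\<^sup>2)"
proof -
  have n: "2 \<le> n" and W: "W \<in> carrier_mat n n"
    and sym: "\<forall>i<n. \<forall>j<n. W $$ (i, j) = W $$ (j, i)"
    and row: "\<forall>i<n. (\<Sum>j<n. W $$ (i, j)) = 1"
    using nt unfolding network_topology_def by auto
  obtain evs where evs: "length evs = n" "char_poly W = (\<Prod>e\<leftarrow>evs. [:- e, 1:])" "sorted_wrt (\<ge>) evs"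
     "evs ! 0 = 1" "\<rho> = max \<bar>evs ! 1\<bar> \<bar>evs ! (n - 1)\<bar>"
    using nt unfolding network_topology_def by auto
  define x where "x m = mix n (W ^\<^sub>m m) u" for m
  define a where "a m = (\<Sum>i<n. (norm (x m i))\<^sup>2)" for m
  note PS = pow_mat_symmetric_stochastic[OF W sym row]
  have Wk: "W ^\<^sub>m k \<in> carrier_mat n n" for k using W by simp
  have x0: "x 0 i = u i" if "i < n" for i
  proof -
    have "x 0 i = (\<Sum>j<n. (1\<^sub>m n $$ (i, j)) *\<^sub>R u j)"
      unfolding x_def mix_def using W by simp
    also have "\<dots> = (\<Sum>j<n. if i = j then u j else 0)"
      by (rule sum.cong) (use that in auto)
    finally show ?thesis using that by simp
  qed
  have xS: "x (Suc m) i = mix n W (x m) i" if "i < n" for m i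
    unfolding x_def using mix_mult[OF W Wk that, of m u] PS[of m] by simp
  have lc: "(a (Suc m))\<^sup>2 \<le> a m * a (Suc (Suc m))" for m
  proof -
    have "a (Suc m) = (\<Sum>i<n. inner (mix n W (x m) i) (x (Suc m) i))"
      unfolding a_def using xS by (auto intro!: sum.cong simp: power2_norm_eq_inner)
    also have "\<dots> = (\<Sum>i<n. inner (x m i) (mix n W (x (Suc m)) i))"
      by (rule mix_self_adjoint[OF sym])
    also have "\<dots> = (\<Sum>i<n. inner (x m i) (x (Suc (Suc m)) i))"
      using xS[of _ "Suc m"] by (auto intro!: sum.cong)
    finally show ?thesis unfolding a_def
      using sum_inner_Cauchy_Schwarz[of "x m" "x (Suc (Suc m))" n] by simp
  qed
  have ub: "a m \<le> real n * (\<rho>\<^sup>2) ^ m * a 0" for m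
  proof -
    \<comment> \<open>the power of \<open>W\<close> without its consensus direction, on which \<open>u\<close> has no component\<close>
    define A where "A = mat n n (\<lambda>(i, j). (W ^\<^sub>m m) $$ (i, j) - 1 / real n)"
    have Ax: "mix n A u i = x m i" if "i < n" for i
    proof -
      have "mix n A u i = (\<Sum>j<n. (W ^\<^sub>m m) $$ (i, j) *\<^sub>R u j - (1 / real n) *\<^sub>R u j)"
        unfolding mix_def A_def using that by (auto intro!: sum.cong simp: scaleR_left_diff_distrib)
      also have "\<dots> = x m i - (1 / real n) *\<^sub>R (\<Sum>j<n. u j)"
        unfolding x_def mix_def by (simp add: sum_subtractf scaleR_sum_right)
      finally show ?thesis using zero by simp
    qed
    have A2: "(\<Sum>j<n. (A $$ (i, j))\<^sup>2) = (W ^\<^sub>m (2 * m)) $$ (i, i) - 1 / real n" if "i < n" for i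
    proof -
      have "(\<Sum>j<n. (A $$ (i, j))\<^sup>2) = (\<Sum>j<n. (W ^\<^sub>m m) $$ (i, j) * (W ^\<^sub>m m) $$ (j, i)
             - 2 / real n * (W ^\<^sub>m m) $$ (i, j) + 1 / (real n)\<^sup>2)"
        unfolding A_def using that PS[of m]
        by (auto intro!: sum.cong simp: power2_eq_square field_simps)
      also have "\<dots> = (\<Sum>j<n. (W ^\<^sub>m m) $$ (i, j) * (W ^\<^sub>m m) $$ (j, i))
             - 2 / real n * (\<Sum>j<n. (W ^\<^sub>m m) $$ (i, j)) + real n * (1 / (real n)\<^sup>2)"
        by (simp add: sum.distrib sum_subtractf sum_distrib_left)
      also have "(\<Sum>j<n. (W ^\<^sub>m m) $$ (i, j)) = 1" using PS[of m] that by blast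
      also have "(\<Sum>j<n. (W ^\<^sub>m m) $$ (i, j) * (W ^\<^sub>m m) $$ (j, i)) - 2 / real n * 1
          + real n * (1 / (real n)\<^sup>2) = (W ^\<^sub>m m * W ^\<^sub>m m) $$ (i, i) - 1 / real n"
        using mult_mat_entry[OF Wk Wk that that, of m m] n
        by (simp add: power2_eq_square field_simps)
      also have "W ^\<^sub>m m * W ^\<^sub>m m = W ^\<^sub>m (2 * m)"
        using pow_mat_add[OF W, of m m] by (simp add: mult_2)
      finally show ?thesis .
    qed
    have "a m = (\<Sum>i<n. (norm (mix n A u i))\<^sup>2)" unfolding a_def using Ax by auto
    also have "\<dots> \<le> (\<Sum>i<n. \<Sum>j<n. (A $$ (i, j))\<^sup>2) * (\<Sum>j<n. (norm (u j))\<^sup>2)"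
      by (rule mix_norm_le_frobenius)
    also have "(\<Sum>i<n. \<Sum>j<n. (A $$ (i, j))\<^sup>2) = mat_trace (W ^\<^sub>m (2 * m)) - 1"
      using A2 n W by (simp add: mat_trace_def sum_subtractf)
    also have "\<dots> = (\<Sum>e\<leftarrow>evs. e ^ (2 * m)) - 1"
      using mat_trace_pow_eigenvalues[OF W evs(2)] by simp
    also have "(\<Sum>j<n. (norm (u j))\<^sup>2) = a 0" unfolding a_def using x0 by auto
    also have "((\<Sum>e\<leftarrow>evs. e ^ (2 * m)) - 1) * a 0 \<le> (real n * \<rho> ^ (2 * m)) * a 0"
      using sum_list_eigenvalue_powers_le[of evs \<rho> m] evs n
      by (intro mult_right_mono) (auto simp: a_def sum_nonneg)
    finally show ?thesis by (simp add: power_mult)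
  qed
  have "a 1 \<le> \<rho>\<^sup>2 * a 0"
  proof (rule log_convex_first_ratio_le[where c = "real n"])
    show "(a (Suc m))\<^sup>2 \<le> a m * a (Suc (Suc m))" for m by (rule lc)
    show "a (Suc m) \<le> real n * (\<rho>\<^sup>2) ^ Suc m * a 0" for m by (rule ub)
  qed (auto simp: a_def sum_nonneg)
  moreover have "a 1 = (\<Sum>i<n. (norm (mix n W u i))\<^sup>2)"
    unfolding a_def using xS[of _ 0] x0 by (auto intro!: sum.cong simp: mix_def)
  moreover have "a 0 = (\<Sum>i<n. (norm (u i))\<^sup>2)" unfolding a_def using x0 by auto
  ultimately show ?thesis by simp
qed

section \<open>Gradients and smooth functions\<close>

lemma power2_norm_prod: "(norm z)\<^sup>2 = (norm (fst z))\<^sup>2 + (norm (snd z))\<^sup>2"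
  by (simp add: norm_prod_def)

lemma norm_fst_le_norm: "norm (fst z) \<le> norm z" and norm_snd_le_norm: "norm (snd z) \<le> norm z"
  using norm_fst_le[of "fst z" "snd z"] norm_snd_le[of "snd z" "fst z"] by simp_all

lemma power2_sum_le: "(norm (a + b))\<^sup>2 \<le> 2 * (norm a)\<^sup>2 + 2 * (norm (b :: 'a::real_normed_vector))\<^sup>2"
proof -
  have "(norm (a + b))\<^sup>2 \<le> (norm a + norm b)\<^sup>2" by (intro power_mono norm_triangle_ineq) auto
  also have "\<dots> \<le> 2 * (norm a)\<^sup>2 + 2 * (norm b)\<^sup>2"
    using sum_squares_bound[of "norm a" "norm b"] by (simp add: power2_sum)
  finally show ?thesis .
qed

lemma power2_diff_le: "(norm (a - b))\<^sup>2 \<le> 2 * (norm a)\<^sup>2 + 2 * (norm (b :: 'a::real_normed_vector))\<^sup>2"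
  using power2_sum_le[of a "- b"] by simp

lemma gradient_eqI:
  assumes "(f has_derivative (\<lambda>h. inner h d)) (at z)"
  shows "gradient f z = d"
proof -
  have uniq: "d' = d" if "(f has_derivative (\<lambda>h. inner h d')) (at z)" for d'
  proof -
    have "(\<lambda>h. inner h d') = (\<lambda>h. inner h d)" using has_derivative_unique[OF that assms] .
    hence "inner (d' - d) d' = inner (d' - d) d" by metis
    hence "inner (d' - d) (d' - d) = 0" by (simp add: inner_diff_right)
    thus ?thesis by simp
  qed
  show ?thesis unfolding gradient_def gderiv_def by (rule the_equality) (fact assms, erule uniq)
qed

lemma has_derivative_gradient:
  fixes f :: "'c::euclidean_space \<Rightarrow> real"
  assumes "f differentiable at z"
  shows "(f has_derivative (\<lambda>h. inner h (gradient f z))) (at z)"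
proof -
  obtain f' where f': "(f has_derivative f') (at z)" using assms unfolding differentiable_def by auto
  interpret bounded_linear f' by (rule has_derivative_bounded_linear[OF f'])
  define d where "d = (\<Sum>b\<in>Basis. f' b *\<^sub>R b)"
  have "f' h = inner h d" for h
  proof -
    have "f' h = f' (\<Sum>b\<in>Basis. inner h b *\<^sub>R b)" by (simp add: euclidean_representation)
    also have "\<dots> = inner h d" by (simp add: sum scale d_def inner_sum_right mult.commute)
    finally show ?thesis .
  qed
  hence e: "f' = (\<lambda>h. inner h d)" by auto
  show ?thesis using f' gradient_eqI[of f d z] unfolding e by simp
qed

lemma smoothness_has_derivative:
  fixes f :: "'c::euclidean_space \<Rightarrow> real"
  assumes "smoothness L f"
  shows "(f has_derivative (\<lambda>h. inner h (gradient f z))) (at z)"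
  using assms unfolding smoothness_def by (auto intro: has_derivative_gradient)

lemma smoothness_nonneg: "smoothness L f \<Longrightarrow> 0 \<le> L"
  unfolding smoothness_def by (auto intro: lipschitz_on_nonneg)

lemma smoothness_lipschitz:
  "smoothness L f \<Longrightarrow> norm (gradient f z - gradient f w) \<le> L * norm (z - w)"
  unfolding smoothness_def using lipschitz_onD[of L UNIV "gradient f" z w] by (simp add: dist_norm)

text \<open>
  The mean value inequality yields \<open>L\<close> where integration along the segment would yield \<open>L/2\<close>; the
  gap between \<open>L\<^sub>2\<close> and \<open>1/(2 \<gamma>)\<close> pays for this loss in the proximal problem.
\<close>

lemma smoothness_quadratic_bound:
  fixes f :: "'c::euclidean_space \<Rightarrow> real"
  assumes s: "smoothness L f"
  shows "\<bar>f w - f z - inner (w - z) (gradient f z)\<bar> \<le> L * (norm (w - z))\<^sup>2"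
proof -
  let ?\<phi> = "\<lambda>u. f u - inner u (gradient f z)"
  have "norm (?\<phi> w - ?\<phi> z) \<le> (L * norm (w - z)) * norm (w - z)"
  proof (rule differentiable_bound[where S = "cball z (norm (w - z))"
        and f' = "\<lambda>u h. inner h (gradient f u) - inner h (gradient f z)"])
    fix u assume u: "u \<in> cball z (norm (w - z))"
    show "(?\<phi> has_derivative (\<lambda>h. inner h (gradient f u) - inner h (gradient f z)))
            (at u within cball z (norm (w - z)))"
      by (intro derivative_intros has_derivative_at_withinI[OF smoothness_has_derivative[OF s]])
    show "onorm (\<lambda>h. inner h (gradient f u) - inner h (gradient f z)) \<le> L * norm (w - z)"
    proof (rule onorm_le)
      fix h
      have "norm (inner h (gradient f u) - inner h (gradient f z)) = \<bar>inner h (gradient f u - gradient f z)\<bar>"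
        by (simp add: inner_diff_right)
      also have "\<dots> \<le> norm h * norm (gradient f u - gradient f z)" by (rule Cauchy_Schwarz_ineq2)
      also have "\<dots> \<le> norm h * (L * norm (u - z))"
        by (intro mult_left_mono smoothness_lipschitz[OF s]) auto
      also have "\<dots> \<le> norm h * (L * norm (w - z))"
        using u smoothness_nonneg[OF s] by (intro mult_left_mono) (auto simp: dist_norm norm_minus_commute)
      finally show "norm (inner h (gradient f u) - inner h (gradient f z)) \<le> L * norm (w - z) * norm h"
        by (simp add: ac_simps)
    qed
  qed (auto simp: dist_norm norm_minus_commute)
  thus ?thesis by (simp add: inner_diff_left power2_eq_square algebra_simps)
qed

text \<open>
  This is how the Moreau envelope, which is only known through its values, gets its gradient.
\<close>

lemma has_derivative_of_quadratic_bound: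
  fixes f :: "'c::real_inner \<Rightarrow> real"
  assumes b: "\<And>w. \<bar>f w - f z - inner (w - z) d\<bar> \<le> C * (norm (w - z))\<^sup>2"
  shows "(f has_derivative (\<lambda>h. inner h d)) (at z)"
proof (rule has_derivativeI_sandwich[of 1])
  show "bounded_linear (\<lambda>h. inner h d)" by (rule bounded_linear_inner_left)
  show "((\<lambda>y. C * norm (y - z)) \<longlongrightarrow> 0) (at z)"
    by (auto intro!: tendsto_eq_intros)
  fix y assume y: "y \<noteq> z"
  have "norm (f y - f z - inner (y - z) d) \<le> (C * norm (y - z)) * norm (y - z)"
    using b[of y] by (simp add: power2_eq_square ac_simps)
  thus "norm ((f y - f z) - inner (y - z) d) / norm (y - z) \<le> C * norm (y - z)"
    using y by (simp add: divide_le_eq)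
qed simp

lemma average_scaleR_norm_le:
  fixes u :: "nat \<Rightarrow> 'c::real_normed_vector"
  assumes "0 < n" "\<And>i. i < n \<Longrightarrow> norm (u i) \<le> c"
  shows "norm (average n u) \<le> c"
proof -
  have "norm (\<Sum>i<n. u i) \<le> (\<Sum>i<n. c)" 
    by (rule order_trans[OF norm_sum sum_mono]) (use assms in auto)
  thus ?thesis using assms(1) unfolding average_def by (simp add: divide_le_eq ac_simps)
qed

lemma average_diff: "average n u - average n v = average n (\<lambda>i. u i - v i)"
  unfolding average_def by (simp add: sum_subtractf scaleR_diff_right)

lemma average_add: "average n u + average n v = average n (\<lambda>i. u i + v i)"
  unfolding average_def by (simp add: sum.distrib scaleR_add_right)

lemma average_cong: "(\<And>i. i < n \<Longrightarrow> u i = v i) \<Longrightarrow> average n u = average n v"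
  unfolding average_def by simp

lemma average_bounded_linear: "bounded_linear T \<Longrightarrow> T (average n u) = average n (\<lambda>i. T (u i))"
  unfolding average_def by (simp add: linear_simps linear_sum bounded_linear.linear)

lemma average_scaleR: "c *\<^sub>R average n u = average n (\<lambda>i. c *\<^sub>R u i)"
  unfolding average_def by (simp add: scaleR_sum_right mult.commute)

lemma average_Pair: "average n (\<lambda>i. (u i, v i)) = (average n u, average n v)"
  unfolding average_def by (simp add: prod_eq_iff fst_sum snd_sum)

lemma average_has_derivative:
  fixes f :: "nat \<Rightarrow> 'c::euclidean_space \<Rightarrow> real"
  assumes "\<forall>i<n. smoothness L (f i)"
  shows "((\<lambda>z. average n (\<lambda>i. f i z)) has_derivative
     (\<lambda>h. inner h (average n (\<lambda>i. gradient (f i) z)))) (at z)"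
  unfolding average_def inner_scaleR_right inner_sum_right real_scaleR_def
  by (intro has_derivative_mult_right has_derivative_sum smoothness_has_derivative[of L])
    (use assms in auto)

lemma gradient_average:
  fixes f :: "nat \<Rightarrow> 'c::euclidean_space \<Rightarrow> real"
  assumes "\<forall>i<n. smoothness L (f i)"
  shows "gradient (\<lambda>z. average n (\<lambda>i. f i z)) z = average n (\<lambda>i. gradient (f i) z)"
  by (rule gradient_eqI[OF average_has_derivative[OF assms]])

lemma smoothness_average:
  fixes f :: "nat \<Rightarrow> 'c::euclidean_space \<Rightarrow> real"
  assumes "\<forall>i<n. smoothness L (f i)" "0 < n"
  shows "smoothness L (\<lambda>z. average n (\<lambda>i. f i z))"
proof -
  have L: "0 \<le> L" using assms smoothness_nonneg by blast
  have g: "gradient (\<lambda>z. average n (\<lambda>i. f i z)) = (\<lambda>z. average n (\<lambda>i. gradient (f i) z))"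
    using gradient_average[OF assms(1)] by auto
  have lip: "L-lipschitz_on UNIV (\<lambda>z. average n (\<lambda>i. gradient (f i) z))"
    using assms L by (intro lipschitz_onI)
      (auto simp: dist_norm average_diff intro!: average_scaleR_norm_le smoothness_lipschitz)
  show ?thesis unfolding smoothness_def g
    using average_has_derivative[OF assms(1)] lip lipschitz_on_continuous_on[OF lip]
    by (auto simp: differentiable_def)
qed

section \<open>The proximal point and the Moreau envelope\<close>

definition prox_grad_z ::
    "real \<Rightarrow> ('a::real_inner \<times> 'b::real_inner \<Rightarrow> real) \<Rightarrow> 'a \<times> 'b \<Rightarrow> 'b \<Rightarrow> 'a \<times> 'b" where
  "prox_grad_z \<gamma> g z \<theta> = (fst (gradient g (fst z, \<theta>)), (1 / \<gamma>) *\<^sub>R (snd z - \<theta>))"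

definition prox_grad_theta ::
    "real \<Rightarrow> ('a::real_inner \<times> 'b::real_inner \<Rightarrow> real) \<Rightarrow> 'a \<times> 'b \<Rightarrow> 'b \<Rightarrow> 'b" where
  "prox_grad_theta \<gamma> g z \<theta> = snd (gradient g (fst z, \<theta>)) + (1 / \<gamma>) *\<^sub>R (\<theta> - snd z)"

locale prox_smooth =
  fixes G :: "'a::euclidean_space \<times> 'b::euclidean_space \<Rightarrow> real" and L2 \<gamma> :: real
  assumes smooth_G: "smoothness L2 G" and \<gamma>_pos: "0 < \<gamma>" and \<gamma>_less: "\<gamma> < 1 / (2 * L2)"
begin

lemma L2_pos: "0 < L2"
  using \<gamma>_pos \<gamma>_less by (smt (verit) divide_nonneg_nonpos zero_le_mult_iff divide_le_0_iff)

lemma L2_less: "L2 < 1 / (2 * \<gamma>)"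
  using \<gamma>_pos \<gamma>_less L2_pos by (simp add: field_simps)

lemma inv_\<gamma>_pos: "0 < 1 / \<gamma>" using \<gamma>_pos by simp

lemma L2_le: "L2 \<le> (1 / 2) * (1 / \<gamma>)" using L2_less by simp

lemma grad_pair_lipschitz:
  "norm (gradient G (x, t) - gradient G (x', t')) \<le> L2 * (norm (x - x') + norm (t - t'))"
proof -
  have "norm (gradient G (x, t) - gradient G (x', t')) \<le> L2 * norm ((x, t) - (x', t'))"
    by (rule smoothness_lipschitz[OF smooth_G])
  also have "\<dots> \<le> L2 * (norm (x - x') + norm (t - t'))"
    using L2_pos norm_Pair_le[of "x - x'" "t - t'"] by (intro mult_left_mono) auto
  finally show ?thesis .
qed

text \<open>
  The bound is joint in both arguments because the Lyapunov function below moves both; the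
  proximal term is quadratic, so only \<open>G\<close> contributes a genuine error.
\<close>

lemma prox_objective_quadratic_bound:
  "\<bar>prox_objective \<gamma> G z' t' - prox_objective \<gamma> G z t
     - inner (z' - z) (prox_grad_z \<gamma> G z t) - inner (t' - t) (prox_grad_theta \<gamma> G z t)\<bar>
   \<le> (3 / (2 * \<gamma>)) * ((norm (z' - z))\<^sup>2 + (norm (t' - t))\<^sup>2)"
proof -
  let ?g = "gradient G (fst z, t)"
  define b where "b = (t' - t) - (snd z' - snd z)"
  have eq: "t' - snd z' = (t - snd z) + b" unfolding b_def by simp
  have quad: "(norm (t' - snd z'))\<^sup>2 = (norm (t - snd z))\<^sup>2 + 2 * inner (t - snd z) b + (norm b)\<^sup>2"
    unfolding eq power2_norm_eq_inner by (simp add: inner_add_left inner_add_right inner_commute)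
  have nb: "(norm b)\<^sup>2 \<le> 2 * (norm (t' - t))\<^sup>2 + 2 * (norm (snd z' - snd z))\<^sup>2"
    unfolding b_def by (rule power2_diff_le)
  have gb: "\<bar>G (fst z', t') - G (fst z, t) - inner ((fst z', t') - (fst z, t)) ?g\<bar>
      \<le> L2 * ((norm (fst z' - fst z))\<^sup>2 + (norm (t' - t))\<^sup>2)"
    using smoothness_quadratic_bound[OF smooth_G, of "(fst z', t')" "(fst z, t)"]
    by (simp add: power2_norm_prod[of "(fst z' - fst z, t' - t)"])
  have id: "prox_objective \<gamma> G z' t' - prox_objective \<gamma> G z t
     - inner (z' - z) (prox_grad_z \<gamma> G z t) - inner (t' - t) (prox_grad_theta \<gamma> G z t)
    = (G (fst z', t') - G (fst z, t) - inner ((fst z', t') - (fst z, t)) ?g) + (norm b)\<^sup>2 / (2 * \<gamma>)"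
    unfolding prox_objective_def quad prox_grad_z_def prox_grad_theta_def b_def
    using \<gamma>_pos by (cases ?g) (simp add: inner_prod_def inner_diff_left inner_diff_right inner_add_right
        inner_commute field_simps)
  have "\<bar>(G (fst z', t') - G (fst z, t) - inner ((fst z', t') - (fst z, t)) ?g) + (norm b)\<^sup>2 / (2 * \<gamma>)\<bar>
    \<le> L2 * ((norm (fst z' - fst z))\<^sup>2 + (norm (t' - t))\<^sup>2) + (norm b)\<^sup>2 / (2 * \<gamma>)"
    by (rule order_trans[OF abs_triangle_ineq]) (use gb \<gamma>_pos in simp)
  also have "\<dots> \<le> ((1 / 2) * (1 / \<gamma>)) * ((norm (fst z' - fst z))\<^sup>2 + (norm (t' - t))\<^sup>2)
     + (2 * (norm (t' - t))\<^sup>2 + 2 * (norm (snd z' - snd z))\<^sup>2) / (2 * \<gamma>)"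
    using L2_le nb \<gamma>_pos by (intro add_mono mult_right_mono divide_right_mono) auto
  also have "\<dots> \<le> (3 / (2 * \<gamma>)) * ((norm (z' - z))\<^sup>2 + (norm (t' - t))\<^sup>2)"
    unfolding power2_norm_prod[of "z' - z"] using \<gamma>_pos by (simp add: field_simps)
  finally show ?thesis unfolding id .
qed

text \<open>
  Smoothness lets \<open>G\<close> fall at most like \<open>L\<^sub>2 \<parallel>\<theta> - y\<parallel>\<^sup>2\<close>, which is slower than the proximal term
  grows, so the search for a minimiser can be confined to a ball.
\<close>

lemma prox_point_exists: "\<exists>t. \<forall>t'. prox_objective \<gamma> G z t \<le> prox_objective \<gamma> G z t'"
proof -
  let ?f = "prox_objective \<gamma> G z" and ?y = "snd z"
  define A where "A = norm (gradient G z)"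
  define c where "c = 1 / (2 * \<gamma>) - L2"
  have c: "0 < c" using L2_less by (simp add: c_def)
  have lb: "?f ?y - A * norm (t - ?y) + c * (norm (t - ?y))\<^sup>2 \<le> ?f t" for t
  proof -
    have "\<bar>G (fst z, t) - G z - inner ((fst z, t) - z) (gradient G z)\<bar> \<le> L2 * (norm ((fst z, t) - z))\<^sup>2"
      by (rule smoothness_quadratic_bound[OF smooth_G])
    moreover have "\<bar>inner ((fst z, t) - z) (gradient G z)\<bar> \<le> norm ((fst z, t) - z) * A"
      unfolding A_def by (rule Cauchy_Schwarz_ineq2)
    moreover have "norm ((fst z, t) - z) = norm (t - ?y)" by (simp add: norm_prod_def)
    ultimately show ?thesis unfolding prox_objective_def c_def
      by (simp add: algebra_simps abs_le_iff)
  qed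
  have cont: "continuous_on UNIV G"
    using smooth_G unfolding smoothness_def
    by (intro differentiable_imp_continuous_on) (auto simp: differentiable_on_def differentiable_at_withinI)
  have "continuous_on (cball ?y (A / c)) ?f"
    unfolding prox_objective_def by (intro continuous_intros continuous_on_compose2[OF cont]) (use \<gamma>_pos in auto)
  moreover have "cball ?y (A / c) \<noteq> {}" using c by (simp add: A_def not_less)
  ultimately obtain t where t: "t \<in> cball ?y (A / c)" "\<And>t'. t' \<in> cball ?y (A / c) \<Longrightarrow> ?f t \<le> ?f t'"
    using continuous_attains_inf[OF compact_cball] by metis
  have "?f t \<le> ?f t'" for t'
  proof (cases "t' \<in> cball ?y (A / c)")
    case False
    hence "A / c < norm (t' - ?y)" by (simp add: dist_norm norm_minus_commute)
    hence "A < c * norm (t' - ?y)" using c by (simp add: field_simps)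
    hence "A * norm (t' - ?y) \<le> c * norm (t' - ?y) * norm (t' - ?y)" by (intro mult_right_mono) auto
    hence "?f ?y \<le> ?f t'" using lb[of t'] by (simp add: power2_eq_square ac_simps)
    moreover have "?f t \<le> ?f ?y" using t(2)[of ?y] c by (simp add: A_def)
    ultimately show ?thesis by simp
  qed (use t in auto)
  thus ?thesis by blast
qed

lemma prox_point_le: "prox_objective \<gamma> G z (prox_point \<gamma> G z) \<le> prox_objective \<gamma> G z t"
proof -
  obtain t0 where "\<forall>t'. prox_objective \<gamma> G z t0 \<le> prox_objective \<gamma> G z t'"
    using prox_point_exists by blast
  hence "is_arg_min (prox_objective \<gamma> G z) (\<lambda>_. True) t0"
    by (auto simp: is_arg_min_def not_less)
  hence "is_arg_min (prox_objective \<gamma> G z) (\<lambda>_. True) (prox_point \<gamma> G z)"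
    unfolding prox_point_def arg_min_def by (rule someI)
  thus ?thesis by (auto simp: is_arg_min_def not_less)
qed

lemma moreau_env_eq: "moreau_env \<gamma> G z = prox_objective \<gamma> G z (prox_point \<gamma> G z)"
  unfolding moreau_env_def by (rule cInf_eq_minimum) (auto intro: prox_point_le)

lemma moreau_env_le: "moreau_env \<gamma> G z \<le> prox_objective \<gamma> G z t"
  unfolding moreau_env_eq by (rule prox_point_le)

lemma moreau_env_le_self: "moreau_env \<gamma> G z \<le> G z"
  using moreau_env_le[of z "snd z"] by (simp add: prox_objective_def)

lemma prox_optimal: "prox_grad_theta \<gamma> G z (prox_point \<gamma> G z) = 0"
proof -
  let ?t = "prox_point \<gamma> G z"
  define p where "p = prox_grad_theta \<gamma> G z ?t"
  \<comment> \<open>with this step the quadratic error eats up only half of the linear gain\<close>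
  define s where "s = \<gamma> / 3"
  have s: "0 < s" using \<gamma>_pos by (simp add: s_def)
  have "prox_objective \<gamma> G z ?t \<le> prox_objective \<gamma> G z (?t - s *\<^sub>R p)" by (rule prox_point_le)
  also have "\<dots> \<le> prox_objective \<gamma> G z ?t + inner (- (s *\<^sub>R p)) p + (3 / (2 * \<gamma>)) * (norm (s *\<^sub>R p))\<^sup>2"
    using prox_objective_quadratic_bound[of z "?t - s *\<^sub>R p" z ?t] unfolding p_def by simp
  finally have "s * (norm p)\<^sup>2 \<le> (3 / (2 * \<gamma>)) * s\<^sup>2 * (norm p)\<^sup>2"
    by (simp add: power2_norm_eq_inner[symmetric] power_mult_distrib)
  also have "\<dots> = (s / 2) * (norm p)\<^sup>2" using \<gamma>_pos by (simp add: s_def power2_eq_square field_simps)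
  finally have "(s / 2) * (norm p)\<^sup>2 \<le> 0" by simp
  hence "norm p = 0" using s by (simp add: mult_le_0_iff)
  thus ?thesis unfolding p_def by simp
qed

lemma prox_grad_theta_strongly_monotone:
  "(1 / \<gamma> - L2) * (norm (t - t'))\<^sup>2
     \<le> inner (prox_grad_theta \<gamma> G z t - prox_grad_theta \<gamma> G z t') (t - t')"
proof -
  let ?d = "snd (gradient G (fst z, t)) - snd (gradient G (fst z, t'))"
  have "norm ?d \<le> norm (gradient G (fst z, t) - gradient G (fst z, t'))"
    using norm_snd_le_norm[of "gradient G (fst z, t) - gradient G (fst z, t')"] by simp
  hence "norm ?d \<le> L2 * norm (t - t')" using grad_pair_lipschitz[of "fst z" t "fst z" t'] by simp
  hence "\<bar>inner ?d (t - t')\<bar> \<le> (L2 * norm (t - t')) * norm (t - t')"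
    by (intro order_trans[OF Cauchy_Schwarz_ineq2] mult_right_mono) auto
  moreover have "inner (prox_grad_theta \<gamma> G z t - prox_grad_theta \<gamma> G z t') (t - t')
      = inner ?d (t - t') + (1 / \<gamma>) * (norm (t - t'))\<^sup>2"
    unfolding prox_grad_theta_def
    by (simp add: power2_norm_eq_inner inner_add_left inner_diff_left inner_diff_right algebra_simps)
  ultimately show ?thesis by (simp add: power2_eq_square algebra_simps abs_le_iff)
qed

text \<open>
  The proximal objective is strongly convex in \<open>\<theta>\<close> with modulus \<open>1/\<gamma> - L\<^sub>2 > 1/(2 \<gamma>)\<close>.
\<close>

lemma norm_prox_grad_theta_ge:
  "(1 / (2 * \<gamma>)) * norm (t - prox_point \<gamma> G z) \<le> norm (prox_grad_theta \<gamma> G z t)"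
proof (cases "t = prox_point \<gamma> G z")
  case False
  let ?d = "norm (t - prox_point \<gamma> G z)"
  have "(1 / (2 * \<gamma>)) * ?d\<^sup>2 \<le> (1 / \<gamma> - L2) * ?d\<^sup>2"
    using L2_less \<gamma>_pos by (intro mult_right_mono) (auto simp: field_simps)
  also have "\<dots> \<le> inner (prox_grad_theta \<gamma> G z t) (t - prox_point \<gamma> G z)"
    using prox_grad_theta_strongly_monotone[of t "prox_point \<gamma> G z" z] prox_optimal[of z] by simp
  also have "\<dots> \<le> norm (prox_grad_theta \<gamma> G z t) * ?d" by (rule norm_cauchy_schwarz)
  finally have "(1 / (2 * \<gamma>)) * ?d * ?d \<le> norm (prox_grad_theta \<gamma> G z t) * ?d"
    by (simp add: power2_eq_square)
  thus ?thesis by (rule mult_right_le_imp_le) (use False in simp)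
qed simp

lemma prox_grad_theta_lipschitz:
  "norm (prox_grad_theta \<gamma> G z t - prox_grad_theta \<gamma> G z' t')
     \<le> (3 / (2 * \<gamma>)) * (norm (z - z') + norm (t - t'))"
proof -
  let ?d = "gradient G (fst z, t) - gradient G (fst z', t')"
  have n1: "norm (fst z - fst z') \<le> norm (z - z')" using norm_fst_le_norm[of "z - z'"] by simp
  have n2: "norm (snd z - snd z') \<le> norm (z - z')" using norm_snd_le_norm[of "z - z'"] by simp
  have "norm (snd ?d) \<le> norm ?d" by (rule norm_snd_le_norm)
  also have "\<dots> \<le> L2 * (norm (fst z - fst z') + norm (t - t'))" by (rule grad_pair_lipschitz)
  also have "\<dots> \<le> (1 / (2 * \<gamma>)) * (norm (z - z') + norm (t - t'))"
    using n1 L2_less L2_pos \<gamma>_pos by (intro mult_mono) auto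
  finally have a: "norm (snd ?d) \<le> (1 / (2 * \<gamma>)) * (norm (z - z') + norm (t - t'))" .
  have "norm ((t - t') - (snd z - snd z')) \<le> norm (z - z') + norm (t - t')"
    using norm_triangle_ineq4[of "t - t'" "snd z - snd z'"] n2 by simp
  hence b: "norm ((1 / \<gamma>) *\<^sub>R ((t - t') - (snd z - snd z'))) \<le> (1 / \<gamma>) * (norm (z - z') + norm (t - t'))"
    using \<gamma>_pos by (simp add: divide_right_mono)
  have "prox_grad_theta \<gamma> G z t - prox_grad_theta \<gamma> G z' t'
      = snd ?d + (1 / \<gamma>) *\<^sub>R ((t - t') - (snd z - snd z'))"
    unfolding prox_grad_theta_def by (simp add: algebra_simps)
  hence "norm (prox_grad_theta \<gamma> G z t - prox_grad_theta \<gamma> G z' t')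
      \<le> norm (snd ?d) + norm ((1 / \<gamma>) *\<^sub>R ((t - t') - (snd z - snd z')))"
    by (simp only: norm_triangle_ineq)
  also have "\<dots> \<le> (1 / (2 * \<gamma>)) * (norm (z - z') + norm (t - t')) + (1 / \<gamma>) * (norm (z - z') + norm (t - t'))"
    using a b by linarith
  also have "\<dots> = (3 / (2 * \<gamma>)) * (norm (z - z') + norm (t - t'))"
    using \<gamma>_pos by (simp add: field_simps)
  finally show ?thesis .
qed

lemma prox_grad_z_lipschitz:
  "norm (prox_grad_z \<gamma> G z t - prox_grad_z \<gamma> G z' t')
     \<le> (3 / (2 * \<gamma>)) * (norm (z - z') + norm (t - t'))"
proof -
  let ?d = "gradient G (fst z, t) - gradient G (fst z', t')"
  have n1: "norm (fst z - fst z') \<le> norm (z - z')" using norm_fst_le_norm[of "z - z'"] by simp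
  have n2: "norm (snd z - snd z') \<le> norm (z - z')" using norm_snd_le_norm[of "z - z'"] by simp
  have "norm (fst ?d) \<le> norm ?d" by (rule norm_fst_le_norm)
  also have "\<dots> \<le> L2 * (norm (fst z - fst z') + norm (t - t'))" by (rule grad_pair_lipschitz)
  also have "\<dots> \<le> (1 / (2 * \<gamma>)) * (norm (z - z') + norm (t - t'))"
    using n1 L2_less L2_pos \<gamma>_pos by (intro mult_mono) auto
  finally have a: "norm (fst ?d) \<le> (1 / (2 * \<gamma>)) * (norm (z - z') + norm (t - t'))" .
  have "norm ((snd z - snd z') - (t - t')) \<le> norm (z - z') + norm (t - t')"
    using norm_triangle_ineq4[of "snd z - snd z'" "t - t'"] n2 by simp
  hence b: "norm ((1 / \<gamma>) *\<^sub>R ((snd z - snd z') - (t - t'))) \<le> (1 / \<gamma>) * (norm (z - z') + norm (t - t'))"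
    using \<gamma>_pos by (simp add: divide_right_mono)
  have "prox_grad_z \<gamma> G z t - prox_grad_z \<gamma> G z' t'
      = (fst ?d, (1 / \<gamma>) *\<^sub>R ((snd z - snd z') - (t - t')))"
    unfolding prox_grad_z_def by (simp add: algebra_simps)
  hence "norm (prox_grad_z \<gamma> G z t - prox_grad_z \<gamma> G z' t')
      \<le> norm (fst ?d) + norm ((1 / \<gamma>) *\<^sub>R ((snd z - snd z') - (t - t')))"
    by (simp only: norm_Pair_le)
  also have "\<dots> \<le> (1 / (2 * \<gamma>)) * (norm (z - z') + norm (t - t')) + (1 / \<gamma>) * (norm (z - z') + norm (t - t'))"
    using a b by linarith
  also have "\<dots> = (3 / (2 * \<gamma>)) * (norm (z - z') + norm (t - t'))"
    using \<gamma>_pos by (simp add: field_simps)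
  finally show ?thesis .
qed

text \<open>
  The residual that the minimiser for \<open>z'\<close> leaves at \<open>z\<close> measures the distance of the two
  minimisers, and it is the change of a Lipschitz residual between \<open>z\<close> and \<open>z'\<close>.
\<close>

lemma prox_point_lipschitz: "norm (prox_point \<gamma> G z - prox_point \<gamma> G z') \<le> 3 * norm (z - z')"
proof (cases "prox_point \<gamma> G z = prox_point \<gamma> G z'")
  case False
  let ?t = "prox_point \<gamma> G z" and ?t' = "prox_point \<gamma> G z'"
  have "(1 / (2 * \<gamma>)) * norm (?t' - ?t) \<le> norm (prox_grad_theta \<gamma> G z ?t')"
    by (rule norm_prox_grad_theta_ge)
  also have "\<dots> = norm (prox_grad_theta \<gamma> G z ?t' - prox_grad_theta \<gamma> G z' ?t')"
    using prox_optimal[of z'] by simp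
  also have "\<dots> \<le> (3 / (2 * \<gamma>)) * norm (z - z')"
    using prox_grad_theta_lipschitz[of z ?t' z' ?t'] by simp
  finally show ?thesis using \<gamma>_pos by (simp add: field_simps norm_minus_commute)
qed simp

text \<open>
  The optimality condition \<open>y = \<theta>\<^sup>* + \<gamma> \<nabla>\<^sub>yG(x, \<theta>\<^sup>*)\<close> makes \<open>y\<close> a Lipschitz function of
  \<open>\<theta>\<^sup>*\<close>, so \<open>\<theta>\<^sup>*\<close> cannot be a strong contraction in \<open>y\<close>.
\<close>

lemma prox_lipschitz_constant_ge:
  assumes "L\<theta>-lipschitz_on UNIV (prox_point \<gamma> G)"
  shows "2 / 3 \<le> L\<theta>"
proof -
  obtain b :: 'b where b: "b \<in> Basis" using nonempty_Basis by blast
  define z z' where "z = (0::'a, b)" and "z' = (0::'a, 0::'b)"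
  let ?t = "prox_point \<gamma> G z" and ?t' = "prox_point \<gamma> G z'"
  have "prox_grad_theta \<gamma> G z ?t - prox_grad_theta \<gamma> G z' ?t' = 0"
    using prox_optimal by simp
  hence "(1 / \<gamma>) *\<^sub>R b = (snd (gradient G (0, ?t)) - snd (gradient G (0, ?t'))) + (1 / \<gamma>) *\<^sub>R (?t - ?t')"
    unfolding prox_grad_theta_def z_def z'_def by (simp add: algebra_simps)
  hence "norm ((1 / \<gamma>) *\<^sub>R b) \<le> norm (snd (gradient G (0, ?t)) - snd (gradient G (0, ?t')))
      + norm ((1 / \<gamma>) *\<^sub>R (?t - ?t'))" by (simp only: norm_triangle_ineq)
  also have "norm (snd (gradient G (0, ?t)) - snd (gradient G (0, ?t')))
      \<le> norm (gradient G (0, ?t) - gradient G (0, ?t'))"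
    using norm_snd_le_norm[of "gradient G (0, ?t) - gradient G (0, ?t')"] by simp
  also have "\<dots> \<le> L2 * norm (?t - ?t')" using grad_pair_lipschitz[of 0 ?t 0 ?t'] by simp
  also have "\<dots> \<le> (1 / (2 * \<gamma>)) * norm (?t - ?t')" using L2_less by (intro mult_right_mono) auto
  also have "norm ((1 / \<gamma>) *\<^sub>R (?t - ?t')) = (1 / \<gamma>) * norm (?t - ?t')"
    using \<gamma>_pos unfolding norm_scaleR by simp
  also have "norm ((1 / \<gamma>) *\<^sub>R b) = (1 / \<gamma>) * norm b"
    using \<gamma>_pos unfolding norm_scaleR by simp
  finally have "(1 / \<gamma>) * norm b \<le> (3 / (2 * \<gamma>)) * norm (?t - ?t')"
    using \<gamma>_pos by (simp add: field_simps)
  hence "norm b \<le> (3 / 2) * norm (?t - ?t')" using \<gamma>_pos by (simp add: field_simps)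
  moreover have "norm (?t - ?t') \<le> L\<theta> * norm (z - z')"
    using lipschitz_onD[OF assms, of z z'] by (simp add: dist_norm)
  moreover have "norm (z - z') = norm b" unfolding z_def z'_def by (simp add: norm_Pair)
  ultimately show ?thesis using b by simp
qed

definition env_grad :: "'a \<times> 'b \<Rightarrow> 'a \<times> 'b" where
  "env_grad z = prox_grad_z \<gamma> G z (prox_point \<gamma> G z)"

lemma env_grad_lipschitz: "norm (env_grad z - env_grad z') \<le> (6 / \<gamma>) * norm (z - z')"
proof -
  have "norm (env_grad z - env_grad z')
      \<le> (3 / (2 * \<gamma>)) * (norm (z - z') + norm (prox_point \<gamma> G z - prox_point \<gamma> G z'))"
    unfolding env_grad_def by (rule prox_grad_z_lipschitz)
  also have "\<dots> \<le> (3 / (2 * \<gamma>)) * (norm (z - z') + 3 * norm (z - z'))"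
    using prox_point_lipschitz \<gamma>_pos by (intro mult_left_mono add_left_mono) auto
  finally show ?thesis by simp
qed

text \<open>
  Evaluating the envelope at one point with the minimiser of the other bounds its increment from
  above and from below by increments of the smooth proximal objective.
\<close>

lemma moreau_env_quadratic_bound:
  "\<bar>moreau_env \<gamma> G w - moreau_env \<gamma> G z - inner (w - z) (env_grad z)\<bar> \<le> (8 / \<gamma>) * (norm (w - z))\<^sup>2"
proof -
  have up: "moreau_env \<gamma> G w - moreau_env \<gamma> G z \<le> inner (w - z) (env_grad z) + (3 / (2 * \<gamma>)) * (norm (w - z))\<^sup>2"
    for w z
    using moreau_env_le[of w "prox_point \<gamma> G z"] moreau_env_eq[of z]
      prox_objective_quadratic_bound[of w "prox_point \<gamma> G z" z "prox_point \<gamma> G z"]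
    unfolding env_grad_def by simp
  have "\<bar>inner (w - z) (env_grad w - env_grad z)\<bar> \<le> norm (w - z) * ((6 / \<gamma>) * norm (w - z))"
    by (rule order_trans[OF Cauchy_Schwarz_ineq2]) (intro mult_left_mono env_grad_lipschitz norm_ge_zero)
  hence l: "\<bar>inner (w - z) (env_grad w) - inner (w - z) (env_grad z)\<bar> \<le> (6 / \<gamma>) * (norm (w - z))\<^sup>2"
    by (simp add: inner_diff_right power2_eq_square ac_simps)
  have lo: "moreau_env \<gamma> G z - moreau_env \<gamma> G w \<le> - inner (w - z) (env_grad w) + (3 / (2 * \<gamma>)) * (norm (w - z))\<^sup>2"
    using up[of z w] by (simp add: inner_diff_left norm_minus_commute)
  have c: "(3 / (2 * \<gamma>)) * (norm (w - z))\<^sup>2 + (6 / \<gamma>) * (norm (w - z))\<^sup>2 \<le> (8 / \<gamma>) * (norm (w - z))\<^sup>2"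
    "(3 / (2 * \<gamma>)) * (norm (w - z))\<^sup>2 \<le> (8 / \<gamma>) * (norm (w - z))\<^sup>2"
    using \<gamma>_pos by (auto simp: field_simps)
  show ?thesis using up[of w z] lo l c by (simp only: abs_le_iff) linarith
qed

lemma moreau_env_has_derivative: "(moreau_env \<gamma> G has_derivative (\<lambda>h. inner h (env_grad z))) (at z)"
  by (rule has_derivative_of_quadratic_bound[OF moreau_env_quadratic_bound])

lemma gradient_Psi:
  assumes "smoothness L1 F"
  shows "gradient (Psi \<gamma> F G \<mu>) z = \<mu> *\<^sub>R gradient F z + gradient G z - env_grad z"
  unfolding Psi_def
  by (rule gradient_eqI)
    (auto intro!: derivative_eq_intros smoothness_has_derivative[OF assms]
      smoothness_has_derivative[OF smooth_G] moreau_env_has_derivative simp: algebra_simps inner_diff_right inner_add_right)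

lemma prox_point_near: "norm (snd z - prox_point \<gamma> G z) \<le> 2 * \<gamma> * norm (gradient G z)"
proof -
  have "(1 / (2 * \<gamma>)) * norm (snd z - prox_point \<gamma> G z) \<le> norm (prox_grad_theta \<gamma> G z (snd z))"
    by (rule norm_prox_grad_theta_ge)
  also have "\<dots> \<le> norm (gradient G z)" unfolding prox_grad_theta_def by (simp add: norm_snd_le_norm)
  finally show ?thesis using \<gamma>_pos by (simp add: field_simps)
qed

text \<open>
  By the optimality condition the gradient of the envelope is the gradient of \<open>G\<close> at
  \<open>(x, \<theta>\<^sup>*)\<close>, and \<open>\<theta>\<^sup>*\<close> is close to \<open>y\<close>.
\<close>

lemma norm_gradient_minus_env_grad: "norm (gradient G z - env_grad z) \<le> norm (gradient G z)"
proof -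
  let ?t = "prox_point \<gamma> G z"
  have "(1 / \<gamma>) *\<^sub>R (snd z - ?t) = snd (gradient G (fst z, ?t))"
    using prox_optimal[of z] unfolding prox_grad_theta_def by (simp add: algebra_simps)
  hence "env_grad z = gradient G (fst z, ?t)"
    unfolding env_grad_def prox_grad_z_def by simp
  hence "norm (gradient G z - env_grad z) \<le> L2 * norm (snd z - ?t)"
    using grad_pair_lipschitz[of "fst z" "snd z" "fst z" ?t] by simp
  also have "\<dots> \<le> (1 / (2 * \<gamma>)) * (2 * \<gamma> * norm (gradient G z))"
    using prox_point_near[of z] L2_less \<gamma>_pos by (intro mult_mono) auto
  finally show ?thesis using \<gamma>_pos by simp
qed

lemma prox_gap_le:
  "prox_objective \<gamma> G z t - moreau_env \<gamma> G z \<le> (3 / (2 * \<gamma>)) * (norm (t - prox_point \<gamma> G z))\<^sup>2"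
  using prox_objective_quadratic_bound[of z t z "prox_point \<gamma> G z"] prox_optimal[of z]
    moreau_env_eq[of z] by simp

text \<open>
  Replacing \<open>\<theta>\<^sup>*\<close> by \<open>t\<close> changes the envelope gradient by at most
  \<open>\<surd>(L\<^sub>2\<^sup>2 + \<gamma>\<^sup>-\<^sup>2) \<parallel>t - \<theta>\<^sup>*\<parallel>\<close>, and the residual is at least \<open>\<parallel>t - \<theta>\<^sup>*\<parallel> / (2 \<gamma>)\<close>; hence the
  factor \<open>5 = 4 (1/4 + 1)\<close>.
\<close>

lemma env_error_le_residual:
  "(norm (prox_grad_z \<gamma> G z t - env_grad z))\<^sup>2 \<le> 5 * (norm (prox_grad_theta \<gamma> G z t))\<^sup>2"
proof -
  let ?t = "prox_point \<gamma> G z"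
  let ?d = "gradient G (fst z, t) - gradient G (fst z, ?t)"
  have "norm (fst ?d) \<le> norm ?d" by (rule norm_fst_le_norm)
  also have "\<dots> \<le> (1 / (2 * \<gamma>)) * norm (t - ?t)"
    using grad_pair_lipschitz[of "fst z" t "fst z" ?t] L2_less
      mult_right_mono[of L2 "1 / (2 * \<gamma>)" "norm (t - ?t)"] by auto
  finally have "norm (fst ?d) \<le> (1 / (2 * \<gamma>)) * norm (t - ?t)" .
  hence "(norm (fst ?d))\<^sup>2 \<le> ((1 / (2 * \<gamma>)) * norm (t - ?t))\<^sup>2" by (rule power_mono) simp
  moreover have "prox_grad_z \<gamma> G z t - env_grad z = (fst ?d, - ((1 / \<gamma>) *\<^sub>R (t - ?t)))"
    unfolding env_grad_def prox_grad_z_def by (simp add: algebra_simps)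
  hence "(norm (prox_grad_z \<gamma> G z t - env_grad z))\<^sup>2 = (norm (fst ?d))\<^sup>2 + ((1 / \<gamma>) * norm (t - ?t))\<^sup>2"
    using power2_norm_prod[of "prox_grad_z \<gamma> G z t - env_grad z"] \<gamma>_pos by simp
  ultimately have "(norm (prox_grad_z \<gamma> G z t - env_grad z))\<^sup>2 \<le> 5 * ((1 / (2 * \<gamma>)) * norm (t - ?t))\<^sup>2"
    using \<gamma>_pos by (simp add: power_mult_distrib power_divide field_simps)
  also have "\<dots> \<le> 5 * (norm (prox_grad_theta \<gamma> G z t))\<^sup>2"
    using norm_prox_grad_theta_ge[of t z] \<gamma>_pos by (intro mult_left_mono power_mono) auto
  finally show ?thesis .
qed

end

section \<open>The coupled recursion\<close>

text \<open>
  In the application \<open>\<Delta>\<close> is the consensus error, \<open>T\<close> the spread of the trackers, \<open>Q\<close> the squared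
  size of the mean direction, \<open>N\<close> the mean size of the local gradients of \<open>f\<^sub>i\<close>, \<open>S\<close> the progress
  and \<open>Lyap\<close> the Lyapunov function, all in expectation.  The remaining data are the decrease \<open>d\<close> of
  the penalty parameter, the variance \<open>s2\<close> of a sampled direction and the initial error \<open>r\<close>.
\<close>

definition tracking_recursion ::
    "real \<Rightarrow> real \<Rightarrow> real \<Rightarrow> real \<Rightarrow> nat \<Rightarrow> nat \<Rightarrow> real \<Rightarrow> real \<Rightarrow> (nat \<Rightarrow> real) \<Rightarrow>
     (nat \<Rightarrow> real) \<Rightarrow> (nat \<Rightarrow> real) \<Rightarrow> (nat \<Rightarrow> real) \<Rightarrow> (nat \<Rightarrow> real) \<Rightarrow> (nat \<Rightarrow> real) \<Rightarrow> (nat \<Rightarrow> real) \<Rightarrow> bool" where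
  "tracking_recursion C \<mu>0 \<rho> lam n K r s2 d \<Delta> T Q N S Lyap \<longleftrightarrow>
    1 \<le> C \<and> 0 \<le> \<mu>0 \<and> 0 \<le> \<rho> \<and> \<rho> < 1 \<and> 0 < lam \<and> 1 \<le> n \<and> 1 \<le> K \<and> 0 \<le> r \<and> 0 \<le> s2 \<and>
    (\<forall>k. 0 \<le> d k \<and> real k * d k \<le> \<mu>0 \<and> d k \<le> \<mu>0 \<and> (\<Sum>j<k. d j) \<le> \<mu>0) \<and>
    (\<forall>k<K. 0 \<le> \<Delta> k \<and> 0 \<le> T k \<and> 0 \<le> Q k \<and> 0 \<le> N k \<and> 0 \<le> S k) \<and> 0 \<le> Lyap K \<and>
    \<Delta> 0 \<le> r \<and> T 0 \<le> C * (r + s2) \<and> Lyap 0 \<le> C * r \<and>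
    (\<forall>k. Suc k < K \<longrightarrow> \<Delta> (Suc k) \<le> \<rho> * \<Delta> k + lam\<^sup>2 / (1 - \<rho>) * T k) \<and>
    (\<forall>k. Suc k < K \<longrightarrow> T (Suc k) \<le> \<rho> * T k
        + C / (1 - \<rho>) * (\<Delta> (Suc k) + \<Delta> k + lam\<^sup>2 * Q k + (d k)\<^sup>2 * N k + s2)) \<and>
    (\<forall>k<K. Q k \<le> C * (S k + \<Delta> k + s2 / real n)) \<and>
    (\<forall>k<K. N k \<le> C * (r + \<Delta> k + real k * lam\<^sup>2 * (\<Sum>j<k. Q j))) \<and>
    (\<forall>k<K. S k \<le> C * (r + real k * lam\<^sup>2 * (\<Sum>j<k. Q j))) \<and>
    (\<forall>k<K. Lyap (Suc k) \<le> Lyap k - lam / 2 * S k + C * lam * \<Delta> k + C * lam\<^sup>2 * Q k)"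

lemma sum_contraction_le:
  fixes a b :: "nat \<Rightarrow> real"
  assumes "0 \<le> \<rho>" "\<rho> < 1" "1 \<le> K" "\<And>k. k < K \<Longrightarrow> 0 \<le> a k"
    and "\<And>k. Suc k < K \<Longrightarrow> a (Suc k) \<le> \<rho> * a k + b k"
  shows "(1 - \<rho>) * (\<Sum>k<K. a k) \<le> a 0 + (\<Sum>k<K-1. b k)"
proof -
  obtain K' where K: "K = Suc K'" using assms(3) by (cases K) auto
  have "(\<Sum>k<K. a k) = a 0 + (\<Sum>k<K'. a (Suc k))" unfolding K by (rule sum.lessThan_Suc_shift)
  also have "(\<Sum>k<K'. a (Suc k)) \<le> (\<Sum>k<K'. \<rho> * a k + b k)" using assms(5) K by (intro sum_mono) auto
  also have "\<dots> = \<rho> * (\<Sum>k<K'. a k) + (\<Sum>k<K'. b k)" by (simp add: sum.distrib sum_distrib_left)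
  also have "\<dots> \<le> \<rho> * (\<Sum>k<K. a k) + (\<Sum>k<K'. b k)"
    using assms(1) assms(4)[of K'] K by (intro add_right_mono mult_left_mono) auto
  finally show ?thesis using K by (simp add: algebra_simps)
qed

text \<open>
  Solving the loop consensus error, tracker error, mean direction, progress.  Its gain is
  \<open>lam\<^sup>2 / (1 - \<rho>)\<^sup>4\<close>; when that is small the whole loop closes.
\<close>

lemma tracking_recursion_sum_bound:
  assumes R: "tracking_recursion C \<mu>0 \<rho> lam n K r s2 d \<Delta> T Q N S Lyap"
    and B: "B = C * (3 + C * \<mu>0\<^sup>2)"
    and small: "2 * B * lam\<^sup>2 \<le> (1 - \<rho>) ^ 4" "16 * C\<^sup>2 * lam \<le> 1"
  defines "err \<equiv> r / lam + lam * real K * s2 / real n + lam\<^sup>2 * real K * s2 / (1 - \<rho>) ^ 4"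
  shows "(\<Sum>k<K. S k) \<le> 100 * C\<^sup>2 * B * err" "(\<Sum>k<K. \<Delta> k) \<le> 100 * C\<^sup>2 * B * err"
proof -
  define r' where "r' = 1 - \<rho>"
  have C: "1 \<le> C" and mu: "0 \<le> \<mu>0" and rho: "0 \<le> \<rho>" "\<rho> < 1" and lam: "0 < lam" and n: "1 \<le> n"
    and K: "1 \<le> K" and r: "0 \<le> r" and s2: "0 \<le> s2"
    and d: "\<And>k. 0 \<le> d k" "\<And>k. real k * d k \<le> \<mu>0" "\<And>k. d k \<le> \<mu>0" "\<And>k. (\<Sum>j<k. d j) \<le> \<mu>0"
    and nn: "\<And>k. k < K \<Longrightarrow> 0 \<le> \<Delta> k" "\<And>k. k < K \<Longrightarrow> 0 \<le> T k" "\<And>k. k < K \<Longrightarrow> 0 \<le> Q k"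
       "\<And>k. k < K \<Longrightarrow> 0 \<le> N k" "\<And>k. k < K \<Longrightarrow> 0 \<le> S k"
    and LK: "0 \<le> Lyap K" and D0: "\<Delta> 0 \<le> r" and T0: "T 0 \<le> C * (r + s2)" and L0: "Lyap 0 \<le> C * r"
    and R1: "\<And>k. Suc k < K \<Longrightarrow> \<Delta> (Suc k) \<le> \<rho> * \<Delta> k + lam\<^sup>2 / (1 - \<rho>) * T k"
    and R2: "\<And>k. Suc k < K \<Longrightarrow> T (Suc k) \<le> \<rho> * T k
        + C / (1 - \<rho>) * (\<Delta> (Suc k) + \<Delta> k + lam\<^sup>2 * Q k + (d k)\<^sup>2 * N k + s2)"
    and R4: "\<And>k. k < K \<Longrightarrow> Q k \<le> C * (S k + \<Delta> k + s2 / real n)"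
    and R5: "\<And>k. k < K \<Longrightarrow> N k \<le> C * (r + \<Delta> k + real k * lam\<^sup>2 * (\<Sum>j<k. Q j))"
    and R6: "\<And>k. k < K \<Longrightarrow> Lyap (Suc k) \<le> Lyap k - lam / 2 * S k + C * lam * \<Delta> k + C * lam\<^sup>2 * Q k"
    using R unfolding tracking_recursion_def by blast+
  have r': "0 < r'" "r' \<le> 1" using rho by (auto simp: r'_def)
  define X q s where "X = (\<Sum>k<K. \<Delta> k)" and "q = (\<Sum>k<K. Q k)" and "s = (\<Sum>k<K. S k)"
  have X0: "0 \<le> X" and q0: "0 \<le> q" and s0: "0 \<le> s"
    using nn by (auto simp: X_def q_def s_def intro!: sum_nonneg)
  obtain K' where K': "K = Suc K'" using K by (cases K) auto
  define tot where "tot = X + lam\<^sup>2 * q + r + real K * s2"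
  have tot0: "0 \<le> tot" using X0 q0 r s2 by (simp add: tot_def)

  \<comment> \<open>The drift of the penalty parameter is summable even against the linearly growing
      distance from the starting point, because \<open>k d\<^sub>k\<close> is bounded and \<open>d\<close> is summable.\<close>
  have dN: "(d k)\<^sup>2 * N k \<le> C * (d k * (\<mu>0 * r) + \<mu>0\<^sup>2 * \<Delta> k + d k * (\<mu>0 * (lam\<^sup>2 * q)))" if k: "k < K" for k
  proof -
    have "(\<Sum>j<k. Q j) \<le> q" unfolding q_def using k nn by (intro sum_mono2) auto
    hence "N k \<le> C * (r + \<Delta> k + real k * lam\<^sup>2 * q)"
      using R5[OF k] C by (smt (verit) mult_left_mono of_nat_0_le_iff zero_le_mult_iff zero_le_power2)
    hence "(d k)\<^sup>2 * N k \<le> (d k)\<^sup>2 * (C * (r + \<Delta> k + real k * lam\<^sup>2 * q))" by (intro mult_left_mono) auto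
    also have "\<dots> = C * (d k * (d k * r) + (d k)\<^sup>2 * \<Delta> k + d k * ((real k * d k) * (lam\<^sup>2 * q)))"
      by (simp add: power2_eq_square algebra_simps)
    also have "\<dots> \<le> C * (d k * (\<mu>0 * r) + \<mu>0\<^sup>2 * \<Delta> k + d k * (\<mu>0 * (lam\<^sup>2 * q)))"
      using d r nn(1)[OF k] C q0
      by (intro mult_left_mono add_mono mult_right_mono power_mono) auto
    finally show ?thesis .
  qed
  have sdN: "(\<Sum>k<K'. (d k)\<^sup>2 * N k) \<le> C * \<mu>0\<^sup>2 * (r + X + lam\<^sup>2 * q)"
  proof -
    have "(\<Sum>k<K'. (d k)\<^sup>2 * N k) \<le> (\<Sum>k<K'. C * (d k * (\<mu>0 * r) + \<mu>0\<^sup>2 * \<Delta> k + d k * (\<mu>0 * (lam\<^sup>2 * q))))"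
      using dN K' by (intro sum_mono) auto
    also have "\<dots> = C * (\<Sum>k<K'. d k * (\<mu>0 * r) + \<mu>0\<^sup>2 * \<Delta> k + d k * (\<mu>0 * (lam\<^sup>2 * q)))"
      by (rule sum_distrib_left[symmetric])
    also have "\<dots> = C * ((\<Sum>k<K'. d k) * (\<mu>0 * r) + \<mu>0\<^sup>2 * (\<Sum>k<K'. \<Delta> k) + (\<Sum>k<K'. d k) * (\<mu>0 * (lam\<^sup>2 * q)))"
      by (simp only: sum.distrib sum_distrib_left sum_distrib_right)
    also have "\<dots> \<le> C * (\<mu>0 * (\<mu>0 * r) + \<mu>0\<^sup>2 * X + \<mu>0 * (\<mu>0 * (lam\<^sup>2 * q)))"
      using d(4)[of K'] C mu r q0 nn(1)[of K'] K'
      by (intro mult_left_mono add_mono mult_right_mono) (auto simp: X_def)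
    finally show ?thesis by (simp add: power2_eq_square algebra_simps)
  qed
  have sY: "(\<Sum>k<K'. \<Delta> (Suc k) + \<Delta> k + lam\<^sup>2 * Q k + (d k)\<^sup>2 * N k + s2) \<le> (2 + C * \<mu>0\<^sup>2) * tot"
  proof -
    have "(\<Sum>k<K'. \<Delta> (Suc k)) \<le> X"
      using sum.lessThan_Suc_shift[of \<Delta> K'] nn(1)[of 0] K' by (simp add: X_def)
    moreover have "(\<Sum>k<K'. \<Delta> k) \<le> X" using nn(1)[of K'] K' by (simp add: X_def)
    moreover have "lam\<^sup>2 * (\<Sum>k<K'. Q k) \<le> lam\<^sup>2 * q"
      using nn(3)[of K'] K' by (intro mult_left_mono) (auto simp: q_def)
    moreover have "real K' * s2 \<le> real K * s2" using s2 K' by (intro mult_right_mono) auto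
    moreover have "(\<Sum>k<K'. \<Delta> (Suc k) + \<Delta> k + lam\<^sup>2 * Q k + (d k)\<^sup>2 * N k + s2)
       = (\<Sum>k<K'. \<Delta> (Suc k)) + (\<Sum>k<K'. \<Delta> k) + lam\<^sup>2 * (\<Sum>k<K'. Q k) + (\<Sum>k<K'. (d k)\<^sup>2 * N k) + real K' * s2"
      by (simp add: sum.distrib sum_distrib_left)
    moreover have "C * \<mu>0\<^sup>2 * (r + X + lam\<^sup>2 * q) \<le> C * \<mu>0\<^sup>2 * tot"
      using C s2 by (intro mult_left_mono) (auto simp: tot_def)
    ultimately have "(\<Sum>k<K'. \<Delta> (Suc k) + \<Delta> k + lam\<^sup>2 * Q k + (d k)\<^sup>2 * N k + s2)
      \<le> 2 * X + lam\<^sup>2 * q + C * \<mu>0\<^sup>2 * tot + real K * s2" using sdN by linarith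
    also have "\<dots> \<le> 2 * tot + C * \<mu>0\<^sup>2 * tot" using X0 q0 r s2 by (simp add: tot_def)
    finally show ?thesis by (simp add: algebra_simps)
  qed
  have sT: "r' * (\<Sum>k<K. T k) \<le> (B / r') * tot"
  proof -
    have "(1 - \<rho>) * (\<Sum>k<K. T k)
        \<le> T 0 + (\<Sum>k<K-1. C / (1 - \<rho>) * (\<Delta> (Suc k) + \<Delta> k + lam\<^sup>2 * Q k + (d k)\<^sup>2 * N k + s2))"
      by (rule sum_contraction_le[OF rho K]) (use nn R2 in auto)
    hence "r' * (\<Sum>k<K. T k) \<le> T 0 + (\<Sum>k<K'. C / r' * (\<Delta> (Suc k) + \<Delta> k + lam\<^sup>2 * Q k + (d k)\<^sup>2 * N k + s2))"
      using K' unfolding r'_def by simp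
    also have "\<dots> = T 0 + C / r' * (\<Sum>k<K'. \<Delta> (Suc k) + \<Delta> k + lam\<^sup>2 * Q k + (d k)\<^sup>2 * N k + s2)"
      by (simp only: sum_distrib_left)
    also have "\<dots> \<le> C / r' * tot + C / r' * ((2 + C * \<mu>0\<^sup>2) * tot)"
    proof (intro add_mono mult_left_mono sY)
      have "0 \<le> lam\<^sup>2 * q" using q0 by simp
      hence "r + s2 \<le> tot" using X0 s2 K mult_right_mono[of 1 "real K" s2] by (simp add: tot_def)
      hence "C * (r + s2) \<le> C * tot" using C by (intro mult_left_mono) auto
      also have "\<dots> \<le> C / r' * tot" using C r' tot0
        by (intro mult_right_mono) (auto simp: field_simps mult_left_le)
      finally show "T 0 \<le> C / r' * tot" using T0 by simp
    qed (use C r' in auto)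
    also have "\<dots> = (B / r') * tot" unfolding B by (simp add: divide_inverse algebra_simps)
    finally show ?thesis .
  qed
  have B1: "1 \<le> B" unfolding B using C mult_mono[of 1 C 1 "3 + C * \<mu>0\<^sup>2"] by auto
  \<comment> \<open>the gain of the loop from the consensus error through the trackers back to itself\<close>
  define e where "e = B * lam\<^sup>2 / r' ^ 4"
  have e: "0 \<le> e" "2 * e \<le> 1" using small(1) B1 r' by (auto simp: e_def r'_def[symmetric] field_simps)
  define E0 where "E0 = 2 * r / r' + 2 * e * (r + real K * s2)"
  have E0: "0 \<le> E0" using r r' e s2 by (simp add: E0_def)
  have X1: "X \<le> r / r' + e * tot"
  proof -
    have "(1 - \<rho>) * X \<le> \<Delta> 0 + (\<Sum>k<K-1. lam\<^sup>2 / (1 - \<rho>) * T k)"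
      unfolding X_def by (rule sum_contraction_le[OF rho K]) (use nn R1 in auto)
    hence "r' * X \<le> \<Delta> 0 + (\<Sum>k<K'. lam\<^sup>2 / r' * T k)"
      using K' unfolding r'_def by simp
    also have "(\<Sum>k<K'. lam\<^sup>2 / r' * T k) = lam\<^sup>2 / r' * (\<Sum>k<K'. T k)"
      by (rule sum_distrib_left[symmetric])
    also have "\<Delta> 0 + lam\<^sup>2 / r' * (\<Sum>k<K'. T k) \<le> r + lam\<^sup>2 / r' * (\<Sum>k<K. T k)"
      using D0 nn(2)[of K'] r' K' by (intro add_mono mult_left_mono) auto
    also have "lam\<^sup>2 / r' * (\<Sum>k<K. T k) = lam\<^sup>2 / r'\<^sup>2 * (r' * (\<Sum>k<K. T k))"
      using r' by (simp add: power2_eq_square)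
    also have "\<dots> \<le> lam\<^sup>2 / r'\<^sup>2 * ((B / r') * tot)" using sT r' by (intro mult_left_mono) auto
    also have "\<dots> = r' * (e * tot)" using r' by (simp add: e_def power2_eq_square power4_eq_xxxx)
    finally have "r' * X \<le> r' * (r / r' + e * tot)" using r' by (simp add: algebra_simps)
    thus ?thesis using r' by simp
  qed
  have X2: "X \<le> E0 + lam\<^sup>2 * q"
  proof -
    have eX: "2 * e * X \<le> X" using e X0 by (simp add: mult_left_le_one_le)
    have eq: "2 * e * (lam\<^sup>2 * q) \<le> lam\<^sup>2 * q" using e q0 by (intro mult_left_le_one_le) auto
    have "e * tot = e * X + e * (lam\<^sup>2 * q) + e * (r + real K * s2)" by (simp add: tot_def algebra_simps)
    thus ?thesis using X1 eX eq unfolding E0_def by linarith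
  qed
  have lam1: "4 * C * (4 * C * lam) \<le> 1" using small(2) by (simp add: power2_eq_square ac_simps)
  have Cl: "16 * C * lam \<le> 1"
  proof -
    have "16 * C * lam \<le> 16 * C\<^sup>2 * lam" using C lam by (simp add: power2_eq_square)
    thus ?thesis using small(2) by simp
  qed
  have l1: "lam \<le> 1" "16 * lam \<le> 1" using Cl C lam by (auto intro: order_trans[OF _ Cl] simp: mult_le_cancel_right)
  have l2: "lam\<^sup>2 \<le> lam" using l1 lam by (simp add: power2_eq_square)
  have C2l: "2 * C * lam\<^sup>2 \<le> lam"
  proof -
    have "2 * C * lam * lam \<le> 1 * lam" using Cl lam C by (intro mult_right_mono) auto
    thus ?thesis by (simp add: power2_eq_square ac_simps)
  qed
  define w where "w = real K * s2 / real n"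
  have w0: "0 \<le> w" using s2 by (simp add: w_def)
  have q1: "q \<le> 2 * C * (s + E0 + w)"
  proof -
    have "q \<le> (\<Sum>k<K. C * (S k + \<Delta> k + s2 / real n))" unfolding q_def using R4 by (intro sum_mono) auto
    also have "\<dots> = C * (s + X + w)"
      by (simp add: s_def X_def w_def sum.distrib sum_distrib_left algebra_simps)
    also have "\<dots> \<le> C * (s + (E0 + lam\<^sup>2 * q) + w)" using X2 C by (intro mult_left_mono) auto
    finally have "q \<le> C * (s + E0 + w) + C * lam\<^sup>2 * q" by (simp add: algebra_simps)
    moreover have "2 * C * lam\<^sup>2 * q \<le> 1 * q" using C2l l1 q0 by (intro mult_right_mono) auto
    ultimately show ?thesis by linarith
  qed
  have s1: "s \<le> 4 * C * r / lam + (4 * C + 1) * E0 + 16 * C\<^sup>2 * lam * w"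
  proof -
    have tel: "(\<Sum>k<m. lam / 2 * S k) \<le> Lyap 0 - Lyap m + (\<Sum>k<m. C * lam * \<Delta> k + C * lam\<^sup>2 * Q k)"
      if "m \<le> K" for m using that
    proof (induction m)
      case (Suc m) thus ?case using R6[of m] by simp
    qed simp
    have "lam / 2 * s = (\<Sum>k<K. lam / 2 * S k)" by (simp add: s_def sum_distrib_left)
    also have "\<dots> \<le> C * r + (C * lam * X + C * lam\<^sup>2 * q)"
      using tel[of K] LK L0 by (simp add: X_def q_def sum.distrib sum_distrib_left)
    also have "C * lam * X \<le> C * lam * (E0 + lam\<^sup>2 * q)" using X2 C lam by (intro mult_left_mono) auto
    finally have "lam / 2 * s \<le> C * r + C * lam * E0 + C * lam\<^sup>2 * q + C * lam * (lam\<^sup>2 * q)"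
      by (simp add: algebra_simps)
    moreover have "C * lam * (lam\<^sup>2 * q) \<le> C * 1 * (lam\<^sup>2 * q)"
      using C l1 q0 by (intro mult_right_mono mult_left_mono) auto
    moreover have "2 * C * lam\<^sup>2 * q \<le> 2 * C * lam\<^sup>2 * (2 * C * (s + E0 + w))"
      using q1 C by (intro mult_left_mono) auto
    ultimately have "lam / 2 * s \<le> C * r + C * lam * E0 + 2 * C * lam\<^sup>2 * (2 * C * (s + E0 + w))"
      by (simp add: algebra_simps)
    also have "2 * C * lam\<^sup>2 * (2 * C * (s + E0 + w))
        = (4 * C\<^sup>2 * lam) * (lam * (s + E0)) + 4 * C\<^sup>2 * lam\<^sup>2 * w"
      by (simp add: power2_eq_square algebra_simps)
    also have "(4 * C\<^sup>2 * lam) * (lam * (s + E0)) \<le> (1 / 4) * (lam * (s + E0))"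
      using small(2) lam s0 E0 by (intro mult_right_mono) auto
    finally have "lam * s \<le> lam * (4 * C * r / lam + (4 * C + 1) * E0 + 16 * C\<^sup>2 * lam * w)"
      using lam by (simp add: power2_eq_square algebra_simps)
    thus ?thesis using lam by simp
  qed
  have lr: "lam \<le> r'"
  proof -
    have "lam\<^sup>2 \<le> 2 * B * lam\<^sup>2" using B1 mult_right_mono[of 1 "2 * B" "lam\<^sup>2"] by simp
    also have "\<dots> \<le> r' ^ 4" using small(1) by (simp add: r'_def)
    also have "\<dots> \<le> r' ^ 2" using r' by (intro power_decreasing) auto
    finally show ?thesis using r' by (auto intro: power2_le_imp_le)
  qed
  define v where "v = lam\<^sup>2 * real K * s2 / r' ^ 4"
  have v0: "0 \<le> v" using s2 r' by (simp add: v_def)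
  have E1: "E0 \<le> 3 * (r / lam) + 2 * B * v"
  proof -
    have "r / r' \<le> r / lam" using lr lam r r' by (intro divide_left_mono) auto
    moreover have "2 * e * r \<le> r" using e r by (intro mult_left_le_one_le) auto
    moreover have "r \<le> r / lam" 
      using lam r mult_right_mono[OF l1(1) r] by (simp add: field_simps)
    moreover have "e * (real K * s2) = B * v" by (simp add: e_def v_def)
    moreover have "E0 = 2 * (r / r') + 2 * e * r + 2 * (e * (real K * s2))"
      by (simp add: E0_def algebra_simps)
    ultimately show ?thesis by linarith
  qed
  have err: "err = r / lam + lam * w + v" by (simp add: err_def w_def v_def r'_def)
  have rl0: "0 \<le> r / lam" using r lam by simp
  have lw0: "0 \<le> lam * w" using lam w0 by simp
  have err0: "0 \<le> err" unfolding err using rl0 lw0 v0 by simp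
  have CB: "C \<le> C\<^sup>2 * B" "B \<le> C\<^sup>2 * B" "C * B \<le> C\<^sup>2 * B" "C\<^sup>2 \<le> C\<^sup>2 * B" "1 \<le> C\<^sup>2 * B"
  proof -
    have "1 \<le> C\<^sup>2" "C \<le> C\<^sup>2" 
      using C mult_mono[of 1 C 1 C] mult_left_mono[of 1 C C] by (auto simp: power2_eq_square)
    thus "B \<le> C\<^sup>2 * B" "C * B \<le> C\<^sup>2 * B" "C\<^sup>2 \<le> C\<^sup>2 * B" 
      using B1 C mult_right_mono[of 1 "C\<^sup>2" B] mult_right_mono[of C "C\<^sup>2" B]
        mult_left_mono[of 1 B "C\<^sup>2"] by auto
    thus "C \<le> C\<^sup>2 * B" "1 \<le> C\<^sup>2 * B" using \<open>C \<le> C\<^sup>2\<close> \<open>1 \<le> C\<^sup>2\<close> by linarith+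
  qed
  have E2: "E0 \<le> (3 * B) * err"
  proof -
    have "3 * (r / lam) \<le> 3 * B * (r / lam)" using B1 rl0 by (intro mult_right_mono) auto
    moreover have "2 * B * v \<le> 3 * B * v" using B1 v0 by (intro mult_right_mono) auto
    moreover have "0 \<le> 3 * B * (lam * w)" using B1 lw0 by simp
    ultimately show ?thesis using E1 unfolding err by (simp add: distrib_left)
  qed
  have s2': "s \<le> (4 * C + (4 * C + 1) * (3 * B) + 16 * C\<^sup>2) * err"
  proof -
    have "4 * C * r / lam \<le> 4 * C * err"
      using mult_left_mono[of "r / lam" err "4 * C"] C lw0 v0 unfolding err by simp
    moreover have "(4 * C + 1) * E0 \<le> (4 * C + 1) * ((3 * B) * err)"
      using E2 C by (intro mult_left_mono) auto
    moreover have "16 * C\<^sup>2 * lam * w \<le> 16 * C\<^sup>2 * err"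
    proof -
      have "lam * w \<le> err" unfolding err using rl0 v0 by simp
      from mult_left_mono[OF this, of "16 * C\<^sup>2"] show ?thesis by (simp add: ac_simps)
    qed
    ultimately show ?thesis using s1 by (simp add: algebra_simps)
  qed
  have cc: "4 * C + (4 * C + 1) * (3 * B) + 16 * C\<^sup>2 \<le> 40 * C\<^sup>2 * B"
    using CB by (simp add: algebra_simps)
  have s3: "s \<le> 40 * C\<^sup>2 * B * err" using s2' mult_right_mono[OF cc err0] by linarith
  have "X \<le> 2 * E0 + s + lam * w"
  proof -
    have "lam\<^sup>2 * q \<le> lam\<^sup>2 * (2 * C * (s + E0 + w))" using q1 by (intro mult_left_mono) auto
    also have "\<dots> = (2 * C * lam\<^sup>2) * (s + E0) + (2 * C * lam\<^sup>2) * w" by (simp add: algebra_simps)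
    also have "\<dots> \<le> 1 * (s + E0) + lam * w"
      using C2l l1 s0 E0 w0 by (intro add_mono mult_right_mono) auto
    finally show ?thesis using X2 by simp
  qed
  also have "\<dots> \<le> 2 * ((3 * B) * err) + 40 * C\<^sup>2 * B * err + err"
    using E2 s3 rl0 v0 unfolding err by simp
  also have "\<dots> = (6 * B + 40 * C\<^sup>2 * B + 1) * err" by (simp add: algebra_simps)
  also have "\<dots> \<le> 100 * C\<^sup>2 * B * err" by (rule mult_right_mono) (use CB err0 in linarith)+
  finally show "(\<Sum>k<K. \<Delta> k) \<le> 100 * C\<^sup>2 * B * err" unfolding X_def .
  have "40 * C\<^sup>2 * B * err \<le> 100 * C\<^sup>2 * B * err" by (rule mult_right_mono) (use CB err0 in linarith)+
  thus "(\<Sum>k<K. S k) \<le> 100 * C\<^sup>2 * B * err" using s3 unfolding s_def by linarith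
qed

text \<open>
  Each step multiplies the total error by at most a constant, so after boundedly many steps it is
  still a bounded multiple of the initial error and the variance.
\<close>

lemma tracking_recursion_crude_bound:
  assumes R: "tracking_recursion C \<mu>0 \<rho> lam n K r s2 d \<Delta> T Q N S Lyap"
    and bd: "lam \<le> l" "1 / (1 - \<rho>) \<le> a" "real K \<le> m"
  defines "b1 \<equiv> C * (C + C * m * l\<^sup>2 + 1)"
  defines "b2 \<equiv> 1 + C * a * (2 + a * l\<^sup>2 + l\<^sup>2 * b1 + \<mu>0\<^sup>2 * (C * (1 + m * l\<^sup>2)) + 1)"
  defines "b \<equiv> 3 + a * l\<^sup>2 + b2 + b1"
  shows "k < K \<Longrightarrow> \<Delta> k \<le> 3 * C * b ^ K * (r + s2)"
    and "k < K \<Longrightarrow> S k \<le> b1 * (3 * C * b ^ K * (r + s2))"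
    and "1 \<le> b1" and "1 \<le> b"
proof -
  have C: "1 \<le> C" and mu: "0 \<le> \<mu>0" and rho: "0 \<le> \<rho>" "\<rho> < 1" and lam: "0 < lam" and n: "1 \<le> n"
    and K: "1 \<le> K" and r: "0 \<le> r" and s2: "0 \<le> s2"
    and d: "\<And>k. 0 \<le> d k" "\<And>k. d k \<le> \<mu>0"
    and nn: "\<And>k. k < K \<Longrightarrow> 0 \<le> \<Delta> k" "\<And>k. k < K \<Longrightarrow> 0 \<le> T k" "\<And>k. k < K \<Longrightarrow> 0 \<le> Q k"
       "\<And>k. k < K \<Longrightarrow> 0 \<le> N k" "\<And>k. k < K \<Longrightarrow> 0 \<le> S k"
    and D0: "\<Delta> 0 \<le> r" and T0: "T 0 \<le> C * (r + s2)"
    and R1: "\<And>k. Suc k < K \<Longrightarrow> \<Delta> (Suc k) \<le> \<rho> * \<Delta> k + lam\<^sup>2 / (1 - \<rho>) * T k"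
    and R2: "\<And>k. Suc k < K \<Longrightarrow> T (Suc k) \<le> \<rho> * T k
        + C / (1 - \<rho>) * (\<Delta> (Suc k) + \<Delta> k + lam\<^sup>2 * Q k + (d k)\<^sup>2 * N k + s2)"
    and R4: "\<And>k. k < K \<Longrightarrow> Q k \<le> C * (S k + \<Delta> k + s2 / real n)"
    and R5: "\<And>k. k < K \<Longrightarrow> N k \<le> C * (r + \<Delta> k + real k * lam\<^sup>2 * (\<Sum>j<k. Q j))"
    and R8: "\<And>k. k < K \<Longrightarrow> S k \<le> C * (r + real k * lam\<^sup>2 * (\<Sum>j<k. Q j))"
    using R unfolding tracking_recursion_def by blast+
  \<comment> \<open>all errors accumulated up to step \<open>k\<close>, so that one step is one linear inequality\<close>
  define V where "V k = \<Delta> k + T k + (\<Sum>j<k. Q j) + r + s2" for k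
  have sQ: "0 \<le> (\<Sum>j<k. Q j)" if "k < K" for k using nn(3) that by (intro sum_nonneg) auto
  have parts: "0 \<le> V k" "\<Delta> k \<le> V k" "T k \<le> V k" "(\<Sum>j<k. Q j) \<le> V k" "r \<le> V k" "s2 \<le> V k"
     "r + s2 \<le> V k" "r + (\<Sum>j<k. Q j) \<le> V k" "\<Delta> k + s2 \<le> V k" if "k < K" for k
    using nn[OF that] sQ[OF that] r s2 by (auto simp: V_def)
  have l2: "lam\<^sup>2 \<le> l\<^sup>2" using lam bd by (intro power_mono) auto
  have a0: "0 < a" using bd(2) rho by (meson diff_gt_0_iff_gt less_le_trans zero_less_divide_1_iff)
  have m0: "0 \<le> m" using bd(3) by (meson of_nat_0_le_iff order_trans)
  have kl: "real k * lam\<^sup>2 * (\<Sum>j<k. Q j) \<le> m * l\<^sup>2 * V k" if "k < K" for k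
    using that bd(3) l2 parts(4)[OF that] sQ[OF that] by (intro mult_mono) auto
  have b1: "C \<le> b1" "1 \<le> b1"
  proof -
    have "1 \<le> C + C * m * l\<^sup>2 + 1" using C m0 by simp
    hence "C * 1 \<le> b1" unfolding b1_def using C by (intro mult_left_mono) auto
    thus "C \<le> b1" by simp
    thus "1 \<le> b1" using C by simp
  qed
  have Sb': "S k \<le> (C + C * m * l\<^sup>2) * V k" if k: "k < K" for k
  proof -
    have "S k \<le> C * (V k + m * l\<^sup>2 * V k)"
      using R8[OF k] kl[OF k] parts(5)[OF k] C by (intro order_trans[OF R8[OF k]] mult_left_mono add_mono) auto
    thus ?thesis by (simp add: algebra_simps)
  qed
  have Qb: "Q k \<le> b1 * V k" if k: "k < K" for k
  proof -
    have "s2 / real n \<le> s2" using n s2 by (simp add: divide_le_eq mult_left_le mult_le_cancel_left1)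
    hence "Q k \<le> C * ((C + C * m * l\<^sup>2) * V k + V k)"
      using Sb'[OF k] parts(9)[OF k] C by (intro order_trans[OF R4[OF k]] mult_left_mono) auto
    thus ?thesis by (simp add: b1_def algebra_simps)
  qed
  have Sb: "S k \<le> b1 * V k" if k: "k < K" for k
  proof -
    have "(C + C * m * l\<^sup>2) * 1 \<le> C * (C + C * m * l\<^sup>2)" 
      using C m0 mult_right_mono[of 1 C "C + C * m * l\<^sup>2"] by simp
    hence "(C + C * m * l\<^sup>2) * V k \<le> b1 * V k"
      using C parts(1)[OF k] by (intro mult_right_mono) (auto simp: b1_def algebra_simps)
    thus ?thesis using Sb'[OF k] by simp
  qed
  have ar: "1 / (1 - \<rho>) \<le> a" by fact
  have step: "V (Suc k) \<le> b * V k" if k: "Suc k < K" for k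
  proof -
    have k': "k < K" using k by simp
    note P = parts[OF k']
    have D: "\<Delta> (Suc k) \<le> (1 + a * l\<^sup>2) * V k"
    proof -
      have "\<rho> * \<Delta> k \<le> V k" using rho nn(1)[OF k'] P(2) by (meson less_imp_le mult_left_le_one_le order_trans)
      moreover have "lam\<^sup>2 / (1 - \<rho>) * T k \<le> (l\<^sup>2 * a) * V k"
      proof (rule mult_mono)
        have "lam\<^sup>2 * (1 / (1 - \<rho>)) \<le> l\<^sup>2 * a" using l2 ar rho by (intro mult_mono) auto
        thus "lam\<^sup>2 / (1 - \<rho>) \<le> l\<^sup>2 * a" by simp
      qed (use P nn(2)[OF k'] a0 in auto)
      ultimately show ?thesis using R1[OF k] by (simp add: algebra_simps)
    qed
    have Nb: "N k \<le> (C * (1 + m * l\<^sup>2)) * V k"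
    proof -
      have "r + \<Delta> k \<le> V k" using sQ[OF k'] nn(2)[OF k'] s2 by (simp add: V_def)
      hence "N k \<le> C * (V k + m * l\<^sup>2 * V k)"
        using kl[OF k'] C by (intro order_trans[OF R5[OF k']] mult_left_mono add_mono) auto
      thus ?thesis by (simp add: algebra_simps)
    qed
    define c where "c = 2 + a * l\<^sup>2 + l\<^sup>2 * b1 + \<mu>0\<^sup>2 * (C * (1 + m * l\<^sup>2)) + 1"
    have c0: "0 \<le> c" using a0 b1 C m0 by (simp add: c_def)
    have "\<Delta> (Suc k) + \<Delta> k + lam\<^sup>2 * Q k + (d k)\<^sup>2 * N k + s2
      \<le> (1 + a * l\<^sup>2) * V k + V k + l\<^sup>2 * (b1 * V k) + \<mu>0\<^sup>2 * ((C * (1 + m * l\<^sup>2)) * V k) + V k"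
    proof -
      have "lam\<^sup>2 * Q k \<le> l\<^sup>2 * (b1 * V k)"
        using l2 Qb[OF k'] nn(3)[OF k'] by (intro mult_mono) auto
      moreover have "(d k)\<^sup>2 * N k \<le> \<mu>0\<^sup>2 * ((C * (1 + m * l\<^sup>2)) * V k)"
        using power_mono[OF d(2) d(1), of k 2] Nb nn(4)[OF k'] by (intro mult_mono) auto
      ultimately show ?thesis using D P by linarith
    qed
    also have "\<dots> = c * V k" by (simp add: c_def algebra_simps)
    finally have Y: "\<Delta> (Suc k) + \<Delta> k + lam\<^sup>2 * Q k + (d k)\<^sup>2 * N k + s2 \<le> c * V k" .
    have Y0: "0 \<le> \<Delta> (Suc k) + \<Delta> k + lam\<^sup>2 * Q k + (d k)\<^sup>2 * N k + s2"
      using nn[OF k'] nn(1)[OF k] s2 by simp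
    have "C / (1 - \<rho>) * (\<Delta> (Suc k) + \<Delta> k + lam\<^sup>2 * Q k + (d k)\<^sup>2 * N k + s2) \<le> (C * a) * (c * V k)"
    proof (rule mult_mono[OF _ Y _ Y0])
      have "C * (1 / (1 - \<rho>)) \<le> C * a" using ar C by (intro mult_left_mono) auto
      thus "C / (1 - \<rho>) \<le> C * a" by simp
    qed (use C a0 in auto)
    moreover have "\<rho> * T k \<le> V k" using rho nn(2)[OF k'] P(3) by (meson less_imp_le mult_left_le_one_le order_trans)
    ultimately have Tb: "T (Suc k) \<le> b2 * V k"
      using R2[OF k] unfolding b2_def c_def[symmetric] by (simp add: algebra_simps)
    have "V (Suc k) = \<Delta> (Suc k) + T (Suc k) + Q k + ((\<Sum>j<k. Q j) + r + s2)" by (simp add: V_def)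
    also have "\<dots> \<le> (1 + a * l\<^sup>2) * V k + b2 * V k + b1 * V k + 2 * V k"
      using D Tb Qb[OF k'] nn[OF k'] P by (intro add_mono) (auto simp: V_def)
    also have "\<dots> = b * V k" by (simp add: b_def algebra_simps)
    finally show ?thesis .
  qed
  have b2_0: "0 \<le> b2" unfolding b2_def using C a0 b1 m0 by simp
  have bge: "1 \<le> b" unfolding b_def using a0 b1 b2_0 by simp
  have V0: "V 0 \<le> 3 * C * (r + s2)"
  proof -
    have "r + s2 \<le> C * (r + s2)" using C r s2 mult_right_mono[of 1 C "r + s2"] by simp
    thus ?thesis using D0 T0 r s2 unfolding V_def by simp
  qed
  have Vk: "V k \<le> b ^ k * (3 * C * (r + s2))" if "k < K" for k using that
  proof (induction k)
    case 0 thus ?case using V0 by simp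
  next
    case (Suc k)
    have "V (Suc k) \<le> b * V k" using step Suc by simp
    also have "\<dots> \<le> b * (b ^ k * (3 * C * (r + s2)))" using Suc bge by (intro mult_left_mono) auto
    finally show ?case by (simp add: ac_simps)
  qed
  have VK: "V k \<le> 3 * C * b ^ K * (r + s2)" if k: "k < K" for k
  proof -
    have "b ^ k * (3 * C * (r + s2)) \<le> b ^ K * (3 * C * (r + s2))"
      using k bge C r s2 by (intro mult_right_mono power_increasing) auto
    thus ?thesis using Vk[OF k] by (simp add: algebra_simps)
  qed
  show "k < K \<Longrightarrow> \<Delta> k \<le> 3 * C * b ^ K * (r + s2)" using VK parts(2) by (meson order_trans)
  show "k < K \<Longrightarrow> S k \<le> b1 * (3 * C * b ^ K * (r + s2))"
    using Sb VK b1 by (meson mult_left_mono order_trans zero_le_one)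
  show "1 \<le> b1" "1 \<le> b" by (fact b1(2), fact bge)
qed

section \<open>The direction field and its Lyapunov function\<close>

text \<open>
  The three updates with step sizes \<open>c \<lambda>\<close>, \<open>c \<lambda>\<close>, \<open>\<lambda>\<close> are one update of
  \<open>u = ((x, y), \<theta>)\<close> with step size \<open>\<lambda>\<close>.
\<close>

definition joint_dir ::
    "real \<Rightarrow> real \<Rightarrow> real \<Rightarrow> ('a::real_inner \<times> 'b::real_inner \<Rightarrow> real) \<Rightarrow> ('a \<times> 'b \<Rightarrow> real) \<Rightarrow>
     ('a \<times> 'b) \<times> 'b \<Rightarrow> ('a \<times> 'b) \<times> 'b" where
  "joint_dir \<gamma> c \<mu> f g u =
     (c *\<^sub>R (\<mu> *\<^sub>R gradient f (fst u) + gradient g (fst u) - prox_grad_z \<gamma> g (fst u) (snd u)),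
      prox_grad_theta \<gamma> g (fst u) (snd u))"

lemma joint_dir_eq:
  "joint_dir \<gamma> c \<mu> f g ((x, y), t) =
     ((c *\<^sub>R dir_x \<mu> f g x y t, c *\<^sub>R dir_y \<gamma> \<mu> f g x y t), dir_theta \<gamma> g x y t)"
  by (simp add: joint_dir_def dir_x_def dir_y_def dir_theta_def prox_grad_z_def prox_grad_theta_def
      prod_eq_iff)

lemma power2_sum3_le:
  "(norm (a + b + d))\<^sup>2 \<le> 3 * (norm a)\<^sup>2 + 3 * (norm b)\<^sup>2 + 3 * (norm (d :: 'a::real_normed_vector))\<^sup>2"
proof -
  have e: "(p + q + t)\<^sup>2 \<le> 3 * p\<^sup>2 + 3 * q\<^sup>2 + 3 * t\<^sup>2" for p q t :: real
  proof -
    have "0 \<le> (p - q)\<^sup>2 + (q - t)\<^sup>2 + (p - t)\<^sup>2" by simp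
    thus ?thesis by (simp add: power2_eq_square algebra_simps)
  qed
  have "norm (a + b + d) \<le> norm a + norm b + norm d"
    using norm_triangle_ineq[of "a + b" d] norm_triangle_ineq[of a b] by linarith
  hence "(norm (a + b + d))\<^sup>2 \<le> (norm a + norm b + norm d)\<^sup>2" by (intro power_mono) auto
  thus ?thesis using e by (meson order_trans)
qed

lemma (in prox_smooth) joint_dir_lipschitz:
  assumes f: "smoothness L1 f" and \<mu>: "0 \<le> \<mu>" "\<mu> \<le> \<mu>0" and c: "0 \<le> c" "c \<le> 1"
  shows "norm (joint_dir \<gamma> c \<mu> f G u - joint_dir \<gamma> c \<mu> f G v) \<le> (\<mu>0 * L1 + 8 / \<gamma>) * norm (u - v)"
proof -
  define N where "N = norm (u - v)"
  have n1: "norm (fst u - fst v) \<le> N" using norm_fst_le_norm[of "u - v"] by (simp add: N_def)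
  have n2: "norm (snd u - snd v) \<le> N" using norm_snd_le_norm[of "u - v"] by (simp add: N_def)
  have N0: "0 \<le> N" by (simp add: N_def)
  have L1: "0 \<le> L1" using smoothness_nonneg[OF f] .
  let ?a = "\<mu> *\<^sub>R (gradient f (fst u) - gradient f (fst v))"
  let ?b = "gradient G (fst u) - gradient G (fst v)"
  let ?d = "prox_grad_z \<gamma> G (fst u) (snd u) - prox_grad_z \<gamma> G (fst v) (snd v)"
  let ?e = "prox_grad_theta \<gamma> G (fst u) (snd u) - prox_grad_theta \<gamma> G (fst v) (snd v)"
  have "norm ?a \<le> \<mu>0 * (L1 * N)"
  proof -
    have "norm (gradient f (fst u) - gradient f (fst v)) \<le> L1 * N"
      using smoothness_lipschitz[OF f, of "fst u" "fst v"] n1 L1 by (meson mult_left_mono order_trans)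
    hence "\<mu> * norm (gradient f (fst u) - gradient f (fst v)) \<le> \<mu>0 * (L1 * N)"
      using \<mu> by (intro mult_mono) auto
    thus ?thesis using \<mu> by simp
  qed
  moreover have "norm ?b \<le> (1 / (2 * \<gamma>)) * N"
    using smoothness_lipschitz[OF smooth_G, of "fst u" "fst v"] n1 L2_less L2_pos N0
      mult_mono[of L2 "1 / (2 * \<gamma>)" "norm (fst u - fst v)" N] \<gamma>_pos by auto
  moreover have 3: "(3 / (2 * \<gamma>)) * (norm (fst u - fst v) + norm (snd u - snd v)) \<le> (3 / \<gamma>) * N"
  proof -
    have "(3 / (2 * \<gamma>)) * (norm (fst u - fst v) + norm (snd u - snd v)) \<le> (3 / (2 * \<gamma>)) * (2 * N)"
      using n1 n2 \<gamma>_pos by (intro mult_left_mono) auto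
    thus ?thesis by simp
  qed
  moreover have "norm ?d \<le> (3 / \<gamma>) * N"
    using prox_grad_z_lipschitz[of "fst u" "snd u" "fst v" "snd v"] 3 by linarith
  moreover have e: "norm ?e \<le> (3 / \<gamma>) * N"
    using prox_grad_theta_lipschitz[of "fst u" "snd u" "fst v" "snd v"] 3 by linarith
  moreover have "norm (?a + ?b - ?d) \<le> norm ?a + norm ?b + norm ?d"
    using norm_triangle_ineq4[of "?a + ?b" ?d] norm_triangle_ineq[of ?a ?b] by linarith
  moreover have "norm (c *\<^sub>R (?a + ?b - ?d)) \<le> norm (?a + ?b - ?d)"
    using c by (simp add: mult_left_le_one_le)
  moreover have "norm (joint_dir \<gamma> c \<mu> f G u - joint_dir \<gamma> c \<mu> f G v) = norm (c *\<^sub>R (?a + ?b - ?d), ?e)"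
    unfolding joint_dir_def by (simp add: algebra_simps)
  moreover have "norm (c *\<^sub>R (?a + ?b - ?d), ?e) \<le> norm (c *\<^sub>R (?a + ?b - ?d)) + norm ?e"
    by (rule norm_Pair_le)
  ultimately have "norm (joint_dir \<gamma> c \<mu> f G u - joint_dir \<gamma> c \<mu> f G v)
      \<le> \<mu>0 * (L1 * N) + (1 / (2 * \<gamma>)) * N + (3 / \<gamma>) * N + (3 / \<gamma>) * N" by linarith
  also have "\<dots> \<le> (\<mu>0 * L1 + 8 / \<gamma>) * N"
    using \<gamma>_pos N0 by (simp add: field_simps)
  finally show ?thesis by (simp add: N_def)
qed

locale bilevel = prox_smooth G L2 \<gamma>
  for G :: "'a::euclidean_space \<times> 'b::euclidean_space \<Rightarrow> real" and L2 \<gamma> :: real +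
  fixes F :: "'a \<times> 'b \<Rightarrow> real" and L1 c \<mu>0 Flow :: real
  assumes smooth_F: "smoothness L1 F" and c_pos: "0 < c" and c_le: "c \<le> 3 / 32"
    and \<mu>0_pos: "0 < \<mu>0" and F_ge: "Flow \<le> F z"
begin

definition gradPsi :: "real \<Rightarrow> 'a \<times> 'b \<Rightarrow> 'a \<times> 'b" where
  "gradPsi \<mu> z = gradient (Psi \<gamma> F G \<mu>) z"

definition env_error :: "('a \<times> 'b) \<times> 'b \<Rightarrow> 'a \<times> 'b" where
  "env_error u = prox_grad_z \<gamma> G (fst u) (snd u) - env_grad (fst u)"

definition residual :: "('a \<times> 'b) \<times> 'b \<Rightarrow> 'b" where
  "residual u = prox_grad_theta \<gamma> G (fst u) (snd u)"

definition progress :: "real \<Rightarrow> ('a \<times> 'b) \<times> 'b \<Rightarrow> real" where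
  "progress \<mu> u = c * (norm (gradPsi \<mu> (fst u)))\<^sup>2 + (norm (residual u))\<^sup>2 / 2"

text \<open>
  The gap of the proximal objective replaces the squared distance of \<open>\<theta>\<close> to the minimiser:
  unlike that distance it has a Lipschitz gradient although \<open>\<theta>\<^sup>*\<close> is merely Lipschitz, so the
  noise enters it only through the square of the step size.
\<close>

definition lyap :: "real \<Rightarrow> ('a \<times> 'b) \<times> 'b \<Rightarrow> real" where
  "lyap \<mu> u = Psi \<gamma> F G \<mu> (fst u) + (prox_objective \<gamma> G (fst u) (snd u) - moreau_env \<gamma> G (fst u))"

definition lyap_grad :: "real \<Rightarrow> ('a \<times> 'b) \<times> 'b \<Rightarrow> ('a \<times> 'b) \<times> 'b" where
  "lyap_grad \<mu> u = (gradPsi \<mu> (fst u) + env_error u, residual u)"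

lemma gradPsi_eq: "gradPsi \<mu> z = \<mu> *\<^sub>R gradient F z + gradient G z - env_grad z"
  unfolding gradPsi_def by (rule gradient_Psi[OF smooth_F])

lemma joint_dir_mean: "joint_dir \<gamma> c \<mu> F G u = (c *\<^sub>R (gradPsi \<mu> (fst u) - env_error u), residual u)"
  unfolding joint_dir_def gradPsi_eq env_error_def residual_def by simp

lemma env_error_le: "(norm (env_error u))\<^sup>2 \<le> 5 * (norm (residual u))\<^sup>2"
  unfolding env_error_def residual_def by (rule env_error_le_residual)

lemma progress_nonneg: "0 \<le> progress \<mu> u"
  unfolding progress_def using c_pos by simp

text \<open>
  The errors of the \<open>z\<close>-blocks of direction and Lyapunov gradient have opposite signs, so the
  cross terms cancel.
\<close>

lemma inner_lyap_grad_joint_dir: "progress \<mu> u \<le> inner (lyap_grad \<mu> u) (joint_dir \<gamma> c \<mu> F G u)"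
proof -
  have "inner (lyap_grad \<mu> u) (joint_dir \<gamma> c \<mu> F G u)
    = c * ((norm (gradPsi \<mu> (fst u)))\<^sup>2 - (norm (env_error u))\<^sup>2) + (norm (residual u))\<^sup>2"
    unfolding joint_dir_mean lyap_grad_def
    by (simp add: inner_prod_def power2_norm_eq_inner inner_add_left inner_diff_right inner_commute algebra_simps)
  moreover have "c * (norm (env_error u))\<^sup>2 \<le> (3 / 32) * (5 * (norm (residual u))\<^sup>2)"
    using c_pos c_le env_error_le by (intro mult_mono) auto
  moreover have "0 \<le> (norm (residual u))\<^sup>2" by simp
  ultimately show ?thesis unfolding progress_def right_diff_distrib by linarith
qed

lemma norm_joint_dir_le: "(norm (joint_dir \<gamma> c \<mu> F G u))\<^sup>2 \<le> 22 * progress \<mu> u"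
proof -
  let ?P = "gradPsi \<mu> (fst u)" and ?e = "env_error u" and ?r = "residual u"
  have "(norm (?P - ?e))\<^sup>2 \<le> 2 * (norm ?P)\<^sup>2 + 2 * (norm ?e)\<^sup>2" by (rule power2_diff_le)
  also have "\<dots> \<le> 2 * (norm ?P)\<^sup>2 + 10 * (norm ?r)\<^sup>2" using env_error_le[of u] by simp
  finally have "c * (c * (norm (?P - ?e))\<^sup>2) \<le> 1 * (c * (2 * (norm ?P)\<^sup>2 + 10 * (norm ?r)\<^sup>2))"
    using c_pos c_le by (intro mult_mono mult_left_mono) auto
  also have "\<dots> \<le> 2 * (c * (norm ?P)\<^sup>2) + 10 * (norm ?r)\<^sup>2"
    using c_pos c_le by (simp add: distrib_left mult_left_le_one_le)
  finally have "c * (c * (norm (?P - ?e))\<^sup>2) \<le> 2 * (c * (norm ?P)\<^sup>2) + 10 * (norm ?r)\<^sup>2" .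
  moreover have "(norm (joint_dir \<gamma> c \<mu> F G u))\<^sup>2 = c * (c * (norm (?P - ?e))\<^sup>2) + (norm ?r)\<^sup>2"
    unfolding joint_dir_mean power2_norm_prod[of "(_, _)"] using c_pos
    by (simp add: power_mult_distrib power2_eq_square)
  moreover have "0 \<le> c * (norm ?P)\<^sup>2" using c_pos by simp
  ultimately show ?thesis unfolding progress_def by simp
qed

lemma norm_lyap_grad_le: "(norm (lyap_grad \<mu> u))\<^sup>2 \<le> (2 / c + 22) * progress \<mu> u"
proof -
  let ?P = "gradPsi \<mu> (fst u)" and ?e = "env_error u" and ?r = "residual u"
  have "(norm (?P + ?e))\<^sup>2 \<le> 2 * (norm ?P)\<^sup>2 + 2 * (norm ?e)\<^sup>2" by (rule power2_sum_le)
  hence "(norm (lyap_grad \<mu> u))\<^sup>2 \<le> 2 * (norm ?P)\<^sup>2 + 11 * (norm ?r)\<^sup>2"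
    using env_error_le[of u] unfolding lyap_grad_def power2_norm_prod[of "(_, _)"] by simp
  moreover have "(2 / c + 22) * progress \<mu> u
     = 2 * (norm ?P)\<^sup>2 + 11 * (norm ?r)\<^sup>2 + (22 * c * (norm ?P)\<^sup>2 + (norm ?r)\<^sup>2 / c)"
    unfolding progress_def using c_pos by (simp add: field_simps)
  moreover have "0 \<le> 22 * c * (norm ?P)\<^sup>2 + (norm ?r)\<^sup>2 / c" using c_pos by simp
  ultimately show ?thesis by linarith
qed

text \<open>
  The envelope enters twice with a negative sign, so its lower quadratic bound is the one that
  matters.
\<close>

lemma lyap_descent:
  assumes \<mu>: "0 \<le> \<mu>" "\<mu> \<le> \<mu>0"
  shows "lyap \<mu> v \<le> lyap \<mu> u + inner (v - u) (lyap_grad \<mu> u) + (\<mu>0 * L1 + 18 / \<gamma>) * (norm (v - u))\<^sup>2"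
proof -
  define N where "N = (norm (v - u))\<^sup>2"
  let ?z = "fst u" and ?w = "fst v"
  have Nz: "(norm (?w - ?z))\<^sup>2 \<le> N" using power2_norm_prod[of "v - u"] by (simp add: N_def)
  have Nt: "(norm (?w - ?z))\<^sup>2 + (norm (snd v - snd u))\<^sup>2 = N" using power2_norm_prod[of "v - u"] by (simp add: N_def)
  have L1: "0 \<le> L1" using smoothness_nonneg[OF smooth_F] .
  have "F ?w - F ?z - inner (?w - ?z) (gradient F ?z) \<le> L1 * N"
    using smoothness_quadratic_bound[OF smooth_F, of ?w ?z] mult_left_mono[OF Nz L1] by (simp add: abs_le_iff)
  hence "\<mu> * (F ?w - F ?z - inner (?w - ?z) (gradient F ?z)) \<le> \<mu> * (L1 * N)"
    using \<mu> by (intro mult_left_mono) auto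
  also have "\<dots> \<le> \<mu>0 * (L1 * N)" using \<mu> L1 by (intro mult_right_mono) (auto simp: N_def)
  finally have 1: "\<mu> * (F ?w - F ?z - inner (?w - ?z) (gradient F ?z)) \<le> \<mu>0 * (L1 * N)" .
  have 2: "G ?w - G ?z - inner (?w - ?z) (gradient G ?z) \<le> (1 / (2 * \<gamma>)) * N"
    using smoothness_quadratic_bound[OF smooth_G, of ?w ?z] L2_less L2_pos Nz
      mult_mono[of L2 "1 / (2 * \<gamma>)" "(norm (?w - ?z))\<^sup>2" N] \<gamma>_pos by (simp add: abs_le_iff)
  have 3: "- moreau_env \<gamma> G ?w + moreau_env \<gamma> G ?z + inner (?w - ?z) (env_grad ?z) \<le> (8 / \<gamma>) * N"
    using moreau_env_quadratic_bound[of ?w ?z] mult_left_mono[OF Nz, of "8 / \<gamma>"] \<gamma>_pos by (simp add: abs_le_iff)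
  have 4: "prox_objective \<gamma> G ?w (snd v) - prox_objective \<gamma> G ?z (snd u)
     - inner (?w - ?z) (prox_grad_z \<gamma> G ?z (snd u)) - inner (snd v - snd u) (residual u) \<le> (3 / (2 * \<gamma>)) * N"
    using prox_objective_quadratic_bound[of ?w "snd v" ?z "snd u"] unfolding Nt residual_def
    by (simp add: abs_le_iff)
  have ip: "inner (v - u) (lyap_grad \<mu> u) = \<mu> * inner (?w - ?z) (gradient F ?z) + inner (?w - ?z) (gradient G ?z)
     - 2 * inner (?w - ?z) (env_grad ?z) + inner (?w - ?z) (prox_grad_z \<gamma> G ?z (snd u)) + inner (snd v - snd u) (residual u)"
    unfolding lyap_grad_def gradPsi_eq env_error_def
    by (simp add: inner_prod_def inner_add_right inner_diff_right distrib_left)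
  have "lyap \<mu> v - lyap \<mu> u - inner (v - u) (lyap_grad \<mu> u)
     = \<mu> * (F ?w - F ?z - inner (?w - ?z) (gradient F ?z)) + (G ?w - G ?z - inner (?w - ?z) (gradient G ?z))
      + 2 * (- moreau_env \<gamma> G ?w + moreau_env \<gamma> G ?z + inner (?w - ?z) (env_grad ?z))
      + (prox_objective \<gamma> G ?w (snd v) - prox_objective \<gamma> G ?z (snd u)
     - inner (?w - ?z) (prox_grad_z \<gamma> G ?z (snd u)) - inner (snd v - snd u) (residual u))"
    unfolding ip lyap_def Psi_def by (simp add: algebra_simps)
  also have "\<dots> \<le> \<mu>0 * (L1 * N) + (1 / (2 * \<gamma>)) * N + 2 * ((8 / \<gamma>) * N) + (3 / (2 * \<gamma>)) * N"
    by (intro add_mono mult_left_mono 1 2 3 4) auto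
  also have "\<dots> = (\<mu>0 * L1 + 18 / \<gamma>) * N" using \<gamma>_pos by (simp add: field_simps)
  finally show ?thesis unfolding N_def by simp
qed

lemma lyap_ge: "0 \<le> \<mu> \<Longrightarrow> \<mu> * Flow \<le> lyap \<mu> u"
  using moreau_env_le_self[of "fst u"] moreau_env_le[of "fst u" "snd u"] mult_left_mono[OF F_ge[of "fst u"], of \<mu>]
  unfolding lyap_def Psi_def by simp

text \<open>
  Subtracting \<open>\<mu> Flow\<close> turns the multiplier of \<open>\<mu>\<close> into the nonnegative \<open>F - Flow\<close>, so lowering the
  penalty parameter cannot hurt.
\<close>

lemma lyap_mono: "\<mu>' \<le> \<mu> \<Longrightarrow> lyap \<mu>' u - \<mu>' * Flow \<le> lyap \<mu> u - \<mu> * Flow"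
  using mult_left_mono[OF F_ge[of "fst u"], of "\<mu> - \<mu>'"] unfolding lyap_def Psi_def
  by (simp add: algebra_simps)

lemma lyap_initial_le:
  "lyap \<mu> u - \<mu> * Flow \<le> (Psi \<gamma> F G \<mu> (fst u) - \<mu> * Flow)
      + (3 / (2 * \<gamma>)) * (norm (snd u - prox_point \<gamma> G (fst u)))\<^sup>2"
  unfolding lyap_def using prox_gap_le[of "fst u" "snd u"] by simp

text \<open>
  Progress is the square of a Lipschitz function of the state.  Where the step size is not small and
  the Lyapunov decrease says nothing, it is controlled by the distance travelled.
\<close>

lemma progress_growth:
  assumes \<mu>: "0 \<le> \<mu>" "\<mu> \<le> \<mu>0"
  shows "progress \<mu> u \<le> (3 * \<mu>0\<^sup>2 + 3 + 3 * (\<mu>0 * L1 + 7 / \<gamma>)\<^sup>2 + 18 / \<gamma>\<^sup>2) *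
     ((norm (gradient F (fst v)))\<^sup>2 + (norm (gradient G (fst v)))\<^sup>2
       + (norm (snd v - prox_point \<gamma> G (fst v)))\<^sup>2 + (norm (u - v))\<^sup>2)"
proof -
  define N where "N = norm (u - v)"
  define a b e where "a = norm (gradient F (fst v))" and "b = norm (gradient G (fst v))"
    and "e = norm (snd v - prox_point \<gamma> G (fst v))"
  have n1: "norm (fst u - fst v) \<le> N" using norm_fst_le_norm[of "u - v"] by (simp add: N_def)
  have n2: "norm (snd u - snd v) \<le> N" using norm_snd_le_norm[of "u - v"] by (simp add: N_def)
  have N0: "0 \<le> N" by (simp add: N_def)
  have L1: "0 \<le> L1" using smoothness_nonneg[OF smooth_F] .
  let ?p = "\<lambda>z. gradient G z - env_grad z"
  have F1: "norm (gradient F (fst u)) \<le> a + L1 * N"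
    using smoothness_lipschitz[OF smooth_F, of "fst u" "fst v"] mult_left_mono[OF n1 L1]
      norm_triangle_ineq2[of "gradient F (fst u)" "gradient F (fst v)"] by (simp add: a_def)
  have p1: "norm (?p (fst u)) \<le> b + (7 / \<gamma>) * N"
  proof -
    have "norm (gradient G (fst u) - gradient G (fst v)) \<le> (1 / (2 * \<gamma>)) * N"
      using smoothness_lipschitz[OF smooth_G, of "fst u" "fst v"] n1 L2_less L2_pos N0
        mult_mono[of L2 "1 / (2 * \<gamma>)" "norm (fst u - fst v)" N] \<gamma>_pos by auto
    moreover have "norm (env_grad (fst u) - env_grad (fst v)) \<le> (6 / \<gamma>) * N"
      using env_grad_lipschitz[of "fst u" "fst v"] mult_left_mono[OF n1, of "6 / \<gamma>"] \<gamma>_pos by simp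
    moreover have "norm (?p (fst v)) \<le> b" unfolding b_def by (rule norm_gradient_minus_env_grad)
    moreover have "?p (fst u) = ?p (fst v) + (gradient G (fst u) - gradient G (fst v)) - (env_grad (fst u) - env_grad (fst v))"
      by simp
    moreover have "norm (x + y - w) \<le> norm x + norm y + norm w" for x y w :: "'a \<times> 'b"
      using norm_triangle_ineq4[of "x + y" w] norm_triangle_ineq[of x y] by linarith
    then have "norm (?p (fst v) + (gradient G (fst u) - gradient G (fst v)) - (env_grad (fst u) - env_grad (fst v)))
      \<le> norm (?p (fst v)) + norm (gradient G (fst u) - gradient G (fst v)) + norm (env_grad (fst u) - env_grad (fst v))" .
    moreover have "(1 / (2 * \<gamma>)) * N + (6 / \<gamma>) * N \<le> (7 / \<gamma>) * N" using \<gamma>_pos N0 by (simp add: field_simps)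
    ultimately show ?thesis by (simp only:)
  qed
  have P1: "norm (gradPsi \<mu> (fst u)) \<le> \<mu>0 * a + b + (\<mu>0 * L1 + 7 / \<gamma>) * N"
  proof -
    have "gradPsi \<mu> (fst u) = \<mu> *\<^sub>R gradient F (fst u) + ?p (fst u)" unfolding gradPsi_eq by simp
    hence "norm (gradPsi \<mu> (fst u)) \<le> norm (\<mu> *\<^sub>R gradient F (fst u)) + norm (?p (fst u))"
      by (simp only: norm_triangle_ineq)
    moreover have "norm (\<mu> *\<^sub>R gradient F (fst u)) \<le> \<mu>0 * (a + L1 * N)"
      using F1 \<mu> by (auto intro!: mult_mono)
    ultimately show ?thesis using p1 by (simp add: algebra_simps)
  qed
  define K where "K = \<mu>0 * L1 + 7 / \<gamma>"
  have P2: "(norm (gradPsi \<mu> (fst u)))\<^sup>2 \<le> 3 * (\<mu>0\<^sup>2 * a\<^sup>2) + 3 * b\<^sup>2 + 3 * (K\<^sup>2 * N\<^sup>2)"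
  proof -
    have "(norm (gradPsi \<mu> (fst u)))\<^sup>2 \<le> (norm (\<mu>0 * a + b + K * N))\<^sup>2"
      using P1 by (intro power_mono) (auto simp: K_def)
    also have "\<dots> \<le> 3 * (norm (\<mu>0 * a))\<^sup>2 + 3 * (norm b)\<^sup>2 + 3 * (norm (K * N))\<^sup>2" by (rule power2_sum3_le)
    finally show ?thesis by (simp add: power_mult_distrib)
  qed
  have r1: "norm (residual u) \<le> (3 / (2 * \<gamma>)) * e + (3 / \<gamma>) * N"
  proof -
    have "norm (residual u - residual v) \<le> (3 / (2 * \<gamma>)) * (norm (fst u - fst v) + norm (snd u - snd v))"
      unfolding residual_def by (rule prox_grad_theta_lipschitz)
    also have "\<dots> \<le> (3 / (2 * \<gamma>)) * (2 * N)" using n1 n2 \<gamma>_pos by (intro mult_left_mono) auto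
    finally have "norm (residual u - residual v) \<le> (3 / \<gamma>) * N" by simp
    moreover have "norm (residual v) \<le> (3 / (2 * \<gamma>)) * e"
      using prox_grad_theta_lipschitz[of "fst v" "snd v" "fst v" "prox_point \<gamma> G (fst v)"] prox_optimal[of "fst v"]
      unfolding residual_def e_def by simp
    ultimately show ?thesis using norm_triangle_ineq2[of "residual u" "residual v"] by linarith
  qed
  have r2: "(norm (residual u))\<^sup>2 \<le> 2 * ((9 / (4 * \<gamma>\<^sup>2)) * e\<^sup>2) + 2 * ((9 / \<gamma>\<^sup>2) * N\<^sup>2)"
  proof -
    have "(norm (residual u))\<^sup>2 \<le> (norm ((3 / (2 * \<gamma>)) * e + (3 / \<gamma>) * N))\<^sup>2"
      using r1 by (intro power_mono) auto
    also have "\<dots> \<le> 2 * (norm ((3 / (2 * \<gamma>)) * e))\<^sup>2 + 2 * (norm ((3 / \<gamma>) * N))\<^sup>2" by (rule power2_sum_le)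
    finally show ?thesis by (simp add: power_mult_distrib power_divide)
  qed
  define T where "T = 3 * \<mu>0\<^sup>2 + 3 + 3 * K\<^sup>2 + 18 / \<gamma>\<^sup>2"
  have T0: "3 * \<mu>0\<^sup>2 \<le> T" "3 \<le> T" "3 * K\<^sup>2 + 9 / \<gamma>\<^sup>2 \<le> T" "9 / (4 * \<gamma>\<^sup>2) \<le> T"
  proof -
    define g where "g = 1 / \<gamma>\<^sup>2"
    have g: "9 / \<gamma>\<^sup>2 = 9 * g" "9 / (4 * \<gamma>\<^sup>2) = (9 / 4) * g" "18 / \<gamma>\<^sup>2 = 18 * g" "0 \<le> g"
      by (auto simp: g_def)
    have "0 \<le> \<mu>0\<^sup>2" "0 \<le> K\<^sup>2" by auto
    thus "3 * \<mu>0\<^sup>2 \<le> T" "3 \<le> T" "3 * K\<^sup>2 + 9 / \<gamma>\<^sup>2 \<le> T" "9 / (4 * \<gamma>\<^sup>2) \<le> T"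
      using g(4) unfolding T_def g(1,2,3) by linarith+
  qed
  have "progress \<mu> u \<le> (norm (gradPsi \<mu> (fst u)))\<^sup>2 + (norm (residual u))\<^sup>2 / 2"
    unfolding progress_def using c_pos c_le by (simp add: mult_left_le_one_le)
  also have "\<dots> \<le> (3 * \<mu>0\<^sup>2) * a\<^sup>2 + 3 * b\<^sup>2 + (9 / (4 * \<gamma>\<^sup>2)) * e\<^sup>2 + (3 * K\<^sup>2 + 9 / \<gamma>\<^sup>2) * N\<^sup>2"
    using P2 r2 by (simp add: algebra_simps)
  also have "\<dots> \<le> T * a\<^sup>2 + T * b\<^sup>2 + T * e\<^sup>2 + T * N\<^sup>2"
    using T0 by (intro add_mono mult_right_mono) auto
  also have "\<dots> = T * (a\<^sup>2 + b\<^sup>2 + e\<^sup>2 + N\<^sup>2)" by (simp add: algebra_simps)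
  finally show ?thesis unfolding T_def K_def a_def b_def e_def N_def .
qed

end

section \<open>Measurability of sampled gradients\<close>

text \<open>
  The point is approximated by simple functions of itself, for which joint measurability only needs
  the sections in the sample.
\<close>

lemma Caratheodory_jointly_measurable:
  fixes h :: "'s \<Rightarrow> 'c::euclidean_space \<Rightarrow> real"
  assumes m: "\<And>z. (\<lambda>s. h s z) \<in> borel_measurable P"
    and c: "\<And>s. s \<in> space P \<Longrightarrow> continuous_on UNIV (h s)"
  shows "(\<lambda>p. h (fst p) (snd p)) \<in> borel_measurable (P \<Otimes>\<^sub>M borel)"
proof -
  have id: "(\<lambda>z::'c. z) \<in> borel_measurable borel" by simp
  obtain S :: "nat \<Rightarrow> 'c \<Rightarrow> 'c" where S: "\<And>i. simple_function borel (S i)"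
    and lim: "\<And>z. (\<lambda>i. S i z) \<longlonglongrightarrow> z"
    using borel_measurable_implies_sequence_metric[OF id, of 0] by auto
  show ?thesis
  proof (rule borel_measurable_LIMSEQ_metric)
    fix i
    have cs: "S i \<in> measurable borel (count_space (range (S i)))"
      using S[of i] unfolding simple_function_def by (auto intro!: measurable_count_space_eq2[THEN iffD2])
    have cr: "countable (range (S i))"
      using S[of i] unfolding simple_function_def by (auto intro: countable_finite)
    have gm: "(\<lambda>p. S i (snd p)) \<in> measurable (P \<Otimes>\<^sub>M borel) (count_space (range (S i)))"
      by (rule measurable_compose[OF measurable_snd cs])
    have hm: "(\<lambda>p. h (fst p) z) \<in> borel_measurable (P \<Otimes>\<^sub>M borel)" for z
      by (rule measurable_compose[OF measurable_fst m])
    show "(\<lambda>p. h (fst p) (S i (snd p))) \<in> borel_measurable (P \<Otimes>\<^sub>M borel)"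
      by (rule measurable_compose_countable'[where f = "\<lambda>z p. h (fst p) z", OF hm gm cr])
  next
    fix p assume "p \<in> space (P \<Otimes>\<^sub>M (borel :: 'c measure))"
    hence "fst p \<in> space P" by (auto simp: space_pair_measure)
    hence "isCont (h (fst p)) (snd p)" using c continuous_on_eq_continuous_at[of UNIV] by auto
    thus "(\<lambda>i. h (fst p) (S i (snd p))) \<longlonglongrightarrow> h (fst p) (snd p)"
      using lim isCont_tendsto_compose by blast
  qed
qed

lemma gradient_inner_difference_quotient:
  fixes f :: "'c::euclidean_space \<Rightarrow> real"
  assumes "f differentiable at z"
  shows "(\<lambda>m. real (Suc m) * (f (z + (1 / real (Suc m)) *\<^sub>R b) - f z)) \<longlonglongrightarrow> inner b (gradient f z)"
proof -
  have "((\<lambda>t. f (z + t *\<^sub>R b)) has_derivative (\<lambda>t. inner (t *\<^sub>R b) (gradient f z))) (at 0)"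
  proof (rule has_derivative_compose[where f = "\<lambda>t. z + t *\<^sub>R b" and g = f])
    show "((\<lambda>t. z + t *\<^sub>R b) has_derivative (\<lambda>t. t *\<^sub>R b)) (at 0)"
      by (auto intro!: derivative_eq_intros)
    show "(f has_derivative (\<lambda>h. inner h (gradient f z))) (at (z + 0 *\<^sub>R b))"
      using has_derivative_gradient[OF assms] by simp
  qed
  hence "((\<lambda>t. f (z + t *\<^sub>R b)) has_field_derivative inner b (gradient f z)) (at 0)"
    unfolding has_field_derivative_def by (simp add: mult.commute[of _ "inner b (gradient f z)"] mult_commute_abs)
  hence l: "((\<lambda>t. (f (z + t *\<^sub>R b) - f z) / t) \<longlongrightarrow> inner b (gradient f z)) (at 0)"
    unfolding DERIV_def by simp
  have "filterlim (\<lambda>m. 1 / real (Suc m)) (at 0) sequentially"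
    unfolding filterlim_at using LIMSEQ_inverse_real_of_nat by (auto simp: inverse_eq_divide)
  from filterlim_compose[OF l this] show ?thesis by (simp add: field_simps)
qed

text \<open>
  A sampled gradient need not be continuous in the point, but it is a limit of difference quotients
  of a function that is jointly measurable.
\<close>

lemma gradient_jointly_measurable:
  fixes h :: "'s \<Rightarrow> 'c::euclidean_space \<Rightarrow> real"
  assumes m: "\<And>z. (\<lambda>s. h s z) \<in> borel_measurable P"
    and d: "\<And>s z. s \<in> space P \<Longrightarrow> h s differentiable at z"
  shows "(\<lambda>p. gradient (h (fst p)) (snd p)) \<in> borel_measurable (P \<Otimes>\<^sub>M borel)"
proof -
  have c: "continuous_on UNIV (h s)" if "s \<in> space P" for s
    using d[OF that] by (intro differentiable_imp_continuous_on)
      (auto simp: differentiable_on_def differentiable_at_withinI)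
  note joint = Caratheodory_jointly_measurable[OF m c]
  have "(\<lambda>p. inner b (gradient (h (fst p)) (snd p))) \<in> borel_measurable (P \<Otimes>\<^sub>M borel)" for b
  proof (rule borel_measurable_LIMSEQ_metric)
    fix i
    have "(\<lambda>p. (fst p, snd p + (1 / real (Suc i)) *\<^sub>R b)) \<in> measurable (P \<Otimes>\<^sub>M borel) (P \<Otimes>\<^sub>M borel)"
      by measurable
    from measurable_compose[OF this joint] joint
    show "(\<lambda>p. real (Suc i) * (h (fst p) (snd p + (1 / real (Suc i)) *\<^sub>R b) - h (fst p) (snd p)))
        \<in> borel_measurable (P \<Otimes>\<^sub>M borel)" by simp
  next
    fix p assume "p \<in> space (P \<Otimes>\<^sub>M (borel :: 'c measure))"
    hence "fst p \<in> space P" by (auto simp: space_pair_measure)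
    thus "(\<lambda>i. real (Suc i) * (h (fst p) (snd p + (1 / real (Suc i)) *\<^sub>R b) - h (fst p) (snd p)))
        \<longlonglongrightarrow> inner b (gradient (h (fst p)) (snd p))"
      by (intro gradient_inner_difference_quotient d)
  qed
  thus ?thesis by (subst borel_measurable_euclidean_space) (simp add: inner_commute)
qed

section \<open>Square integrable random vectors\<close>

definition sq_integrable :: "'w measure \<Rightarrow> ('w \<Rightarrow> 'c::euclidean_space) \<Rightarrow> bool" where
  "sq_integrable M X \<longleftrightarrow> X \<in> borel_measurable M \<and> integrable M (\<lambda>\<omega>. (norm (X \<omega>))\<^sup>2)"

lemma sq_integrable_measurable: "sq_integrable M X \<Longrightarrow> X \<in> borel_measurable M"
  by (simp add: sq_integrable_def)

lemma sq_integrable_integrable: "sq_integrable M X \<Longrightarrow> integrable M (\<lambda>\<omega>. (norm (X \<omega>))\<^sup>2)"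
  by (simp add: sq_integrable_def)

lemma sq_integrable_add:
  assumes "sq_integrable M X" "sq_integrable M Y"
  shows "sq_integrable M (\<lambda>\<omega>. X \<omega> + Y \<omega>)"
  unfolding sq_integrable_def
proof
  show m: "(\<lambda>\<omega>. X \<omega> + Y \<omega>) \<in> borel_measurable M"
    using assms by (auto simp: sq_integrable_def)
  show "integrable M (\<lambda>\<omega>. (norm (X \<omega> + Y \<omega>))\<^sup>2)"
  proof (rule Bochner_Integration.integrable_bound)
    show "integrable M (\<lambda>\<omega>. 2 * (norm (X \<omega>))\<^sup>2 + 2 * (norm (Y \<omega>))\<^sup>2)"
      using assms by (auto simp: sq_integrable_def)
    show "(\<lambda>\<omega>. (norm (X \<omega> + Y \<omega>))\<^sup>2) \<in> borel_measurable M" using m by measurable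
  qed (auto simp: power2_sum_le)
qed

lemma sq_integrable_scaleR: "sq_integrable M X \<Longrightarrow> sq_integrable M (\<lambda>\<omega>. c *\<^sub>R X \<omega>)"
  by (auto simp: sq_integrable_def power_mult_distrib)

lemma sq_integrable_diff:
  "sq_integrable M X \<Longrightarrow> sq_integrable M Y \<Longrightarrow> sq_integrable M (\<lambda>\<omega>. X \<omega> - Y \<omega>)"
  using sq_integrable_add[of M X "\<lambda>\<omega>. (-1) *\<^sub>R Y \<omega>"] sq_integrable_scaleR[of M Y "-1"] by simp

lemma sq_integrable_sum:
  "(\<And>i. i \<in> A \<Longrightarrow> sq_integrable M (X i)) \<Longrightarrow> sq_integrable M (\<lambda>\<omega>. \<Sum>i\<in>A. X i \<omega>)"
proof (induction A rule: infinite_finite_induct)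
  case (insert x A)
  thus ?case by (simp add: sq_integrable_add)
qed (simp_all add: sq_integrable_def)

lemma sq_integrable_average:
  "(\<And>i. i < n \<Longrightarrow> sq_integrable M (X i)) \<Longrightarrow> sq_integrable M (\<lambda>\<omega>. average n (\<lambda>i. X i \<omega>))"
  unfolding average_def by (intro sq_integrable_scaleR sq_integrable_sum) auto

lemma (in finite_measure) sq_integrable_const: "sq_integrable M (\<lambda>\<omega>. c)"
  by (simp add: sq_integrable_def)

lemma sq_integrable_cong:
  "(\<And>\<omega>. \<omega> \<in> space M \<Longrightarrow> X \<omega> = Y \<omega>) \<Longrightarrow> sq_integrable M X \<longleftrightarrow> sq_integrable M Y"
  unfolding sq_integrable_def
  by (intro conj_cong measurable_cong Bochner_Integration.integrable_cong) auto

lemma sq_integrable_bound: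
  assumes "sq_integrable M X" "Y \<in> borel_measurable M" "\<And>\<omega>. norm (Y \<omega>) \<le> c * norm (X \<omega>)"
  shows "sq_integrable M Y"
  unfolding sq_integrable_def
proof
  show "integrable M (\<lambda>\<omega>. (norm (Y \<omega>))\<^sup>2)"
  proof (rule Bochner_Integration.integrable_bound)
    show "integrable M (\<lambda>\<omega>. c\<^sup>2 * (norm (X \<omega>))\<^sup>2)" using assms(1) by (simp add: sq_integrable_def)
    show "(\<lambda>\<omega>. (norm (Y \<omega>))\<^sup>2) \<in> borel_measurable M" using assms(2) by measurable
    show "AE \<omega> in M. norm ((norm (Y \<omega>))\<^sup>2) \<le> norm (c\<^sup>2 * (norm (X \<omega>))\<^sup>2)"
      using power_mono[OF assms(3), of _ 2] by (simp add: power_mult_distrib)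
  qed
qed fact

lemma sq_integrable_fst: "sq_integrable M X \<Longrightarrow> sq_integrable M (\<lambda>\<omega>. fst (X \<omega>))"
  by (rule sq_integrable_bound[where c = 1 and X = X])
    (auto simp: sq_integrable_def norm_fst_le_norm intro: measurable_compose[OF _ borel_measurable_continuous_onI[OF continuous_on_fst[OF continuous_on_id]]])

lemma sq_integrable_snd: "sq_integrable M X \<Longrightarrow> sq_integrable M (\<lambda>\<omega>. snd (X \<omega>))"
  by (rule sq_integrable_bound[where c = 1 and X = X])
    (auto simp: sq_integrable_def norm_snd_le_norm intro: measurable_compose[OF _ borel_measurable_continuous_onI[OF continuous_on_snd[OF continuous_on_id]]])

lemma sq_integrable_Pair:
  assumes "sq_integrable M X" "sq_integrable M Y"
  shows "sq_integrable M (\<lambda>\<omega>. (X \<omega>, Y \<omega>))"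
  using assms unfolding sq_integrable_def power2_norm_prod[of "(_, _)"]
  by (auto intro!: borel_measurable_Pair)

lemma lipschitz_borel_measurable:
  assumes "\<And>x y. norm (g x - g y) \<le> L * norm (x - y)"
  shows "(g :: 'c::euclidean_space \<Rightarrow> 'd::euclidean_space) \<in> borel_measurable borel"
proof (rule borel_measurable_continuous_onI, rule lipschitz_on_continuous_on)
  show "(max L 0)-lipschitz_on UNIV g"
  proof (rule lipschitz_onI)
    fix x y :: 'c
    have "L * norm (x - y) \<le> max L 0 * norm (x - y)" by (intro mult_right_mono) auto
    thus "dist (g x) (g y) \<le> max L 0 * dist x y" using assms[of x y] by (simp add: dist_norm)
  qed simp
qed

lemma (in finite_measure) sq_integrable_lipschitz:
  assumes X: "sq_integrable M X" and g: "\<And>x y. norm (g x - g y) \<le> L * norm (x - y)"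
  shows "sq_integrable M (\<lambda>\<omega>. g (X \<omega>) :: 'd::euclidean_space)"
proof -
  have "(\<lambda>\<omega>. g (X \<omega>)) \<in> borel_measurable M"
    using measurable_compose[OF sq_integrable_measurable[OF X] lipschitz_borel_measurable[OF g]] .
  hence "sq_integrable M (\<lambda>\<omega>. g (X \<omega>) - g 0)"
    using g[of _ 0] by (intro sq_integrable_bound[OF X]) auto
  from sq_integrable_add[OF this sq_integrable_const[of "g 0"]] show ?thesis by simp
qed

lemma sq_integrable_inner:
  assumes "sq_integrable M X" "sq_integrable M Y"
  shows "integrable M (\<lambda>\<omega>. inner (X \<omega>) (Y \<omega>))"
proof (rule Bochner_Integration.integrable_bound)
  show "integrable M (\<lambda>\<omega>. (norm (X \<omega>))\<^sup>2 + (norm (Y \<omega>))\<^sup>2)"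
    using assms by (auto simp: sq_integrable_def)
  show "(\<lambda>\<omega>. inner (X \<omega>) (Y \<omega>)) \<in> borel_measurable M"
    using assms by (auto simp: sq_integrable_def)
  have "\<bar>inner x y\<bar> \<le> (norm x)\<^sup>2 + (norm y)\<^sup>2" for x y :: 'b
  proof -
    have "2 * norm x * norm y \<le> (norm x)\<^sup>2 + (norm y)\<^sup>2" by (rule sum_squares_bound)
    moreover have "0 \<le> norm x * norm y" by simp
    ultimately show ?thesis using Cauchy_Schwarz_ineq2[of x y] by linarith
  qed
  thus "AE \<omega> in M. norm (inner (X \<omega>) (Y \<omega>)) \<le> norm ((norm (X \<omega>))\<^sup>2 + (norm (Y \<omega>))\<^sup>2)" by simp
qed

section \<open>Independent samples and their past\<close>

locale samples = prob_space M for M :: "'w measure" +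
  fixes N :: "'i \<Rightarrow> 'x measure" and \<xi> :: "'i \<Rightarrow> 'w \<Rightarrow> 'x" and I :: "'i set"
  assumes indep: "indep_vars N \<xi> I"
    and law: "a \<in> I \<Longrightarrow> distr M (N a) (\<xi> a) = N a"
begin

text \<open>
  The information carried by the samples with index in \<open>A\<close>, as a measure space on the outcomes, so
  that adaptedness is plain measurability.
\<close>

definition past :: "'i set \<Rightarrow> 'w measure" where
  "past A = vimage_algebra (space M) (\<lambda>\<omega>. restrict (\<lambda>a. \<xi> a \<omega>) A) (PiM A N)"

lemma space_past [simp]: "space (past A) = space M" by (simp add: past_def)

lemma measurable_sample: "a \<in> I \<Longrightarrow> \<xi> a \<in> measurable M (N a)"
  using indep unfolding indep_vars_def by auto

lemma restrict_in: "A \<subseteq> I \<Longrightarrow> (\<lambda>\<omega>. restrict (\<lambda>a. \<xi> a \<omega>) A) \<in> space M \<rightarrow> space (PiM A N)"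
  by (auto simp: space_PiM subset_iff intro!: measurable_space[OF measurable_sample])

lemma sample_past: "A \<subseteq> I \<Longrightarrow> a \<in> A \<Longrightarrow> \<xi> a \<in> measurable (past A) (N a)"
proof -
  assume A: "A \<subseteq> I" "a \<in> A"
  have "(\<lambda>\<omega>. restrict (\<lambda>a. \<xi> a \<omega>) A) \<in> measurable (past A) (PiM A N)"
    unfolding past_def by (rule measurable_vimage_algebra1[OF restrict_in[OF A(1)]])
  from measurable_compose[OF this measurable_component_singleton[OF A(2)]]
  show ?thesis using A by simp
qed

lemma past_subset:
  assumes "A \<subseteq> B" "B \<subseteq> I" "f \<in> measurable (past A) S"
  shows "f \<in> measurable (past B) S"
proof -
  have "(\<lambda>\<omega>. \<omega>) \<in> measurable (past B) (past A)"
    unfolding past_def[of A]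
  proof (rule measurable_vimage_algebra2)
    show "(\<lambda>\<omega>. restrict (\<lambda>a. \<xi> a \<omega>) A) \<in> measurable (past B) (PiM A N)"
      using assms(1,2) by (intro measurable_restrict sample_past) auto
  qed simp
  from measurable_compose[OF this assms(3)] show ?thesis .
qed

lemma past_measurable:
  assumes "A \<subseteq> I" "f \<in> measurable (past A) S"
  shows "f \<in> measurable M S"
proof -
  have "(\<lambda>\<omega>. \<omega>) \<in> measurable M (past A)"
    unfolding past_def
  proof (rule measurable_vimage_algebra2)
    show "(\<lambda>\<omega>. restrict (\<lambda>a. \<xi> a \<omega>) A) \<in> measurable M (PiM A N)"
      using assms(1) measurable_sample by (intro measurable_restrict) auto
  qed simp
  from measurable_compose[OF this assms(2)] show ?thesis .
qed

lemma indep_past: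
  assumes A: "A \<subseteq> I" and b: "b \<in> I" "b \<notin> A" and C: "C \<in> sets (past A)" and D: "D \<in> sets (N b)"
  shows "prob (C \<inter> (\<xi> b -` D \<inter> space M)) = prob C * prob (\<xi> b -` D \<inter> space M)"
proof -
  let ?r = "\<lambda>A \<omega>. restrict (\<lambda>a. \<xi> a \<omega>) A"
  have "indep_var (PiM A N) (?r A) (PiM {b} N) (?r {b})"
    using A b by (intro indep_var_restrict[OF indep]) auto
  hence iv: "indep_set (sigma_sets (space M) {?r A -` C \<inter> space M | C. C \<in> sets (PiM A N)})
       (sigma_sets (space M) {?r {b} -` C \<inter> space M | C. C \<in> sets (PiM {b} N)})"
    unfolding indep_var_eq by blast
  have sp: "sets (past A) = sigma_sets (space M) {?r A -` C \<inter> space M | C. C \<in> sets (PiM A N)}" for A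
    unfolding past_def by (rule sets_vimage_algebra)
  have "\<xi> b \<in> measurable (past {b}) (N b)" using b by (intro sample_past) auto
  from measurable_sets[OF this D] have "\<xi> b -` D \<inter> space M \<in> sets (past {b})" by simp
  with iv C show ?thesis unfolding sp by (rule indep_setD)
qed

text \<open>
  \<open>X\<close> and the samples have different value types, whereas \<open>indep_var\<close> wants a common one; the product
  law is therefore checked on rectangles.
\<close>

lemma joint_law:
  assumes A: "A \<subseteq> I" and b: "b \<in> I" "b \<notin> A" and X: "X \<in> measurable (past A) S"
  shows "distr M (S \<Otimes>\<^sub>M N b) (\<lambda>\<omega>. (X \<omega>, \<xi> b \<omega>)) = distr M S X \<Otimes>\<^sub>M N b"
proof -
  have XM: "X \<in> measurable M S" by (rule past_measurable[OF A X])
  have xiM: "\<xi> b \<in> measurable M (N b)" by (rule measurable_sample[OF b(1)])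
  interpret D: prob_space "distr M S X" by (rule prob_space_distr[OF XM])
  interpret Nb: prob_space "N b" using prob_space_distr[OF xiM] unfolding law[OF b(1)] .
  have pm: "(\<lambda>\<omega>. (X \<omega>, \<xi> b \<omega>)) \<in> measurable M (S \<Otimes>\<^sub>M N b)" using XM xiM by measurable
  have "distr M S X \<Otimes>\<^sub>M N b = distr M (S \<Otimes>\<^sub>M N b) (\<lambda>\<omega>. (X \<omega>, \<xi> b \<omega>))"
  proof (rule pair_measure_eqI)
    show "sigma_finite_measure (distr M S X)" "sigma_finite_measure (N b)" by unfold_locales
    show "sets (distr M S X \<Otimes>\<^sub>M N b) = sets (distr M (S \<Otimes>\<^sub>M N b) (\<lambda>\<omega>. (X \<omega>, \<xi> b \<omega>)))"
      by simp
    fix C D assume "C \<in> sets (distr M S X)" and D: "D \<in> sets (N b)"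
    hence C: "C \<in> sets S" by simp
    have XC: "X -` C \<inter> space M \<in> sets (past A)" using measurable_sets[OF X C] by simp
    have "emeasure (N b) D = emeasure (distr M (N b) (\<xi> b)) D" using law[OF b(1)] by simp
    also have "\<dots> = emeasure M (\<xi> b -` D \<inter> space M)" by (rule emeasure_distr[OF xiM D])
    finally have eD: "emeasure (N b) D = ennreal (prob (\<xi> b -` D \<inter> space M))"
      by (simp add: emeasure_eq_measure)
    have eC: "emeasure (distr M S X) C = ennreal (prob (X -` C \<inter> space M))"
      by (simp add: emeasure_distr[OF XM C] emeasure_eq_measure)
    have "emeasure (distr M (S \<Otimes>\<^sub>M N b) (\<lambda>\<omega>. (X \<omega>, \<xi> b \<omega>))) (C \<times> D)
        = emeasure M ((\<lambda>\<omega>. (X \<omega>, \<xi> b \<omega>)) -` (C \<times> D) \<inter> space M)"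
      by (rule emeasure_distr[OF pm]) (use C D in simp)
    also have "(\<lambda>\<omega>. (X \<omega>, \<xi> b \<omega>)) -` (C \<times> D) \<inter> space M = (X -` C \<inter> space M) \<inter> (\<xi> b -` D \<inter> space M)"
      by auto
    also have "emeasure M \<dots> = ennreal (prob (X -` C \<inter> space M) * prob (\<xi> b -` D \<inter> space M))"
      using indep_past[OF A b XC D] by (simp add: emeasure_eq_measure)
    finally show "emeasure (distr M S X) C * emeasure (N b) D
        = emeasure (distr M (S \<Otimes>\<^sub>M N b) (\<lambda>\<omega>. (X \<omega>, \<xi> b \<omega>))) (C \<times> D)"
      unfolding eC eD by (simp add: ennreal_mult)
  qed
  thus ?thesis by simp
qed

text \<open>
  An error with mean zero at every fixed point keeps its second moment and becomes orthogonal to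
  the past when it is evaluated at a random point that depends on the past alone.
\<close>

lemma noise_at_random_point:
  fixes e :: "'x \<Rightarrow> 'z::euclidean_space \<Rightarrow> 'c::euclidean_space"
  assumes A: "A \<subseteq> I" and b: "b \<in> I" "b \<notin> A"
    and em: "(\<lambda>p. e (fst p) (snd p)) \<in> borel_measurable (N b \<Otimes>\<^sub>M borel)"
    and e1: "\<And>z. integrable (N b) (\<lambda>s. e s z)" "\<And>z. (\<integral>s. e s z \<partial>N b) = 0"
    and e2: "\<And>z. integrable (N b) (\<lambda>s. (norm (e s z))\<^sup>2)" "\<And>z. (\<integral>s. (norm (e s z))\<^sup>2 \<partial>N b) \<le> v"
    and Z: "Z \<in> borel_measurable (past A)"
  shows "sq_integrable M (\<lambda>\<omega>. e (\<xi> b \<omega>) (Z \<omega>))"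
    and "(\<integral>\<omega>. (norm (e (\<xi> b \<omega>) (Z \<omega>)))\<^sup>2 \<partial>M) \<le> v"
    and "(\<lambda>\<omega>. e (\<xi> b \<omega>) (Z \<omega>)) \<in> borel_measurable (past (insert b A))"
    and "X \<in> borel_measurable (past A) \<Longrightarrow> sq_integrable M X \<Longrightarrow>
      (\<integral>\<omega>. inner (X \<omega>) (e (\<xi> b \<omega>) (Z \<omega>)) \<partial>M) = 0"
proof -
  let ?E = "\<lambda>\<omega>. e (\<xi> b \<omega>) (Z \<omega>)"
  have psN: "prob_space (N b)"
    using prob_space_distr[OF measurable_sample[OF b(1)]] unfolding law[OF b(1)] .
  interpret Nb: prob_space "N b" by (rule psN)
  have insI: "insert b A \<subseteq> I" using A b by simp
  have "(\<lambda>\<omega>. (\<xi> b \<omega>, Z \<omega>)) \<in> measurable (past (insert b A)) (N b \<Otimes>\<^sub>M borel)"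
    by (intro measurable_Pair sample_past[OF insI] past_subset[OF _ insI Z]) auto
  from measurable_compose[OF this em]
  show meas: "?E \<in> borel_measurable (past (insert b A))" by simp
  have measM: "?E \<in> borel_measurable M" by (rule past_measurable[OF insI meas])
  have ZM: "Z \<in> borel_measurable M" by (rule past_measurable[OF A Z])
  have xiM: "\<xi> b \<in> measurable M (N b)" by (rule measurable_sample[OF b(1)])
  have v: "0 \<le> v" using e2(2)[of 0] by (meson integral_nonneg zero_le_power2 order_trans norm_ge_zero Bochner_Integration.integral_nonneg)
  have ms: "(\<lambda>p. e (snd p) (fst p)) \<in> borel_measurable (borel \<Otimes>\<^sub>M N b)"
  proof -
    have "(\<lambda>p. (snd p, fst p)) \<in> measurable (borel \<Otimes>\<^sub>M N b) (N b \<Otimes>\<^sub>M borel)" by measurable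
    from measurable_compose[OF this em] show ?thesis by simp
  qed
  have "(\<integral>\<^sup>+\<omega>. ennreal ((norm (?E \<omega>))\<^sup>2) \<partial>M)
      = (\<integral>\<^sup>+p. ennreal ((norm (e (snd p) (fst p)))\<^sup>2) \<partial>(distr M (borel \<Otimes>\<^sub>M N b) (\<lambda>\<omega>. (Z \<omega>, \<xi> b \<omega>))))"
    by (subst nn_integral_distr) (use ZM xiM ms in auto)
  also have "\<dots> = (\<integral>\<^sup>+p. ennreal ((norm (e (snd p) (fst p)))\<^sup>2) \<partial>(distr M borel Z \<Otimes>\<^sub>M N b))"
    unfolding joint_law[OF A b Z] ..
  also have "\<dots> = (\<integral>\<^sup>+z. \<integral>\<^sup>+s. ennreal ((norm (e s z))\<^sup>2) \<partial>N b \<partial>distr M borel Z)"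
    by (subst Nb.nn_integral_fst[symmetric]) (use ms in auto)
  also have "\<dots> \<le> (\<integral>\<^sup>+z. ennreal v \<partial>distr M borel Z)"
  proof (rule nn_integral_mono)
    fix z
    have "(\<integral>\<^sup>+s. ennreal ((norm (e s z))\<^sup>2) \<partial>N b) = ennreal (\<integral>s. (norm (e s z))\<^sup>2 \<partial>N b)"
      by (rule nn_integral_eq_integral[OF e2(1)]) simp
    also have "\<dots> \<le> ennreal v" using e2(2) by (rule ennreal_leI)
    finally show "(\<integral>\<^sup>+s. ennreal ((norm (e s z))\<^sup>2) \<partial>N b) \<le> ennreal v" .
  qed
  also have "\<dots> = ennreal v"
    using prob_space.emeasure_space_1[OF prob_space_distr[OF ZM]] by simp
  finally have nn: "(\<integral>\<^sup>+\<omega>. ennreal ((norm (?E \<omega>))\<^sup>2) \<partial>M) \<le> ennreal v" .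
  have int: "integrable M (\<lambda>\<omega>. (norm (?E \<omega>))\<^sup>2)"
    unfolding integrable_iff_bounded using nn measM
    by (auto simp: ennreal_less_top le_less_trans)
  show sq: "sq_integrable M ?E" unfolding sq_integrable_def using int measM by simp
  have "ennreal (\<integral>\<omega>. (norm (?E \<omega>))\<^sup>2 \<partial>M) \<le> ennreal v"
    using nn nn_integral_eq_integral[OF int] by simp
  thus "(\<integral>\<omega>. (norm (?E \<omega>))\<^sup>2 \<partial>M) \<le> v" using v by simp
  show "(\<integral>\<omega>. inner (X \<omega>) (?E \<omega>) \<partial>M) = 0" if X: "X \<in> borel_measurable (past A)" "sq_integrable M X"
  proof -
    have Y: "(\<lambda>\<omega>. (X \<omega>, Z \<omega>)) \<in> measurable (past A) (borel \<Otimes>\<^sub>M borel)" using X Z by measurable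
    have YM: "(\<lambda>\<omega>. (X \<omega>, Z \<omega>)) \<in> measurable M (borel \<Otimes>\<^sub>M borel)" by (rule past_measurable[OF A Y])
    let ?\<phi> = "\<lambda>p. inner (fst (fst p)) (e (snd p) (snd (fst p)))"
    let ?D = "distr M (borel \<Otimes>\<^sub>M borel) (\<lambda>\<omega>. (X \<omega>, Z \<omega>))"
    have \<phi>m: "?\<phi> \<in> borel_measurable ((borel \<Otimes>\<^sub>M borel) \<Otimes>\<^sub>M N b)"
    proof -
      have "(\<lambda>p. (snd p, snd (fst p))) \<in> measurable ((borel \<Otimes>\<^sub>M borel) \<Otimes>\<^sub>M N b) (N b \<Otimes>\<^sub>M borel)" by measurable
      from measurable_compose[OF this em]
      have "(\<lambda>p. e (snd p) (snd (fst p))) \<in> borel_measurable ((borel \<Otimes>\<^sub>M borel) \<Otimes>\<^sub>M N b)" by simp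
      thus ?thesis by measurable
    qed
    have pm: "(\<lambda>\<omega>. ((X \<omega>, Z \<omega>), \<xi> b \<omega>)) \<in> measurable M ((borel \<Otimes>\<^sub>M borel) \<Otimes>\<^sub>M N b)"
      using YM xiM by measurable
    have "integrable M (\<lambda>\<omega>. ?\<phi> ((X \<omega>, Z \<omega>), \<xi> b \<omega>))" using sq_integrable_inner[OF X(2) sq] by simp
    hence "integrable (distr M ((borel \<Otimes>\<^sub>M borel) \<Otimes>\<^sub>M N b) (\<lambda>\<omega>. ((X \<omega>, Z \<omega>), \<xi> b \<omega>))) ?\<phi>"
      by (subst integrable_distr_eq[OF pm \<phi>m])
    hence intD: "integrable (?D \<Otimes>\<^sub>M N b) ?\<phi>" unfolding joint_law[OF A b Y] .
    have "(\<integral>\<omega>. inner (X \<omega>) (?E \<omega>) \<partial>M) = (\<integral>p. ?\<phi> p \<partial>distr M ((borel \<Otimes>\<^sub>M borel) \<Otimes>\<^sub>M N b) (\<lambda>\<omega>. ((X \<omega>, Z \<omega>), \<xi> b \<omega>)))"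
      by (subst integral_distr[OF pm \<phi>m]) simp
    also have "\<dots> = (\<integral>p. ?\<phi> p \<partial>(?D \<Otimes>\<^sub>M N b))" unfolding joint_law[OF A b Y] ..
    also have "\<dots> = (\<integral>y. (\<integral>s. ?\<phi> (y, s) \<partial>N b) \<partial>?D)"
    proof -
      interpret D: prob_space ?D by (rule prob_space_distr[OF YM])
      interpret pair_sigma_finite ?D "N b" ..
      show ?thesis by (rule integral_fst'[OF intD, symmetric])
    qed
    also have "\<dots> = 0" using e1 by simp
    finally show ?thesis .
  qed
qed

end

section \<open>Gradient tracking along one trajectory\<close>

definition mean_sq :: "nat \<Rightarrow> (nat \<Rightarrow> 'c::real_normed_vector) \<Rightarrow> real" where
  "mean_sq n v = average n (\<lambda>i. (norm (v i))\<^sup>2)"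

definition spread :: "nat \<Rightarrow> (nat \<Rightarrow> 'c::real_normed_vector) \<Rightarrow> real" where
  "spread n v = mean_sq n (\<lambda>i. v i - average n v)"

lemma average_real_mono: "(\<And>i. i < n \<Longrightarrow> a i \<le> b i) \<Longrightarrow> average n a \<le> (average n b :: real)"
  unfolding average_def by (auto intro!: divide_right_mono sum_mono)

lemma average_real_nonneg: "(\<And>i. i < n \<Longrightarrow> 0 \<le> a i) \<Longrightarrow> 0 \<le> (average n a :: real)"
  unfolding average_def by (auto intro!: mult_nonneg_nonneg sum_nonneg divide_nonneg_nonneg)

lemma average_real_mult: "average n (\<lambda>i. c * a i) = c * (average n a :: real)"
  unfolding average_def by (simp add: sum_distrib_left)

lemma average_const: "0 < n \<Longrightarrow> average n (\<lambda>_. c) = c"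
  unfolding average_def by (simp add: sum_constant_scaleR)

lemma mean_sq_nonneg: "0 \<le> mean_sq n v"
  unfolding mean_sq_def by (rule average_real_nonneg) simp

lemma spread_nonneg: "0 \<le> spread n v"
  unfolding spread_def by (rule mean_sq_nonneg)

lemma mean_sq_mono: "(\<And>i. i < n \<Longrightarrow> norm (v i) \<le> norm (w i)) \<Longrightarrow> mean_sq n v \<le> mean_sq n w"
  unfolding mean_sq_def by (rule average_real_mono) (auto intro: power_mono)

lemma mean_sq_cong: "(\<And>i. i < n \<Longrightarrow> v i = w i) \<Longrightarrow> mean_sq n v = mean_sq n w"
  unfolding mean_sq_def by (rule average_cong) simp

lemma spread_cong: "(\<And>i. i < n \<Longrightarrow> v i = w i) \<Longrightarrow> spread n v = spread n w"
  unfolding spread_def by (intro mean_sq_cong) (simp add: average_cong[of n v w])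

lemma mean_sq_scaleR: "mean_sq n (\<lambda>i. c *\<^sub>R v i) = c\<^sup>2 * mean_sq n v"
  unfolding mean_sq_def by (simp add: power_mult_distrib average_real_mult)

lemma norm_average_le_mean_sq:
  fixes v :: "nat \<Rightarrow> 'c::real_normed_vector"
  shows "(norm (average n v))\<^sup>2 \<le> mean_sq n v"
proof (cases "n = 0")
  case False
  have "norm (\<Sum>i<n. v i) \<le> (\<Sum>i<n. norm (v i) * 1)" using norm_sum[of v "{..<n}"] by simp
  hence "(norm (\<Sum>i<n. v i))\<^sup>2 \<le> (\<Sum>i<n. norm (v i) * 1)\<^sup>2" by (rule power_mono) simp
  also have "\<dots> \<le> (\<Sum>i<n. (norm (v i))\<^sup>2) * (\<Sum>i<n. 1\<^sup>2)" by (rule Cauchy_Schwarz_ineq_sum)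
  finally have "(norm (\<Sum>i<n. v i))\<^sup>2 \<le> real n * (\<Sum>i<n. (norm (v i))\<^sup>2)" by (simp add: mult.commute)
  thus ?thesis using False unfolding mean_sq_def average_def
    by (simp add: power_divide field_simps power2_eq_square)
qed (simp add: average_def mean_sq_def)

lemma spread_eq:
  fixes v :: "nat \<Rightarrow> 'c::real_inner"
  assumes "0 < n"
  shows "spread n v = mean_sq n v - (norm (average n v))\<^sup>2"
proof -
  let ?m = "average n v"
  have s: "(\<Sum>i<n. v i) = real n *\<^sub>R ?m" using assms unfolding average_def by simp
  have "(\<Sum>i<n. (norm (v i - ?m))\<^sup>2) = (\<Sum>i<n. (norm (v i))\<^sup>2 - 2 * inner (v i) ?m + (norm ?m)\<^sup>2)"
    by (intro sum.cong) (auto simp: power2_norm_eq_inner inner_diff_left inner_diff_right inner_commute)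
  also have "\<dots> = (\<Sum>i<n. (norm (v i))\<^sup>2) - 2 * inner (\<Sum>i<n. v i) ?m + real n * (norm ?m)\<^sup>2"
    by (simp add: sum.distrib sum_subtractf inner_sum_left sum_distrib_left)
  also have "\<dots> = (\<Sum>i<n. (norm (v i))\<^sup>2) - real n * (norm ?m)\<^sup>2"
    unfolding s by (simp add: power2_norm_eq_inner)
  finally have e: "(\<Sum>i<n. (norm (v i - ?m))\<^sup>2) = (\<Sum>i<n. (norm (v i))\<^sup>2) - real n * (norm ?m)\<^sup>2" .
  show ?thesis unfolding spread_def mean_sq_def average_def[of n "\<lambda>i. (norm (v i - ?m))\<^sup>2"] e
    average_def[of n "\<lambda>i. (norm (v i))\<^sup>2"] using assms by (simp add: right_diff_distrib)
qed

lemma spread_le_mean_sq: "0 < n \<Longrightarrow> spread n v \<le> mean_sq n (v :: nat \<Rightarrow> 'c::real_inner)"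
  by (simp add: spread_eq)

lemma network_topology_n: "network_topology n W \<rho> \<Longrightarrow> 0 < n"
  unfolding network_topology_def by auto

lemma average_mix:
  assumes "network_topology n W \<rho>"
  shows "average n (mix n W v) = average n v"
proof -
  have col: "\<forall>j<n. (\<Sum>i<n. W $$ (i, j)) = 1" using assms unfolding network_topology_def by auto
  have "(\<Sum>i<n. mix n W v i) = (\<Sum>j<n. \<Sum>i<n. W $$ (i, j) *\<^sub>R v j)"
    unfolding mix_def by (rule sum.swap)
  also have "\<dots> = (\<Sum>j<n. v j)" using col by (simp add: scaleR_sum_left[symmetric])
  finally show ?thesis unfolding average_def by simp
qed

lemma mix_const:
  assumes "network_topology n W \<rho>" "i < n"
  shows "mix n W (\<lambda>_. c) i = c"
proof -
  have "(\<Sum>j<n. W $$ (i, j)) = 1" using assms unfolding network_topology_def by auto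
  thus ?thesis unfolding mix_def by (simp add: scaleR_sum_left[symmetric])
qed

lemma spread_mix:
  fixes v :: "nat \<Rightarrow> 'c::real_inner"
  assumes nt: "network_topology n W \<rho>"
  shows "spread n (mix n W v) \<le> \<rho>\<^sup>2 * spread n v"
proof -
  let ?m = "average n v"
  have n: "0 < n" by (rule network_topology_n[OF nt])
  have z: "(\<Sum>i<n. v i - ?m) = 0" unfolding average_def using n
    by (simp add: sum_subtractf sum_constant_scaleR)
  have e: "mix n W v i - ?m = mix n W (\<lambda>i. v i - ?m) i" if "i < n" for i
    using mix_const[OF nt that, of ?m] unfolding mix_def by (simp add: scaleR_diff_right sum_subtractf)
  have "(\<Sum>i<n. (norm (mix n W v i - ?m))\<^sup>2) = (\<Sum>i<n. (norm (mix n W (\<lambda>i. v i - ?m) i))\<^sup>2)"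
    using e by simp
  also have "\<dots> \<le> \<rho>\<^sup>2 * (\<Sum>i<n. (norm (v i - ?m))\<^sup>2)" by (rule mix_contraction[OF nt z])
  finally have "(1 / real n) * (\<Sum>i<n. (norm (mix n W v i - ?m))\<^sup>2)
      \<le> (1 / real n) * (\<rho>\<^sup>2 * (\<Sum>i<n. (norm (v i - ?m))\<^sup>2))" by (rule mult_left_mono) simp
  thus ?thesis unfolding spread_def mean_sq_def average_mix[OF nt]
    unfolding average_def[of n "\<lambda>i. (norm (mix n W v i - ?m))\<^sup>2"] average_def[of n "\<lambda>i. (norm (v i - ?m))\<^sup>2"]
    by simp
qed

text \<open>
  The weights of Young's inequality are chosen so that the squared contraction \<open>\<rho>\<^sup>2\<close> becomes \<open>\<rho>\<close> on
  the old error, at the price of \<open>1/(1 - \<rho>)\<close> on the perturbation.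
\<close>

lemma contraction_Young:
  fixes a b :: "'c::real_normed_vector"
  assumes "0 \<le> \<rho>" "\<rho> < 1"
  shows "\<rho>\<^sup>2 * (norm (a + b))\<^sup>2 \<le> \<rho> * (norm a)\<^sup>2 + 1 / (1 - \<rho>) * (norm b)\<^sup>2"
proof -
  define \<alpha> \<beta> where "\<alpha> = norm a" and "\<beta> = norm b"
  have "\<rho>\<^sup>2 * (norm (a + b))\<^sup>2 \<le> \<rho>\<^sup>2 * (\<alpha> + \<beta>)\<^sup>2"
    unfolding \<alpha>_def \<beta>_def by (intro mult_left_mono power_mono norm_triangle_ineq) auto
  also have "\<dots> \<le> \<rho> * \<alpha>\<^sup>2 + 1 / (1 - \<rho>) * \<beta>\<^sup>2"
  proof -
    have "\<rho>\<^sup>2 \<le> 1" using assms by (simp add: power_le_one)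
    hence "0 \<le> \<rho> * ((1 - \<rho>) * \<alpha> - \<rho> * \<beta>)\<^sup>2 + (1 - \<rho>\<^sup>2) * \<beta>\<^sup>2"
      using assms by (intro add_nonneg_nonneg mult_nonneg_nonneg) auto
    also have "\<dots> = (1 - \<rho>) * (\<rho> * \<alpha>\<^sup>2) + \<beta>\<^sup>2 - (1 - \<rho>) * (\<rho>\<^sup>2 * (\<alpha> + \<beta>)\<^sup>2)"
      by (simp add: power2_eq_square algebra_simps)
    finally show ?thesis using assms by (simp add: field_simps)
  qed
  finally show ?thesis unfolding \<alpha>_def \<beta>_def .
qed

lemma spread_mix_add:
  fixes v w :: "nat \<Rightarrow> 'c::real_inner"
  assumes nt: "network_topology n W \<rho>"
  shows "spread n (mix n W (\<lambda>i. v i + w i)) \<le> \<rho> * spread n v + 1 / (1 - \<rho>) * spread n w"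
proof -
  note r = network_topology_rho[OF nt]
  have "spread n (mix n W (\<lambda>i. v i + w i)) \<le> \<rho>\<^sup>2 * spread n (\<lambda>i. v i + w i)"
    by (rule spread_mix[OF nt])
  also have "\<dots> = average n (\<lambda>i. \<rho>\<^sup>2 * (norm ((v i - average n v) + (w i - average n w)))\<^sup>2)"
    unfolding spread_def mean_sq_def average_real_mult[symmetric] average_add[symmetric]
    by (simp add: algebra_simps)
  also have "\<dots> \<le> average n (\<lambda>i. \<rho> * (norm (v i - average n v))\<^sup>2 + 1 / (1 - \<rho>) * (norm (w i - average n w))\<^sup>2)"
    by (intro average_real_mono contraction_Young r)
  also have "\<dots> = \<rho> * spread n v + 1 / (1 - \<rho>) * spread n w"
    unfolding average_add[symmetric] average_real_mult spread_def mean_sq_def ..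
  finally show ?thesis .
qed

context
  fixes n K :: nat and W :: "real mat" and \<rho> lam :: real and H D u :: "nat \<Rightarrow> nat \<Rightarrow> 'c::real_inner"
  assumes nt: "network_topology n W \<rho>" and gt: "gradient_tracking n W K (\<lambda>_. lam) H D u"
begin

lemma tracker_eq: "k < K \<Longrightarrow> i < n \<Longrightarrow> D k i = mix n W (\<lambda>j. prev D k j + H k j - prev H k j) i"
  using gt unfolding gradient_tracking_def mix_def by blast

lemma iterate_eq: "k < K \<Longrightarrow> i < n \<Longrightarrow> u (Suc k) i = mix n W (\<lambda>j. u k j - lam *\<^sub>R D k j) i"
  using gt unfolding gradient_tracking_def mix_def by blast

text \<open>
  Mixing preserves averages, so the increments of the directions telescope.
\<close>

lemma average_tracker: "k < K \<Longrightarrow> average n (D k) = average n (H k)"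
proof (induction k)
  case 0
  have "average n (D 0) = average n (mix n W (\<lambda>j. prev D 0 j + H 0 j - prev H 0 j))"
    by (rule average_cong) (use tracker_eq 0 in auto)
  thus ?case unfolding average_mix[OF nt] by (simp add: prev_def)
next
  case (Suc k)
  have "average n (D (Suc k)) = average n (mix n W (\<lambda>j. prev D (Suc k) j + H (Suc k) j - prev H (Suc k) j))"
    by (rule average_cong) (use tracker_eq Suc in auto)
  also have "\<dots> = average n (\<lambda>j. D k j + H (Suc k) j - H k j)"
    unfolding average_mix[OF nt] by (simp add: prev_def)
  also have "\<dots> = average n (D k) + average n (H (Suc k)) - average n (H k)"
    by (simp add: average_add average_diff)
  finally show ?case using Suc by simp
qed

lemma average_iterate: "k < K \<Longrightarrow> average n (u (Suc k)) = average n (u k) - lam *\<^sub>R average n (H k)"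
proof -
  assume k: "k < K"
  have "average n (u (Suc k)) = average n (mix n W (\<lambda>j. u k j - lam *\<^sub>R D k j))"
    by (rule average_cong) (use iterate_eq k in auto)
  thus ?thesis unfolding average_mix[OF nt] average_tracker[OF k, symmetric]
    by (simp add: average_diff average_scaleR)
qed

lemma spread_iterate:
  assumes "k < K"
  shows "spread n (u (Suc k)) \<le> \<rho> * spread n (u k) + lam\<^sup>2 / (1 - \<rho>) * spread n (D k)"
proof -
  have "spread n (u (Suc k)) = spread n (mix n W (\<lambda>j. u k j + (- lam) *\<^sub>R D k j))"
    by (rule spread_cong) (use iterate_eq assms in auto)
  also have "\<dots> \<le> \<rho> * spread n (u k) + 1 / (1 - \<rho>) * spread n (\<lambda>j. (- lam) *\<^sub>R D k j)"
    by (rule spread_mix_add[OF nt])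
  also have "spread n (\<lambda>j. (- lam) *\<^sub>R D k j) = lam\<^sup>2 * spread n (D k)"
    using mean_sq_scaleR[of n "- lam" "\<lambda>i. D k i - average n (D k)"]
    unfolding spread_def average_scaleR[symmetric] by (simp add: scaleR_diff_right)
  finally show ?thesis by simp
qed

lemma spread_tracker:
  assumes "Suc k < K"
  shows "spread n (D (Suc k)) \<le> \<rho> * spread n (D k) + 1 / (1 - \<rho>) * mean_sq n (\<lambda>i. H (Suc k) i - H k i)"
proof -
  have "spread n (D (Suc k)) = spread n (mix n W (\<lambda>j. D k j + (H (Suc k) j - H k j)))"
    by (rule spread_cong) (use tracker_eq[OF assms] in \<open>auto simp: prev_def algebra_simps\<close>)
  also have "\<dots> \<le> \<rho> * spread n (D k) + 1 / (1 - \<rho>) * spread n (\<lambda>j. H (Suc k) j - H k j)"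
    by (rule spread_mix_add[OF nt])
  also have "\<dots> \<le> \<rho> * spread n (D k) + 1 / (1 - \<rho>) * mean_sq n (\<lambda>i. H (Suc k) i - H k i)"
    using network_topology_rho[OF nt]
    by (intro add_left_mono mult_left_mono spread_le_mean_sq network_topology_n[OF nt]) auto
  finally show ?thesis .
qed

lemma spread_tracker_0:
  assumes "0 < K"
  shows "spread n (D 0) \<le> mean_sq n (H 0)"
proof -
  have r: "\<rho>\<^sup>2 \<le> 1" using network_topology_rho[OF nt] by (simp add: power_le_one)
  have "spread n (D 0) = spread n (mix n W (H 0))"
    by (rule spread_cong) (use tracker_eq[OF assms] in \<open>auto simp: prev_def mix_def\<close>)
  also have "\<dots> \<le> \<rho>\<^sup>2 * spread n (H 0)" by (rule spread_mix[OF nt])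
  also have "\<dots> \<le> spread n (H 0)" using r by (intro mult_left_le_one_le spread_nonneg) auto
  also have "\<dots> \<le> mean_sq n (H 0)" by (rule spread_le_mean_sq[OF network_topology_n[OF nt]])
  finally show ?thesis .
qed

text \<open>
  Cauchy-Schwarz over the iterations; the factor \<open>k\<close> is what the summability of the penalty
  decreases has to absorb later.
\<close>

lemma drift_le:
  assumes "k \<le> K"
  shows "(norm (average n (u k) - average n (u 0)))\<^sup>2 \<le> real k * lam\<^sup>2 * (\<Sum>j<k. (norm (average n (H j)))\<^sup>2)"
proof -
  have "average n (u 0) - average n (u k) = lam *\<^sub>R (\<Sum>j<k. average n (H j))" using assms
  proof (induction k)
    case (Suc k) thus ?case using average_iterate[of k] by (simp add: algebra_simps)
  qed simp
  hence "norm (average n (u k) - average n (u 0)) = norm (lam *\<^sub>R (\<Sum>j<k. average n (H j)))"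
    by (simp add: norm_minus_commute)
  hence e: "(norm (average n (u k) - average n (u 0)))\<^sup>2 = lam\<^sup>2 * (norm (\<Sum>j<k. average n (H j)))\<^sup>2"
    by (simp add: power_mult_distrib)
  have "(norm (\<Sum>j<k. average n (H j)))\<^sup>2 \<le> (\<Sum>j<k. norm (average n (H j)) * 1)\<^sup>2"
    using norm_sum[of "\<lambda>j. average n (H j)" "{..<k}"] by (intro power_mono) auto
  also have "\<dots> \<le> (\<Sum>j<k. (norm (average n (H j)))\<^sup>2) * (\<Sum>j<k. 1\<^sup>2)" by (rule Cauchy_Schwarz_ineq_sum)
  finally have "(norm (\<Sum>j<k. average n (H j)))\<^sup>2 \<le> real k * (\<Sum>j<k. (norm (average n (H j)))\<^sup>2)"
    by (simp add: mult.commute)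
  from mult_left_mono[OF this, of "lam\<^sup>2"] show ?thesis unfolding e by (simp add: ac_simps)
qed

lemma mean_sq_step_le:
  assumes "k < K"
  shows "mean_sq n (\<lambda>i. u (Suc k) i - u k i)
     \<le> 3 * spread n (u (Suc k)) + 3 * spread n (u k) + 3 * lam\<^sup>2 * (norm (average n (H k)))\<^sup>2"
proof -
  let ?a = "\<lambda>i. u (Suc k) i - average n (u (Suc k))" and ?b = "\<lambda>i. u k i - average n (u k)"
    and ?c = "lam *\<^sub>R average n (H k)"
  have "mean_sq n (\<lambda>i. u (Suc k) i - u k i)
      \<le> average n (\<lambda>i. 3 * (norm (?a i))\<^sup>2 + 3 * (norm (?b i))\<^sup>2 + 3 * (norm ?c)\<^sup>2)"
    unfolding mean_sq_def
  proof (rule average_real_mono)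
    fix i
    have e: "?a i + - ?b i + - ?c = u (Suc k) i - u k i" using average_iterate[OF assms] by simp
    show "(norm (u (Suc k) i - u k i))\<^sup>2 \<le> 3 * (norm (?a i))\<^sup>2 + 3 * (norm (?b i))\<^sup>2 + 3 * (norm ?c)\<^sup>2"
      using power2_sum3_le[of "?a i" "- ?b i" "- ?c"] unfolding e norm_minus_cancel .
  qed
  also have "\<dots> = 3 * spread n (u (Suc k)) + 3 * spread n (u k) + 3 * (norm ?c)\<^sup>2"
    unfolding average_add[symmetric] average_real_mult average_const[OF network_topology_n[OF nt]]
      spread_def mean_sq_def ..
  finally show ?thesis by (simp add: power_mult_distrib)
qed

end

section \<open>Errors of sampled gradients along the trajectory\<close>

text \<open>
  A sample is a pair of independent draws, and \<open>\<pi>\<close> selects the one that the objective depends on.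
\<close>

lemma (in samples) oracle_noise:
  fixes h :: "'s \<Rightarrow> 'c::euclidean_space \<Rightarrow> real"
  assumes A: "A \<subseteq> I" and b: "b \<in> I" "b \<notin> A"
    and \<pi>: "\<pi> \<in> measurable (N b) P" "distr (N b) P \<pi> = P"
    and or: "stochastic_oracle P h f \<delta>" and sm: "smoothness L f"
    and Z: "Z \<in> borel_measurable (past A)"
  defines "E \<equiv> \<lambda>\<omega>. gradient (h (\<pi> (\<xi> b \<omega>))) (Z \<omega>) - gradient f (Z \<omega>)"
  shows "sq_integrable M E"
    and "(\<integral>\<omega>. (norm (E \<omega>))\<^sup>2 \<partial>M) \<le> \<delta>\<^sup>2"
    and "E \<in> borel_measurable (past (insert b A))"
    and "X \<in> borel_measurable (past A) \<Longrightarrow> sq_integrable M X \<Longrightarrow> (\<integral>\<omega>. inner (X \<omega>) (E \<omega>) \<partial>M) = 0"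
proof -
  have P: "prob_space P" and d: "\<And>s z. s \<in> space P \<Longrightarrow> h s differentiable at z"
    and hm: "\<And>z. integrable P (\<lambda>s. h s z)"
    and g1: "\<And>z. integrable P (\<lambda>s. gradient (h s) z)" "\<And>z. (\<integral>s. gradient (h s) z \<partial>P) = gradient f z"
    and g2: "\<And>z. integrable P (\<lambda>s. (norm (gradient (h s) z - gradient f z))\<^sup>2)"
      "\<And>z. (\<integral>s. (norm (gradient (h s) z - gradient f z))\<^sup>2 \<partial>P) \<le> \<delta>\<^sup>2"
    using or unfolding stochastic_oracle_def by auto
  interpret P: prob_space P by (rule P)
  let ?e = "\<lambda>s z. gradient (h (\<pi> s)) z - gradient f z"
  have fm: "gradient f \<in> borel_measurable borel"
    by (rule lipschitz_borel_measurable[of _ L]) (rule smoothness_lipschitz[OF sm])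
  have gm: "(\<lambda>p. gradient (h (fst p)) (snd p)) \<in> borel_measurable (P \<Otimes>\<^sub>M borel)"
    by (rule gradient_jointly_measurable) (use hm d in auto)
  have em: "(\<lambda>p. ?e (fst p) (snd p)) \<in> borel_measurable (N b \<Otimes>\<^sub>M borel)"
  proof -
    have "(\<lambda>p. (\<pi> (fst p), snd p)) \<in> measurable (N b \<Otimes>\<^sub>M borel) (P \<Otimes>\<^sub>M borel)" using \<pi>(1) by measurable
    from measurable_compose[OF this gm]
    have "(\<lambda>p. gradient (h (\<pi> (fst p))) (snd p)) \<in> borel_measurable (N b \<Otimes>\<^sub>M borel)" by simp
    moreover have "(\<lambda>p. gradient f (snd p)) \<in> borel_measurable (N b \<Otimes>\<^sub>M borel)"
      by (rule measurable_compose[OF measurable_snd fm])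
    ultimately show ?thesis by simp
  qed
  have tr: "integrable (N b) (\<lambda>s. q (\<pi> s)) \<and> (\<integral>s. q (\<pi> s) \<partial>N b) = (\<integral>s. q s \<partial>P)"
    if q: "integrable P q" for q :: "'s \<Rightarrow> 'd::euclidean_space"
  proof -
    have qm: "q \<in> borel_measurable P" using q by simp
    have "integrable (distr (N b) P \<pi>) q" unfolding \<pi>(2) by (rule q)
    hence "integrable (N b) (\<lambda>s. q (\<pi> s))" using integrable_distr_eq[OF \<pi>(1) qm] by simp
    moreover have "(\<integral>s. q s \<partial>P) = (\<integral>s. q s \<partial>distr (N b) P \<pi>)" unfolding \<pi>(2) ..
    hence "(\<integral>s. q s \<partial>P) = (\<integral>s. q (\<pi> s) \<partial>N b)" using integral_distr[OF \<pi>(1) qm] by simp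
    ultimately show ?thesis by simp
  qed
  have c0: "integrable P (\<lambda>s. gradient (h s) z - gradient f z)" for z using g1 by simp
  have c1: "(\<integral>s. gradient (h s) z - gradient f z \<partial>P) = 0" for z using g1 P.prob_space by simp
  have i1: "integrable (N b) (\<lambda>s. ?e s z)" and i2: "(\<integral>s. ?e s z \<partial>N b) = 0"
    and i3: "integrable (N b) (\<lambda>s. (norm (?e s z))\<^sup>2)" and i4: "(\<integral>s. (norm (?e s z))\<^sup>2 \<partial>N b) \<le> \<delta>\<^sup>2" for z
    using tr[OF c0[of z]] c1[of z] tr[OF g2(1)[of z]] g2(2)[of z] by auto
  note N = noise_at_random_point[where e = ?e, OF A b em i1 i2 i3 i4 Z]
  show "sq_integrable M E" "(\<integral>\<omega>. (norm (E \<omega>))\<^sup>2 \<partial>M) \<le> \<delta>\<^sup>2" "E \<in> borel_measurable (past (insert b A))"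
    "X \<in> borel_measurable (past A) \<Longrightarrow> sq_integrable M X \<Longrightarrow> (\<integral>\<omega>. inner (X \<omega>) (E \<omega>) \<partial>M) = 0"
    unfolding E_def by (fact N(1), fact N(2), fact N(3), fact N(4))
qed

section \<open>The algorithm as a single tracked process\<close>

lemma prev_Pair: "prev (\<lambda>k i. (A k i, B k i)) k j = (prev A k j, prev B k j)"
  by (cases k) (auto simp: prev_def zero_prod_def)

lemma prev_scaleR: "prev (\<lambda>k i. c *\<^sub>R (A k i :: 'c::real_vector)) k j = c *\<^sub>R prev A k j"
  by (cases k) (auto simp: prev_def zero_prod_def)

lemma gradient_tracking_Pair:
  assumes "gradient_tracking n W K lam A D u" "gradient_tracking n W K lam B E v"
  shows "gradient_tracking n W K lam (\<lambda>k i. (A k i, B k i)) (\<lambda>k i. (D k i, E k i)) (\<lambda>k i. (u k i, v k i))"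
  using assms unfolding gradient_tracking_def prev_Pair
  by (auto simp: prod_eq_iff fst_sum snd_sum)

text \<open>
  Tracking is linear, so a factor of the step size can be moved into the direction.
\<close>

lemma gradient_tracking_scaleR:
  assumes "gradient_tracking n W K (\<lambda>k. c * lam k) A D u"
  shows "gradient_tracking n W K lam (\<lambda>k i. c *\<^sub>R A k i) (\<lambda>k i. c *\<^sub>R D k i) u"
proof -
  have e: "c *\<^sub>R (\<Sum>j<n. W $$ (i, j) *\<^sub>R (a j + b j - d j))
      = (\<Sum>j<n. W $$ (i, j) *\<^sub>R (c *\<^sub>R a j + c *\<^sub>R b j - c *\<^sub>R d j))" for i and a b d :: "nat \<Rightarrow> 'a"
    by (simp add: scaleR_sum_right scaleR_add_right scaleR_diff_right mult.commute)
  show ?thesis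
    unfolding gradient_tracking_def prev_scaleR
  proof (intro allI impI conjI)
    fix k i assume "k < K" "i < n"
    hence a: "D k i = (\<Sum>j<n. W $$ (i, j) *\<^sub>R (prev D k j + A k j - prev A k j))"
      and b: "u (Suc k) i = (\<Sum>j<n. W $$ (i, j) *\<^sub>R (u k j - (c * lam k) *\<^sub>R D k j))"
      using assms unfolding gradient_tracking_def by blast+
    show "c *\<^sub>R D k i = (\<Sum>j<n. W $$ (i, j) *\<^sub>R (c *\<^sub>R prev D k j + c *\<^sub>R A k j - c *\<^sub>R prev A k j))"
      unfolding e[symmetric] using a by simp
    show "u (Suc k) i = (\<Sum>j<n. W $$ (i, j) *\<^sub>R (u k j - lam k *\<^sub>R (c *\<^sub>R D k j)))"
      using b by (simp add: mult.commute)
  qed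
qed

lemma average_joint_dir:
  fixes f g :: "nat \<Rightarrow> 'a::euclidean_space \<times> 'b::euclidean_space \<Rightarrow> real"
  assumes "\<forall>i<n. smoothness L1 (f i) \<and> smoothness L2 (g i)" "0 < n"
  shows "average n (\<lambda>i. joint_dir \<gamma> c \<mu> (f i) (g i) v)
       = joint_dir \<gamma> c \<mu> (\<lambda>z. average n (\<lambda>i. f i z)) (\<lambda>z. average n (\<lambda>i. g i z)) v"
proof -
  have gf: "gradient (\<lambda>z. average n (\<lambda>i. f i z)) = (\<lambda>z. average n (\<lambda>i. gradient (f i) z))"
    using gradient_average[of n L1 f] assms by blast
  have gg: "gradient (\<lambda>z. average n (\<lambda>i. g i z)) = (\<lambda>z. average n (\<lambda>i. gradient (g i) z))"
    using gradient_average[of n L2 g] assms by blast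
  have k: "average n (\<lambda>_. d) = d" for d :: "'d::real_vector"
    using average_const[OF assms(2)] .
  show ?thesis
    unfolding joint_dir_def prox_grad_z_def prox_grad_theta_def gf gg average_Pair
      average_bounded_linear[OF bounded_linear_fst] average_bounded_linear[OF bounded_linear_snd]
      average_scaleR average_add[symmetric] average_diff[symmetric]
    by (simp add: average_add[symmetric] average_diff[symmetric] average_Pair average_scaleR[symmetric] k)
qed

locale sun_dsbo_run =
  fixes n K :: nat and W :: "real mat" and \<rho> p L1 L2 \<gamma> \<mu>0 lam c Flow \<delta>f \<delta>g :: real
    and f g :: "nat \<Rightarrow> 'a::euclidean_space \<times> 'b::euclidean_space \<Rightarrow> real"
    and Pf :: "nat \<Rightarrow> 's measure" and fs :: "nat \<Rightarrow> 's \<Rightarrow> 'a \<times> 'b \<Rightarrow> real"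
    and Pg :: "nat \<Rightarrow> 't measure" and gs :: "nat \<Rightarrow> 't \<Rightarrow> 'a \<times> 'b \<Rightarrow> real"
    and M :: "'w measure" and \<xi>f :: "nat \<Rightarrow> nat \<Rightarrow> 'w \<Rightarrow> 's" and \<xi>g :: "nat \<Rightarrow> nat \<Rightarrow> 'w \<Rightarrow> 't"
    and x0 :: "nat \<Rightarrow> 'a" and y0 \<theta>0 :: "nat \<Rightarrow> 'b"
    and x :: "nat \<Rightarrow> nat \<Rightarrow> 'w \<Rightarrow> 'a" and y \<theta> :: "nat \<Rightarrow> nat \<Rightarrow> 'w \<Rightarrow> 'b"
  assumes nt: "network_topology n W \<rho>" and K_pos: "0 < K" and p: "0 < p" "p < 1"
    and smooth: "\<forall>i<n. smoothness L1 (f i) \<and> smoothness L2 (g i)"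
    and F_lower: "\<forall>z. Flow \<le> average n (\<lambda>i. f i z)"
    and stoch: "\<forall>i<n. stochastic_oracle (Pf i) (fs i) (f i) \<delta>f \<and> stochastic_oracle (Pg i) (gs i) (g i) \<delta>g"
    and iid: "iid_samples M n K Pf Pg \<xi>f \<xi>g"
    and \<mu>0_pos: "0 < \<mu>0" and \<gamma>_pos: "0 < \<gamma>" and \<gamma>_less: "\<gamma> < 1 / (2 * L2)"
    and c_pos: "0 < c" and c_le: "c \<le> 3 / 32" and lam_pos: "0 < lam"
    and run: "sun_dsbo_gt M n W K \<gamma> (\<lambda>k. \<mu>0 * real (k + 1) powr (- p)) (\<lambda>_. c * lam) (\<lambda>_. c * lam)
      (\<lambda>_. lam) fs gs \<xi>f \<xi>g x0 y0 \<theta>0 x y \<theta>"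
begin

lemma n_pos: "0 < n" by (rule network_topology_n[OF nt])

lemma smooth_f: "i < n \<Longrightarrow> smoothness L1 (f i)" and smooth_g: "i < n \<Longrightarrow> smoothness L2 (g i)"
  using smooth by auto

definition F :: "'a \<times> 'b \<Rightarrow> real" where "F = (\<lambda>z. average n (\<lambda>i. f i z))"
definition G :: "'a \<times> 'b \<Rightarrow> real" where "G = (\<lambda>z. average n (\<lambda>i. g i z))"

lemma smooth_F: "smoothness L1 F" and smooth_G: "smoothness L2 G"
  unfolding F_def G_def using smooth n_pos by (auto intro!: smoothness_average)

lemma gradient_F: "gradient F z = average n (\<lambda>i. gradient (f i) z)"
  and gradient_G: "gradient G z = average n (\<lambda>i. gradient (g i) z)"
  unfolding F_def G_def using smooth by (auto intro!: gradient_average)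

sublocale avg: bilevel G L2 \<gamma> F L1 c \<mu>0 Flow
  using smooth_F smooth_G \<gamma>_pos \<gamma>_less c_pos c_le \<mu>0_pos F_lower
  by unfold_locales (auto simp: F_def)

sublocale smp: samples M "\<lambda>(k, i). Pf i \<Otimes>\<^sub>M Pg i" "\<lambda>(k, i) \<omega>. (\<xi>f k i \<omega>, \<xi>g k i \<omega>)" "{..<K} \<times> {..<n}"
  unfolding samples_def samples_axioms_def using iid unfolding iid_samples_def by auto

definition mu :: "nat \<Rightarrow> real" where "mu k = \<mu>0 * real (k + 1) powr (- p)"

lemma mu_pos: "0 < mu k" unfolding mu_def using \<mu>0_pos by simp

lemma mu_0: "mu 0 = \<mu>0" unfolding mu_def by simp

lemma mu_Suc_le: "mu (Suc k) \<le> mu k"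
  unfolding mu_def using \<mu>0_pos p by (intro mult_left_mono powr_mono2') auto

lemma mu_le: "mu k \<le> \<mu>0"
  by (induction k) (use mu_0 mu_Suc_le order_trans in auto)

definition mu_drop :: "nat \<Rightarrow> real" where "mu_drop k = mu k - mu (Suc k)"

lemma mu_drop_nonneg: "0 \<le> mu_drop k" unfolding mu_drop_def using mu_Suc_le by simp

lemma sum_mu_drop: "(\<Sum>j<k. mu_drop j) = \<mu>0 - mu k"
  unfolding mu_drop_def by (induction k) (auto simp: mu_0)

lemma mu_drop_le: "mu_drop k \<le> \<mu>0"
  unfolding mu_drop_def using mu_le[of k] mu_pos[of "Suc k"] by simp

text \<open>
  As \<open>p \<le> 1\<close>, the penalty shrinks from step \<open>k\<close> to \<open>k + 1\<close> at most by the factor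
  \<open>(k + 1)/(k + 2)\<close>.
\<close>

lemma mult_mu_drop_le: "real k * mu_drop k \<le> \<mu>0"
proof -
  define a b where "a = real (k + 1)" and "b = real (Suc k + 1)"
  have ab: "0 < a" "0 < b" "a \<le> b" "b - a = 1" "real k \<le> b" by (auto simp: a_def b_def)
  have "b powr (- p) = a powr (- p) * (a / b) powr p"
    using ab by (simp add: powr_divide powr_minus field_simps)
  hence "mu (Suc k) = mu k * (a / b) powr p" unfolding mu_def a_def[symmetric] b_def[symmetric] by simp
  moreover have "(a / b) powr 1 \<le> (a / b) powr p" using ab p by (intro powr_mono') auto
  ultimately have "mu k * (a / b) \<le> mu (Suc k)"
    using ab mu_pos[of k] mult_left_mono[of "a / b" "(a / b) powr p" "mu k"] by simp
  hence "mu_drop k \<le> mu k * (1 - a / b)" unfolding mu_drop_def by (simp add: algebra_simps)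
  also have "1 - a / b = 1 / b" using ab by (simp add: field_simps)
  finally have "b * mu_drop k \<le> mu k" using ab by (simp add: field_simps)
  moreover have "real k * mu_drop k \<le> b * mu_drop k" using ab mu_drop_nonneg by (intro mult_right_mono) auto
  ultimately show ?thesis using mu_le[of k] by linarith
qed

definition u :: "nat \<Rightarrow> nat \<Rightarrow> 'w \<Rightarrow> ('a \<times> 'b) \<times> 'b" where
  "u k i \<omega> = ((x k i \<omega>, y k i \<omega>), \<theta> k i \<omega>)"

definition H :: "nat \<Rightarrow> nat \<Rightarrow> 'w \<Rightarrow> ('a \<times> 'b) \<times> 'b" where
  "H k i \<omega> = joint_dir \<gamma> c (mu k) (fs i (\<xi>f k i \<omega>)) (gs i (\<xi>g k i \<omega>)) (u k i \<omega>)"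

definition h :: "nat \<Rightarrow> nat \<Rightarrow> ('a \<times> 'b) \<times> 'b \<Rightarrow> ('a \<times> 'b) \<times> 'b" where
  "h k i v = joint_dir \<gamma> c (mu k) (f i) (g i) v"

definition noise :: "nat \<Rightarrow> nat \<Rightarrow> 'w \<Rightarrow> ('a \<times> 'b) \<times> 'b" where
  "noise k i \<omega> = H k i \<omega> - h k i (u k i \<omega>)"

text \<open>
  The algorithm supplies trackers for each outcome separately.  The recursion determines their
  relevant values, so the choice made here does not spoil measurability.
\<close>

definition tracker :: "'w \<Rightarrow> nat \<Rightarrow> nat \<Rightarrow> ('a \<times> 'b) \<times> 'b" where
  "tracker \<omega> = (SOME D. gradient_tracking n W K (\<lambda>_. lam) (\<lambda>k i. H k i \<omega>) D (\<lambda>k i. u k i \<omega>))"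

definition D :: "nat \<Rightarrow> nat \<Rightarrow> 'w \<Rightarrow> ('a \<times> 'b) \<times> 'b" where "D k i \<omega> = tracker \<omega> k i"

lemma u_0: "\<omega> \<in> space M \<Longrightarrow> i < n \<Longrightarrow> u 0 i \<omega> = ((x0 i, y0 i), \<theta>0 i)"
  using run unfolding sun_dsbo_gt_def u_def by auto

lemma path: "\<omega> \<in> space M \<Longrightarrow> gradient_tracking n W K (\<lambda>_. lam) (\<lambda>k i. H k i \<omega>) (\<lambda>k i. D k i \<omega>) (\<lambda>k i. u k i \<omega>)"
proof -
  assume \<omega>: "\<omega> \<in> space M"
  obtain Dx Dy Dt where
    t: "gradient_tracking n W K (\<lambda>_. lam) (\<lambda>k i. dir_theta \<gamma> (gs i (\<xi>g k i \<omega>)) (x k i \<omega>) (y k i \<omega>) (\<theta> k i \<omega>)) Dt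
          (\<lambda>k i. \<theta> k i \<omega>)"
    and x: "gradient_tracking n W K (\<lambda>_. c * lam)
          (\<lambda>k i. dir_x (mu k) (fs i (\<xi>f k i \<omega>)) (gs i (\<xi>g k i \<omega>)) (x k i \<omega>) (y k i \<omega>) (\<theta> k i \<omega>)) Dx (\<lambda>k i. x k i \<omega>)"
    and y: "gradient_tracking n W K (\<lambda>_. c * lam)
          (\<lambda>k i. dir_y \<gamma> (mu k) (fs i (\<xi>f k i \<omega>)) (gs i (\<xi>g k i \<omega>)) (x k i \<omega>) (y k i \<omega>) (\<theta> k i \<omega>)) Dy (\<lambda>k i. y k i \<omega>)"
    using run \<omega> unfolding sun_dsbo_gt_def sun_dsbo_gt_path_def mu_def by blast
  have "\<exists>D. gradient_tracking n W K (\<lambda>_. lam) (\<lambda>k i. H k i \<omega>) D (\<lambda>k i. u k i \<omega>)"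
  proof (rule exI)
    show "gradient_tracking n W K (\<lambda>_. lam) (\<lambda>k i. H k i \<omega>)
        (\<lambda>k i. ((c *\<^sub>R Dx k i, c *\<^sub>R Dy k i), Dt k i)) (\<lambda>k i. u k i \<omega>)"
      unfolding H_def u_def joint_dir_eq
      by (intro gradient_tracking_Pair gradient_tracking_scaleR x y t)
  qed
  hence "gradient_tracking n W K (\<lambda>_. lam) (\<lambda>k i. H k i \<omega>) (tracker \<omega>) (\<lambda>k i. u k i \<omega>)"
    unfolding tracker_def by (fact someI_ex)
  thus ?thesis by (simp only: D_def)
qed

definition before :: "nat \<Rightarrow> (nat \<times> nat) set" where "before k = {..<k} \<times> {..<n}"

lemma before_sub: "k \<le> K \<Longrightarrow> before k \<subseteq> {..<K} \<times> {..<n}"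
  by (auto simp: before_def)

definition Lh :: real where "Lh = \<mu>0 * L1 + 8 / \<gamma>"

lemma L1_nonneg: "0 \<le> L1" using smooth_f[OF n_pos] smoothness_nonneg by blast

lemma Lh_nonneg: "0 \<le> Lh" unfolding Lh_def using \<mu>0_pos \<gamma>_pos L1_nonneg by simp

lemma agent: "i < n \<Longrightarrow> prox_smooth (g i) L2 \<gamma>"
  using smooth_g \<gamma>_pos \<gamma>_less by unfold_locales auto

lemma h_lipschitz: "i < n \<Longrightarrow> norm (h k i v - h k i w) \<le> Lh * norm (v - w)"
  unfolding h_def Lh_def
  using mu_pos[of k] mu_le c_pos c_le by (intro prox_smooth.joint_dir_lipschitz[OF agent] smooth_f) auto

definition s2 :: real where "s2 = (3 * \<mu>0\<^sup>2 + 7) * (\<delta>f\<^sup>2 + \<delta>g\<^sup>2)"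

lemma s2_nonneg: "0 \<le> s2" unfolding s2_def by (intro mult_nonneg_nonneg add_nonneg_nonneg) auto

text \<open>
  \<open>A\<close> may contain samples that other agents draw in the same iteration; this gives orthogonality of
  the errors over the agents as well as over time.
\<close>

lemma noise_properties:
  assumes k: "k < K" and i: "i < n" and A: "before k \<subseteq> A" "A \<subseteq> {..<K} \<times> {..<n}" "(k, i) \<notin> A"
    and um: "u k i \<in> borel_measurable (smp.past (before k))"
  shows "sq_integrable M (noise k i)"
    and "(\<integral>\<omega>. (norm (noise k i \<omega>))\<^sup>2 \<partial>M) \<le> s2"
    and "noise k i \<in> borel_measurable (smp.past (insert (k, i) A))"
    and "X \<in> borel_measurable (smp.past A) \<Longrightarrow> sq_integrable M X \<Longrightarrow> (\<integral>\<omega>. inner (X \<omega>) (noise k i \<omega>) \<partial>M) = 0"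
proof -
  let ?b = "(k, i)"
  have b: "?b \<in> {..<K} \<times> {..<n}" using k i by auto
  have uA: "u k i \<in> borel_measurable (smp.past A)" by (rule smp.past_subset[OF A(1,2) um])
  define z where "z \<omega> = fst (u k i \<omega>)" for \<omega>
  define v where "v \<omega> = (fst (fst (u k i \<omega>)), snd (u k i \<omega>))" for \<omega>
  have cont: "fst \<in> borel_measurable borel" "(\<lambda>w. (fst (fst w), snd w)) \<in> borel_measurable borel"
    if "True" for w :: "('a \<times> 'b) \<times> 'b"
    by (intro borel_measurable_continuous_onI continuous_intros)+
  have zA: "z \<in> borel_measurable (smp.past A)" and vA: "v \<in> borel_measurable (smp.past A)"
    unfolding z_def v_def using measurable_compose[OF uA cont(1)] measurable_compose[OF uA cont(2)] by auto
  have PP: "prob_space (Pf i)" "prob_space (Pg i)" and of: "stochastic_oracle (Pf i) (fs i) (f i) \<delta>f"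
    and og: "stochastic_oracle (Pg i) (gs i) (g i) \<delta>g"
    using stoch i unfolding stochastic_oracle_def by auto
  interpret Pf: prob_space "Pf i" by (rule PP)
  interpret Pg: prob_space "Pg i" by (rule PP)
  have d1: "distr (Pf i \<Otimes>\<^sub>M Pg i) (Pf i) fst = Pf i" by (rule Pg.distr_pair_fst)
  have d2: "distr (Pf i \<Otimes>\<^sub>M Pg i) (Pg i) snd = Pg i"
  proof -
    interpret pair_sigma_finite "Pg i" "Pf i" ..
    have "distr (Pg i \<Otimes>\<^sub>M Pf i) (Pg i) fst = Pg i" by (rule Pf.distr_pair_fst)
    also have "distr (Pg i \<Otimes>\<^sub>M Pf i) (Pg i) fst
       = distr (distr (Pf i \<Otimes>\<^sub>M Pg i) (Pg i \<Otimes>\<^sub>M Pf i) (\<lambda>(x, y). (y, x))) (Pg i) fst"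
      using distr_pair_swap by simp
    also have "\<dots> = distr (Pf i \<Otimes>\<^sub>M Pg i) (Pg i) (fst \<circ> (\<lambda>(x, y). (y, x)))"
      by (rule distr_distr) auto
    also have "fst \<circ> (\<lambda>(x, y). (y, x)) = (snd :: 's \<times> 't \<Rightarrow> 't)" by auto
    finally show ?thesis .
  qed
  define e1 where "e1 \<omega> = gradient (fs i (\<xi>f k i \<omega>)) (z \<omega>) - gradient (f i) (z \<omega>)" for \<omega>
  define e2 where "e2 \<omega> = gradient (gs i (\<xi>g k i \<omega>)) (z \<omega>) - gradient (g i) (z \<omega>)" for \<omega>
  define e3 where "e3 \<omega> = gradient (gs i (\<xi>g k i \<omega>)) (v \<omega>) - gradient (g i) (v \<omega>)" for \<omega>
  have m1: "fst \<in> measurable ((\<lambda>(k, i). Pf i \<Otimes>\<^sub>M Pg i) ?b) (Pf i)"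
    and m2: "snd \<in> measurable ((\<lambda>(k, i). Pf i \<Otimes>\<^sub>M Pg i) ?b) (Pg i)"
    and d1': "distr ((\<lambda>(k, i). Pf i \<Otimes>\<^sub>M Pg i) ?b) (Pf i) fst = Pf i"
    and d2': "distr ((\<lambda>(k, i). Pf i \<Otimes>\<^sub>M Pg i) ?b) (Pg i) snd = Pg i"
    using d1 d2 by auto
  note N1 = smp.oracle_noise[OF A(2) b A(3) m1 d1' of smooth_f[OF i] zA, simplified, folded e1_def]
  note N2 = smp.oracle_noise[OF A(2) b A(3) m2 d2' og smooth_g[OF i] zA, simplified, folded e2_def]
  note N3 = smp.oracle_noise[OF A(2) b A(3) m2 d2' og smooth_g[OF i] vA, simplified, folded e3_def]
  have eq: "noise k i \<omega> = (c *\<^sub>R (mu k *\<^sub>R e1 \<omega> + e2 \<omega> - (fst (e3 \<omega>), 0)), snd (e3 \<omega>))" for \<omega>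
    unfolding noise_def H_def h_def joint_dir_def prox_grad_z_def prox_grad_theta_def e1_def e2_def e3_def z_def v_def
    by (simp add: prod_eq_iff algebra_simps)
  have "sq_integrable M e1" "sq_integrable M e2" "sq_integrable M e3" using N1(1) N2(1) N3(1) by auto
  note sq = this
  have s3: "sq_integrable M (\<lambda>\<omega>. (fst (e3 \<omega>), 0::'b))"
    by (intro sq_integrable_Pair sq_integrable_fst sq smp.sq_integrable_const)
  show "sq_integrable M (noise k i)"
    unfolding eq[abs_def]
    by (intro sq_integrable_Pair sq_integrable_scaleR sq_integrable_diff sq_integrable_add sq s3 sq_integrable_snd)
  have c1: "c \<le> 1" using c_le by simp
  have nb: "(norm (noise k i \<omega>))\<^sup>2 \<le> 3 * \<mu>0\<^sup>2 * (norm (e1 \<omega>))\<^sup>2 + 3 * (norm (e2 \<omega>))\<^sup>2 + 4 * (norm (e3 \<omega>))\<^sup>2" for \<omega>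
  proof -
    let ?w = "mu k *\<^sub>R e1 \<omega> + e2 \<omega> + - (fst (e3 \<omega>), 0)"
    have "c\<^sup>2 * (norm ?w)\<^sup>2 \<le> (norm ?w)\<^sup>2"
      using c_pos c1 by (intro mult_left_le_one_le) (auto simp: power_le_one)
    also have "\<dots> \<le> 3 * (norm (mu k *\<^sub>R e1 \<omega>))\<^sup>2 + 3 * (norm (e2 \<omega>))\<^sup>2 + 3 * (norm (- (fst (e3 \<omega>), 0::'b)))\<^sup>2"
      by (rule power2_sum3_le)
    also have "(norm (mu k *\<^sub>R e1 \<omega>))\<^sup>2 \<le> \<mu>0\<^sup>2 * (norm (e1 \<omega>))\<^sup>2"
      using mu_pos[of k] mu_le[of k] by (auto simp: power_mult_distrib intro!: mult_right_mono power_mono)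
    also have "(norm (- (fst (e3 \<omega>), 0::'b)))\<^sup>2 = (norm (fst (e3 \<omega>)))\<^sup>2" by (simp add: norm_Pair)
    finally have "c\<^sup>2 * (norm ?w)\<^sup>2 \<le> 3 * (\<mu>0\<^sup>2 * (norm (e1 \<omega>))\<^sup>2) + 3 * (norm (e2 \<omega>))\<^sup>2 + 3 * (norm (fst (e3 \<omega>)))\<^sup>2"
      by simp
    moreover have "(norm (noise k i \<omega>))\<^sup>2 = c\<^sup>2 * (norm ?w)\<^sup>2 + (norm (snd (e3 \<omega>)))\<^sup>2"
      unfolding eq power2_norm_prod[of "(_, _)"] add_uminus_conv_diff by (simp add: power_mult_distrib)
    moreover have "(norm (e3 \<omega>))\<^sup>2 = (norm (fst (e3 \<omega>)))\<^sup>2 + (norm (snd (e3 \<omega>)))\<^sup>2" by (rule power2_norm_prod)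
    moreover have "0 \<le> (norm (fst (e3 \<omega>)))\<^sup>2" "0 \<le> (norm (snd (e3 \<omega>)))\<^sup>2" by auto
    ultimately show ?thesis by linarith
  qed
  have "(\<integral>\<omega>. (norm (noise k i \<omega>))\<^sup>2 \<partial>M)
      \<le> (\<integral>\<omega>. 3 * \<mu>0\<^sup>2 * (norm (e1 \<omega>))\<^sup>2 + 3 * (norm (e2 \<omega>))\<^sup>2 + 4 * (norm (e3 \<omega>))\<^sup>2 \<partial>M)"
    using \<open>sq_integrable M (noise k i)\<close> sq nb
    by (intro integral_mono Bochner_Integration.integrable_add integrable_mult_right) (auto simp: sq_integrable_def)
  also have "\<dots> = 3 * \<mu>0\<^sup>2 * (\<integral>\<omega>. (norm (e1 \<omega>))\<^sup>2 \<partial>M) + 3 * (\<integral>\<omega>. (norm (e2 \<omega>))\<^sup>2 \<partial>M) + 4 * (\<integral>\<omega>. (norm (e3 \<omega>))\<^sup>2 \<partial>M)"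
    using sq by (simp add: sq_integrable_def)
  also have "\<dots> \<le> 3 * \<mu>0\<^sup>2 * \<delta>f\<^sup>2 + 3 * \<delta>g\<^sup>2 + 4 * \<delta>g\<^sup>2"
    using N1(2) N2(2) N3(2) by (intro add_mono mult_left_mono) auto
  also have "\<dots> \<le> s2" unfolding s2_def by (simp add: algebra_simps)
  finally show "(\<integral>\<omega>. (norm (noise k i \<omega>))\<^sup>2 \<partial>M) \<le> s2" .
  have lin: "(\<lambda>(a, b, d). (c *\<^sub>R (mu k *\<^sub>R a + b - (fst d, 0)), snd d))
      \<in> borel_measurable (borel :: (('a \<times> 'b) \<times> ('a \<times> 'b) \<times> ('a \<times> 'b)) measure)"
    unfolding case_prod_beta
    by (intro borel_measurable_continuous_onI continuous_intros)
  have "(\<lambda>\<omega>. (e1 \<omega>, e2 \<omega>, e3 \<omega>)) \<in> borel_measurable (smp.past (insert ?b A))"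
    using N1(3) N2(3) N3(3) by (intro borel_measurable_Pair) auto
  from measurable_compose[OF this lin]
  show "noise k i \<in> borel_measurable (smp.past (insert (k, i) A))" unfolding eq[abs_def] by simp
  show "(\<integral>\<omega>. inner (X \<omega>) (noise k i \<omega>) \<partial>M) = 0"
    if X: "X \<in> borel_measurable (smp.past A)" "sq_integrable M X"
  proof -
    have fX: "(\<lambda>\<omega>. fst (X \<omega>)) \<in> borel_measurable (smp.past A)"
      by (rule measurable_compose[OF X(1)]) (intro borel_measurable_continuous_onI continuous_intros)
    have gX: "(\<lambda>\<omega>. (- c *\<^sub>R fst (fst (X \<omega>)), snd (X \<omega>))) \<in> borel_measurable (smp.past A)"
      by (rule measurable_compose[OF X(1)]) (intro borel_measurable_continuous_onI continuous_intros)
    have sfX: "sq_integrable M (\<lambda>\<omega>. fst (X \<omega>))" by (intro sq_integrable_fst X)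
    have sgX: "sq_integrable M (\<lambda>\<omega>. (- c *\<^sub>R fst (fst (X \<omega>)), snd (X \<omega>)))"
      by (intro sq_integrable_Pair sq_integrable_scaleR sq_integrable_fst sq_integrable_snd X)
    have "inner (X \<omega>) (noise k i \<omega>) = (c * mu k) * inner (fst (X \<omega>)) (e1 \<omega>) + c * inner (fst (X \<omega>)) (e2 \<omega>)
        + inner (- c *\<^sub>R fst (fst (X \<omega>)), snd (X \<omega>)) (e3 \<omega>)" for \<omega>
      unfolding eq by (simp add: inner_prod_def inner_add_right inner_diff_right algebra_simps)
    hence "(\<integral>\<omega>. inner (X \<omega>) (noise k i \<omega>) \<partial>M) = (\<integral>\<omega>. (c * mu k) * inner (fst (X \<omega>)) (e1 \<omega>) + c * inner (fst (X \<omega>)) (e2 \<omega>)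
        + inner (- c *\<^sub>R fst (fst (X \<omega>)), snd (X \<omega>)) (e3 \<omega>) \<partial>M)" by simp
    also have "\<dots> = (c * mu k) * (\<integral>\<omega>. inner (fst (X \<omega>)) (e1 \<omega>) \<partial>M) + c * (\<integral>\<omega>. inner (fst (X \<omega>)) (e2 \<omega>) \<partial>M)
        + (\<integral>\<omega>. inner (- c *\<^sub>R fst (fst (X \<omega>)), snd (X \<omega>)) (e3 \<omega>) \<partial>M)"
      using sq_integrable_inner[OF sfX sq(1)] sq_integrable_inner[OF sfX sq(2)] sq_integrable_inner[OF sgX sq(3)]
      by simp
    also have "\<dots> = 0" using N1(4)[OF fX sfX] N2(4)[OF fX sfX] N3(4)[OF gX sgX] by simp
    finally show ?thesis .
  qed
qed

definition adapted :: "nat \<Rightarrow> ('w \<Rightarrow> ('a \<times> 'b) \<times> 'b) \<Rightarrow> bool" where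
  "adapted k X \<longleftrightarrow> X \<in> borel_measurable (smp.past (before k)) \<and> sq_integrable M X"

lemma adapted_add: "adapted k X \<Longrightarrow> adapted k Y \<Longrightarrow> adapted k (\<lambda>\<omega>. X \<omega> + Y \<omega>)"
  unfolding adapted_def by (auto intro: sq_integrable_add)

lemma adapted_diff: "adapted k X \<Longrightarrow> adapted k Y \<Longrightarrow> adapted k (\<lambda>\<omega>. X \<omega> - Y \<omega>)"
  unfolding adapted_def by (auto intro: sq_integrable_diff)

lemma adapted_scaleR: "adapted k X \<Longrightarrow> adapted k (\<lambda>\<omega>. r *\<^sub>R X \<omega>)"
  unfolding adapted_def by (auto intro: sq_integrable_scaleR)

lemma adapted_const: "adapted k (\<lambda>\<omega>. d)"
  unfolding adapted_def by (auto intro: smp.sq_integrable_const)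

lemma adapted_mix: "(\<And>j. j < n \<Longrightarrow> adapted k (X j)) \<Longrightarrow> adapted k (\<lambda>\<omega>. mix n W (\<lambda>j. X j \<omega>) i)"
  unfolding adapted_def mix_def by (auto intro!: sq_integrable_sum sq_integrable_scaleR borel_measurable_sum borel_measurable_scaleR)

lemma adapted_average: "(\<And>j. j < n \<Longrightarrow> adapted k (X j)) \<Longrightarrow> adapted k (\<lambda>\<omega>. average n (\<lambda>j. X j \<omega>))"
  unfolding adapted_def average_def by (auto intro!: sq_integrable_sum sq_integrable_scaleR borel_measurable_sum borel_measurable_scaleR)

lemma adapted_lipschitz:
  "adapted k X \<Longrightarrow> (\<And>v w. norm (q v - q w) \<le> L * norm (v - w)) \<Longrightarrow> adapted k (\<lambda>\<omega>. q (X \<omega>))"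
  unfolding adapted_def
  using measurable_compose[OF _ lipschitz_borel_measurable[of q L]] smp.sq_integrable_lipschitz[of X q L] by auto

lemma adapted_cong: "(\<And>\<omega>. \<omega> \<in> space M \<Longrightarrow> X \<omega> = Y \<omega>) \<Longrightarrow> adapted k X \<longleftrightarrow> adapted k Y"
  unfolding adapted_def using sq_integrable_cong[of M X Y]
  by (intro conj_cong measurable_cong) auto

lemma adapted_Suc:
  assumes "k < K" "adapted k X"
  shows "adapted (Suc k) X"
proof -
  have "before k \<subseteq> before (Suc k)" by (auto simp: before_def)
  moreover have "before (Suc k) \<subseteq> {..<K} \<times> {..<n}" using before_sub[of "Suc k"] assms(1) by simp
  moreover have "X \<in> borel_measurable (smp.past (before k))" using assms(2) by (simp add: adapted_def)
  ultimately have "X \<in> borel_measurable (smp.past (before (Suc k)))" by (rule smp.past_subset)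
  thus ?thesis using assms(2) by (simp add: adapted_def)
qed

lemma adapted_noise:
  assumes "k < K" "i < n" "adapted k (u k i)"
  shows "adapted (Suc k) (noise k i)"
proof -
  have um: "u k i \<in> borel_measurable (smp.past (before k))" using assms by (simp add: adapted_def)
  have A: "before k \<subseteq> {..<K} \<times> {..<n}" "(k, i) \<notin> before k" using assms by (auto simp: before_def)
  note N = noise_properties[OF assms(1,2) subset_refl A um]
  have "noise k i \<in> borel_measurable (smp.past (before (Suc k)))"
    by (rule smp.past_subset[OF _ _ N(3)]) (use assms in \<open>auto simp: before_def\<close>)
  thus ?thesis using N(1) by (simp add: adapted_def)
qed

lemma adapted_H:
  assumes "k < K" "i < n" "adapted k (u k i)"
  shows "adapted (Suc k) (H k i)"
proof -
  have "adapted k (\<lambda>\<omega>. h k i (u k i \<omega>))"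
    by (rule adapted_lipschitz[where X = "u k i" and L = Lh and q = "h k i"])
      (fact assms(3), rule h_lipschitz[OF assms(2)])
  from adapted_add[OF adapted_noise[OF assms] adapted_Suc[OF assms(1) this]]
  have "adapted (Suc k) (\<lambda>\<omega>. noise k i \<omega> + h k i (u k i \<omega>))" .
  thus ?thesis by (simp add: noise_def)
qed

text \<open>
  Adaptedness and square integrability have to be proved together, because the sampled direction
  inherits both from the state at which it is evaluated.
\<close>

lemma adapted_process:
  "k \<le> K \<Longrightarrow> (\<forall>i<n. adapted k (u k i)) \<and> (\<forall>i<n. adapted k (\<lambda>\<omega>. prev (\<lambda>k i. D k i \<omega>) k i))
     \<and> (\<forall>i<n. adapted k (\<lambda>\<omega>. prev (\<lambda>k i. H k i \<omega>) k i))"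
proof (induction k)
  case 0
  have "adapted 0 (u 0 i)" if "i < n" for i
    using adapted_cong[of "u 0 i" "\<lambda>_. ((x0 i, y0 i), \<theta>0 i)"] adapted_const u_0 that by simp
  thus ?case by (simp add: prev_def adapted_const)
next
  case (Suc k)
  hence k: "k < K" and IH: "\<And>i. i < n \<Longrightarrow> adapted k (u k i)"
    "\<And>i. i < n \<Longrightarrow> adapted k (\<lambda>\<omega>. prev (\<lambda>k i. D k i \<omega>) k i)"
    "\<And>i. i < n \<Longrightarrow> adapted k (\<lambda>\<omega>. prev (\<lambda>k i. H k i \<omega>) k i)" by auto
  have H: "adapted (Suc k) (H k i)" if "i < n" for i using adapted_H[OF k that IH(1)[OF that]] .
  have Di: "adapted (Suc k) (D k i)" if i: "i < n" for i
  proof -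
    have "adapted (Suc k) (\<lambda>\<omega>. mix n W (\<lambda>j. prev (\<lambda>k i. D k i \<omega>) k j + H k j \<omega> - prev (\<lambda>k i. H k i \<omega>) k j) i)"
      by (intro adapted_mix adapted_add adapted_diff adapted_Suc[OF k] IH H)
    thus ?thesis using adapted_cong[of "D k i"] tracker_eq[OF nt path k i] by simp
  qed
  have "adapted (Suc k) (u (Suc k) i)" if i: "i < n" for i
  proof -
    have "adapted (Suc k) (\<lambda>\<omega>. mix n W (\<lambda>j. u k j \<omega> - lam *\<^sub>R D k j \<omega>) i)"
      by (intro adapted_mix adapted_diff adapted_scaleR adapted_Suc[OF k] IH Di)
    thus ?thesis using adapted_cong[of "u (Suc k) i"] iterate_eq[OF nt path k i] by simp
  qed
  thus ?case using H Di by (simp add: prev_def)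
qed

lemma adapted_sq: "adapted k X \<Longrightarrow> sq_integrable M X"
  by (simp add: adapted_def)

lemma adapted_u: "k \<le> K \<Longrightarrow> i < n \<Longrightarrow> adapted k (u k i)"
  using adapted_process[of k] by blast

lemma sq_u: "k \<le> K \<Longrightarrow> i < n \<Longrightarrow> sq_integrable M (u k i)"
  by (rule adapted_sq[OF adapted_u])

lemma sq_H: "k < K \<Longrightarrow> i < n \<Longrightarrow> sq_integrable M (H k i)"
  by (rule adapted_sq[OF adapted_H[OF _ _ adapted_u]]) auto

lemma sq_D:
  assumes "k < K" "i < n"
  shows "sq_integrable M (D k i)"
proof -
  have "adapted (Suc k) (\<lambda>\<omega>. prev (\<lambda>k i. D k i \<omega>) (Suc k) i)"
    using adapted_process[of "Suc k"] assms by auto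
  thus ?thesis by (simp add: adapted_def prev_def)
qed

lemma noise_at:
  assumes "k < K" "i < n"
  shows "sq_integrable M (noise k i)" "(\<integral>\<omega>. (norm (noise k i \<omega>))\<^sup>2 \<partial>M) \<le> s2"
    and "adapted k X \<Longrightarrow> (\<integral>\<omega>. inner (X \<omega>) (noise k i \<omega>) \<partial>M) = 0"
proof -
  have um: "u k i \<in> borel_measurable (smp.past (before k))"
    using adapted_u[of k i] assms by (simp add: adapted_def)
  have A: "before k \<subseteq> {..<K} \<times> {..<n}" "(k, i) \<notin> before k" using assms by (auto simp: before_def)
  note N = noise_properties[OF assms subset_refl A um]
  show "sq_integrable M (noise k i)" "(\<integral>\<omega>. (norm (noise k i \<omega>))\<^sup>2 \<partial>M) \<le> s2" by (fact N(1), fact N(2))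
  show "adapted k X \<Longrightarrow> (\<integral>\<omega>. inner (X \<omega>) (noise k i \<omega>) \<partial>M) = 0"
    unfolding adapted_def by (rule N(4)) auto
qed

text \<open>
  Agents draw independently, so their errors are orthogonal and averaging divides the variance
  by \<open>n\<close>.
\<close>

lemma sum_noise:
  assumes k: "k < K"
  shows "m \<le> n \<Longrightarrow> (\<lambda>\<omega>. \<Sum>i<m. noise k i \<omega>) \<in> borel_measurable (smp.past (before k \<union> {k} \<times> {..<m})) \<and>
      (\<integral>\<omega>. (norm (\<Sum>i<m. noise k i \<omega>))\<^sup>2 \<partial>M) \<le> real m * s2"
proof (induction m)
  case 0
  show ?case by simp
next
  case (Suc m)
  let ?A = "before k \<union> {k} \<times> {..<m}"
  let ?S = "\<lambda>\<omega>. \<Sum>i<m. noise k i \<omega>"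
  have m: "m < n" using Suc by simp
  have A: "before k \<subseteq> ?A" "?A \<subseteq> {..<K} \<times> {..<n}" "(k, m) \<notin> ?A" using k m by (auto simp: before_def)
  have um: "u k m \<in> borel_measurable (smp.past (before k))"
    using adapted_u[of k m] k m by (simp add: adapted_def)
  note N = noise_properties[OF k m A um]
  have ins: "insert (k, m) ?A = before k \<union> {k} \<times> {..<Suc m}" by auto
  have IH: "?S \<in> borel_measurable (smp.past ?A)" "(\<integral>\<omega>. (norm (?S \<omega>))\<^sup>2 \<partial>M) \<le> real m * s2"
    using Suc by auto
  have sqS: "sq_integrable M ?S" by (intro sq_integrable_sum noise_at(1)[OF k]) (use m in auto)
  have "?S \<in> borel_measurable (smp.past (insert (k, m) ?A))"
    by (rule smp.past_subset[OF _ _ IH(1)]) (use A k m in auto)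
  hence meas: "(\<lambda>\<omega>. ?S \<omega> + noise k m \<omega>) \<in> borel_measurable (smp.past (before k \<union> {k} \<times> {..<Suc m}))"
    using N(3) unfolding ins by auto
  have "(\<integral>\<omega>. (norm (?S \<omega> + noise k m \<omega>))\<^sup>2 \<partial>M)
     = (\<integral>\<omega>. (norm (?S \<omega>))\<^sup>2 + 2 * inner (?S \<omega>) (noise k m \<omega>) + (norm (noise k m \<omega>))\<^sup>2 \<partial>M)"
    by (intro Bochner_Integration.integral_cong) (auto simp: power2_norm_eq_inner inner_add_left inner_add_right inner_commute)
  also have "\<dots> = (\<integral>\<omega>. (norm (?S \<omega>))\<^sup>2 \<partial>M) + 2 * (\<integral>\<omega>. inner (?S \<omega>) (noise k m \<omega>) \<partial>M)
      + (\<integral>\<omega>. (norm (noise k m \<omega>))\<^sup>2 \<partial>M)"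
    using sqS N(1) sq_integrable_inner[OF sqS N(1)] by (simp add: sq_integrable_def)
  also have "\<dots> \<le> real m * s2 + 2 * 0 + s2"
    using IH(2) N(2) N(4)[OF IH(1) sqS] by simp
  finally show ?case using meas by (simp add: algebra_simps)
qed

lemma average_noise:
  assumes k: "k < K"
  shows "(\<integral>\<omega>. (norm (average n (\<lambda>i. noise k i \<omega>)))\<^sup>2 \<partial>M) \<le> s2 / real n"
proof -
  have "(\<integral>\<omega>. (norm (average n (\<lambda>i. noise k i \<omega>)))\<^sup>2 \<partial>M)
     = (1 / real n)\<^sup>2 * (\<integral>\<omega>. (norm (\<Sum>i<n. noise k i \<omega>))\<^sup>2 \<partial>M)"
    unfolding average_def by (simp add: power_mult_distrib power_divide)
  also have "\<dots> \<le> (1 / real n)\<^sup>2 * (real n * s2)"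
    using sum_noise[OF k, of n] by (intro mult_left_mono) auto
  finally show ?thesis using n_pos by (simp add: power2_eq_square)
qed

lemma average_noise_orthogonal:
  assumes k: "k < K" and X: "adapted k X"
  shows "(\<integral>\<omega>. inner (X \<omega>) (average n (\<lambda>i. noise k i \<omega>)) \<partial>M) = 0"
proof -
  have "(\<integral>\<omega>. inner (X \<omega>) (average n (\<lambda>i. noise k i \<omega>)) \<partial>M)
      = (\<integral>\<omega>. (1 / real n) * (\<Sum>i<n. inner (X \<omega>) (noise k i \<omega>)) \<partial>M)"
    unfolding average_def by (simp add: inner_sum_right)
  also have "\<dots> = (1 / real n) * (\<Sum>i<n. \<integral>\<omega>. inner (X \<omega>) (noise k i \<omega>) \<partial>M)"
    by (subst Bochner_Integration.integral_mult_right_zero, subst Bochner_Integration.integral_sum)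
      (auto intro: sq_integrable_inner adapted_sq[OF X] noise_at(1)[OF k])
  also have "\<dots> = 0" using noise_at(3)[OF k _ X] by simp
  finally show ?thesis .
qed

end

section \<open>The recursion satisfied by the algorithm\<close>

definition tracking_lipschitz :: "real \<Rightarrow> real \<Rightarrow> real \<Rightarrow> real" where
  "tracking_lipschitz L1 \<gamma> \<mu>0 = \<mu>0 * L1 + 8 / \<gamma>"

text \<open>
  Each summand bounds the constant of one of the inequalities below; what matters is that none of
  them involves \<open>n\<close>, \<open>K\<close>, \<open>\<rho>\<close> or the variances.
\<close>

definition tracking_const :: "real \<Rightarrow> real \<Rightarrow> real \<Rightarrow> real \<Rightarrow> real" where
  "tracking_const L1 \<gamma> \<mu>0 c =
     (let l = (tracking_lipschitz L1 \<gamma> \<mu>0)\<^sup>2 in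
      1 + (12 * l + 8) + (88 + 4 * l + 2) + (2 + 12 * L1\<^sup>2) + ((2 / c + 22) * l) + (\<mu>0 * L1 + 18 / \<gamma>)
      + (1 + 3 / (2 * \<gamma>)) + (2 * (4 * \<mu>0\<^sup>2 + 16 + 2 * l * (16 + 32 * \<gamma>\<^sup>2)) + 2)
      + (3 * \<mu>0\<^sup>2 + 3 + 3 * (\<mu>0 * L1 + 7 / \<gamma>)\<^sup>2 + 18 / \<gamma>\<^sup>2) * (5 + 2 * L1\<^sup>2 + 1 / \<gamma>\<^sup>2))"

lemma tracking_const_ge:
  assumes "0 \<le> L1" "0 < \<gamma>" "0 < \<mu>0" "0 < c"
  defines "l \<equiv> (tracking_lipschitz L1 \<gamma> \<mu>0)\<^sup>2"
  shows "1 \<le> tracking_const L1 \<gamma> \<mu>0 c" "12 * l + 8 \<le> tracking_const L1 \<gamma> \<mu>0 c"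
    "88 + 4 * l + 2 \<le> tracking_const L1 \<gamma> \<mu>0 c" "2 + 12 * L1\<^sup>2 \<le> tracking_const L1 \<gamma> \<mu>0 c"
    "(2 / c + 22) * l \<le> tracking_const L1 \<gamma> \<mu>0 c" "\<mu>0 * L1 + 18 / \<gamma> \<le> tracking_const L1 \<gamma> \<mu>0 c"
    "1 + 3 / (2 * \<gamma>) \<le> tracking_const L1 \<gamma> \<mu>0 c"
    "2 * (4 * \<mu>0\<^sup>2 + 16 + 2 * l * (16 + 32 * \<gamma>\<^sup>2)) + 2 \<le> tracking_const L1 \<gamma> \<mu>0 c"
    "(3 * \<mu>0\<^sup>2 + 3 + 3 * (\<mu>0 * L1 + 7 / \<gamma>)\<^sup>2 + 18 / \<gamma>\<^sup>2) * (5 + 2 * L1\<^sup>2 + 1 / \<gamma>\<^sup>2) \<le> tracking_const L1 \<gamma> \<mu>0 c"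
proof -
  define t1 t2 t3 t4 t5 t6 t7 t8 where "t1 = 12 * l + 8" and "t2 = 88 + 4 * l + 2" and "t3 = 2 + 12 * L1\<^sup>2"
    and "t4 = (2 / c + 22) * l" and "t5 = \<mu>0 * L1 + 18 / \<gamma>" and "t6 = 1 + 3 / (2 * \<gamma>)"
    and "t7 = 2 * (4 * \<mu>0\<^sup>2 + 16 + 2 * l * (16 + 32 * \<gamma>\<^sup>2)) + 2"
    and "t8 = (3 * \<mu>0\<^sup>2 + 3 + 3 * (\<mu>0 * L1 + 7 / \<gamma>)\<^sup>2 + 18 / \<gamma>\<^sup>2) * (5 + 2 * L1\<^sup>2 + 1 / \<gamma>\<^sup>2)"
  have l: "0 \<le> l" by (simp add: l_def)
  have nn: "0 \<le> t1" "0 \<le> t2" "0 \<le> t3" "0 \<le> t4" "0 \<le> t5" "0 \<le> t6" "0 \<le> t7" "0 \<le> t8"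
    using assms(1-4) l
    by (auto simp: t1_def t2_def t3_def t4_def t5_def t6_def t7_def t8_def
        intro!: mult_nonneg_nonneg add_nonneg_nonneg)
  have e: "tracking_const L1 \<gamma> \<mu>0 c = 1 + t1 + t2 + t3 + t4 + t5 + t6 + t7 + t8"
    unfolding tracking_const_def Let_def l_def[symmetric] t1_def t2_def t3_def t4_def t5_def t6_def t7_def t8_def ..
  show "1 \<le> tracking_const L1 \<gamma> \<mu>0 c" "12 * l + 8 \<le> tracking_const L1 \<gamma> \<mu>0 c"
    "88 + 4 * l + 2 \<le> tracking_const L1 \<gamma> \<mu>0 c" "2 + 12 * L1\<^sup>2 \<le> tracking_const L1 \<gamma> \<mu>0 c"
    "(2 / c + 22) * l \<le> tracking_const L1 \<gamma> \<mu>0 c" "\<mu>0 * L1 + 18 / \<gamma> \<le> tracking_const L1 \<gamma> \<mu>0 c"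
    "1 + 3 / (2 * \<gamma>) \<le> tracking_const L1 \<gamma> \<mu>0 c"
    "2 * (4 * \<mu>0\<^sup>2 + 16 + 2 * l * (16 + 32 * \<gamma>\<^sup>2)) + 2 \<le> tracking_const L1 \<gamma> \<mu>0 c"
    "(3 * \<mu>0\<^sup>2 + 3 + 3 * (\<mu>0 * L1 + 7 / \<gamma>)\<^sup>2 + 18 / \<gamma>\<^sup>2) * (5 + 2 * L1\<^sup>2 + 1 / \<gamma>\<^sup>2) \<le> tracking_const L1 \<gamma> \<mu>0 c"
    unfolding e t1_def[symmetric] t2_def[symmetric] t3_def[symmetric] t4_def[symmetric] t5_def[symmetric]
      t6_def[symmetric] t7_def[symmetric] t8_def[symmetric]
    using nn by linarith+
qed

lemma consensus_gap_eq:
  "consensus_gap n x y t i = (norm (((x i, y i), t i) - average n (\<lambda>i. ((x i, y i), t i))))\<^sup>2"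
  unfolding consensus_gap_def average_Pair power2_norm_prod[of "_ - _"] by (simp add: power2_norm_prod[of "(_, _)"])

lemma integrable_mean_sq:
  assumes "\<And>i. i < n \<Longrightarrow> sq_integrable M (X i)"
  shows "integrable M (\<lambda>\<omega>. mean_sq n (\<lambda>i. X i \<omega>))"
    and "(\<integral>\<omega>. mean_sq n (\<lambda>i. X i \<omega>) \<partial>M) = average n (\<lambda>i. \<integral>\<omega>. (norm (X i \<omega>))\<^sup>2 \<partial>M)"
proof -
  have i: "integrable M (\<lambda>\<omega>. (norm (X i \<omega>))\<^sup>2)" if "i < n" for i
    using assms that by (simp add: sq_integrable_def)
  show "integrable M (\<lambda>\<omega>. mean_sq n (\<lambda>i. X i \<omega>))"
    unfolding mean_sq_def average_def
    by (intro integrable_scaleR_right Bochner_Integration.integrable_sum i) auto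
  show "(\<integral>\<omega>. mean_sq n (\<lambda>i. X i \<omega>) \<partial>M) = average n (\<lambda>i. \<integral>\<omega>. (norm (X i \<omega>))\<^sup>2 \<partial>M)"
    unfolding mean_sq_def average_def
    by (subst integral_scaleR_right, subst Bochner_Integration.integral_sum) (auto intro: i)
qed

lemma integrable_spread:
  assumes "\<And>i. i < n \<Longrightarrow> sq_integrable M (X i)"
  shows "integrable M (\<lambda>\<omega>. spread n (\<lambda>i. X i \<omega>))"
  unfolding spread_def by (intro integrable_mean_sq sq_integrable_diff sq_integrable_average assms)

context sun_dsbo_run
begin

definition ub :: "nat \<Rightarrow> 'w \<Rightarrow> ('a \<times> 'b) \<times> 'b" where "ub k \<omega> = average n (\<lambda>i. u k i \<omega>)"
definition Hb :: "nat \<Rightarrow> 'w \<Rightarrow> ('a \<times> 'b) \<times> 'b" where "Hb k \<omega> = average n (\<lambda>i. H k i \<omega>)"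

definition mean_spread :: "nat \<Rightarrow> real" where "mean_spread k = (\<integral>\<omega>. spread n (\<lambda>i. u k i \<omega>) \<partial>M)"
definition mean_tracker_spread :: "nat \<Rightarrow> real" where "mean_tracker_spread k = (\<integral>\<omega>. spread n (\<lambda>i. D k i \<omega>) \<partial>M)"
definition mean_step :: "nat \<Rightarrow> real" where "mean_step k = (\<integral>\<omega>. (norm (Hb k \<omega>))\<^sup>2 \<partial>M)"
definition mean_local_grad :: "nat \<Rightarrow> real" where
  "mean_local_grad k = (\<integral>\<omega>. mean_sq n (\<lambda>i. gradient (f i) (fst (u k i \<omega>))) \<partial>M)"
definition mean_progress :: "nat \<Rightarrow> real" where "mean_progress k = (\<integral>\<omega>. avg.progress (mu k) (ub k \<omega>) \<partial>M)"
definition mean_lyap :: "nat \<Rightarrow> real" where "mean_lyap k = (\<integral>\<omega>. avg.lyap (mu k) (ub k \<omega>) - mu k * Flow \<partial>M)"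

lemma adapted_ub: "k \<le> K \<Longrightarrow> adapted k (ub k)"
  unfolding ub_def[abs_def] by (rule adapted_average) (rule adapted_u)

lemma sq_ub: "k \<le> K \<Longrightarrow> sq_integrable M (ub k)"
  by (rule adapted_sq[OF adapted_ub])

lemma sq_Hb: "k < K \<Longrightarrow> sq_integrable M (Hb k)"
  unfolding Hb_def[abs_def] by (rule sq_integrable_average) (rule sq_H)

lemma sq_grad: "k \<le> K \<Longrightarrow> i < n \<Longrightarrow> sq_integrable M (\<lambda>\<omega>. gradient (f i) (fst (u k i \<omega>)))"
  by (rule smp.sq_integrable_lipschitz[where L = L1 and g = "gradient (f i)"])
    (auto intro: sq_integrable_fst sq_u smoothness_lipschitz[OF smooth_f])

lemma gradPsi_lipschitz: "norm (avg.gradPsi (mu k) z - avg.gradPsi (mu k) z') \<le> (\<mu>0 * L1 + 7 / \<gamma>) * norm (z - z')"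
proof -
  have F: "norm (mu k *\<^sub>R (gradient F z - gradient F z')) \<le> \<mu>0 * (L1 * norm (z - z'))"
    using mu_pos[of k] mu_le[of k] smoothness_lipschitz[OF smooth_F, of z z'] by (auto intro!: mult_mono)
  have "norm (gradient G z - gradient G z') \<le> L2 * norm (z - z')" by (rule smoothness_lipschitz[OF smooth_G])
  also have "\<dots> \<le> (1 / \<gamma>) * norm (z - z')"
  proof (rule mult_right_mono)
    show "L2 \<le> 1 / \<gamma>" using avg.L2_le avg.inv_\<gamma>_pos by linarith
  qed simp
  finally have G: "norm (gradient G z - gradient G z') \<le> (1 / \<gamma>) * norm (z - z')" .
  have E: "norm (avg.env_grad z - avg.env_grad z') \<le> (6 / \<gamma>) * norm (z - z')" by (rule avg.env_grad_lipschitz)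
  have tri: "norm (a + b - d) \<le> norm a + norm b + norm d" for a b d :: "'a \<times> 'b"
    using norm_triangle_ineq4[of "a + b" d] norm_triangle_ineq[of a b] by linarith
  have "avg.gradPsi (mu k) z - avg.gradPsi (mu k) z' = mu k *\<^sub>R (gradient F z - gradient F z')
      + (gradient G z - gradient G z') - (avg.env_grad z - avg.env_grad z')"
    unfolding avg.gradPsi_eq by (simp add: algebra_simps)
  hence "norm (avg.gradPsi (mu k) z - avg.gradPsi (mu k) z') \<le> norm (mu k *\<^sub>R (gradient F z - gradient F z'))
      + norm (gradient G z - gradient G z') + norm (avg.env_grad z - avg.env_grad z')"
    using tri by metis
  also have "\<dots> \<le> \<mu>0 * (L1 * norm (z - z')) + (1 / \<gamma>) * norm (z - z') + (6 / \<gamma>) * norm (z - z')"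
    by (intro add_mono F G E)
  finally show ?thesis by (simp add: algebra_simps add_divide_distrib[symmetric])
qed

lemma residual_lipschitz: "norm (avg.residual v - avg.residual w) \<le> (3 / \<gamma>) * norm (v - w)"
proof -
  have "norm (avg.residual v - avg.residual w) \<le> (3 / (2 * \<gamma>)) * (norm (fst v - fst w) + norm (snd v - snd w))"
    unfolding avg.residual_def by (rule avg.prox_grad_theta_lipschitz)
  also have "\<dots> \<le> (3 / (2 * \<gamma>)) * (2 * norm (v - w))"
    using norm_fst_le_norm[of "v - w"] norm_snd_le_norm[of "v - w"] \<gamma>_pos by (intro mult_left_mono) auto
  finally show ?thesis by simp
qed

lemma lyap_grad_lipschitz: "\<exists>L. \<forall>v w. norm (avg.lyap_grad (mu k) v - avg.lyap_grad (mu k) w) \<le> L * norm (v - w)"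
proof -
  have "norm (avg.lyap_grad (mu k) v - avg.lyap_grad (mu k) w)
    \<le> ((\<mu>0 * L1 + 7 / \<gamma>) + (3 / \<gamma> + 6 / \<gamma>) + 3 / \<gamma>) * norm (v - w)" for v w
  proof -
    define N where "N = norm (v - w)"
    have n1: "norm (fst v - fst w) \<le> N" using norm_fst_le_norm[of "v - w"] by (simp add: N_def)
    have n2: "norm (snd v - snd w) \<le> N" using norm_snd_le_norm[of "v - w"] by (simp add: N_def)
    have k1: "0 \<le> \<mu>0 * L1 + 7 / \<gamma>" using \<mu>0_pos \<gamma>_pos L1_nonneg by simp
    have a: "norm (avg.gradPsi (mu k) (fst v) - avg.gradPsi (mu k) (fst w)) \<le> (\<mu>0 * L1 + 7 / \<gamma>) * N"
      using gradPsi_lipschitz[of k "fst v" "fst w"] mult_left_mono[OF n1 k1] by linarith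
    have "norm (prox_grad_z \<gamma> G (fst v) (snd v) - prox_grad_z \<gamma> G (fst w) (snd w)) \<le> (3 / (2 * \<gamma>)) * (2 * N)"
      using avg.prox_grad_z_lipschitz[of "fst v" "snd v" "fst w" "snd w"]
        mult_left_mono[of "norm (fst v - fst w) + norm (snd v - snd w)" "2 * N" "3 / (2 * \<gamma>)"] n1 n2 \<gamma>_pos by simp
    hence b1: "norm (prox_grad_z \<gamma> G (fst v) (snd v) - prox_grad_z \<gamma> G (fst w) (snd w)) \<le> (3 / \<gamma>) * N" by simp
    have b2: "norm (avg.env_grad (fst v) - avg.env_grad (fst w)) \<le> (6 / \<gamma>) * N"
      using avg.env_grad_lipschitz[of "fst v" "fst w"] mult_left_mono[OF n1, of "6 / \<gamma>"] \<gamma>_pos by simp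
    have "norm (avg.env_error v - avg.env_error w) \<le> norm (prox_grad_z \<gamma> G (fst v) (snd v) - prox_grad_z \<gamma> G (fst w) (snd w))
       + norm (avg.env_grad (fst v) - avg.env_grad (fst w))"
      using norm_triangle_ineq4[of "prox_grad_z \<gamma> G (fst v) (snd v) - prox_grad_z \<gamma> G (fst w) (snd w)"
          "avg.env_grad (fst v) - avg.env_grad (fst w)"]
      unfolding avg.env_error_def by (simp add: algebra_simps)
    hence b: "norm (avg.env_error v - avg.env_error w) \<le> (3 / \<gamma> + 6 / \<gamma>) * N"
      using b1 b2 unfolding distrib_right by linarith
    have d: "norm (avg.residual v - avg.residual w) \<le> (3 / \<gamma>) * N" unfolding N_def by (rule residual_lipschitz)
    have "norm (avg.lyap_grad (mu k) v - avg.lyap_grad (mu k) w)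
      \<le> norm ((avg.gradPsi (mu k) (fst v) - avg.gradPsi (mu k) (fst w)) + (avg.env_error v - avg.env_error w))
        + norm (avg.residual v - avg.residual w)"
      unfolding avg.lyap_grad_def
      using norm_Pair_le[of "(avg.gradPsi (mu k) (fst v) - avg.gradPsi (mu k) (fst w)) + (avg.env_error v - avg.env_error w)"
          "avg.residual v - avg.residual w"] by (simp add: algebra_simps)
    also have "norm ((avg.gradPsi (mu k) (fst v) - avg.gradPsi (mu k) (fst w)) + (avg.env_error v - avg.env_error w))
      \<le> norm (avg.gradPsi (mu k) (fst v) - avg.gradPsi (mu k) (fst w)) + norm (avg.env_error v - avg.env_error w)"
      by (rule norm_triangle_ineq)
    finally show ?thesis using a b d unfolding N_def distrib_right by linarith
  qed
  thus ?thesis by blast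
qed

lemma adapted_lyap_grad: "k \<le> K \<Longrightarrow> adapted k (\<lambda>\<omega>. avg.lyap_grad (mu k) (ub k \<omega>))"
proof -
  assume k: "k \<le> K"
  obtain L where L: "\<forall>v w. norm (avg.lyap_grad (mu k) v - avg.lyap_grad (mu k) w) \<le> L * norm (v - w)"
    using lyap_grad_lipschitz by blast
  show ?thesis
    by (rule adapted_lipschitz[where X = "ub k" and q = "avg.lyap_grad (mu k)" and L = L])
      (use L adapted_ub[OF k] in auto)
qed

lemma sq_lyap_grad: "k \<le> K \<Longrightarrow> sq_integrable M (\<lambda>\<omega>. avg.lyap_grad (mu k) (ub k \<omega>))"
  by (rule adapted_sq[OF adapted_lyap_grad])

lemma integrable_progress: "k \<le> K \<Longrightarrow> integrable M (\<lambda>\<omega>. avg.progress (mu k) (ub k \<omega>))"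
proof -
  assume k: "k \<le> K"
  have "sq_integrable M (\<lambda>\<omega>. avg.gradPsi (mu k) (fst (ub k \<omega>)))"
    by (rule smp.sq_integrable_lipschitz[where g = "avg.gradPsi (mu k)" and X = "\<lambda>\<omega>. fst (ub k \<omega>)"])
      (rule sq_integrable_fst[OF sq_ub[OF k]], rule gradPsi_lipschitz)
  moreover have "sq_integrable M (\<lambda>\<omega>. avg.residual (ub k \<omega>))"
    by (rule smp.sq_integrable_lipschitz[where g = avg.residual and X = "ub k"])
      (rule sq_ub[OF k], rule residual_lipschitz)
  ultimately show ?thesis unfolding avg.progress_def sq_integrable_def by auto
qed

lemma lyap_measurable: "avg.lyap \<mu> \<in> borel_measurable borel"
proof -
  have F: "continuous_on UNIV F" and G: "continuous_on UNIV G" and V: "continuous_on UNIV (moreau_env \<gamma> G)"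
    by (intro continuous_at_imp_continuous_on ballI,
        rule has_derivative_continuous[OF smoothness_has_derivative[OF smooth_F]]
          has_derivative_continuous[OF smoothness_has_derivative[OF smooth_G]]
          has_derivative_continuous[OF avg.moreau_env_has_derivative])+
  show ?thesis
    unfolding avg.lyap_def[abs_def] Psi_def prox_objective_def
    using \<gamma>_pos by (intro borel_measurable_continuous_onI continuous_intros
        continuous_on_compose2[OF F] continuous_on_compose2[OF G] continuous_on_compose2[OF V]) auto
qed

text \<open>
  Bounded below by \<open>lyap_ge\<close> and above by the quadratic upper bound at the origin.
\<close>

lemma integrable_lyap:
  assumes k: "k \<le> K" and m: "0 \<le> m" "m \<le> \<mu>0"
  shows "integrable M (\<lambda>\<omega>. avg.lyap m (ub k \<omega>))"
proof (rule Bochner_Integration.integrable_bound)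
  define a where "a = norm (avg.lyap_grad m 0)"
  define C where "C = \<mu>0 * L1 + 18 / \<gamma>"
  let ?B = "\<lambda>\<omega>. \<bar>m * Flow\<bar> + \<bar>avg.lyap m 0\<bar> + a * (1 + (norm (ub k \<omega>))\<^sup>2) + C * (norm (ub k \<omega>))\<^sup>2"
  have C: "0 \<le> C" using \<mu>0_pos \<gamma>_pos L1_nonneg by (simp add: C_def)
  show "integrable M ?B"
    using sq_integrable_integrable[OF sq_ub[OF k]] by (intro Bochner_Integration.integrable_add integrable_mult_right) auto
  show "(\<lambda>\<omega>. avg.lyap m (ub k \<omega>)) \<in> borel_measurable M"
    by (rule measurable_compose[OF sq_integrable_measurable[OF sq_ub[OF k]] lyap_measurable])
  show "AE \<omega> in M. norm (avg.lyap m (ub k \<omega>)) \<le> norm (?B \<omega>)"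
  proof (rule AE_I2)
    fix \<omega>
    let ?v = "ub k \<omega>"
    have lo: "m * Flow \<le> avg.lyap m ?v" by (rule avg.lyap_ge[OF m(1)])
    have "avg.lyap m ?v \<le> avg.lyap m 0 + inner (?v - 0) (avg.lyap_grad m 0) + C * (norm (?v - 0))\<^sup>2"
      unfolding C_def by (rule avg.lyap_descent[OF m])
    moreover have "inner ?v (avg.lyap_grad m 0) \<le> norm ?v * a"
      unfolding a_def by (rule norm_cauchy_schwarz)
    moreover have "norm ?v * a \<le> (1 + (norm ?v)\<^sup>2) * a"
    proof (rule mult_right_mono)
      have "0 \<le> (norm ?v - 1)\<^sup>2" by simp
      moreover have "(norm ?v - 1)\<^sup>2 = (norm ?v)\<^sup>2 - 2 * norm ?v + 1" by (simp add: power2_diff)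
      ultimately show "norm ?v \<le> 1 + (norm ?v)\<^sup>2" using norm_ge_zero[of ?v] zero_le_power2[of "norm ?v"] by linarith
    qed (simp add: a_def)
    moreover have "0 \<le> a * (1 + (norm ?v)\<^sup>2)" "0 \<le> C * (norm ?v)\<^sup>2" using C by (auto simp: a_def)
    ultimately show "norm (avg.lyap m ?v) \<le> norm (?B \<omega>)" using lo by (simp add: mult.commute)
  qed
qed

lemma nonneg_means: "0 \<le> mean_spread k" "0 \<le> mean_tracker_spread k" "0 \<le> mean_step k"
    "0 \<le> mean_local_grad k" "0 \<le> mean_progress k"
  unfolding mean_spread_def mean_tracker_spread_def mean_step_def mean_local_grad_def mean_progress_def
  by (auto intro!: Bochner_Integration.integral_nonneg simp: spread_nonneg mean_sq_nonneg avg.progress_nonneg)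

lemma mean_lyap_nonneg: "0 \<le> mean_lyap k"
  unfolding mean_lyap_def
  using avg.lyap_ge[of "mu k"] mu_pos[of k] by (intro Bochner_Integration.integral_nonneg) auto

lemma spread_recursion:
  assumes k: "k < K"
  shows "mean_spread (Suc k) \<le> \<rho> * mean_spread k + lam\<^sup>2 / (1 - \<rho>) * mean_tracker_spread k"
proof -
  have i: "integrable M (\<lambda>\<omega>. spread n (\<lambda>i. u k i \<omega>))" "integrable M (\<lambda>\<omega>. spread n (\<lambda>i. D k i \<omega>))"
    "integrable M (\<lambda>\<omega>. spread n (\<lambda>i. u (Suc k) i \<omega>))"
    using k by (auto intro!: integrable_spread sq_u sq_D)
  have "mean_spread (Suc k) \<le> (\<integral>\<omega>. \<rho> * spread n (\<lambda>i. u k i \<omega>) + lam\<^sup>2 / (1 - \<rho>) * spread n (\<lambda>i. D k i \<omega>) \<partial>M)"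
    unfolding mean_spread_def
    by (rule integral_mono) (use i spread_iterate[OF nt path k] in auto)
  also have "\<dots> = \<rho> * mean_spread k + lam\<^sup>2 / (1 - \<rho>) * mean_tracker_spread k"
    using i unfolding mean_spread_def mean_tracker_spread_def by simp
  finally show ?thesis .
qed

lemma H_split: "H k i \<omega> = h k i (u k i \<omega>) + noise k i \<omega>"
  unfolding noise_def by simp

lemma h_drift: "norm (h (Suc k) i v - h k i v) \<le> mu_drop k * norm (gradient (f i) (fst v))"
proof -
  have "h (Suc k) i v - h k i v = (- (c * mu_drop k) *\<^sub>R gradient (f i) (fst v), 0)"
    unfolding h_def joint_dir_def mu_drop_def by (simp add: algebra_simps)
  hence "norm (h (Suc k) i v - h k i v) = c * (mu_drop k * norm (gradient (f i) (fst v)))"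
    using c_pos mu_drop_nonneg[of k] by (simp add: norm_Pair abs_mult)
  also have "\<dots> \<le> mu_drop k * norm (gradient (f i) (fst v))"
    using c_pos c_le mu_drop_nonneg by (intro mult_left_le_one_le) auto
  finally show ?thesis .
qed

text \<open>
  The sampled direction changes because the state moves, because the penalty parameter decreases,
  and because of two independent sampling errors.  The errors are not averaged over the agents here,
  so their full variance remains.
\<close>

lemma direction_change:
  assumes k: "Suc k < K"
  shows "(\<integral>\<omega>. mean_sq n (\<lambda>i. H (Suc k) i \<omega> - H k i \<omega>) \<partial>M)
    \<le> (12 * Lh\<^sup>2 + 8) * (mean_spread (Suc k) + mean_spread k + lam\<^sup>2 * mean_step k
         + (mu_drop k)\<^sup>2 * mean_local_grad k + s2)"
proof -
  have k': "k < K" using k by simp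
  let ?st = "\<lambda>\<omega>. mean_sq n (\<lambda>i. u (Suc k) i \<omega> - u k i \<omega>)"
    and ?gr = "\<lambda>\<omega>. mean_sq n (\<lambda>i. gradient (f i) (fst (u k i \<omega>)))"
    and ?n1 = "\<lambda>\<omega>. mean_sq n (\<lambda>i. noise (Suc k) i \<omega>)" and ?n0 = "\<lambda>\<omega>. mean_sq n (\<lambda>i. noise k i \<omega>)"
  have ist: "integrable M ?st" and igr: "integrable M ?gr" and in1: "integrable M ?n1" and in0: "integrable M ?n0"
    and iH: "integrable M (\<lambda>\<omega>. mean_sq n (\<lambda>i. H (Suc k) i \<omega> - H k i \<omega>))"
    using k k' by (auto intro!: integrable_mean_sq sq_integrable_diff sq_u sq_H sq_grad noise_at(1))
  have pw: "mean_sq n (\<lambda>i. H (Suc k) i \<omega> - H k i \<omega>)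
      \<le> 4 * Lh\<^sup>2 * ?st \<omega> + 4 * (mu_drop k)\<^sup>2 * ?gr \<omega> + 4 * ?n1 \<omega> + 4 * ?n0 \<omega>" for \<omega>
  proof -
    have "mean_sq n (\<lambda>i. H (Suc k) i \<omega> - H k i \<omega>) \<le> average n (\<lambda>i. 4 * Lh\<^sup>2 * (norm (u (Suc k) i \<omega> - u k i \<omega>))\<^sup>2
       + 4 * (mu_drop k)\<^sup>2 * (norm (gradient (f i) (fst (u k i \<omega>))))\<^sup>2 + 4 * (norm (noise (Suc k) i \<omega>))\<^sup>2 + 4 * (norm (noise k i \<omega>))\<^sup>2)"
      unfolding mean_sq_def
    proof (rule average_real_mono)
      fix i assume i: "i < n"
      let ?a = "h (Suc k) i (u (Suc k) i \<omega>) - h (Suc k) i (u k i \<omega>)" and ?b = "h (Suc k) i (u k i \<omega>) - h k i (u k i \<omega>)"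
      have "H (Suc k) i \<omega> - H k i \<omega> = (?a + ?b) + (noise (Suc k) i \<omega> - noise k i \<omega>)"
        unfolding H_split by simp
      hence "(norm (H (Suc k) i \<omega> - H k i \<omega>))\<^sup>2 \<le> 2 * (norm (?a + ?b))\<^sup>2 + 2 * (norm (noise (Suc k) i \<omega> - noise k i \<omega>))\<^sup>2"
        by (simp only: power2_sum_le)
      moreover have "(norm (?a + ?b))\<^sup>2 \<le> 2 * (norm ?a)\<^sup>2 + 2 * (norm ?b)\<^sup>2" by (rule power2_sum_le)
      moreover have "(norm (noise (Suc k) i \<omega> - noise k i \<omega>))\<^sup>2 \<le> 2 * (norm (noise (Suc k) i \<omega>))\<^sup>2 + 2 * (norm (noise k i \<omega>))\<^sup>2"
        by (rule power2_diff_le)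
      moreover have "(norm ?a)\<^sup>2 \<le> Lh\<^sup>2 * (norm (u (Suc k) i \<omega> - u k i \<omega>))\<^sup>2"
        using power_mono[OF h_lipschitz[OF i], of _ _ _ 2] by (simp add: power_mult_distrib)
      moreover have "(norm ?b)\<^sup>2 \<le> (mu_drop k)\<^sup>2 * (norm (gradient (f i) (fst (u k i \<omega>))))\<^sup>2"
        using power_mono[OF h_drift, of _ _ _ 2] by (simp add: power_mult_distrib)
      ultimately show "(norm (H (Suc k) i \<omega> - H k i \<omega>))\<^sup>2 \<le> 4 * Lh\<^sup>2 * (norm (u (Suc k) i \<omega> - u k i \<omega>))\<^sup>2
       + 4 * (mu_drop k)\<^sup>2 * (norm (gradient (f i) (fst (u k i \<omega>))))\<^sup>2 + 4 * (norm (noise (Suc k) i \<omega>))\<^sup>2 + 4 * (norm (noise k i \<omega>))\<^sup>2"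
        by linarith
    qed
    thus ?thesis unfolding average_add[symmetric] average_real_mult mean_sq_def .
  qed
  have "(\<integral>\<omega>. mean_sq n (\<lambda>i. H (Suc k) i \<omega> - H k i \<omega>) \<partial>M)
     \<le> (\<integral>\<omega>. 4 * Lh\<^sup>2 * ?st \<omega> + 4 * (mu_drop k)\<^sup>2 * ?gr \<omega> + 4 * ?n1 \<omega> + 4 * ?n0 \<omega> \<partial>M)"
    by (rule integral_mono) (use ist igr in1 in0 iH pw in auto)
  also have "\<dots> = 4 * Lh\<^sup>2 * (\<integral>\<omega>. ?st \<omega> \<partial>M) + 4 * (mu_drop k)\<^sup>2 * mean_local_grad k
      + 4 * (\<integral>\<omega>. ?n1 \<omega> \<partial>M) + 4 * (\<integral>\<omega>. ?n0 \<omega> \<partial>M)"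
    using ist igr in1 in0 unfolding mean_local_grad_def by simp
  also have "(\<integral>\<omega>. ?st \<omega> \<partial>M) \<le> 3 * mean_spread (Suc k) + 3 * mean_spread k + 3 * lam\<^sup>2 * mean_step k"
  proof -
    have iu: "integrable M (\<lambda>\<omega>. spread n (\<lambda>i. u k i \<omega>))" "integrable M (\<lambda>\<omega>. spread n (\<lambda>i. u (Suc k) i \<omega>))"
      and iQ: "integrable M (\<lambda>\<omega>. (norm (Hb k \<omega>))\<^sup>2)"
      using k' by (auto intro!: integrable_spread sq_u sq_integrable_integrable sq_Hb)
    have "(\<integral>\<omega>. ?st \<omega> \<partial>M) \<le> (\<integral>\<omega>. 3 * spread n (\<lambda>i. u (Suc k) i \<omega>) + 3 * spread n (\<lambda>i. u k i \<omega>) + 3 * lam\<^sup>2 * (norm (Hb k \<omega>))\<^sup>2 \<partial>M)"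
      by (rule integral_mono) (use ist iu iQ mean_sq_step_le[OF nt path k'] in \<open>auto simp: Hb_def\<close>)
    thus ?thesis using iu iQ unfolding mean_spread_def mean_step_def by simp
  qed
  also have "(\<integral>\<omega>. ?n1 \<omega> \<partial>M) \<le> s2"
  proof -
    have "(\<integral>\<omega>. ?n1 \<omega> \<partial>M) = average n (\<lambda>i. \<integral>\<omega>. (norm (noise (Suc k) i \<omega>))\<^sup>2 \<partial>M)"
      by (rule integrable_mean_sq(2)) (rule noise_at(1)[OF k])
    also have "\<dots> \<le> average n (\<lambda>_. s2)" by (rule average_real_mono) (rule noise_at(2)[OF k])
    finally show ?thesis by (simp add: average_const[OF n_pos])
  qed
  also have "(\<integral>\<omega>. ?n0 \<omega> \<partial>M) \<le> s2"
  proof -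
    have "(\<integral>\<omega>. ?n0 \<omega> \<partial>M) = average n (\<lambda>i. \<integral>\<omega>. (norm (noise k i \<omega>))\<^sup>2 \<partial>M)"
      by (rule integrable_mean_sq(2)) (rule noise_at(1)[OF k'])
    also have "\<dots> \<le> average n (\<lambda>_. s2)" by (rule average_real_mono) (rule noise_at(2)[OF k'])
    finally show ?thesis by (simp add: average_const[OF n_pos])
  qed
  finally have fin: "(\<integral>\<omega>. mean_sq n (\<lambda>i. H (Suc k) i \<omega> - H k i \<omega>) \<partial>M)
    \<le> 4 * Lh\<^sup>2 * (3 * mean_spread (Suc k) + 3 * mean_spread k + 3 * lam\<^sup>2 * mean_step k)
      + 4 * (mu_drop k)\<^sup>2 * mean_local_grad k + 4 * s2 + 4 * s2"
    by (simp add: mult_left_mono)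
  define P where "P = mean_spread (Suc k) + mean_spread k + lam\<^sup>2 * mean_step k"
  define Y where "Y = (mu_drop k)\<^sup>2 * mean_local_grad k"
  have nn: "0 \<le> P" "0 \<le> Y" using nonneg_means unfolding P_def Y_def by auto
  have "4 * Lh\<^sup>2 * (3 * mean_spread (Suc k) + 3 * mean_spread k + 3 * lam\<^sup>2 * mean_step k) = (12 * Lh\<^sup>2) * P"
    unfolding P_def by (simp add: algebra_simps)
  moreover have "(12 * Lh\<^sup>2) * (P + Y + s2) = (12 * Lh\<^sup>2) * P + (12 * Lh\<^sup>2) * (Y + s2)" by (simp add: algebra_simps)
  moreover have "0 \<le> (12 * Lh\<^sup>2) * (Y + s2)" using nn s2_nonneg by simp
  moreover have "(12 * Lh\<^sup>2 + 8) * (P + Y + s2) = (12 * Lh\<^sup>2) * (P + Y + s2) + 8 * P + 8 * Y + 8 * s2"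
    by (simp add: algebra_simps)
  ultimately show ?thesis using fin nn unfolding P_def[symmetric] Y_def[symmetric] mult.assoc[of 4 "(mu_drop k)\<^sup>2"]
    by linarith
qed

lemma tracker_recursion:
  assumes k: "Suc k < K"
  shows "mean_tracker_spread (Suc k) \<le> \<rho> * mean_tracker_spread k
    + 1 / (1 - \<rho>) * ((12 * Lh\<^sup>2 + 8) * (mean_spread (Suc k) + mean_spread k + lam\<^sup>2 * mean_step k
         + (mu_drop k)\<^sup>2 * mean_local_grad k + s2))"
proof -
  have k': "k < K" using k by simp
  have iD: "integrable M (\<lambda>\<omega>. spread n (\<lambda>i. D k i \<omega>))" "integrable M (\<lambda>\<omega>. spread n (\<lambda>i. D (Suc k) i \<omega>))"
    and iH: "integrable M (\<lambda>\<omega>. mean_sq n (\<lambda>i. H (Suc k) i \<omega> - H k i \<omega>))"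
    using k k' by (auto intro!: integrable_spread sq_D integrable_mean_sq sq_integrable_diff sq_H)
  have "mean_tracker_spread (Suc k) \<le> (\<integral>\<omega>. \<rho> * spread n (\<lambda>i. D k i \<omega>)
      + 1 / (1 - \<rho>) * mean_sq n (\<lambda>i. H (Suc k) i \<omega> - H k i \<omega>) \<partial>M)"
    unfolding mean_tracker_spread_def
    by (rule integral_mono) (use iD iH spread_tracker[OF nt path k] in auto)
  also have "\<dots> = \<rho> * mean_tracker_spread k + 1 / (1 - \<rho>) * (\<integral>\<omega>. mean_sq n (\<lambda>i. H (Suc k) i \<omega> - H k i \<omega>) \<partial>M)"
    using iD iH unfolding mean_tracker_spread_def by simp
  also have "\<dots> \<le> \<rho> * mean_tracker_spread k + 1 / (1 - \<rho>) * ((12 * Lh\<^sup>2 + 8) * (mean_spread (Suc k) + mean_spread k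
      + lam\<^sup>2 * mean_step k + (mu_drop k)\<^sup>2 * mean_local_grad k + s2))"
    using network_topology_rho[OF nt] by (intro add_left_mono mult_left_mono direction_change[OF k]) auto
  finally show ?thesis .
qed

lemma h_at_average: "average n (\<lambda>i. h k i v) = joint_dir \<gamma> c (mu k) F G v"
  unfolding h_def F_def G_def by (rule average_joint_dir[OF smooth n_pos])

lemma local_direction_error:
  "(norm (average n (\<lambda>i. h k i (u k i \<omega>) - h k i (ub k \<omega>))))\<^sup>2 \<le> Lh\<^sup>2 * spread n (\<lambda>i. u k i \<omega>)"
proof -
  have "(norm (average n (\<lambda>i. h k i (u k i \<omega>) - h k i (ub k \<omega>))))\<^sup>2
      \<le> mean_sq n (\<lambda>i. h k i (u k i \<omega>) - h k i (ub k \<omega>))"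
    by (rule norm_average_le_mean_sq)
  also have "\<dots> \<le> mean_sq n (\<lambda>i. Lh *\<^sub>R (u k i \<omega> - ub k \<omega>))"
    by (rule mean_sq_mono) (use h_lipschitz Lh_nonneg in auto)
  also have "\<dots> = Lh\<^sup>2 * spread n (\<lambda>i. u k i \<omega>)"
    unfolding mean_sq_scaleR spread_def ub_def ..
  finally show ?thesis .
qed

lemma Hb_split: "Hb k \<omega> = joint_dir \<gamma> c (mu k) F G (ub k \<omega>)
    + average n (\<lambda>i. h k i (u k i \<omega>) - h k i (ub k \<omega>)) + average n (\<lambda>i. noise k i \<omega>)"
  unfolding Hb_def H_split h_at_average[symmetric] by (simp add: average_add)

lemma step_bound:
  assumes k: "k < K"
  shows "mean_step k \<le> (88 + 4 * Lh\<^sup>2 + 2) * (mean_progress k + mean_spread k + s2 / real n)"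
proof -
  have k': "k \<le> K" using k by simp
  let ?nb = "\<lambda>\<omega>. (norm (average n (\<lambda>i. noise k i \<omega>)))\<^sup>2"
  have ip: "integrable M (\<lambda>\<omega>. avg.progress (mu k) (ub k \<omega>))" by (rule integrable_progress[OF k'])
  have isp: "integrable M (\<lambda>\<omega>. spread n (\<lambda>i. u k i \<omega>))" using k' by (auto intro!: integrable_spread sq_u)
  have inb: "integrable M ?nb" by (rule sq_integrable_integrable[OF sq_integrable_average[OF noise_at(1)[OF k]]])
  have iQ: "integrable M (\<lambda>\<omega>. (norm (Hb k \<omega>))\<^sup>2)" by (rule sq_integrable_integrable[OF sq_Hb[OF k]])
  have pw: "(norm (Hb k \<omega>))\<^sup>2 \<le> 88 * avg.progress (mu k) (ub k \<omega>) + 4 * Lh\<^sup>2 * spread n (\<lambda>i. u k i \<omega>) + 2 * ?nb \<omega>" for \<omega>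
  proof -
    let ?a = "joint_dir \<gamma> c (mu k) F G (ub k \<omega>)" and ?b = "average n (\<lambda>i. h k i (u k i \<omega>) - h k i (ub k \<omega>))"
    have "(norm (Hb k \<omega>))\<^sup>2 \<le> 2 * (norm (?a + ?b))\<^sup>2 + 2 * ?nb \<omega>"
      unfolding Hb_split by (rule power2_sum_le)
    moreover have "(norm (?a + ?b))\<^sup>2 \<le> 2 * (norm ?a)\<^sup>2 + 2 * (norm ?b)\<^sup>2" by (rule power2_sum_le)
    moreover have "(norm ?a)\<^sup>2 \<le> 22 * avg.progress (mu k) (ub k \<omega>)" by (rule avg.norm_joint_dir_le)
    moreover have "(norm ?b)\<^sup>2 \<le> Lh\<^sup>2 * spread n (\<lambda>i. u k i \<omega>)" by (rule local_direction_error)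
    moreover have "0 \<le> avg.progress (mu k) (ub k \<omega>)" by (rule avg.progress_nonneg)
    ultimately show ?thesis by linarith
  qed
  have "mean_step k \<le> (\<integral>\<omega>. 88 * avg.progress (mu k) (ub k \<omega>) + 4 * Lh\<^sup>2 * spread n (\<lambda>i. u k i \<omega>) + 2 * ?nb \<omega> \<partial>M)"
    unfolding mean_step_def by (rule integral_mono) (use ip isp inb iQ pw in auto)
  also have "\<dots> = 88 * mean_progress k + 4 * Lh\<^sup>2 * mean_spread k + 2 * (\<integral>\<omega>. ?nb \<omega> \<partial>M)"
    using ip isp inb unfolding mean_progress_def mean_spread_def by simp
  also have "\<dots> \<le> 88 * mean_progress k + 4 * Lh\<^sup>2 * mean_spread k + 2 * (s2 / real n)"
    using average_noise[OF k] by simp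
  also have "\<dots> \<le> (88 + 4 * Lh\<^sup>2 + 2) * mean_progress k + (88 + 4 * Lh\<^sup>2 + 2) * mean_spread k + (88 + 4 * Lh\<^sup>2 + 2) * (s2 / real n)"
    using nonneg_means s2_nonneg by (intro add_mono mult_right_mono) auto
  finally show ?thesis by (simp only: distrib_left)
qed

lemma mean_drift:
  assumes k: "k < K"
  shows "integrable M (\<lambda>\<omega>. (norm (ub k \<omega> - ub 0 \<omega>))\<^sup>2)"
    and "(\<integral>\<omega>. (norm (ub k \<omega> - ub 0 \<omega>))\<^sup>2 \<partial>M) \<le> real k * lam\<^sup>2 * (\<Sum>j<k. mean_step j)"
proof -
  show i: "integrable M (\<lambda>\<omega>. (norm (ub k \<omega> - ub 0 \<omega>))\<^sup>2)"
    using k by (intro sq_integrable_integrable sq_integrable_diff sq_ub) auto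
  have iQ: "integrable M (\<lambda>\<omega>. (norm (Hb j \<omega>))\<^sup>2)" if "j < k" for j
    using that k by (intro sq_integrable_integrable sq_Hb) auto
  have "(\<integral>\<omega>. (norm (ub k \<omega> - ub 0 \<omega>))\<^sup>2 \<partial>M) \<le> (\<integral>\<omega>. real k * lam\<^sup>2 * (\<Sum>j<k. (norm (Hb j \<omega>))\<^sup>2) \<partial>M)"
    by (rule integral_mono) (use i iQ k drift_le[OF nt path, of _ k] in \<open>auto simp: ub_def Hb_def\<close>)
  also have "\<dots> = real k * lam\<^sup>2 * (\<Sum>j<k. mean_step j)"
    using iQ unfolding mean_step_def by (simp add: Bochner_Integration.integral_sum)
  finally show "(\<integral>\<omega>. (norm (ub k \<omega> - ub 0 \<omega>))\<^sup>2 \<partial>M) \<le> real k * lam\<^sup>2 * (\<Sum>j<k. mean_step j)" .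
qed

text \<open>
  The mean direction yields the progress, the deviation of the agents from their mean costs half of
  it by Young's inequality, and the averaged sampling error has no first-order effect because it is
  orthogonal to the past.
\<close>

lemma lyap_recursion:
  assumes k: "k < K"
  shows "mean_lyap (Suc k) \<le> mean_lyap k - lam / 2 * mean_progress k
     + ((2 / c + 22) * Lh\<^sup>2) * lam * mean_spread k + (\<mu>0 * L1 + 18 / \<gamma>) * lam\<^sup>2 * mean_step k"
proof -
  have k': "k \<le> K" "Suc k \<le> K" using k by auto
  define Kl where "Kl = 2 / c + 22"
  have Kl: "0 < Kl" using c_pos by (simp add: Kl_def add_pos_pos)
  define C where "C = \<mu>0 * L1 + 18 / \<gamma>"
  let ?nb = "\<lambda>\<omega>. average n (\<lambda>i. noise k i \<omega>)" and ?lg = "\<lambda>\<omega>. avg.lyap_grad (mu k) (ub k \<omega>)"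
  have ip: "integrable M (\<lambda>\<omega>. avg.progress (mu k) (ub k \<omega>))" by (rule integrable_progress[OF k'(1)])
  have isp: "integrable M (\<lambda>\<omega>. spread n (\<lambda>i. u k i \<omega>))" using k' by (auto intro!: integrable_spread sq_u)
  have iQ: "integrable M (\<lambda>\<omega>. (norm (Hb k \<omega>))\<^sup>2)" by (rule sq_integrable_integrable[OF sq_Hb[OF k]])
  have iI: "integrable M (\<lambda>\<omega>. inner (?lg \<omega>) (?nb \<omega>))"
    by (rule sq_integrable_inner[OF sq_lyap_grad[OF k'(1)] sq_integrable_average[OF noise_at(1)[OF k]]])
  have iL: "integrable M (\<lambda>\<omega>. avg.lyap (mu k) (ub k \<omega>))" "integrable M (\<lambda>\<omega>. avg.lyap (mu (Suc k)) (ub (Suc k) \<omega>))"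
    by (intro integrable_lyap k' mu_le less_imp_le[OF mu_pos])+
  have iL': "integrable M (\<lambda>\<omega>. avg.lyap (mu k) (ub k \<omega>) - mu k * Flow)"
    "integrable M (\<lambda>\<omega>. avg.lyap (mu (Suc k)) (ub (Suc k) \<omega>) - mu (Suc k) * Flow)"
    using iL by auto
  have pw: "avg.lyap (mu (Suc k)) (ub (Suc k) \<omega>) - mu (Suc k) * Flow
     \<le> (avg.lyap (mu k) (ub k \<omega>) - mu k * Flow) - lam / 2 * avg.progress (mu k) (ub k \<omega>)
       + (Kl * Lh\<^sup>2) * lam * spread n (\<lambda>i. u k i \<omega>) + C * lam\<^sup>2 * (norm (Hb k \<omega>))\<^sup>2 - lam * inner (?lg \<omega>) (?nb \<omega>)"
    if \<omega>: "\<omega> \<in> space M" for \<omega>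
  proof -
    let ?v = "ub k \<omega>" and ?v' = "ub (Suc k) \<omega>"
    let ?d = "average n (\<lambda>i. h k i (u k i \<omega>) - h k i ?v)"
    let ?p = "avg.progress (mu k) ?v" and ?s = "spread n (\<lambda>i. u k i \<omega>)"
    have st: "?v' - ?v = - (lam *\<^sub>R Hb k \<omega>)"
      unfolding ub_def Hb_def using average_iterate[OF nt path[OF \<omega>] k] by simp
    have "avg.lyap (mu (Suc k)) ?v' - mu (Suc k) * Flow \<le> avg.lyap (mu k) ?v' - mu k * Flow"
      by (rule avg.lyap_mono[OF mu_Suc_le])
    also have "avg.lyap (mu k) ?v' \<le> avg.lyap (mu k) ?v + inner (?v' - ?v) (?lg \<omega>) + C * (norm (?v' - ?v))\<^sup>2"
      unfolding C_def using mu_pos[of k] mu_le[of k] by (intro avg.lyap_descent) auto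
    finally have 1: "avg.lyap (mu (Suc k)) ?v' - mu (Suc k) * Flow
      \<le> avg.lyap (mu k) ?v - mu k * Flow - lam * inner (?lg \<omega>) (Hb k \<omega>) + C * lam\<^sup>2 * (norm (Hb k \<omega>))\<^sup>2"
      unfolding st by (simp add: inner_commute power_mult_distrib)
    have "inner (?lg \<omega>) (Hb k \<omega>) = inner (?lg \<omega>) (joint_dir \<gamma> c (mu k) F G ?v) + inner (?lg \<omega>) ?d + inner (?lg \<omega>) (?nb \<omega>)"
      unfolding Hb_split by (simp add: inner_add_right)
    moreover have "?p \<le> inner (?lg \<omega>) (joint_dir \<gamma> c (mu k) F G ?v)" by (rule avg.inner_lyap_grad_joint_dir)
    moreover have "- (?p / 2 + Kl * Lh\<^sup>2 * ?s) \<le> inner (?lg \<omega>) ?d"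
    proof -
      let ?x = "norm (?lg \<omega>)" and ?y = "norm ?d"
      have "\<bar>inner (?lg \<omega>) ?d\<bar> \<le> ?x * ?y" by (rule Cauchy_Schwarz_ineq2)
      moreover have "2 * (?x * ?y) \<le> ?x\<^sup>2 / Kl + Kl * ?y\<^sup>2"
      proof -
        have "0 \<le> (?x - Kl * ?y)\<^sup>2 / Kl" using Kl by simp
        also have "\<dots> = ?x\<^sup>2 / Kl + Kl * ?y\<^sup>2 - 2 * (?x * ?y)" using Kl by (simp add: power2_eq_square field_simps)
        finally show ?thesis by simp
      qed
      moreover have "?x\<^sup>2 / Kl \<le> ?p"
        using avg.norm_lyap_grad_le[of "mu k" ?v] Kl unfolding Kl_def[symmetric] by (simp add: divide_le_eq mult.commute)
      moreover have "Kl * ?y\<^sup>2 \<le> Kl * (Lh\<^sup>2 * ?s)"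
        using local_direction_error[of k \<omega>] Kl by (intro mult_left_mono) auto
      moreover have "0 \<le> Kl * (Lh\<^sup>2 * ?s)" using Kl spread_nonneg[of n "\<lambda>i. u k i \<omega>"] by simp
      ultimately show ?thesis by (simp add: abs_le_iff mult.assoc)
    qed
    ultimately have "?p / 2 - Kl * Lh\<^sup>2 * ?s + inner (?lg \<omega>) (?nb \<omega>) \<le> inner (?lg \<omega>) (Hb k \<omega>)" by linarith
    from mult_left_mono[OF this, of lam]
    have "lam / 2 * ?p - (Kl * Lh\<^sup>2) * lam * ?s + lam * inner (?lg \<omega>) (?nb \<omega>) \<le> lam * inner (?lg \<omega>) (Hb k \<omega>)"
      using lam_pos by (simp add: algebra_simps)
    thus ?thesis using 1 by linarith
  qed
  have "mean_lyap (Suc k) \<le> (\<integral>\<omega>. (avg.lyap (mu k) (ub k \<omega>) - mu k * Flow) - lam / 2 * avg.progress (mu k) (ub k \<omega>)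
       + (Kl * Lh\<^sup>2) * lam * spread n (\<lambda>i. u k i \<omega>) + C * lam\<^sup>2 * (norm (Hb k \<omega>))\<^sup>2 - lam * inner (?lg \<omega>) (?nb \<omega>) \<partial>M)"
    unfolding mean_lyap_def
    by (rule integral_mono[OF iL'(2) _ pw])
      (intro Bochner_Integration.integrable_add Bochner_Integration.integrable_diff integrable_mult_right iL'(1) ip isp iQ iI)
  also have "\<dots> = mean_lyap k - lam / 2 * mean_progress k + (Kl * Lh\<^sup>2) * lam * mean_spread k + C * lam\<^sup>2 * mean_step k
      - lam * (\<integral>\<omega>. inner (?lg \<omega>) (?nb \<omega>) \<partial>M)"
    unfolding mean_lyap_def mean_progress_def mean_spread_def mean_step_def
    using iL'(1) ip isp iQ iI
    by (simp only: Bochner_Integration.integral_add Bochner_Integration.integral_diff integral_mult_right_zero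
        integrable_mult_right Bochner_Integration.integrable_add Bochner_Integration.integrable_diff)
  also have "(\<integral>\<omega>. inner (?lg \<omega>) (?nb \<omega>) \<partial>M) = 0"
    by (rule average_noise_orthogonal[OF k adapted_lyap_grad[OF k'(1)]])
  finally show ?thesis by (simp add: Kl_def C_def)
qed

end

section \<open>The starting point\<close>

context sun_dsbo_run
begin

definition r0 :: real where "r0 = initial_error n \<gamma> \<mu>0 Flow f g x0 y0 \<theta>0"

context
  fixes \<omega> assumes \<omega>: "\<omega> \<in> space M"
begin

lemma ub_0: "ub 0 \<omega> = ((average n x0, average n y0), average n \<theta>0)"
proof -
  have "ub 0 \<omega> = average n (\<lambda>i. ((x0 i, y0 i), \<theta>0 i))"
    unfolding ub_def by (rule average_cong) (rule u_0[OF \<omega>])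
  thus ?thesis by (simp add: average_Pair)
qed

lemma r0_eq:
  "r0 = (Psi \<gamma> F G \<mu>0 (fst (ub 0 \<omega>)) - \<mu>0 * Flow)
     + (norm (snd (ub 0 \<omega>) - prox_point \<gamma> G (fst (ub 0 \<omega>))))\<^sup>2
     + spread n (\<lambda>i. u 0 i \<omega>)
     + (mean_sq n (\<lambda>i. gradient (f i) (fst (u 0 i \<omega>))) + mean_sq n (\<lambda>i. gradient (g i) (fst (u 0 i \<omega>))))"
proof -
  have s: "spread n (\<lambda>i. u 0 i \<omega>) = average n (consensus_gap n x0 y0 \<theta>0)"
  proof -
    have "spread n (\<lambda>i. u 0 i \<omega>) = spread n (\<lambda>i. ((x0 i, y0 i), \<theta>0 i))"
      by (rule spread_cong) (rule u_0[OF \<omega>])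
    thus ?thesis unfolding spread_def mean_sq_def consensus_gap_eq[abs_def] by simp
  qed
  have gr: "average n (\<lambda>i. (norm (gradient (f i) (x0 i, y0 i)))\<^sup>2 + (norm (gradient (g i) (x0 i, y0 i)))\<^sup>2)
    = mean_sq n (\<lambda>i. gradient (f i) (fst (u 0 i \<omega>))) + mean_sq n (\<lambda>i. gradient (g i) (fst (u 0 i \<omega>)))"
    unfolding mean_sq_def average_add by (rule average_cong) (simp add: u_0[OF \<omega>])
  show ?thesis
    unfolding r0_def initial_error_def Let_def gr s ub_0 F_def[symmetric] G_def[symmetric] by simp
qed

lemma Psi_start_nonneg: "0 \<le> Psi \<gamma> F G \<mu>0 (fst (ub 0 \<omega>)) - \<mu>0 * Flow"
proof -
  have "\<mu>0 * Flow \<le> \<mu>0 * F (fst (ub 0 \<omega>))" using \<mu>0_pos avg.F_ge by (intro mult_left_mono) auto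
  thus ?thesis unfolding Psi_def using avg.moreau_env_le_self[of "fst (ub 0 \<omega>)"] by simp
qed

lemma r0_bounds:
  "Psi \<gamma> F G \<mu>0 (fst (ub 0 \<omega>)) - \<mu>0 * Flow \<le> r0"
  "(norm (snd (ub 0 \<omega>) - prox_point \<gamma> G (fst (ub 0 \<omega>))))\<^sup>2 \<le> r0"
  "spread n (\<lambda>i. u 0 i \<omega>) \<le> r0"
  "mean_sq n (\<lambda>i. gradient (f i) (fst (u 0 i \<omega>))) \<le> r0"
  "mean_sq n (\<lambda>i. gradient (g i) (fst (u 0 i \<omega>))) \<le> r0"
  "0 \<le> r0"
proof -
  have "0 \<le> (norm (snd (ub 0 \<omega>) - prox_point \<gamma> G (fst (ub 0 \<omega>))))\<^sup>2" by simp
  note nn = this Psi_start_nonneg spread_nonneg[of n "\<lambda>i. u 0 i \<omega>"]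
    mean_sq_nonneg[of n "\<lambda>i. gradient (f i) (fst (u 0 i \<omega>))"] mean_sq_nonneg[of n "\<lambda>i. gradient (g i) (fst (u 0 i \<omega>))"]
  show "Psi \<gamma> F G \<mu>0 (fst (ub 0 \<omega>)) - \<mu>0 * Flow \<le> r0"
    "(norm (snd (ub 0 \<omega>) - prox_point \<gamma> G (fst (ub 0 \<omega>))))\<^sup>2 \<le> r0"
    "spread n (\<lambda>i. u 0 i \<omega>) \<le> r0"
    "mean_sq n (\<lambda>i. gradient (f i) (fst (u 0 i \<omega>))) \<le> r0"
    "mean_sq n (\<lambda>i. gradient (g i) (fst (u 0 i \<omega>))) \<le> r0"
    "0 \<le> r0"
    using nn r0_eq by linarith+
qed

text \<open>
  \<open>initial_error\<close> contains gradients at the agents' own starting points; moving them to the common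
  mean costs the initial consensus error.
\<close>

lemma average_gradient_start:
  assumes "\<And>i. i < n \<Longrightarrow> smoothness L (q i)"
    and "mean_sq n (\<lambda>i. gradient (q i) (fst (u 0 i \<omega>))) \<le> r0"
  shows "(norm (average n (\<lambda>i. gradient (q i) (fst (ub 0 \<omega>)))))\<^sup>2 \<le> (2 + 2 * L\<^sup>2) * r0"
proof -
  have "(norm (average n (\<lambda>i. gradient (q i) (fst (ub 0 \<omega>)))))\<^sup>2 \<le> mean_sq n (\<lambda>i. gradient (q i) (fst (ub 0 \<omega>)))"
    by (rule norm_average_le_mean_sq)
  also have "\<dots> \<le> average n (\<lambda>i. 2 * (norm (gradient (q i) (fst (u 0 i \<omega>))))\<^sup>2 + 2 * L\<^sup>2 * (norm (u 0 i \<omega> - ub 0 \<omega>))\<^sup>2)"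
    unfolding mean_sq_def
  proof (rule average_real_mono)
    fix i assume i: "i < n"
    let ?a = "gradient (q i) (fst (u 0 i \<omega>))" and ?b = "gradient (q i) (fst (ub 0 \<omega>))"
    have L: "0 \<le> L" using smoothness_nonneg[OF assms(1)[OF i]] .
    have "norm (?a - ?b) \<le> L * norm (fst (u 0 i \<omega>) - fst (ub 0 \<omega>))"
      by (rule smoothness_lipschitz[OF assms(1)[OF i]])
    also have "\<dots> \<le> L * norm (u 0 i \<omega> - ub 0 \<omega>)"
      using norm_fst_le_norm[of "u 0 i \<omega> - ub 0 \<omega>"] L by (intro mult_left_mono) auto
    finally have "(norm (?a - ?b))\<^sup>2 \<le> (L * norm (u 0 i \<omega> - ub 0 \<omega>))\<^sup>2" by (rule power_mono) simp
    moreover have "(norm (?a - (?a - ?b)))\<^sup>2 \<le> 2 * (norm ?a)\<^sup>2 + 2 * (norm (?a - ?b))\<^sup>2" by (rule power2_diff_le)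
    ultimately show "(norm ?b)\<^sup>2 \<le> 2 * (norm ?a)\<^sup>2 + 2 * L\<^sup>2 * (norm (u 0 i \<omega> - ub 0 \<omega>))\<^sup>2"
      by (simp add: power_mult_distrib)
  qed
  also have "\<dots> = 2 * mean_sq n (\<lambda>i. gradient (q i) (fst (u 0 i \<omega>))) + 2 * L\<^sup>2 * spread n (\<lambda>i. u 0 i \<omega>)"
    unfolding average_add[symmetric] average_real_mult spread_def mean_sq_def ub_def ..
  also have "\<dots> \<le> 2 * r0 + 2 * L\<^sup>2 * r0"
    using assms(2) r0_bounds(3) by (intro add_mono mult_left_mono) auto
  finally show ?thesis by (simp add: algebra_simps)
qed

lemma gradient_F_start: "(norm (gradient F (fst (ub 0 \<omega>))))\<^sup>2 \<le> (2 + 2 * L1\<^sup>2) * r0"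
  unfolding gradient_F by (rule average_gradient_start[OF smooth_f r0_bounds(4)])

lemma L2_\<gamma>: "L2 * \<gamma> \<le> 1 / 2"
  using avg.L2_less \<gamma>_pos by (simp add: field_simps)

lemma gradient_G_start: "(norm (gradient G (fst (ub 0 \<omega>))))\<^sup>2 \<le> (2 + 2 * L2\<^sup>2) * r0"
  unfolding gradient_G by (rule average_gradient_start[OF smooth_g r0_bounds(5)])

text \<open>
  Comparison with the point \<open>\<theta> = y\<close>, where the proximal terms vanish and gradients of
  \<open>f\<^sub>i\<close> and \<open>g\<^sub>i\<close> at \<open>z\<close> are all that is left.
\<close>

lemma h_start_le:
  assumes i: "i < n"
  shows "(norm (h k i v))\<^sup>2 \<le> 4 * \<mu>0\<^sup>2 * (norm (gradient (f i) (fst v)))\<^sup>2 + 16 * (norm (gradient (g i) (fst v)))\<^sup>2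
      + 2 * Lh\<^sup>2 * (norm (snd v - snd (fst v)))\<^sup>2"
proof -
  let ?a = "gradient (f i) (fst v)" and ?b = "gradient (g i) (fst v)" and ?w = "(fst v, snd (fst v))"
  have "h k i ?w = (c *\<^sub>R (mu k *\<^sub>R ?a + (?b - (fst ?b, 0))), snd ?b)"
    unfolding h_def joint_dir_def prox_grad_z_def prox_grad_theta_def by simp
  hence "norm (h k i ?w) \<le> norm (c *\<^sub>R (mu k *\<^sub>R ?a + (?b - (fst ?b, 0)))) + norm (snd ?b)"
    by (simp only: norm_Pair_le)
  also have "norm (c *\<^sub>R (mu k *\<^sub>R ?a + (?b - (fst ?b, 0)))) \<le> norm (mu k *\<^sub>R ?a + (?b - (fst ?b, 0)))"
    using c_pos c_le by (simp add: mult_left_le_one_le)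
  also have "\<dots> \<le> norm (mu k *\<^sub>R ?a) + norm (?b - (fst ?b, 0))" by (rule norm_triangle_ineq)
  also have "norm (mu k *\<^sub>R ?a) \<le> \<mu>0 * norm ?a"
    using mu_pos[of k] mu_le[of k] by (auto intro: mult_right_mono)
  also have "norm (?b - (fst ?b, 0)) = norm (snd ?b)"
    by (cases ?b) (simp add: norm_Pair)
  finally have "norm (h k i ?w) \<le> \<mu>0 * norm ?a + 2 * norm ?b"
    using norm_snd_le_norm[of ?b] by simp
  hence "(norm (h k i ?w))\<^sup>2 \<le> (norm (\<mu>0 * norm ?a + 2 * norm ?b))\<^sup>2" by (intro power_mono) auto
  also have "\<dots> \<le> 2 * (norm (\<mu>0 * norm ?a))\<^sup>2 + 2 * (norm (2 * norm ?b))\<^sup>2" by (rule power2_sum_le)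
  finally have 1: "(norm (h k i ?w))\<^sup>2 \<le> 2 * \<mu>0\<^sup>2 * (norm ?a)\<^sup>2 + 8 * (norm ?b)\<^sup>2" by (simp add: power_mult_distrib)
  have "norm (h k i v - h k i ?w) \<le> Lh * norm (v - ?w)" by (rule h_lipschitz[OF i])
  also have "norm (v - ?w) = norm (snd v - snd (fst v))" by (cases v) (simp add: norm_Pair)
  finally have "(norm (h k i v - h k i ?w))\<^sup>2 \<le> (Lh * norm (snd v - snd (fst v)))\<^sup>2" by (rule power_mono) simp
  hence 2: "(norm (h k i v - h k i ?w))\<^sup>2 \<le> Lh\<^sup>2 * (norm (snd v - snd (fst v)))\<^sup>2" by (simp add: power_mult_distrib)
  have "(norm (h k i ?w + (h k i v - h k i ?w)))\<^sup>2 \<le> 2 * (norm (h k i ?w))\<^sup>2 + 2 * (norm (h k i v - h k i ?w))\<^sup>2"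
    by (rule power2_sum_le)
  thus ?thesis using 1 2 by simp
qed

text \<open>
  The way from \<open>\<theta>\<^sub>i\<close> to \<open>y\<^sub>i\<close> leads through the averages and the proximal point of the average,
  whose distance to the average of \<open>y\<close> is bounded by the gradient of \<open>G\<close>.
\<close>

lemma prox_gap_start:
  "average n (\<lambda>i. (norm (snd (u 0 i \<omega>) - snd (fst (u 0 i \<omega>))))\<^sup>2) \<le> (16 + 32 * \<gamma>\<^sup>2) * r0"
proof -
  let ?z = "fst (ub 0 \<omega>)" and ?t = "snd (ub 0 \<omega>)" and ?p = "prox_point \<gamma> G (fst (ub 0 \<omega>))"
  define e where "e = (norm (?t - ?p))\<^sup>2 + (norm (snd ?z - ?p))\<^sup>2"
  have "average n (\<lambda>i. (norm (snd (u 0 i \<omega>) - snd (fst (u 0 i \<omega>))))\<^sup>2)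
      \<le> average n (\<lambda>i. 4 * (norm (u 0 i \<omega> - ub 0 \<omega>))\<^sup>2 + 4 * e)"
  proof (rule average_real_mono)
    fix i
    let ?v = "u 0 i \<omega>"
    let ?a = "snd ?v - ?t" and ?b = "?t - ?p" and ?c = "snd ?z - ?p" and ?d = "snd (fst ?v) - snd ?z"
    have "snd ?v - snd (fst ?v) = (?a - ?d) + (?b - ?c)" by simp
    hence 1: "(norm (snd ?v - snd (fst ?v)))\<^sup>2 \<le> 2 * (norm (?a - ?d))\<^sup>2 + 2 * (norm (?b - ?c))\<^sup>2"
      by (simp only: power2_sum_le)
    have 2: "(norm (?a - ?d))\<^sup>2 \<le> 2 * (norm ?a)\<^sup>2 + 2 * (norm ?d)\<^sup>2" by (rule power2_diff_le)
    have 3: "(norm (?b - ?c))\<^sup>2 \<le> 2 * (norm ?b)\<^sup>2 + 2 * (norm ?c)\<^sup>2" by (rule power2_diff_le)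
    have 4: "(norm ?a)\<^sup>2 + (norm ?d)\<^sup>2 \<le> (norm (?v - ub 0 \<omega>))\<^sup>2"
      using power2_norm_prod[of "?v - ub 0 \<omega>"] power2_norm_prod[of "fst (?v - ub 0 \<omega>)"] by simp
    have "s \<le> 4 * m + 4 * (b + d)"
      if "s \<le> 2 * p + 2 * q" "p \<le> 2 * a + 2 * t" "q \<le> 2 * b + 2 * d" "a + t \<le> m" for s m b d p q a t :: real
    proof -
      have "s \<le> 2 * p + 2 * q" by (rule that(1))
      also have "\<dots> \<le> 2 * (2 * a + 2 * t) + 2 * (2 * b + 2 * d)"
        by (intro add_mono mult_left_mono that) auto
      also have "\<dots> = 4 * (a + t) + 4 * (b + d)" by simp
      also have "\<dots> \<le> 4 * m + 4 * (b + d)" by (intro add_right_mono mult_left_mono that) auto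
      finally show ?thesis .
    qed
    from this[OF 1 2 3 4] show "(norm (snd ?v - snd (fst ?v)))\<^sup>2 \<le> 4 * (norm (?v - ub 0 \<omega>))\<^sup>2 + 4 * e"
      unfolding e_def .
  qed
  also have "\<dots> = 4 * spread n (\<lambda>i. u 0 i \<omega>) + 4 * e"
    unfolding average_add[symmetric] average_real_mult average_const[OF n_pos] spread_def mean_sq_def ub_def ..
  also have "\<dots> \<le> 4 * r0 + 4 * (r0 + (2 + 8 * \<gamma>\<^sup>2) * r0)"
  proof -
    have "(norm (snd ?z - ?p))\<^sup>2 \<le> (2 * \<gamma> * norm (gradient G ?z))\<^sup>2"
      using avg.prox_point_near[of ?z] by (intro power_mono) auto
    also have "\<dots> = 4 * \<gamma>\<^sup>2 * (norm (gradient G ?z))\<^sup>2" by (simp add: power_mult_distrib)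
    also have "\<dots> \<le> 4 * \<gamma>\<^sup>2 * ((2 + 2 * L2\<^sup>2) * r0)" using gradient_G_start by (intro mult_left_mono) auto
    also have "\<dots> = (8 * (L2 * \<gamma>)\<^sup>2 + 8 * \<gamma>\<^sup>2) * r0" by (simp add: power_mult_distrib algebra_simps)
    also have "\<dots> \<le> (2 + 8 * \<gamma>\<^sup>2) * r0"
    proof (rule mult_right_mono)
      have "(L2 * \<gamma>)\<^sup>2 \<le> (1 / 2)\<^sup>2" using L2_\<gamma> avg.L2_pos \<gamma>_pos by (intro power_mono) auto
      thus "8 * (L2 * \<gamma>)\<^sup>2 + 8 * \<gamma>\<^sup>2 \<le> 2 + 8 * \<gamma>\<^sup>2" by (simp add: power_divide)
    qed (rule r0_bounds(6))
    finally have "e \<le> r0 + (2 + 8 * \<gamma>\<^sup>2) * r0" unfolding e_def using r0_bounds(2) by linarith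
    thus ?thesis using r0_bounds(3) by (intro add_mono mult_left_mono) auto
  qed
  finally show ?thesis by (simp add: algebra_simps)
qed

lemma h_start_mean_sq:
  "mean_sq n (\<lambda>i. h 0 i (u 0 i \<omega>)) \<le> (4 * \<mu>0\<^sup>2 + 16 + 2 * Lh\<^sup>2 * (16 + 32 * \<gamma>\<^sup>2)) * r0"
proof -
  have "mean_sq n (\<lambda>i. h 0 i (u 0 i \<omega>))
     \<le> average n (\<lambda>i. 4 * \<mu>0\<^sup>2 * (norm (gradient (f i) (fst (u 0 i \<omega>))))\<^sup>2 + 16 * (norm (gradient (g i) (fst (u 0 i \<omega>))))\<^sup>2
        + 2 * Lh\<^sup>2 * (norm (snd (u 0 i \<omega>) - snd (fst (u 0 i \<omega>))))\<^sup>2)"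
    unfolding mean_sq_def by (rule average_real_mono) (rule h_start_le)
  also have "\<dots> = 4 * \<mu>0\<^sup>2 * mean_sq n (\<lambda>i. gradient (f i) (fst (u 0 i \<omega>))) + 16 * mean_sq n (\<lambda>i. gradient (g i) (fst (u 0 i \<omega>)))
      + 2 * Lh\<^sup>2 * average n (\<lambda>i. (norm (snd (u 0 i \<omega>) - snd (fst (u 0 i \<omega>))))\<^sup>2)"
    unfolding average_add[symmetric] average_real_mult mean_sq_def ..
  also have "\<dots> \<le> 4 * \<mu>0\<^sup>2 * r0 + 16 * r0 + 2 * Lh\<^sup>2 * ((16 + 32 * \<gamma>\<^sup>2) * r0)"
    using r0_bounds prox_gap_start by (intro add_mono mult_left_mono) auto
  finally show ?thesis by (simp add: algebra_simps)
qed

end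

lemma r0_nonneg: "0 \<le> r0"
  using r0_bounds(6) smp.not_empty by blast

lemma mean_le_const:
  fixes X :: "'w \<Rightarrow> real"
  shows "integrable M X \<Longrightarrow> (\<And>\<omega>. \<omega> \<in> space M \<Longrightarrow> X \<omega> \<le> a) \<Longrightarrow> (\<integral>\<omega>. X \<omega> \<partial>M) \<le> a"
  by (rule smp.integral_le_const) auto

lemma mean_spread_0: "mean_spread 0 \<le> r0"
  unfolding mean_spread_def by (rule mean_le_const) (auto intro: integrable_spread sq_u r0_bounds(3))

lemma mean_local_grad_0: "mean_local_grad 0 \<le> r0"
  unfolding mean_local_grad_def by (rule mean_le_const) (auto intro: integrable_mean_sq sq_grad r0_bounds(4))

lemma mean_lyap_0: "mean_lyap 0 \<le> (1 + 3 / (2 * \<gamma>)) * r0"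
  unfolding mean_lyap_def
proof (rule mean_le_const)
  show "integrable M (\<lambda>\<omega>. avg.lyap (mu 0) (ub 0 \<omega>) - mu 0 * Flow)"
    using mu_pos[of 0] mu_le[of 0] by (intro Bochner_Integration.integrable_diff integrable_lyap) auto
  fix \<omega> assume \<omega>: "\<omega> \<in> space M"
  have "avg.lyap (mu 0) (ub 0 \<omega>) - mu 0 * Flow \<le> r0 + (3 / (2 * \<gamma>)) * r0"
    using avg.lyap_initial_le[of \<mu>0 "ub 0 \<omega>"] r0_bounds(1,2)[OF \<omega>] \<gamma>_pos
      mult_left_mono[OF r0_bounds(2)[OF \<omega>], of "3 / (2 * \<gamma>)"] unfolding mu_0 by simp
  thus "avg.lyap (mu 0) (ub 0 \<omega>) - mu 0 * Flow \<le> (1 + 3 / (2 * \<gamma>)) * r0" by (simp add: algebra_simps)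
qed

lemma mean_tracker_spread_0:
  "mean_tracker_spread 0 \<le> (2 * (4 * \<mu>0\<^sup>2 + 16 + 2 * Lh\<^sup>2 * (16 + 32 * \<gamma>\<^sup>2)) + 2) * (r0 + s2)"
proof -
  define B where "B = 4 * \<mu>0\<^sup>2 + 16 + 2 * Lh\<^sup>2 * (16 + 32 * \<gamma>\<^sup>2)"
  have B0: "0 \<le> B" unfolding B_def by (intro add_nonneg_nonneg mult_nonneg_nonneg) auto
  have inz: "integrable M (\<lambda>\<omega>. mean_sq n (\<lambda>i. noise 0 i \<omega>))"
    by (rule integrable_mean_sq) (rule noise_at(1)[OF K_pos])
  have "mean_tracker_spread 0 \<le> (\<integral>\<omega>. 2 * (B * r0) + 2 * mean_sq n (\<lambda>i. noise 0 i \<omega>) \<partial>M)"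
    unfolding mean_tracker_spread_def
  proof (rule integral_mono)
    show "integrable M (\<lambda>\<omega>. spread n (\<lambda>i. D 0 i \<omega>))" by (intro integrable_spread sq_D K_pos)
    show "integrable M (\<lambda>\<omega>. 2 * (B * r0) + 2 * mean_sq n (\<lambda>i. noise 0 i \<omega>))" using inz by simp
    fix \<omega> assume \<omega>: "\<omega> \<in> space M"
    have "spread n (\<lambda>i. D 0 i \<omega>) \<le> mean_sq n (\<lambda>i. H 0 i \<omega>)"
      by (rule spread_tracker_0[OF nt path[OF \<omega>] K_pos])
    also have "\<dots> \<le> average n (\<lambda>i. 2 * (norm (h 0 i (u 0 i \<omega>)))\<^sup>2 + 2 * (norm (noise 0 i \<omega>))\<^sup>2)"
      unfolding mean_sq_def H_split by (rule average_real_mono) (rule power2_sum_le)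
    also have "\<dots> = 2 * mean_sq n (\<lambda>i. h 0 i (u 0 i \<omega>)) + 2 * mean_sq n (\<lambda>i. noise 0 i \<omega>)"
      unfolding average_add[symmetric] average_real_mult mean_sq_def ..
    also have "\<dots> \<le> 2 * (B * r0) + 2 * mean_sq n (\<lambda>i. noise 0 i \<omega>)"
      using h_start_mean_sq[OF \<omega>] unfolding B_def by simp
    finally show "spread n (\<lambda>i. D 0 i \<omega>) \<le> 2 * (B * r0) + 2 * mean_sq n (\<lambda>i. noise 0 i \<omega>)" .
  qed
  also have "\<dots> = 2 * (B * r0) + 2 * (\<integral>\<omega>. mean_sq n (\<lambda>i. noise 0 i \<omega>) \<partial>M)"
    using inz by (simp add: smp.prob_space)
  also have "(\<integral>\<omega>. mean_sq n (\<lambda>i. noise 0 i \<omega>) \<partial>M) \<le> s2"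
  proof -
    have "(\<integral>\<omega>. mean_sq n (\<lambda>i. noise 0 i \<omega>) \<partial>M) = average n (\<lambda>i. \<integral>\<omega>. (norm (noise 0 i \<omega>))\<^sup>2 \<partial>M)"
      by (rule integrable_mean_sq(2)) (rule noise_at(1)[OF K_pos])
    also have "\<dots> \<le> average n (\<lambda>_. s2)" by (rule average_real_mono) (rule noise_at(2)[OF K_pos])
    finally show ?thesis by (simp add: average_const[OF n_pos])
  qed
  finally have "mean_tracker_spread 0 \<le> 2 * (B * r0) + 2 * s2" by simp
  moreover have "(2 * B + 2) * (r0 + s2) = 2 * (B * r0) + 2 * s2 + (2 * r0 + 2 * (B * s2))"
    by (simp add: algebra_simps)
  moreover have "0 \<le> 2 * r0 + 2 * (B * s2)" using r0_nonneg B0 s2_nonneg by simp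
  ultimately show ?thesis unfolding B_def by linarith
qed

lemma local_grad_bound:
  assumes k: "k < K"
  shows "mean_local_grad k \<le> (2 + 12 * L1\<^sup>2) * (r0 + mean_spread k + real k * lam\<^sup>2 * (\<Sum>j<k. mean_step j))"
proof -
  have k': "k \<le> K" using k by simp
  define dr where "dr = real k * lam\<^sup>2 * (\<Sum>j<k. mean_step j)"
  have dr0: "0 \<le> dr" unfolding dr_def using nonneg_means by (intro mult_nonneg_nonneg sum_nonneg) auto
  let ?g = "\<lambda>k \<omega>. mean_sq n (\<lambda>i. gradient (f i) (fst (u k i \<omega>)))" and ?s = "\<lambda>k \<omega>. spread n (\<lambda>i. u k i \<omega>)"
    and ?d = "\<lambda>\<omega>. (norm (ub k \<omega> - ub 0 \<omega>))\<^sup>2"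
  have ig: "integrable M (?g k)" "integrable M (?g 0)" and isp: "integrable M (?s k)" "integrable M (?s 0)"
    using k' by (auto intro!: integrable_mean_sq sq_grad integrable_spread sq_u)
  note idr = mean_drift(1)[OF k]
  have pw: "?g k \<omega> \<le> 2 * ?g 0 \<omega> + 6 * L1\<^sup>2 * ?s k \<omega> + 6 * L1\<^sup>2 * ?s 0 \<omega> + 6 * L1\<^sup>2 * ?d \<omega>" for \<omega>
  proof -
    have "?g k \<omega> \<le> average n (\<lambda>i. 2 * (norm (gradient (f i) (fst (u 0 i \<omega>))))\<^sup>2
       + 6 * L1\<^sup>2 * (norm (u k i \<omega> - ub k \<omega>))\<^sup>2 + 6 * L1\<^sup>2 * (norm (u 0 i \<omega> - ub 0 \<omega>))\<^sup>2 + 6 * L1\<^sup>2 * ?d \<omega>)"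
      unfolding mean_sq_def
    proof (rule average_real_mono)
      fix i assume i: "i < n"
      let ?a = "gradient (f i) (fst (u k i \<omega>))" and ?b = "gradient (f i) (fst (u 0 i \<omega>))"
      let ?p = "u k i \<omega> - ub k \<omega>" and ?q = "u 0 i \<omega> - ub 0 \<omega>" and ?r = "ub k \<omega> - ub 0 \<omega>"
      have "norm (?a - ?b) \<le> L1 * norm (fst (u k i \<omega>) - fst (u 0 i \<omega>))"
        by (rule smoothness_lipschitz[OF smooth_f[OF i]])
      also have "\<dots> \<le> L1 * norm (u k i \<omega> - u 0 i \<omega>)"
        using norm_fst_le_norm[of "u k i \<omega> - u 0 i \<omega>"] L1_nonneg by (intro mult_left_mono) auto
      finally have "(norm (?a - ?b))\<^sup>2 \<le> (L1 * norm (u k i \<omega> - u 0 i \<omega>))\<^sup>2" by (rule power_mono) simp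
      hence 1: "(norm (?a - ?b))\<^sup>2 \<le> L1\<^sup>2 * (norm (u k i \<omega> - u 0 i \<omega>))\<^sup>2" by (simp add: power_mult_distrib)
      have e: "?p + - ?q + ?r = u k i \<omega> - u 0 i \<omega>" by simp
      have "(norm (u k i \<omega> - u 0 i \<omega>))\<^sup>2 \<le> 3 * (norm ?p)\<^sup>2 + 3 * (norm ?q)\<^sup>2 + 3 * (norm ?r)\<^sup>2"
        using power2_sum3_le[of ?p "- ?q" ?r] unfolding e norm_minus_cancel .
      from mult_left_mono[OF this, of "L1\<^sup>2"]
      have "L1\<^sup>2 * (norm (u k i \<omega> - u 0 i \<omega>))\<^sup>2
          \<le> 3 * L1\<^sup>2 * (norm ?p)\<^sup>2 + 3 * L1\<^sup>2 * (norm ?q)\<^sup>2 + 3 * L1\<^sup>2 * (norm ?r)\<^sup>2" by (simp add: algebra_simps)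
      moreover have "(norm (?b + (?a - ?b)))\<^sup>2 \<le> 2 * (norm ?b)\<^sup>2 + 2 * (norm (?a - ?b))\<^sup>2" by (rule power2_sum_le)
      hence "(norm ?a)\<^sup>2 \<le> 2 * (norm ?b)\<^sup>2 + 2 * (norm (?a - ?b))\<^sup>2" by simp
      ultimately show "(norm ?a)\<^sup>2 \<le> 2 * (norm ?b)\<^sup>2 + 6 * L1\<^sup>2 * (norm ?p)\<^sup>2 + 6 * L1\<^sup>2 * (norm ?q)\<^sup>2 + 6 * L1\<^sup>2 * (norm ?r)\<^sup>2"
        using 1 by linarith
    qed
    thus ?thesis unfolding average_add[symmetric] average_real_mult average_const[OF n_pos]
      unfolding mean_sq_def[symmetric] spread_def ub_def .
  qed
  have "mean_local_grad k \<le> (\<integral>\<omega>. 2 * ?g 0 \<omega> + 6 * L1\<^sup>2 * ?s k \<omega> + 6 * L1\<^sup>2 * ?s 0 \<omega> + 6 * L1\<^sup>2 * ?d \<omega> \<partial>M)"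
    unfolding mean_local_grad_def by (rule integral_mono) (use ig isp idr pw in auto)
  also have "\<dots> = 2 * mean_local_grad 0 + 6 * L1\<^sup>2 * mean_spread k + 6 * L1\<^sup>2 * mean_spread 0 + 6 * L1\<^sup>2 * (\<integral>\<omega>. ?d \<omega> \<partial>M)"
    using ig isp idr unfolding mean_local_grad_def mean_spread_def by simp
  also have "\<dots> \<le> 2 * r0 + 6 * L1\<^sup>2 * mean_spread k + 6 * L1\<^sup>2 * r0 + 6 * L1\<^sup>2 * dr"
    using mean_local_grad_0 mean_spread_0 mean_drift(2)[OF k] unfolding dr_def by (intro add_mono mult_left_mono) auto
  also have "\<dots> \<le> (2 + 12 * L1\<^sup>2) * r0 + (2 + 12 * L1\<^sup>2) * mean_spread k + (2 + 12 * L1\<^sup>2) * dr"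
  proof -
    have "0 \<le> L1\<^sup>2 * r0" "0 \<le> L1\<^sup>2 * mean_spread k" "0 \<le> L1\<^sup>2 * dr" "0 \<le> mean_spread k"
      using r0_nonneg nonneg_means dr0 by auto
    thus ?thesis using dr0 unfolding distrib_right mult.assoc by linarith
  qed
  finally show ?thesis unfolding dr_def[symmetric] by (simp only: distrib_left)
qed

lemma progress_bound:
  assumes k: "k < K"
  shows "mean_progress k \<le> ((3 * \<mu>0\<^sup>2 + 3 + 3 * (\<mu>0 * L1 + 7 / \<gamma>)\<^sup>2 + 18 / \<gamma>\<^sup>2) * (5 + 2 * L1\<^sup>2 + 1 / \<gamma>\<^sup>2))
     * (r0 + real k * lam\<^sup>2 * (\<Sum>j<k. mean_step j))"
proof -
  have k': "k \<le> K" using k by simp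
  define Kp where "Kp = 3 * \<mu>0\<^sup>2 + 3 + 3 * (\<mu>0 * L1 + 7 / \<gamma>)\<^sup>2 + 18 / \<gamma>\<^sup>2"
  define E where "E = 5 + 2 * L1\<^sup>2 + 1 / \<gamma>\<^sup>2"
  define dr where "dr = real k * lam\<^sup>2 * (\<Sum>j<k. mean_step j)"
  have dr0: "0 \<le> dr" unfolding dr_def using nonneg_means by (intro mult_nonneg_nonneg sum_nonneg) auto
  have Kp: "0 \<le> Kp" unfolding Kp_def by (intro add_nonneg_nonneg mult_nonneg_nonneg) auto
  have E1: "1 \<le> E" unfolding E_def by simp
  let ?d = "\<lambda>\<omega>. (norm (ub k \<omega> - ub 0 \<omega>))\<^sup>2"
  note idr = mean_drift(1)[OF k]
  have pw: "avg.progress (mu k) (ub k \<omega>) \<le> Kp * (E * r0) + Kp * ?d \<omega>" if \<omega>: "\<omega> \<in> space M" for \<omega>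
  proof -
    let ?z = "fst (ub 0 \<omega>)"
    have "avg.progress (mu k) (ub k \<omega>) \<le> Kp * ((norm (gradient F ?z))\<^sup>2 + (norm (gradient G ?z))\<^sup>2
       + (norm (snd (ub 0 \<omega>) - prox_point \<gamma> G ?z))\<^sup>2 + ?d \<omega>)"
      unfolding Kp_def using mu_pos[of k] mu_le[of k] by (intro avg.progress_growth) auto
    also have "\<dots> \<le> Kp * ((2 + 2 * L1\<^sup>2) * r0 + (2 + 1 / \<gamma>\<^sup>2) * r0 + r0 + ?d \<omega>)"
    proof (intro mult_left_mono add_mono order_refl gradient_F_start[OF \<omega>] r0_bounds(2)[OF \<omega>] Kp)
      have "L2\<^sup>2 \<le> ((1 / 2) * (1 / \<gamma>))\<^sup>2" using avg.L2_le avg.L2_pos by (intro power_mono) auto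
      also have "\<dots> = (1 / 4) * (1 / \<gamma>\<^sup>2)" by (simp add: power_divide power_mult_distrib)
      also have "\<dots> \<le> (1 / 2) * (1 / \<gamma>\<^sup>2)" by (rule mult_right_mono) auto
      finally have "(2 + 2 * L2\<^sup>2) * r0 \<le> (2 + 1 / \<gamma>\<^sup>2) * r0" using r0_nonneg by (intro mult_right_mono) auto
      thus "(norm (gradient G ?z))\<^sup>2 \<le> (2 + 1 / \<gamma>\<^sup>2) * r0" using gradient_G_start[OF \<omega>] by linarith
    qed
    also have "\<dots> = Kp * (E * r0) + Kp * ?d \<omega>" by (simp add: E_def algebra_simps)
    finally show ?thesis .
  qed
  have "mean_progress k \<le> (\<integral>\<omega>. Kp * (E * r0) + Kp * ?d \<omega> \<partial>M)"
    unfolding mean_progress_def by (rule integral_mono) (use integrable_progress[OF k'] idr pw in auto)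
  also have "\<dots> = Kp * (E * r0) + Kp * (\<integral>\<omega>. ?d \<omega> \<partial>M)" using idr by (simp add: smp.prob_space)
  also have "\<dots> \<le> Kp * (E * r0) + Kp * (E * dr)"
  proof -
    have "(\<integral>\<omega>. ?d \<omega> \<partial>M) \<le> dr" using mean_drift(2)[OF k] by (simp add: dr_def)
    also have "dr \<le> E * dr" using mult_right_mono[OF E1 dr0] by simp
    finally show ?thesis using Kp by (intro add_left_mono mult_left_mono)
  qed
  also have "\<dots> = (Kp * E) * (r0 + dr)" by (simp add: algebra_simps)
  finally show ?thesis unfolding Kp_def E_def dr_def .
qed

lemma Lh_eq: "Lh = tracking_lipschitz L1 \<gamma> \<mu>0" unfolding Lh_def tracking_lipschitz_def ..

lemma satisfies_tracking_recursion:
  "tracking_recursion (tracking_const L1 \<gamma> \<mu>0 c) \<mu>0 \<rho> lam n K r0 s2 mu_drop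
     mean_spread mean_tracker_spread mean_step mean_local_grad mean_progress mean_lyap"
proof -
  define C where "C = tracking_const L1 \<gamma> \<mu>0 c"
  note T = tracking_const_ge[OF L1_nonneg \<gamma>_pos \<mu>0_pos c_pos, folded Lh_eq C_def]
  note rho = network_topology_rho[OF nt]
  have dr: "0 \<le> real k * lam\<^sup>2 * (\<Sum>j<k. mean_step j)" for k
    using nonneg_means by (intro mult_nonneg_nonneg sum_nonneg) auto
  show ?thesis
    unfolding tracking_recursion_def C_def[symmetric]
  proof (intro conjI allI impI)
    show "1 \<le> C" by (rule T(1))
    show "0 \<le> \<mu>0" using \<mu>0_pos by simp
    show "0 \<le> \<rho>" "\<rho> < 1" by (rule rho)+
    show "0 < lam" by (rule lam_pos)
    show "1 \<le> n" "1 \<le> K" using n_pos K_pos by auto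
    show "0 \<le> r0" "0 \<le> s2" by (rule r0_nonneg, rule s2_nonneg)
    show "0 \<le> mu_drop k" "real k * mu_drop k \<le> \<mu>0" "mu_drop k \<le> \<mu>0" for k
      by (rule mu_drop_nonneg, rule mult_mu_drop_le, rule mu_drop_le)
    show "(\<Sum>j<k. mu_drop j) \<le> \<mu>0" for k unfolding sum_mu_drop using mu_pos[of k] by simp
    show "0 \<le> mean_spread k" "0 \<le> mean_tracker_spread k" "0 \<le> mean_step k" "0 \<le> mean_local_grad k" "0 \<le> mean_progress k" for k
      by (rule nonneg_means)+
    show "0 \<le> mean_lyap K" by (rule mean_lyap_nonneg)
    show "mean_spread 0 \<le> r0" by (rule mean_spread_0)
    show "mean_tracker_spread 0 \<le> C * (r0 + s2)"
      using mean_tracker_spread_0 mult_right_mono[OF T(8), of "r0 + s2"] r0_nonneg s2_nonneg by linarith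
    show "mean_lyap 0 \<le> C * r0"
      using mean_lyap_0 mult_right_mono[OF T(7) r0_nonneg] by linarith
    show "mean_spread (Suc k) \<le> \<rho> * mean_spread k + lam\<^sup>2 / (1 - \<rho>) * mean_tracker_spread k" if "Suc k < K" for k
      using spread_recursion[of k] that by simp
    show "mean_tracker_spread (Suc k) \<le> \<rho> * mean_tracker_spread k + C / (1 - \<rho>) * (mean_spread (Suc k) + mean_spread k
        + lam\<^sup>2 * mean_step k + (mu_drop k)\<^sup>2 * mean_local_grad k + s2)" if k: "Suc k < K" for k
    proof -
      define Y where "Y = mean_spread (Suc k) + mean_spread k + lam\<^sup>2 * mean_step k + (mu_drop k)\<^sup>2 * mean_local_grad k + s2"
      have Y: "0 \<le> Y" unfolding Y_def using nonneg_means s2_nonneg by (intro add_nonneg_nonneg mult_nonneg_nonneg) auto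
      have "1 / (1 - \<rho>) * ((12 * Lh\<^sup>2 + 8) * Y) \<le> 1 / (1 - \<rho>) * (C * Y)"
        using rho by (intro mult_left_mono mult_right_mono T(2) Y) auto
      thus ?thesis using tracker_recursion[OF k] unfolding Y_def[symmetric] by simp
    qed
    show "mean_step k \<le> C * (mean_progress k + mean_spread k + s2 / real n)" if k: "k < K" for k
    proof -
      have "0 \<le> mean_progress k + mean_spread k + s2 / real n" using nonneg_means s2_nonneg by simp
      from mult_right_mono[OF T(3) this] show ?thesis using step_bound[OF k] by linarith
    qed
    show "mean_local_grad k \<le> C * (r0 + mean_spread k + real k * lam\<^sup>2 * (\<Sum>j<k. mean_step j))" if k: "k < K" for k
    proof -
      have "0 \<le> r0 + mean_spread k + real k * lam\<^sup>2 * (\<Sum>j<k. mean_step j)"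
        using nonneg_means(1)[of k] r0_nonneg dr[of k] by linarith
      from mult_right_mono[OF T(4) this] show ?thesis using local_grad_bound[OF k] by linarith
    qed
    show "mean_progress k \<le> C * (r0 + real k * lam\<^sup>2 * (\<Sum>j<k. mean_step j))" if k: "k < K" for k
    proof -
      have "0 \<le> r0 + real k * lam\<^sup>2 * (\<Sum>j<k. mean_step j)" using r0_nonneg dr[of k] by linarith
      from mult_right_mono[OF T(9) this] show ?thesis using progress_bound[OF k] by linarith
    qed
    show "mean_lyap (Suc k) \<le> mean_lyap k - lam / 2 * mean_progress k + C * lam * mean_spread k + C * lam\<^sup>2 * mean_step k"
      if k: "k < K" for k
    proof -
      have "((2 / c + 22) * Lh\<^sup>2) * lam * mean_spread k \<le> C * lam * mean_spread k"
        using T(5) lam_pos nonneg_means by (intro mult_right_mono) auto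
      moreover have "(\<mu>0 * L1 + 18 / \<gamma>) * lam\<^sup>2 * mean_step k \<le> C * lam\<^sup>2 * mean_step k"
        using T(6) nonneg_means by (intro mult_right_mono) auto
      ultimately show ?thesis using lyap_recursion[OF k] by linarith
    qed
  qed
qed

lemma mean_spread_eq_consensus_error: "k \<le> K \<Longrightarrow> consensus_error M n x y \<theta> k = mean_spread k"
proof -
  assume k: "k \<le> K"
  have "consensus_error M n x y \<theta> k
      = average n (\<lambda>i. \<integral>\<omega>. consensus_gap n (\<lambda>i. x k i \<omega>) (\<lambda>i. y k i \<omega>) (\<lambda>i. \<theta> k i \<omega>) i \<partial>M)"
    unfolding consensus_error_def by (simp add: average_def)
  also have "\<dots> = average n (\<lambda>i. \<integral>\<omega>. (norm (u k i \<omega> - ub k \<omega>))\<^sup>2 \<partial>M)"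
    by (simp add: consensus_gap_eq ub_def u_def)
  also have "\<dots> = (\<integral>\<omega>. mean_sq n (\<lambda>i. u k i \<omega> - ub k \<omega>) \<partial>M)"
    by (rule integrable_mean_sq(2)[symmetric]) (intro sq_integrable_diff sq_u sq_ub k)
  finally show ?thesis unfolding mean_spread_def spread_def ub_def .
qed

lemma gradient_Psi_le_progress:
  assumes k: "k \<le> K"
  shows "(\<integral>\<omega>. (norm (gradient (Psi \<gamma> F G (mu k)) (average n (\<lambda>i. x k i \<omega>), average n (\<lambda>i. y k i \<omega>))))\<^sup>2 \<partial>M)
     \<le> mean_progress k / c"
proof -
  have ub: "fst (ub k \<omega>) = (average n (\<lambda>i. x k i \<omega>), average n (\<lambda>i. y k i \<omega>))" for \<omega>
    unfolding ub_def u_def by (simp add: average_Pair)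
  have i: "integrable M (\<lambda>\<omega>. (norm (avg.gradPsi (mu k) (fst (ub k \<omega>))))\<^sup>2)"
    by (rule sq_integrable_integrable, rule smp.sq_integrable_lipschitz[where g = "avg.gradPsi (mu k)" and X = "\<lambda>\<omega>. fst (ub k \<omega>)"])
      (rule sq_integrable_fst[OF sq_ub[OF k]], rule gradPsi_lipschitz)
  have "c * (\<integral>\<omega>. (norm (avg.gradPsi (mu k) (fst (ub k \<omega>))))\<^sup>2 \<partial>M)
      = (\<integral>\<omega>. c * (norm (avg.gradPsi (mu k) (fst (ub k \<omega>))))\<^sup>2 \<partial>M)" by simp
  also have "\<dots> \<le> mean_progress k"
    unfolding mean_progress_def
    by (rule integral_mono) (use i integrable_progress[OF k] in \<open>auto simp: avg.progress_def\<close>)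
  finally show ?thesis using c_pos unfolding avg.gradPsi_def ub by (simp add: field_simps)
qed

end

section \<open>Rates\<close>

text \<open>
  The bound on \<open>\<lambda>\<close> with \<open>S\<close> in its denominator contains \<open>9 \<tau>\<^sub>7 L\<^sub>2\<^sup>2\<close>, where
  \<open>\<tau>\<^sub>7 \<ge> 6 L\<^sub>2\<^sup>2 / (1 - \<rho>)\<^sup>3\<close>; this is where the fourth power of the spectral gap comes from.
\<close>

lemma step_size_conditions_consequences:
  assumes ss: "step_size_conditions L1 L2 \<gamma> \<mu>0 L\<theta> c \<rho> lam"
    and L2: "0 < L2" and \<gamma>: "0 < \<gamma>" "\<gamma> < 1 / (2 * L2)" and c: "0 < c" and rho: "\<rho> < 1" and L\<theta>: "2 / 3 \<le> L\<theta>"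
  shows "c \<le> 3 / 32" "lam \<le> (1 - \<rho>) ^ 4 / (27648 * c * L2 ^ 4)"
proof -
  define \<eta> where "\<eta> = 1 / \<gamma> - L2"
  define L\<Phi> where "L\<Phi> = L2 + min L2 (1 / \<gamma>)"
  define a1 where "a1 = 1 / (2 * L\<theta>) * sqrt (L2\<^sup>2 + (1 / \<gamma>)\<^sup>2)"
  define m l h where "m = \<mu>0\<^sup>2 * L1\<^sup>2" and "l = L2\<^sup>2" and "h = (1 / \<gamma>)\<^sup>2"
  define \<tau>2 where "\<tau>2 = 2 * ((3 * (m + 2 * l) * c + 4 * (m + l) * c + 12 * a1 / \<eta> * l) / (c * (1 - \<rho>)))"
  define \<tau>3 where "\<tau>3 = 2 * ((3 * (m + l) * c + 4 * (m + l + h) * c + 12 * a1 / \<eta> * h) / (c * (1 - \<rho>)))"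
  define \<tau>4 where "\<tau>4 = 2 * ((3 * l * c + 4 * h * c + 12 * a1 / \<eta> * (l + h)) / (c * (1 - \<rho>)))"
  define S where "S = 9 * (\<tau>2 / (1 - \<rho>)\<^sup>2) * 1 * (m + 2 * l) + 12 * (\<tau>3 / (1 - \<rho>)\<^sup>2) * 1 * (m + l) + 9 * (\<tau>4 / (1 - \<rho>)\<^sup>2) * l"
  note defs = \<eta>_def L\<Phi>_def a1_def m_def l_def h_def \<tau>2_def \<tau>3_def \<tau>4_def S_def
  have 1: "c \<le> \<eta> / (32 * a1 * L\<theta>\<^sup>2)" and 2: "lam \<le> (1 - \<rho>) / (64 * c * (L\<Phi> / 2 + 4 * a1 * L\<theta>\<^sup>2 + 8 * S))"
    using ss unfolding step_size_conditions_def Let_def defs by blast+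
  have L2\<gamma>: "L2 < 1 / (2 * \<gamma>)" using \<gamma> L2 by (simp add: field_simps)
  hence \<eta>: "0 < \<eta>" "\<eta> \<le> 1 / \<gamma>" using \<gamma> L2 by (auto simp: \<eta>_def field_simps)
  have Lp: "0 < L\<theta>" using L\<theta> by simp
  define s where "s = sqrt (L2\<^sup>2 + (1 / \<gamma>)\<^sup>2)"
  have "sqrt ((1 / \<gamma>)\<^sup>2) \<le> s" unfolding s_def by (rule real_sqrt_le_mono) simp
  hence s: "1 / \<gamma> \<le> s" using \<gamma> by simp
  have s0: "0 < s" using s \<gamma> by (meson less_le_trans zero_less_divide_1_iff)
  have e: "32 * a1 * L\<theta>\<^sup>2 = 16 * L\<theta> * s" unfolding a1_def s_def[symmetric] using Lp by (simp add: power2_eq_square)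
  have "c \<le> \<eta> / (16 * L\<theta> * s)" using 1 unfolding e .
  also have "\<dots> \<le> s / (16 * L\<theta> * s)" using \<eta> s Lp s0 by (intro divide_right_mono) auto
  also have "\<dots> = 1 / (16 * L\<theta>)" using s0 by simp
  also have "\<dots> \<le> 3 / 32" using L\<theta> by (simp add: field_simps)
  finally show "c \<le> 3 / 32" .
  have r: "0 < 1 - \<rho>" using rho by simp
  have a1: "0 < a1" unfolding a1_def s_def[symmetric] using Lp s0 by simp
  have nn: "0 \<le> m" "0 < l" "0 \<le> h" using L2 by (auto simp: m_def l_def h_def)
  have q: "0 \<le> 12 * a1 / \<eta>" using a1 \<eta> by simp
  have t2: "0 \<le> \<tau>2" unfolding \<tau>2_def using c r q a1 \<eta> nn
    by (intro mult_nonneg_nonneg divide_nonneg_nonneg add_nonneg_nonneg) auto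
  have t3: "0 \<le> \<tau>3" unfolding \<tau>3_def using c r q a1 \<eta> nn
    by (intro mult_nonneg_nonneg divide_nonneg_nonneg add_nonneg_nonneg) auto
  have t4: "6 * l / (1 - \<rho>) \<le> \<tau>4"
  proof -
    have "0 \<le> 4 * h * c" using c nn by simp
    moreover have "0 \<le> 12 * a1 / \<eta> * (l + h)" by (rule mult_nonneg_nonneg[OF q]) (use nn in simp)
    ultimately have "3 * l * c / (c * (1 - \<rho>)) \<le> (3 * l * c + 4 * h * c + 12 * a1 / \<eta> * (l + h)) / (c * (1 - \<rho>))"
      using c r by (intro divide_right_mono) auto
    hence "2 * (3 * l * c / (c * (1 - \<rho>))) \<le> \<tau>4" unfolding \<tau>4_def by (rule mult_left_mono) simp
    moreover have "2 * (3 * l * c / (c * (1 - \<rho>))) = 6 * l / (1 - \<rho>)" using c by simp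
    ultimately show ?thesis by simp
  qed
  have S: "54 * l\<^sup>2 / (1 - \<rho>) ^ 3 \<le> S"
  proof -
    have "9 * ((6 * l / (1 - \<rho>)) / (1 - \<rho>)\<^sup>2) * l \<le> 9 * (\<tau>4 / (1 - \<rho>)\<^sup>2) * l"
      using t4 nn by (intro mult_right_mono mult_left_mono divide_right_mono) auto
    moreover have "9 * ((6 * l / (1 - \<rho>)) / (1 - \<rho>)\<^sup>2) * l = 54 * l\<^sup>2 / (1 - \<rho>) ^ 3"
      by (simp add: power2_eq_square power3_eq_cube mult.assoc)
    moreover have "0 \<le> 9 * (\<tau>2 / (1 - \<rho>)\<^sup>2) * 1 * (m + 2 * l)" "0 \<le> 12 * (\<tau>3 / (1 - \<rho>)\<^sup>2) * 1 * (m + l)"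
      using t2 t3 nn by auto
    ultimately show ?thesis unfolding S_def by linarith
  qed
  have p0: "0 < 64 * c * (8 * (54 * l\<^sup>2 / (1 - \<rho>) ^ 3))" using c nn r by simp
  have "lam \<le> (1 - \<rho>) / (64 * c * (L\<Phi> / 2 + 4 * a1 * L\<theta>\<^sup>2 + 8 * S))" by (rule 2)
  also have "\<dots> \<le> (1 - \<rho>) / (64 * c * (8 * (54 * l\<^sup>2 / (1 - \<rho>) ^ 3)))"
  proof (rule divide_left_mono)
    have "0 \<le> L\<Phi> / 2" "0 \<le> 4 * a1 * L\<theta>\<^sup>2" using L2 \<gamma> a1 by (auto simp: L\<Phi>_def)
    thus "64 * c * (8 * (54 * l\<^sup>2 / (1 - \<rho>) ^ 3)) \<le> 64 * c * (L\<Phi> / 2 + 4 * a1 * L\<theta>\<^sup>2 + 8 * S)"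
      using S c by (intro mult_left_mono) auto
    hence "0 < 64 * c * (L\<Phi> / 2 + 4 * a1 * L\<theta>\<^sup>2 + 8 * S)" using p0 by (rule less_le_trans[rotated])
    thus "0 < (64 * c * (L\<Phi> / 2 + 4 * a1 * L\<theta>\<^sup>2 + 8 * S)) * (64 * c * (8 * (54 * l\<^sup>2 / (1 - \<rho>) ^ 3)))"
      using p0 by (rule mult_pos_pos)
  qed (use r in simp)
  also have "\<dots> = (1 - \<rho>) ^ 4 / (27648 * c * L2 ^ 4)"
    unfolding l_def using r c L2 by (simp add: field_simps power2_eq_square power3_eq_cube power4_eq_xxxx)
  finally show "lam \<le> (1 - \<rho>) ^ 4 / (27648 * c * L2 ^ 4)" .
qed

definition loop_const :: "real \<Rightarrow> real \<Rightarrow> real" where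
  "loop_const C \<mu>0 = C * (3 + C * \<mu>0\<^sup>2)"

definition noise_const :: "real \<Rightarrow> real" where "noise_const \<mu>0 = 3 * \<mu>0\<^sup>2 + 7"

text \<open>
  The factor in the bound \<open>\<lambda> \<le> const (1 - \<rho>)\<^sup>4\<close> that the step-size conditions imply.
\<close>

definition gap_const :: "real \<Rightarrow> real \<Rightarrow> real" where "gap_const L2 c = 1 / (27648 * c * L2 ^ 4)"

text \<open>
  From this ratio \<open>K / n\<close> on, \<open>\<lambda>\<close> is at most a small absolute number and at most a fixed multiple
  of \<open>(1 - \<rho>)\<^sup>4\<close>; the product of both bounds makes \<open>\<lambda>\<^sup>2 / (1 - \<rho>)\<^sup>4\<close> small enough to close the
  loop.
\<close>

definition rate_threshold :: "real \<Rightarrow> real \<Rightarrow> real \<Rightarrow> real \<Rightarrow> real \<Rightarrow> real" where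
  "rate_threshold C L2 \<mu>0 ctheta c = (ctheta * (2 * loop_const C \<mu>0 * gap_const L2 c + 16 * C\<^sup>2))\<^sup>2"

definition large_const :: "real \<Rightarrow> real \<Rightarrow> real \<Rightarrow> real" where
  "large_const C \<mu>0 ctheta = 100 * C\<^sup>2 * loop_const C \<mu>0
     * (1 / ctheta + ctheta * noise_const \<mu>0 + ctheta\<^sup>2 * noise_const \<mu>0)"

definition crude_step_const :: "real \<Rightarrow> real \<Rightarrow> real \<Rightarrow> real" where
  "crude_step_const C m l = C * (C + C * m * l\<^sup>2 + 1)"

definition crude_growth :: "real \<Rightarrow> real \<Rightarrow> real \<Rightarrow> real \<Rightarrow> real \<Rightarrow> real" where
  "crude_growth C \<mu>0 m l a = 3 + a * l\<^sup>2
     + (1 + C * a * (2 + a * l\<^sup>2 + l\<^sup>2 * crude_step_const C m l + \<mu>0\<^sup>2 * (C * (1 + m * l\<^sup>2)) + 1))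
     + crude_step_const C m l"

definition crude_const :: "real \<Rightarrow> real \<Rightarrow> real \<Rightarrow> real \<Rightarrow> real \<Rightarrow> real" where
  "crude_const C \<mu>0 m l a = crude_step_const C m l * (3 * C * crude_growth C \<mu>0 m l a ^ nat \<lceil>m\<rceil>)"

context sun_dsbo_run
begin

abbreviation (input) CC :: real where "CC \<equiv> tracking_const L1 \<gamma> \<mu>0 c"

lemma rates_many_iterations:
  assumes lam_eq: "lam = ctheta * sqrt (real n) / sqrt (real K)" and ct: "0 < ctheta"
    and small: "2 * loop_const CC \<mu>0 * lam\<^sup>2 \<le> (1 - \<rho>) ^ 4" "16 * CC\<^sup>2 * lam \<le> 1"
  defines "Z \<equiv> large_const CC \<mu>0 ctheta * ((r0 + (\<delta>f\<^sup>2 + \<delta>g\<^sup>2)) / (sqrt (real n) * sqrt (real K))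
      + real n * (\<delta>f\<^sup>2 + \<delta>g\<^sup>2) / ((1 - \<rho>) ^ 4 * real K))"
  shows "(1 / real K) * (\<Sum>k<K. mean_progress k) \<le> Z" "(1 / real K) * (\<Sum>k<K. mean_spread k) \<le> Z"
proof -
  define \<sigma> where "\<sigma> = \<delta>f\<^sup>2 + \<delta>g\<^sup>2"
  define m2 where "m2 = noise_const \<mu>0"
  define B where "B = loop_const CC \<mu>0"
  have s2: "s2 = m2 * \<sigma>" by (simp add: s2_def m2_def noise_const_def \<sigma>_def)
  have \<sigma>: "0 \<le> \<sigma>" by (simp add: \<sigma>_def)
  have m2: "0 \<le> m2" by (simp add: m2_def noise_const_def)
  have rho: "0 < 1 - \<rho>" using network_topology_rho[OF nt] by simp
  have C1: "1 \<le> CC" by (rule tracking_const_ge(1)[OF L1_nonneg \<gamma>_pos \<mu>0_pos c_pos])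
  have B0: "0 \<le> B" unfolding B_def loop_const_def using C1 by (intro mult_nonneg_nonneg add_nonneg_nonneg) auto
  define err where "err = r0 / lam + lam * real K * s2 / real n + lam\<^sup>2 * real K * s2 / (1 - \<rho>) ^ 4"
  note T = tracking_recursion_sum_bound[OF satisfies_tracking_recursion loop_const_def[of CC \<mu>0] small, folded err_def B_def]
  define N k where "N = sqrt (real n)" and "k = sqrt (real K)"
  have Nk: "0 < N" "0 < k" "real n = N\<^sup>2" "real K = k\<^sup>2" using n_pos K_pos by (auto simp: N_def k_def)
  define P Q where "P = 1 / (N * k)" and "Q = N\<^sup>2 / ((1 - \<rho>) ^ 4 * k\<^sup>2)"
  have PQ: "0 \<le> P" "0 \<le> Q" using Nk by (auto simp: P_def Q_def)
  have lam': "lam = ctheta * N / k" unfolding lam_eq N_def k_def ..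
  have i1: "(1 / k\<^sup>2) * (r0 / lam) = (1 / ctheta) * r0 * P"
    unfolding lam' P_def using Nk(1,2) ct by (simp add: field_simps power2_eq_square)
  have i2: "(1 / k\<^sup>2) * (lam * k\<^sup>2 * s2 / N\<^sup>2) = ctheta * m2 * \<sigma> * P"
    unfolding lam' P_def s2 using Nk(1,2) ct by (simp add: field_simps power2_eq_square)
  have i3: "(1 / k\<^sup>2) * (lam\<^sup>2 * k\<^sup>2 * s2 / (1 - \<rho>) ^ 4) = ctheta\<^sup>2 * m2 * (\<sigma> * Q)"
    unfolding lam' Q_def s2 using Nk(1,2) ct rho by (simp add: field_simps power2_eq_square)
  have "(1 / k\<^sup>2) * err = (1 / ctheta) * r0 * P + ctheta * m2 * \<sigma> * P + ctheta\<^sup>2 * m2 * (\<sigma> * Q)"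
    unfolding err_def Nk(3,4) distrib_left i1 i2 i3 ..
  also have "\<dots> \<le> (1 / ctheta + ctheta * m2 + ctheta\<^sup>2 * m2) * ((r0 + \<sigma>) * P + \<sigma> * Q)"
  proof -
    have a: "0 \<le> 1 / ctheta" "0 \<le> ctheta * m2" "0 \<le> ctheta\<^sup>2 * m2" using ct m2 by auto
    have b: "0 \<le> r0 * P" "0 \<le> \<sigma> * P" "0 \<le> \<sigma> * Q" using r0_nonneg \<sigma> PQ by auto
    define p q t where "p = 1 / ctheta" and "q = ctheta * m2" and "t = ctheta\<^sup>2 * m2"
    have "(p + q + t) * ((r0 + \<sigma>) * P + \<sigma> * Q) = (p * (r0 * P) + q * (\<sigma> * P) + t * (\<sigma> * Q))
        + (p * (\<sigma> * P) + p * (\<sigma> * Q) + q * (r0 * P) + q * (\<sigma> * Q) + t * (r0 * P) + t * (\<sigma> * P))"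
      by (simp add: algebra_simps)
    moreover have "0 \<le> p * (\<sigma> * P) + p * (\<sigma> * Q) + q * (r0 * P) + q * (\<sigma> * Q) + t * (r0 * P) + t * (\<sigma> * P)"
      using a b by (auto simp: p_def[symmetric] q_def[symmetric] t_def[symmetric] intro!: add_nonneg_nonneg mult_nonneg_nonneg)
    ultimately show ?thesis unfolding p_def[symmetric] q_def[symmetric] t_def[symmetric] by (simp add: mult.assoc)
  qed
  finally have e: "(1 / k\<^sup>2) * err \<le> (1 / ctheta + ctheta * m2 + ctheta\<^sup>2 * m2) * ((r0 + \<sigma>) * P + \<sigma> * Q)" .
  have Z: "Z = (100 * CC\<^sup>2 * B) * ((1 / ctheta + ctheta * m2 + ctheta\<^sup>2 * m2) * ((r0 + \<sigma>) * P + \<sigma> * Q))"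
    unfolding Z_def large_const_def B_def m2_def \<sigma>_def[symmetric] N_def[symmetric] k_def[symmetric] Nk(3,4) P_def Q_def
    using Nk(1,2) by (simp add: mult.commute mult.left_commute)
  have fin: "(1 / real K) * x \<le> Z" if "x \<le> 100 * CC\<^sup>2 * B * err" for x
  proof -
    have "(1 / k\<^sup>2) * x \<le> (1 / k\<^sup>2) * (100 * CC\<^sup>2 * B * err)" using that by (intro mult_left_mono) auto
    also have "\<dots> = (100 * CC\<^sup>2 * B) * ((1 / k\<^sup>2) * err)" by simp
    also have "\<dots> \<le> Z" unfolding Z using B0 by (intro mult_left_mono e) auto
    finally show ?thesis unfolding Nk(4) .
  qed
  show "(1 / real K) * (\<Sum>k<K. mean_progress k) \<le> Z" "(1 / real K) * (\<Sum>k<K. mean_spread k) \<le> Z"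
    using fin T by auto
qed

lemma rates_few_iterations:
  assumes bd: "lam \<le> l" "1 / (1 - \<rho>) \<le> a" "real K \<le> m"
  defines "Z \<equiv> crude_const CC \<mu>0 m l a * ((1 + noise_const \<mu>0) * (r0 + (\<delta>f\<^sup>2 + \<delta>g\<^sup>2)))"
  shows "(1 / real K) * (\<Sum>k<K. mean_progress k) \<le> Z" "(1 / real K) * (\<Sum>k<K. mean_spread k) \<le> Z"
proof -
  define \<sigma> where "\<sigma> = \<delta>f\<^sup>2 + \<delta>g\<^sup>2"
  have \<sigma>: "0 \<le> \<sigma>" by (simp add: \<sigma>_def)
  have s2: "s2 = noise_const \<mu>0 * \<sigma>" by (simp add: s2_def noise_const_def \<sigma>_def)
  have nc: "0 \<le> noise_const \<mu>0" by (simp add: noise_const_def)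
  note T = tracking_recursion_crude_bound[OF satisfies_tracking_recursion bd, folded crude_step_const_def,
      folded crude_growth_def]
  have C1: "1 \<le> CC" by (rule tracking_const_ge(1)[OF L1_nonneg \<gamma>_pos \<mu>0_pos c_pos])
  define b1 b where "b1 = crude_step_const CC m l" and "b = crude_growth CC \<mu>0 m l a"
  have b1: "1 \<le> b1" and b: "1 \<le> b" using T(3,4) by (auto simp: b1_def b_def)
  have rs: "r0 + s2 \<le> (1 + noise_const \<mu>0) * (r0 + \<sigma>)"
    unfolding s2 using nc r0_nonneg \<sigma> by (simp add: algebra_simps)
  have rs0: "0 \<le> r0 + s2" using r0_nonneg s2_nonneg by simp
  have "K \<le> nat \<lceil>m\<rceil>" using bd(3) by linarith
  hence "b ^ K \<le> b ^ nat \<lceil>m\<rceil>" using b by (rule power_increasing)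
  hence "3 * CC * b ^ K * (r0 + s2) \<le> 3 * CC * b ^ nat \<lceil>m\<rceil> * ((1 + noise_const \<mu>0) * (r0 + \<sigma>))"
    using C1 rs rs0 b by (intro mult_mono) auto
  hence main: "b1 * (3 * CC * b ^ K * (r0 + s2)) \<le> b1 * (3 * CC * b ^ nat \<lceil>m\<rceil> * ((1 + noise_const \<mu>0) * (r0 + \<sigma>)))"
    using b1 by (intro mult_left_mono) auto
  have Z: "b1 * (3 * CC * b ^ nat \<lceil>m\<rceil> * ((1 + noise_const \<mu>0) * (r0 + \<sigma>))) = Z"
    unfolding Z_def crude_const_def b1_def b_def \<sigma>_def by (simp add: mult.assoc)
  have p: "mean_progress k \<le> Z" if "k < K" for k
    using T(2)[OF that] main unfolding Z b1_def[symmetric] b_def[symmetric] by linarith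
  have d: "mean_spread k \<le> Z" if "k < K" for k
  proof -
    have "3 * CC * b ^ K * (r0 + s2) \<le> b1 * (3 * CC * b ^ K * (r0 + s2))"
      using mult_right_mono[OF b1, of "3 * CC * b ^ K * (r0 + s2)"] C1 b rs0 by simp
    thus ?thesis using T(1)[OF that] main unfolding Z b_def[symmetric] by linarith
  qed
  have av: "(1 / real K) * (\<Sum>k<K. q k) \<le> Z" if "\<And>k. k < K \<Longrightarrow> q k \<le> Z" for q :: "nat \<Rightarrow> real"
  proof -
    have "(\<Sum>k<K. q k) \<le> (\<Sum>k<K. Z)" using that by (intro sum_mono) auto
    thus ?thesis using K_pos by (simp add: divide_le_eq mult.commute)
  qed
  show "(1 / real K) * (\<Sum>k<K. mean_progress k) \<le> Z" "(1 / real K) * (\<Sum>k<K. mean_spread k) \<le> Z"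
    using av p d by auto
qed

end

definition rate_const :: "real \<Rightarrow> real \<Rightarrow> real \<Rightarrow> real \<Rightarrow> real" where
  "rate_const C \<mu>0 ctheta c = (1 + 1 / c) * large_const C \<mu>0 ctheta"

text \<open>
  When \<open>K < \<kappa> n\<close> the step size is bounded below, hence by the step-size conditions so is the
  spectral gap.
\<close>

definition small_K_const :: "real \<Rightarrow> real \<Rightarrow> real \<Rightarrow> real \<Rightarrow> real \<Rightarrow> nat \<Rightarrow> real" where
  "small_K_const C L2 \<mu>0 ctheta c n = (let \<kappa> = rate_threshold C L2 \<mu>0 ctheta c in
     1 + \<bar>(1 + 1 / c) * crude_const C \<mu>0 (\<kappa> * real n) (ctheta * sqrt (real n)) (gap_const L2 c * sqrt \<kappa> / ctheta)
          * (1 + noise_const \<mu>0) * (real n * sqrt \<kappa>)\<bar>)"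

definition rate_data :: "real \<Rightarrow> real \<Rightarrow> real \<Rightarrow> real" where
  "rate_data r s t = 1 + \<bar>r\<bar> + \<bar>s\<bar> + \<bar>t\<bar>"

text \<open>
  Both claims follow from one bound \<open>A (R / \<surd>(n K) + n \<sigma>\<^sup>2 / ((1 - \<rho>)\<^sup>4 K))\<close>, which holds for the
  progress as well as for the consensus error; the second claim only weakens it.  The factor
  \<open>1 + 1/c\<^sub>\<lambda>\<close> in \<open>A\<close> serves both and recovers \<open>\<parallel>\<nabla>\<Psi>\<parallel>\<^sup>2\<close> from the progress.
\<close>

lemma sun_dsbo_gt_rates:
  fixes f g :: "nat \<Rightarrow> 'a::euclidean_space \<times> 'b::euclidean_space \<Rightarrow> real"
    and Pf :: "nat \<Rightarrow> 's measure" and Pg :: "nat \<Rightarrow> 't measure" and M :: "'w measure"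
    and n K :: nat and L1 L2 \<gamma> \<mu>0 ctheta clam Flow \<delta>f \<delta>g :: real
    and x0 :: "nat \<Rightarrow> 'a" and y0 \<theta>0 :: "nat \<Rightarrow> 'b"
  assumes \<mu>0: "0 < \<mu>0" and \<gamma>: "0 < \<gamma>" "\<gamma> < 1 / (2 * L2)" and ct: "0 < ctheta" and c: "0 < clam"
  defines "C \<equiv> tracking_const \<bar>L1\<bar> \<gamma> \<mu>0 clam"
  defines "lam \<equiv> ctheta * sqrt (real n) / sqrt (real K)"
  defines "R \<equiv> rate_data (initial_error n \<gamma> \<mu>0 Flow f g x0 y0 \<theta>0) (\<delta>f\<^sup>2) (\<delta>g\<^sup>2)"
  defines "A \<equiv> (if rate_threshold C L2 \<mu>0 ctheta clam * real n \<le> real K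
      then rate_const C \<mu>0 ctheta clam else small_K_const C L2 \<mu>0 ctheta clam n)"
  assumes nt: "network_topology n W \<rho>" and p: "0 < p" "p < 1 / 4"
    and sm: "\<forall>i<n. smoothness L1 (f i) \<and> smoothness L2 (g i)"
    and Fl: "\<forall>z. Flow \<le> average n (\<lambda>i. f i z)"
    and so: "\<forall>i<n. stochastic_oracle (Pf i) (fs i) (f i) \<delta>f \<and> stochastic_oracle (Pg i) (gs i) (g i) \<delta>g"
    and iid: "iid_samples M n K Pf Pg \<xi>f \<xi>g"
    and L\<theta>: "L\<theta>-lipschitz_on UNIV (prox_point \<gamma> (\<lambda>z. average n (\<lambda>i. g i z)))"
    and ss: "\<forall>k<K. step_size_conditions L1 L2 \<gamma> \<mu>0 L\<theta> clam \<rho> lam"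
    and run: "sun_dsbo_gt M n W K \<gamma> (\<lambda>k. \<mu>0 * real (k + 1) powr (- p)) (\<lambda>_. clam * lam) (\<lambda>_. clam * lam) (\<lambda>_. lam)
      fs gs \<xi>f \<xi>g x0 y0 \<theta>0 x y \<theta>"
  shows "(1 / real K) * (\<Sum>k<K. \<integral>\<omega>. (norm (gradient (Psi \<gamma> (\<lambda>z. average n (\<lambda>i. f i z)) (\<lambda>z. average n (\<lambda>i. g i z))
            (\<mu>0 * real (k + 1) powr (- p)))
            (average n (\<lambda>i. x k i \<omega>), average n (\<lambda>i. y k i \<omega>))))\<^sup>2 \<partial>M)
         \<le> A * (R / (sqrt (real n) * sqrt (real K)))
           + A * (real n * (\<delta>f\<^sup>2 + \<delta>g\<^sup>2) / ((1 - \<rho>) ^ 4 * real K)) \<and>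
       (1 / real K) * (\<Sum>k<K. consensus_error M n x y \<theta> k)
         \<le> A * (R / sqrt (real K))
           + A * (real n powr (3 / 2) * (\<delta>f\<^sup>2 + \<delta>g\<^sup>2) / ((1 - \<rho>) ^ 4 * real K))"
proof (cases "K = 0")
  case True
  thus ?thesis by simp
next
  case False
  hence K: "0 < K" by simp
  have n: "0 < n" by (rule network_topology_n[OF nt])
  note rho = network_topology_rho[OF nt]
  have L1: "\<bar>L1\<bar> = L1" using smoothness_nonneg[of L1 "f 0"] sm n by auto
  interpret pr: prox_smooth "\<lambda>z. average n (\<lambda>i. g i z)" L2 \<gamma>
    using sm n \<gamma> by unfold_locales (auto intro: smoothness_average)
  note step = step_size_conditions_consequences[OF ss[rule_format, OF K] pr.L2_pos \<gamma> c rho(2)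
      pr.prox_lipschitz_constant_ge[OF L\<theta>]]
  have lam: "0 < lam" unfolding lam_def using n K ct by simp
  interpret sun_dsbo_run n K W \<rho> p L1 L2 \<gamma> \<mu>0 lam clam Flow \<delta>f \<delta>g f g Pf fs Pg gs M \<xi>f \<xi>g x0 y0 \<theta>0 x y \<theta>
    using nt K p sm Fl so iid \<mu>0 \<gamma> c step(1) lam run by unfold_locales auto
  define \<kappa> where "\<kappa> = rate_threshold C L2 \<mu>0 ctheta clam"
  define G0 where "G0 = gap_const L2 clam"
  define \<sigma> where "\<sigma> = \<delta>f\<^sup>2 + \<delta>g\<^sup>2"
  have CC: "tracking_const L1 \<gamma> \<mu>0 clam = C" unfolding C_def L1 ..
  have C1: "1 \<le> C" using tracking_const_ge(1)[OF L1_nonneg \<gamma>(1) \<mu>0 c] unfolding CC .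
  have G0: "0 < G0" unfolding G0_def gap_const_def using c pr.L2_pos by simp
  have B0: "0 < loop_const C \<mu>0" unfolding loop_const_def using C1 by (intro mult_pos_pos add_pos_nonneg) auto
  have gap: "lam \<le> G0 * (1 - \<rho>) ^ 4" using step(2) unfolding G0_def gap_const_def by simp
  have R: "r0 + \<sigma> \<le> R" "0 \<le> R" unfolding R_def rate_data_def r0_def \<sigma>_def by auto
  have \<sigma>: "0 \<le> \<sigma>" by (simp add: \<sigma>_def)
  define E where "E = 2 * loop_const C \<mu>0 * G0 + 16 * C\<^sup>2"
  have E: "0 < E" unfolding E_def using B0 G0 C1 by (simp add: add_pos_nonneg)
  have sk: "sqrt \<kappa> = ctheta * E" unfolding \<kappa>_def rate_threshold_def E_def[unfolded G0_def, symmetric]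
    using ct E by (simp add: real_sqrt_abs)
  have \<kappa>: "0 < \<kappa>" using sk ct E by (metis mult_pos_pos real_sqrt_gt_0_iff)
  have c1: "1 \<le> 1 + 1 / clam" "1 / clam \<le> 1 + 1 / clam" using c by auto
  define P where "P = 1 / (sqrt (real n) * sqrt (real K))"
  define Q where "Q = real n * \<sigma> / ((1 - \<rho>) ^ 4 * real K)"
  have P0: "0 \<le> P" and Q0: "0 \<le> Q" using \<sigma> by (auto simp: P_def Q_def)
  have key: "(1 / real K) * (\<Sum>k<K. mean_progress k) / clam \<le> A * (R * P + Q) \<and>
       (1 / real K) * (\<Sum>k<K. mean_spread k) \<le> A * (R * P + Q) \<and> 0 \<le> A"
  proof (cases "\<kappa> * real n \<le> real K")
    case True
    hence A: "A = (1 + 1 / clam) * large_const C \<mu>0 ctheta" unfolding A_def \<kappa>_def rate_const_def by simp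
    have lc: "0 \<le> large_const C \<mu>0 ctheta"
      unfolding large_const_def noise_const_def using B0 ct by (intro mult_nonneg_nonneg add_nonneg_nonneg) auto
    have le: "E * lam \<le> 1"
    proof -
      have "sqrt \<kappa> * sqrt (real n) \<le> sqrt (real K)"
        using real_sqrt_le_mono[OF True] by (simp add: real_sqrt_mult)
      thus ?thesis unfolding sk lam_def using K by (simp add: divide_le_eq ac_simps)
    qed
    have "16 * C\<^sup>2 * lam \<le> E * lam" unfolding E_def using B0 G0 lam by (intro mult_right_mono) auto
    hence small2: "16 * C\<^sup>2 * lam \<le> 1" using le by simp
    have "2 * loop_const C \<mu>0 * lam\<^sup>2 = (2 * loop_const C \<mu>0 * lam) * lam" by (simp add: power2_eq_square)
    also have "\<dots> \<le> (2 * loop_const C \<mu>0 * lam) * (G0 * (1 - \<rho>) ^ 4)"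
      using gap B0 lam by (intro mult_left_mono) auto
    also have "\<dots> = (2 * loop_const C \<mu>0 * G0 * lam) * (1 - \<rho>) ^ 4" by simp
    also have "\<dots> \<le> (E * lam) * (1 - \<rho>) ^ 4"
      unfolding E_def using lam rho by (intro mult_right_mono) auto
    also have "\<dots> \<le> 1 * (1 - \<rho>) ^ 4" using le rho by (intro mult_right_mono) auto
    finally have small1: "2 * loop_const C \<mu>0 * lam\<^sup>2 \<le> (1 - \<rho>) ^ 4" by simp
    note T = rates_many_iterations[OF lam_def[THEN meta_eq_to_obj_eq] ct, unfolded CC, OF small1 small2]
    have "(r0 + \<sigma>) * P \<le> R * P" using R P0 by (intro mult_right_mono) auto
    hence Z: "large_const C \<mu>0 ctheta * ((r0 + \<sigma>) * P + Q) \<le> large_const C \<mu>0 ctheta * (R * P + Q)"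
      using lc by (intro mult_left_mono) auto
    have T': "(1 / real K) * (\<Sum>k<K. mean_progress k) \<le> large_const C \<mu>0 ctheta * (R * P + Q)"
       "(1 / real K) * (\<Sum>k<K. mean_spread k) \<le> large_const C \<mu>0 ctheta * (R * P + Q)"
      using T Z unfolding \<sigma>_def[symmetric] P_def Q_def by auto
    have nn: "0 \<le> large_const C \<mu>0 ctheta * (R * P + Q)" using lc R P0 Q0 by simp
    have "(1 / real K) * (\<Sum>k<K. mean_progress k) / clam \<le> (1 / clam) * (large_const C \<mu>0 ctheta * (R * P + Q))"
      using divide_right_mono[OF T'(1), of clam] c by simp
    also have "\<dots> \<le> (1 + 1 / clam) * (large_const C \<mu>0 ctheta * (R * P + Q))"
      using c1 nn by (intro mult_right_mono) auto
    finally have 1: "(1 / real K) * (\<Sum>k<K. mean_progress k) / clam \<le> A * (R * P + Q)" unfolding A by (simp add: mult.assoc)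
    have "large_const C \<mu>0 ctheta * (R * P + Q) \<le> (1 + 1 / clam) * (large_const C \<mu>0 ctheta * (R * P + Q))"
      using mult_right_mono[OF c1(1) nn] by simp
    hence 2: "(1 / real K) * (\<Sum>k<K. mean_spread k) \<le> A * (R * P + Q)" using T'(2) unfolding A by (simp add: mult.assoc)
    show ?thesis using 1 2 lc c unfolding A by simp
  next
    case False
    hence KK: "real K \<le> \<kappa> * real n" by simp
    define Y where "Y = crude_const C \<mu>0 (\<kappa> * real n) (ctheta * sqrt (real n)) (G0 * sqrt \<kappa> / ctheta)"
    have A: "A = 1 + \<bar>(1 + 1 / clam) * Y * (1 + noise_const \<mu>0) * (real n * sqrt \<kappa>)\<bar>"
      unfolding A_def using False unfolding \<kappa>_def small_K_const_def Y_def G0_def Let_def by simp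
    have l1: "lam \<le> ctheta * sqrt (real n)"
      unfolding lam_def using K ct n by (simp add: divide_le_eq)
    have l2: "ctheta / sqrt \<kappa> \<le> lam"
    proof -
      have "sqrt (real K) \<le> sqrt \<kappa> * sqrt (real n)" using real_sqrt_le_mono[OF KK] by (simp add: real_sqrt_mult)
      thus ?thesis unfolding lam_def using K \<kappa> ct by (simp add: field_simps)
    qed
    have l3: "1 / (1 - \<rho>) \<le> G0 * sqrt \<kappa> / ctheta"
    proof -
      have r1: "0 < 1 - \<rho>" "1 - \<rho> \<le> 1" using rho by auto
      have "(1 - \<rho>) ^ 4 \<le> (1 - \<rho>) ^ 1" using r1 by (intro power_decreasing) auto
      hence "G0 * (1 - \<rho>) ^ 4 \<le> G0 * (1 - \<rho>)" using G0 by simp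
      hence "ctheta / sqrt \<kappa> \<le> G0 * (1 - \<rho>)" using l2 gap by linarith
      thus ?thesis using r1 \<kappa> ct by (simp add: field_simps)
    qed
    note T = rates_few_iterations[OF l1 l3 KK, unfolded CC, folded Y_def]
    define U where "U = Y * ((1 + noise_const \<mu>0) * (r0 + \<sigma>))"
    have T': "(1 / real K) * (\<Sum>k<K. mean_progress k) \<le> U" "(1 / real K) * (\<Sum>k<K. mean_spread k) \<le> U"
      using T unfolding U_def \<sigma>_def by auto
    have U0: "0 \<le> U"
    proof -
      have "0 \<le> (1 / real K) * (\<Sum>k<K. mean_spread k)"
        using nonneg_means by (intro mult_nonneg_nonneg sum_nonneg) auto
      thus ?thesis using T'(2) by linarith
    qed
    have nP: "1 \<le> (real n * sqrt \<kappa>) * P"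
    proof -
      have "sqrt (real n) * sqrt (real K) \<le> sqrt (real n) * (sqrt \<kappa> * sqrt (real n))"
        using real_sqrt_le_mono[OF KK] by (intro mult_left_mono) (auto simp: real_sqrt_mult)
      also have "\<dots> = real n * sqrt \<kappa>" using n by simp
      finally show ?thesis unfolding P_def using n K by (simp add: field_simps)
    qed
    have main: "(1 + 1 / clam) * U \<le> A * (R * P + Q)"
    proof -
      define V where "V = (1 + 1 / clam) * Y * (1 + noise_const \<mu>0)"
      have V: "(1 + 1 / clam) * U = V * (r0 + \<sigma>)" unfolding V_def U_def by (simp add: mult.assoc)
      have "V * (r0 + \<sigma>) \<le> \<bar>V\<bar> * (r0 + \<sigma>)" using r0_nonneg \<sigma> by (intro mult_right_mono) auto
      also have "\<dots> \<le> \<bar>V\<bar> * R" using R by (intro mult_left_mono) auto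
      also have "\<dots> \<le> (\<bar>V\<bar> * R) * ((real n * sqrt \<kappa>) * P)"
        using mult_left_mono[OF nP, of "\<bar>V\<bar> * R"] R by simp
      also have "\<dots> = \<bar>V * (real n * sqrt \<kappa>)\<bar> * (R * P)" using \<kappa> by (simp add: abs_mult)
      also have "\<dots> \<le> A * (R * P)" unfolding A V_def using R P0 by (intro mult_right_mono) auto
      also have "\<dots> \<le> A * (R * P + Q)" unfolding A using Q0 by (intro mult_left_mono) auto
      finally show ?thesis unfolding V .
    qed
    have "(1 / real K) * (\<Sum>k<K. mean_progress k) / clam \<le> (1 / clam) * U"
      using divide_right_mono[OF T'(1), of clam] c by simp
    also have "\<dots> \<le> (1 + 1 / clam) * U" using c1 U0 by (intro mult_right_mono) auto
    finally have 1: "(1 / real K) * (\<Sum>k<K. mean_progress k) / clam \<le> A * (R * P + Q)" using main by linarith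
    have 2: "(1 / real K) * (\<Sum>k<K. mean_spread k) \<le> A * (R * P + Q)"
      using T'(2) mult_right_mono[OF c1(1) U0] main by linarith
    show ?thesis using 1 2 unfolding A by simp
  qed
  have g1: "(1 / real K) * (\<Sum>k<K. \<integral>\<omega>. (norm (gradient (Psi \<gamma> F G (mu k)) (average n (\<lambda>i. x k i \<omega>), average n (\<lambda>i. y k i \<omega>))))\<^sup>2 \<partial>M)
     \<le> (1 / real K) * (\<Sum>k<K. mean_progress k) / clam"
  proof -
    have "(\<Sum>k<K. \<integral>\<omega>. (norm (gradient (Psi \<gamma> F G (mu k)) (average n (\<lambda>i. x k i \<omega>), average n (\<lambda>i. y k i \<omega>))))\<^sup>2 \<partial>M)
      \<le> (\<Sum>k<K. mean_progress k / clam)" by (intro sum_mono gradient_Psi_le_progress) auto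
    from mult_left_mono[OF this, of "1 / real K"] show ?thesis by (simp add: sum_divide_distrib[symmetric])
  qed
  have g2: "(\<Sum>k<K. consensus_error M n x y \<theta> k) = (\<Sum>k<K. mean_spread k)"
    by (intro sum.cong) (auto intro: mean_spread_eq_consensus_error)
  have n1: "1 \<le> real n" using n by simp
  have P1: "P \<le> 1 / sqrt (real K)"
    unfolding P_def using n1 K by (simp add: field_simps)
  have Q1: "Q \<le> real n powr (3 / 2) * \<sigma> / ((1 - \<rho>) ^ 4 * real K)"
    unfolding Q_def
  proof (intro divide_right_mono mult_right_mono \<sigma>)
    have "real n powr 1 \<le> real n powr (3 / 2)" using n1 by (intro powr_mono) auto
    thus "real n \<le> real n powr (3 / 2)" using n1 by simp
  qed (use rho in auto)
  show ?thesis
  proof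
    have "A * (R * P + Q) = A * (R / (sqrt (real n) * sqrt (real K))) + A * (real n * (\<delta>f\<^sup>2 + \<delta>g\<^sup>2) / ((1 - \<rho>) ^ 4 * real K))"
      unfolding P_def Q_def \<sigma>_def by (simp add: distrib_left)
    thus "(1 / real K) * (\<Sum>k<K. \<integral>\<omega>. (norm (gradient (Psi \<gamma> (\<lambda>z. average n (\<lambda>i. f i z)) (\<lambda>z. average n (\<lambda>i. g i z))
            (\<mu>0 * real (k + 1) powr (- p)))
            (average n (\<lambda>i. x k i \<omega>), average n (\<lambda>i. y k i \<omega>))))\<^sup>2 \<partial>M)
         \<le> A * (R / (sqrt (real n) * sqrt (real K)))
           + A * (real n * (\<delta>f\<^sup>2 + \<delta>g\<^sup>2) / ((1 - \<rho>) ^ 4 * real K))"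
      using g1 key unfolding F_def G_def mu_def by linarith
    have "A * (R * P + Q) \<le> A * (R * (1 / sqrt (real K)) + real n powr (3 / 2) * \<sigma> / ((1 - \<rho>) ^ 4 * real K))"
      using key R P1 Q1 by (intro mult_left_mono add_mono) auto
    also have "\<dots> = A * (R / sqrt (real K)) + A * (real n powr (3 / 2) * (\<delta>f\<^sup>2 + \<delta>g\<^sup>2) / ((1 - \<rho>) ^ 4 * real K))"
      unfolding \<sigma>_def by (simp add: distrib_left)
    finally show "(1 / real K) * (\<Sum>k<K. consensus_error M n x y \<theta> k)
         \<le> A * (R / sqrt (real K))
           + A * (real n powr (3 / 2) * (\<delta>f\<^sup>2 + \<delta>g\<^sup>2) / ((1 - \<rho>) ^ 4 * real K))"
      using key unfolding g2 by linarith
  qed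
qed

theorem theorem3p7:
  fixes L1 L2 \<gamma> \<mu>0 ctheta clam :: real
  assumes "0 < \<mu>0" "0 < \<gamma>" "\<gamma> < 1 / (2 * L2)" "0 < ctheta" "0 < clam"
  shows "\<exists>(\<kappa> :: real) (C :: real) (B :: nat \<Rightarrow> real) (C2 :: real \<Rightarrow> real \<Rightarrow> real \<Rightarrow> real).
    0 < \<kappa> \<and> 0 < C \<and> (\<forall>n. 0 < B n) \<and> (\<forall>r s t. 0 < C2 r s t) \<and>
    (\<forall>(n :: nat) (K :: nat) (W :: real mat) (\<rho> :: real) (p :: real) (L\<theta> :: real)
       (\<delta>f :: real) (\<delta>g :: real) (Flow :: real)
       (f :: nat \<Rightarrow> 'a::euclidean_space \<times> 'b::euclidean_space \<Rightarrow> real)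
       (g :: nat \<Rightarrow> 'a \<times> 'b \<Rightarrow> real)
       (Pf :: nat \<Rightarrow> 's measure) (fs :: nat \<Rightarrow> 's \<Rightarrow> 'a \<times> 'b \<Rightarrow> real)
       (Pg :: nat \<Rightarrow> 't measure) (gs :: nat \<Rightarrow> 't \<Rightarrow> 'a \<times> 'b \<Rightarrow> real)
       (M :: 'w measure) (\<xi>f :: nat \<Rightarrow> nat \<Rightarrow> 'w \<Rightarrow> 's) (\<xi>g :: nat \<Rightarrow> nat \<Rightarrow> 'w \<Rightarrow> 't)
       (x0 :: nat \<Rightarrow> 'a) (y0 :: nat \<Rightarrow> 'b) (\<theta>0 :: nat \<Rightarrow> 'b)
       (x :: nat \<Rightarrow> nat \<Rightarrow> 'w \<Rightarrow> 'a) (y :: nat \<Rightarrow> nat \<Rightarrow> 'w \<Rightarrow> 'b) (\<theta> :: nat \<Rightarrow> nat \<Rightarrow> 'w \<Rightarrow> 'b).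
     let F = (\<lambda>z. average n (\<lambda>i. f i z));
         G = (\<lambda>z. average n (\<lambda>i. g i z));
         \<mu> = (\<lambda>k :: nat. \<mu>0 * real (k + 1) powr (- p));
         lamt = (\<lambda>k :: nat. ctheta * sqrt (real n) / sqrt (real K));
         lamx = (\<lambda>k. clam * lamt k);
         lamy = (\<lambda>k. clam * lamt k);
         R = C2 (initial_error n \<gamma> \<mu>0 Flow f g x0 y0 \<theta>0) (\<delta>f\<^sup>2) (\<delta>g\<^sup>2);
         A = (if \<kappa> * real n \<le> real K then C else B n)
     in
       network_topology n W \<rho> \<longrightarrow>
       0 < p \<longrightarrow> p < 1 / 4 \<longrightarrow>
       (\<forall>i<n. smoothness L1 (f i) \<and> smoothness L2 (g i)) \<longrightarrow>
       (\<forall>z. Flow \<le> F z) \<longrightarrow>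
       (\<forall>i<n. stochastic_oracle (Pf i) (fs i) (f i) \<delta>f \<and>
              stochastic_oracle (Pg i) (gs i) (g i) \<delta>g) \<longrightarrow>
       iid_samples M n K Pf Pg \<xi>f \<xi>g \<longrightarrow>
       0 < L\<theta> \<longrightarrow> L\<theta>-lipschitz_on UNIV (prox_point \<gamma> G) \<longrightarrow>
       (\<forall>k<K. step_size_conditions L1 L2 \<gamma> \<mu>0 L\<theta> clam \<rho> (lamt k)) \<longrightarrow>
       sun_dsbo_gt M n W K \<gamma> \<mu> lamx lamy lamt fs gs \<xi>f \<xi>g x0 y0 \<theta>0 x y \<theta> \<longrightarrow>
       (1 / real K) * (\<Sum>k<K. \<integral>\<omega>. (norm (gradient (Psi \<gamma> F G (\<mu> k))
            (average n (\<lambda>i. x k i \<omega>), average n (\<lambda>i. y k i \<omega>))))\<^sup>2 \<partial>M)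
         \<le> A * (R / (sqrt (real n) * sqrt (real K)))
           + A * (real n * (\<delta>f\<^sup>2 + \<delta>g\<^sup>2) / ((1 - \<rho>) ^ 4 * real K)) \<and>
       (1 / real K) * (\<Sum>k<K. consensus_error M n x y \<theta> k)
         \<le> A * (R / sqrt (real K))
           + A * (real n powr (3 / 2) * (\<delta>f\<^sup>2 + \<delta>g\<^sup>2) / ((1 - \<rho>) ^ 4 * real K)))"
proof -
  define C where "C = tracking_const \<bar>L1\<bar> \<gamma> \<mu>0 clam"
  have L2: "0 < L2" using assms(2,3) by (smt (verit) divide_le_0_iff)
  have C: "1 \<le> C" unfolding C_def by (rule tracking_const_ge(1)) (use assms in auto)
  have B0: "0 < loop_const C \<mu>0" unfolding loop_const_def using C by (intro mult_pos_pos add_pos_nonneg) auto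
  have G0: "0 < gap_const L2 clam" unfolding gap_const_def using assms L2 by simp
  have "0 < 2 * loop_const C \<mu>0 * gap_const L2 clam + 16 * C\<^sup>2" using B0 G0 by (simp add: add_pos_nonneg)
  hence 1: "0 < rate_threshold C L2 \<mu>0 ctheta clam" unfolding rate_threshold_def using assms(4) by simp
  have "0 < 1 / ctheta + ctheta * noise_const \<mu>0 + ctheta\<^sup>2 * noise_const \<mu>0"
    unfolding noise_const_def using assms(4) by (intro add_pos_nonneg mult_nonneg_nonneg add_nonneg_nonneg) auto
  moreover have "0 < 100 * C\<^sup>2 * loop_const C \<mu>0" using C B0 by simp
  ultimately have "0 < large_const C \<mu>0 ctheta" unfolding large_const_def by (rule mult_pos_pos[rotated])
  hence 2: "0 < rate_const C \<mu>0 ctheta clam"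
    unfolding rate_const_def using assms(5) by (simp add: add_pos_pos)
  have 3: "0 < small_K_const C L2 \<mu>0 ctheta clam n" for n
    unfolding small_K_const_def Let_def by (rule add_pos_nonneg) auto
  have 4: "0 < rate_data r s t" for r s t unfolding rate_data_def by linarith
  show ?thesis
    by (rule exI[of _ "rate_threshold C L2 \<mu>0 ctheta clam"], rule exI[of _ "rate_const C \<mu>0 ctheta clam"],
        rule exI[of _ "small_K_const C L2 \<mu>0 ctheta clam"], rule exI[of _ rate_data],
        intro conjI allI 1 2 3 4, unfold Let_def C_def, intro impI,
        rule sun_dsbo_gt_rates[OF assms], assumption+)
qed

end
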